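(* Let $\mathfrak{g}$ be an AE-Lie algebra over $\mathbb{K}$ and $z\in\mathbb{K}$. If $R\ge1$, then $\widehat{\mathrm{S}}_R^\bullet(\mathfrak{g})$ is a locally convex Hopf algebra. The same holds for $\widehat{\mathrm{S}}_{1^-}^\bullet(\mathfrak{g})$ if $\mathfrak{g}$ is a nilpotent locally convex Lie algebra with continuous Lie bracket, and for $\widehat{\mathrm{S}}_{1^{--}}^\bullet(\mathfrak{g})$ if $\mathfrak{g}$ is a uniformly topologically nilpotent Banach-Lie algebra (with $\omega_n>0$ for all $n$).
   Context: $\mathbb{K}$ is $\mathbb{R}$ or $\mathbb{C}$. An AE-Lie algebra is a (Hausdorff) locally convex Lie algebra with continuous bracket in which every continuous seminorm $p$ has an asymptotic estimate: a continuous seminorm $q$ with $p(w_n(x_1,\ldots,x_n))\le q(x_1)\cdots q(x_n)$ for all $n\ge1$, all $x_i\in\mathfrak{g}$ and all words $w_n$ made out of $n-1$ Lie brackets of $x_1,\ldots,x_n$ with arbitrary bracketing. Nilpotent means there is $N$ with $\mathrm{ad}_{\xi_1}\circ\cdots\circ\mathrm{ad}_{\xi_n}=0$ for all $n>N$ and all $\xi_i$. Topologies on the symmetric tensor algebra $\mathrm{S}^\bullet(\mathfrak{g})$ (symmetric tensors inside $\mathrm{T}^\bullet(\mathfrak{g})$): $p^n$ is the $n$-th projective tensor power of a continuous seminorm $p$ ($p^0=|\cdot|$), $p_R=\sum_{n\ge0}n!^Rp^n$. $\mathrm{S}_R^\bullet(\mathfrak{g})$ has the topology of all $p_R$; $\mathrm{S}_{1^-}^\bullet(\mathfrak{g})$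 that of all $p_R$ with $R<1$, $p$ a continuous seminorm on $\mathfrak{g}$. For a Banach-Lie algebra ($\|[\xi,\eta]\|\le\|\xi\|\|\eta\|$) let $\mathcal{N}(n)=\sup\{\|\mathrm{ad}_{\xi_1}\circ\cdots\circ\mathrm{ad}_{\xi_n}\|^{1/n}:\|\xi_i\|=1\}$; it is uniformly topologically nilpotent if $\mathcal{N}(n)\to0$. Put $\omega_n=\sup_{m\ge n}\mathcal{N}(m)$ (assumed $>0$ for all $n$) and $\chi_n^{\mathfrak{g}}=\max\{1/\omega_n,2\}$. A sequence $(\alpha_n)_{n\in\mathbb{N}}$ in $(1,\infty)$ is $\mathfrak{g}$-rapidly increasing if $\frac{\log\alpha_n}{n}\to\infty$ and $\alpha_n\le c^n\chi_n^{\mathfrak{g}}$ for all $n$, for some $c>0$. $\mathrm{S}_{1^{--}}^\bullet(\mathfrak{g})$ has the topology defined by all seminorms $\sum_{n\ge0}\frac{n!}{\alpha_n}(c\|\cdot\|)^{\otimes_\pi n}$ with $c>0$ and $(\alpha_n)$ $\mathfrak{g}$-rapidly increasing (degree-$0$ weight with $\alpha_0=1$). Hats denote completions. Hopf structure: $\mathcal{U}(\mathfrak{g}_z)=\mathrm{T}^\bullet(\mathfrak{g})/\langle\xi\otimes\eta-\eta\otimes\xi-z[\xi,\eta]\rangle$ with product $\odot$ is a Hopf algebra with coproduct the algebra homomorphism given by $\xi\mapsto\xi\otimes\mathbf{1}+\mathbf{1}\otimes\xi$, counit vanishing on $\mathfrak{g}$, and antipode the antihomomorphism given by $\xi\mapsto-\xi$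 ($\xi\in\mathfrak{g}$). It is transported to $\mathrm{S}^\bullet(\mathfrak{g})$ by the linear isomorphism $\mathfrak{q}_z(\xi_1\cdots\xi_n)=\frac1{n!}\sum_\sigma\xi_{\sigma(1)}\odot\cdots\odot\xi_{\sigma(n)}$; the resulting product is the Gutt star product $f\star_zg=\mathfrak{q}_z^{-1}(\mathfrak{q}_z(f)\odot\mathfrak{q}_z(g))$. "Locally convex Hopf algebra" means that product, unit, coproduct, counit and antipode are continuous and extend to the completion (with the coproduct taking values in the completed projective tensor product), satisfying the Hopf algebra axioms there.
   Formalization: The S_{1--} claim is stated only where its topology is Hausdorff, i.e. where a g-rapidly increasing sequence exists; for some uniformly topologically nilpotent g (e.g. ω_n of order 1/n) there is none, no seminorm is left, and the claim as written fails. *)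

theory Defs
  imports
    "HOL-Analysis.Analysis"
    "HOL-Algebra.QuotRing"
    "HOL-Algebra.Module"
    "HOL-Combinatorics.Permutations"
begin

text \<open>
  The ground field is a type \<open>'k\<close> of class \<open>real_normed_field\<close> and \<open>banach\<close>.  Both \<open>real\<close> and
  \<open>complex\<close> are instances, and by the Gelfand-Mazur theorem there are no others up to isomorphism.
\<close>

section \<open>Locally convex spaces and Lie algebras\<close>

definition seminorm :: "('k::real_normed_field \<Rightarrow> 'v::ab_group_add \<Rightarrow> 'v) \<Rightarrow> ('v \<Rightarrow> real) \<Rightarrow> bool" where
  "seminorm scaleV p \<longleftrightarrow>
     (\<forall>x y. p (x + y) \<le> p x + p y) \<and> (\<forall>c x. p (scaleV c x) = norm c * p x)"

definition continuous_seminorm ::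
  "('k::real_normed_field \<Rightarrow> 'v::{ab_group_add,topological_space} \<Rightarrow> 'v) \<Rightarrow> ('v \<Rightarrow> real) \<Rightarrow> bool" where
  "continuous_seminorm scaleV p \<longleftrightarrow> seminorm scaleV p \<and> continuous_on UNIV p"

locale locally_convex_space = vector_space scaleV
  for scaleV :: "'k::real_normed_field \<Rightarrow> 'v::{topological_group_add,ab_group_add,t2_space} \<Rightarrow> 'v" +
  assumes continuous_scale: "continuous_on UNIV (\<lambda>(c, x). scaleV c x)"
    and seminorm_neighbourhood:
      "open U \<Longrightarrow> 0 \<in> U \<Longrightarrow> \<exists>p. continuous_seminorm scaleV p \<and> {x. p x < 1} \<subseteq> U"

locale locally_convex_lie_algebra = locally_convex_space scaleV
  for scaleV :: "'k::real_normed_field \<Rightarrow> 'g::{topological_group_add,ab_group_add,t2_space} \<Rightarrow> 'g" +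
  fixes bracket :: "'g \<Rightarrow> 'g \<Rightarrow> 'g"
  assumes bracket_linear_left: "Vector_Spaces.linear scaleV scaleV (\<lambda>x. bracket x y)"
    and bracket_linear_right: "Vector_Spaces.linear scaleV scaleV (bracket x)"
    and bracket_alternating: "bracket x x = 0"
    and jacobi: "bracket x (bracket y w) + bracket y (bracket w x) + bracket w (bracket x y) = 0"
    and continuous_bracket: "continuous_on UNIV (\<lambda>(x, y). bracket x y)"

text \<open>\<open>lie_word bracket xs w\<close>: \<open>w\<close> arises from the list \<open>xs\<close> by some complete bracketing.\<close>

inductive lie_word :: "('g \<Rightarrow> 'g \<Rightarrow> 'g) \<Rightarrow> 'g list \<Rightarrow> 'g \<Rightarrow> bool" for bracket where
  letter: "lie_word bracket [x] x"
| bracket: "lie_word bracket xs u \<Longrightarrow> lie_word bracket ys v \<Longrightarrow> lie_word bracket (xs @ ys) (bracket u v)"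

locale AE_lie_algebra = locally_convex_lie_algebra +
  assumes asymptotic_estimate:
    "continuous_seminorm scaleV p \<Longrightarrow>
      \<exists>q. continuous_seminorm scaleV q \<and>
          (\<forall>xs w. lie_word bracket xs w \<longrightarrow> p w \<le> prod_list (map q xs))"

text \<open>\<open>foldr bracket [\<xi>\<^sub>1, \<dots>, \<xi>\<^sub>n] y\<close> is \<open>(ad \<xi>\<^sub>1 \<circ> \<dots> \<circ> ad \<xi>\<^sub>n) y\<close>.\<close>

definition nilpotent_lie :: "('g::zero \<Rightarrow> 'g \<Rightarrow> 'g) \<Rightarrow> bool" where
  "nilpotent_lie bracket \<longleftrightarrow> (\<exists>N. \<forall>xs. length xs > N \<longrightarrow> (\<forall>y. foldr bracket xs y = 0))"

locale banach_lie_algebra = locally_convex_lie_algebra scaleV bracket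
  for scaleV :: "'k::real_normed_field \<Rightarrow> 'g::{topological_group_add,ab_group_add,t2_space} \<Rightarrow> 'g"
    and bracket :: "'g \<Rightarrow> 'g \<Rightarrow> 'g" +
  fixes nrm :: "'g \<Rightarrow> real"
  assumes seminorm_nrm: "seminorm scaleV nrm"
    and nrm_definite: "nrm x = 0 \<Longrightarrow> x = 0"
    and open_iff_nrm: "open U \<longleftrightarrow> (\<forall>x\<in>U. \<exists>e>0. \<forall>y. nrm (y - x) < e \<longrightarrow> y \<in> U)"
    and nrm_complete:
      "(\<And>e. e > 0 \<Longrightarrow> \<exists>M. \<forall>m\<ge>M. \<forall>n\<ge>M. nrm (X m - X n) < e) \<Longrightarrow> convergent X"
    and nrm_bracket: "nrm (bracket x y) \<le> nrm x * nrm y"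

definition ad_norm :: "('g \<Rightarrow> real) \<Rightarrow> ('g \<Rightarrow> 'g \<Rightarrow> 'g) \<Rightarrow> 'g list \<Rightarrow> real" where
  "ad_norm nrm bracket xs = Sup {nrm (foldr bracket xs y) | y. nrm y \<le> 1}"

text \<open>The sequences below are only meaningful, and only used, for indices \<open>n \<ge> 1\<close>.\<close>

definition nilpotency_rate :: "('g \<Rightarrow> real) \<Rightarrow> ('g \<Rightarrow> 'g \<Rightarrow> 'g) \<Rightarrow> nat \<Rightarrow> real" where
  "nilpotency_rate nrm bracket n =
     Sup {root n (ad_norm nrm bracket xs) | xs. length xs = n \<and> (\<forall>x\<in>set xs. nrm x = 1)}"

definition uniformly_topologically_nilpotent :: "('g \<Rightarrow> real) \<Rightarrow> ('g \<Rightarrow> 'g \<Rightarrow> 'g) \<Rightarrow> bool" where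
  "uniformly_topologically_nilpotent nrm bracket \<longleftrightarrow> nilpotency_rate nrm bracket \<longlonglongrightarrow> 0"

definition nilpotency_omega :: "('g \<Rightarrow> real) \<Rightarrow> ('g \<Rightarrow> 'g \<Rightarrow> 'g) \<Rightarrow> nat \<Rightarrow> real" where
  "nilpotency_omega nrm bracket n = Sup {nilpotency_rate nrm bracket m | m. m \<ge> n}"

definition nilpotency_chi :: "('g \<Rightarrow> real) \<Rightarrow> ('g \<Rightarrow> 'g \<Rightarrow> 'g) \<Rightarrow> nat \<Rightarrow> real" where
  "nilpotency_chi nrm bracket n = max (1 / nilpotency_omega nrm bracket n) 2"

definition rapidly_increasing ::
  "('g \<Rightarrow> real) \<Rightarrow> ('g \<Rightarrow> 'g \<Rightarrow> 'g) \<Rightarrow> (nat \<Rightarrow> real) \<Rightarrow> bool" where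
  "rapidly_increasing nrm bracket \<alpha> \<longleftrightarrow>
     (\<forall>n\<ge>1. \<alpha> n > 1) \<and>
     filterlim (\<lambda>n. ln (\<alpha> n) / real n) at_top sequentially \<and>
     (\<exists>c>0. \<forall>n\<ge>1. \<alpha> n \<le> c ^ n * nilpotency_chi nrm bracket n)"


section \<open>Tensors\<close>

text \<open>
  Vector spaces that occur as subsets of a type are \<^typ>\<open>('k, 'a) module\<close> records, algebras over
  \<open>'k\<close> are such records as well.  For \<open>vec_mod\<close> the ring fields \<open>mult\<close> and \<open>one\<close> are irrelevant
  dummies.
\<close>

definition vec_mod :: "('k \<Rightarrow> 'v::ab_group_add \<Rightarrow> 'v) \<Rightarrow> ('k, 'v) module" where
  "vec_mod scaleV = \<lparr>carrier = UNIV, mult = (\<lambda>_ _. 0), one = 0, zero = 0, add = (+), smult = scaleV\<rparr>"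

definition scalar_algebra :: "('k::comm_ring_1, 'k) module" where
  "scalar_algebra = \<lparr>carrier = UNIV, mult = (*), one = 1, zero = 0, add = (+), smult = (*)\<rparr>"

text \<open>
  \<open>\<phi>\<close> restricted to lists of length \<open>n\<close> is an \<open>n\<close>-linear form, for every \<open>n\<close>.
\<close>

definition multilinear_form :: "('k::field, 'a, 'm) module_scheme \<Rightarrow> ('a list \<Rightarrow> 'k) \<Rightarrow> bool" where
  "multilinear_form M \<phi> \<longleftrightarrow>
     (\<forall>us vs. set us \<subseteq> carrier M \<longrightarrow> set vs \<subseteq> carrier M \<longrightarrow>
        (\<forall>x\<in>carrier M. \<forall>y\<in>carrier M.
           \<phi> (us @ (x \<oplus>\<^bsub>M\<^esub> y) # vs) = \<phi> (us @ x # vs) + \<phi> (us @ y # vs)) \<and>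
        (\<forall>c. \<forall>x\<in>carrier M. \<phi> (us @ (c \<odot>\<^bsub>M\<^esub> x) # vs) = c * \<phi> (us @ x # vs)))"

text \<open>
  The tensor \<open>x\<^sub>1 \<otimes> \<dots> \<otimes> x\<^sub>n\<close> is modelled as evaluation of multilinear forms at \<open>[x\<^sub>1, \<dots>, x\<^sub>n]\<close>.
  Multilinear forms separate the points of an algebraic tensor power of a vector space, so the
  span of these evaluations is the algebraic tensor algebra.  All constructions below are
  determined by their (stated) values on such elementary tensors.
\<close>

type_synonym ('k, 'a) tensor = "('a list \<Rightarrow> 'k) \<Rightarrow> 'k"

definition tensor :: "('k::field, 'a, 'm) module_scheme \<Rightarrow> 'a list \<Rightarrow> ('k, 'a) tensor" where
  "tensor M xs = (\<lambda>\<phi>. if multilinear_form M \<phi> then \<phi> xs else 0)"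

definition tensor_sum ::
  "('k::field, 'a, 'm) module_scheme \<Rightarrow> ('k \<times> 'a list) list \<Rightarrow> ('k, 'a) tensor" where
  "tensor_sum M L = (\<lambda>\<phi>. \<Sum>(c, xs)\<leftarrow>L. c * tensor M xs \<phi>)"

text \<open>The product satisfies \<open>tensor M xs \<otimes> tensor M ys = tensor M (xs @ ys)\<close>.\<close>

definition tensor_algebra ::
  "('k::field, 'a, 'm) module_scheme \<Rightarrow> ('k, ('k, 'a) tensor) module" where
  "tensor_algebra M =
     \<lparr>carrier = {tensor_sum M L | L. \<forall>(c, xs)\<in>set L. set xs \<subseteq> carrier M},
      mult = (\<lambda>s t \<phi>. if multilinear_form M \<phi> then s (\<lambda>xs. t (\<lambda>ys. \<phi> (xs @ ys))) else 0),
      one = tensor M [],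
      zero = (\<lambda>\<phi>. 0),
      add = (\<lambda>s t \<phi>. s \<phi> + t \<phi>),
      smult = (\<lambda>c t \<phi>. c * t \<phi>)\<rparr>"

definition tensor_power ::
  "('k::field, 'a, 'm) module_scheme \<Rightarrow> nat \<Rightarrow> ('k, ('k, 'a) tensor) module" where
  "tensor_power M n = (tensor_algebra M)
     \<lparr>carrier := {tensor_sum M L | L. \<forall>(c, xs)\<in>set L. length xs = n \<and> set xs \<subseteq> carrier M}\<rparr>"

text \<open>
  The component of degree \<open>n\<close>: \<open>tensor M xs\<close> is mapped to itself if \<open>length xs = n\<close> and to
  zero otherwise.
\<close>

definition tensor_component ::
  "('k::field, 'a, 'm) module_scheme \<Rightarrow> nat \<Rightarrow> ('k, 'a) tensor \<Rightarrow> ('k, 'a) tensor" where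
  "tensor_component M n t =
     (\<lambda>\<phi>. if multilinear_form M \<phi> then t (\<lambda>xs. if length xs = n then \<phi> xs else 0) else 0)"

text \<open>For linear \<open>f\<close>, this maps \<open>tensor M xs\<close> to \<open>tensor N (map f xs)\<close>.\<close>

definition tensor_map ::
  "('k::field, 'b, 'm) module_scheme \<Rightarrow> ('a \<Rightarrow> 'b) \<Rightarrow> ('k, 'a) tensor \<Rightarrow> ('k, 'b) tensor" where
  "tensor_map N f t = (\<lambda>\<phi>. if multilinear_form N \<phi> then t (\<lambda>xs. \<phi> (map f xs)) else 0)"

text \<open>
  The tensor product \<open>A \<otimes> A\<close> of an algebra with itself, with
  \<open>(x\<^sub>1 \<otimes> x\<^sub>2) (y\<^sub>1 \<otimes> y\<^sub>2) = x\<^sub>1 y\<^sub>1 \<otimes> x\<^sub>2 y\<^sub>2\<close>.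
\<close>

definition tensor_square_algebra ::
  "('k::field, 'a, 'm) module_scheme \<Rightarrow> ('k, ('k, 'a) tensor) module" where
  "tensor_square_algebra A = (tensor_power A 2)
     \<lparr>mult := (\<lambda>s t \<phi>. if multilinear_form A \<phi> then
                 s (\<lambda>xs. if length xs = 2 then
                       t (\<lambda>ys. if length ys = 2 then \<phi> (map2 (mult A) xs ys) else 0) else 0)
               else 0),
      one := tensor A [\<one>\<^bsub>A\<^esub>, \<one>\<^bsub>A\<^esub>]\<rparr>"

text \<open>\<open>sym_prod M [x\<^sub>1, \<dots>, x\<^sub>n]\<close> is the product \<open>x\<^sub>1 \<cdots> x\<^sub>n\<close> of the symmetric tensor algebra.\<close>

definition sym_prod :: "('k::field_char_0, 'a, 'm) module_scheme \<Rightarrow> 'a list \<Rightarrow> ('k, 'a) tensor" where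
  "sym_prod M xs =
     (\<lambda>\<phi>. (\<Sum>\<sigma> | \<sigma> permutes {..<length xs}. tensor M (permute_list \<sigma> xs) \<phi>) / fact (length xs))"

definition symmetric_tensors ::
  "('k::field_char_0, 'a, 'm) module_scheme \<Rightarrow> ('k, ('k, 'a) tensor) module" where
  "symmetric_tensors M = (tensor_algebra M)
     \<lparr>carrier := {(\<lambda>\<phi>. \<Sum>(c, xs)\<leftarrow>L. c * sym_prod M xs \<phi>) | L.
                    \<forall>(c, xs)\<in>set L. set xs \<subseteq> carrier M}\<rparr>"


section \<open>Seminorms on tensors and completions\<close>

text \<open>The \<open>n\<close>-th projective tensor power of \<open>p\<close>; for \<open>n = 0\<close> this is the absolute value on \<open>'k\<close>.\<close>

definition projective_power ::
  "('k::real_normed_field, 'a, 'm) module_scheme \<Rightarrow> ('a \<Rightarrow> real) \<Rightarrow> nat \<Rightarrow> ('k, 'a) tensor \<Rightarrow> real" where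
  "projective_power M p n t =
     Inf {(\<Sum>(c, xs)\<leftarrow>L. norm c * prod_list (map p xs)) | L.
            (\<forall>(c, xs)\<in>set L. length xs = n \<and> set xs \<subseteq> carrier M) \<and> t = tensor_sum M L}"

text \<open>The series \<open>\<Sum>n. w\<^sub>n p\<^sup>n\<close>; only finitely many terms are nonzero.\<close>

definition weighted_seminorm ::
  "('k::real_normed_field, 'a, 'm) module_scheme \<Rightarrow> (nat \<Rightarrow> real) \<Rightarrow> ('a \<Rightarrow> real) \<Rightarrow>
   ('k, 'a) tensor \<Rightarrow> real" where
  "weighted_seminorm M w p t = (\<Sum>n. w n * projective_power M p n (tensor_component M n t))"

definition S_R_seminorms ::
  "('k::real_normed_field \<Rightarrow> 'g::{ab_group_add,topological_space} \<Rightarrow> 'g) \<Rightarrow> real \<Rightarrow>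
   (('k, 'g) tensor \<Rightarrow> real) set" where
  "S_R_seminorms scaleV R =
     {weighted_seminorm (vec_mod scaleV) (\<lambda>n. fact n powr R) p | p. continuous_seminorm scaleV p}"

definition S_1minus_seminorms ::
  "('k::real_normed_field \<Rightarrow> 'g::{ab_group_add,topological_space} \<Rightarrow> 'g) \<Rightarrow>
   (('k, 'g) tensor \<Rightarrow> real) set" where
  "S_1minus_seminorms scaleV = (\<Union>R\<in>{..<1}. S_R_seminorms scaleV R)"

definition S_1minusminus_seminorms ::
  "('k::real_normed_field \<Rightarrow> 'g::ab_group_add \<Rightarrow> 'g) \<Rightarrow> ('g \<Rightarrow> 'g \<Rightarrow> 'g) \<Rightarrow> ('g \<Rightarrow> real) \<Rightarrow>
   (('k, 'g) tensor \<Rightarrow> real) set" where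
  "S_1minusminus_seminorms scaleV bracket nrm =
     {weighted_seminorm (vec_mod scaleV) (\<lambda>n. if n = 0 then 1 else fact n / \<alpha> n) (\<lambda>x. c * nrm x)
       | c \<alpha>. c > 0 \<and> rapidly_increasing nrm bracket \<alpha>}"

text \<open>The topology on the vector space \<open>E\<close> defined by a set \<open>P\<close> of seminorms.\<close>

definition seminorm_topology :: "('k, 'e, 'm) module_scheme \<Rightarrow> ('e \<Rightarrow> real) set \<Rightarrow> 'e topology" where
  "seminorm_topology E P = topology_generated_by
     (insert (carrier E)
       {{y \<in> carrier E. p (y \<ominus>\<^bsub>E\<^esub> x) < e} | x p e. x \<in> carrier E \<and> p \<in> P \<and> e > 0})"

text \<open>
  The complete Hausdorff locally convex space on the type \<open>'h\<close> with scalar multiplication \<open>scaleH\<close>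
  is a completion of \<open>E\<close> (with the topology defined by \<open>P\<close>) by means of \<open>j\<close>.  Completions are
  unique up to a unique isomorphism.  As \<open>j\<close> is a topological embedding, the topology defined by
  \<open>P\<close> is necessarily Hausdorff.
\<close>

definition is_completion ::
  "('k::real_normed_field, 'e, 'm) module_scheme \<Rightarrow> ('e \<Rightarrow> real) set \<Rightarrow>
   ('k \<Rightarrow> 'h::{uniform_topological_group_add,ab_group_add,complete_uniform_space,t2_space} \<Rightarrow> 'h) \<Rightarrow>
   ('e \<Rightarrow> 'h) \<Rightarrow> bool" where
  "is_completion E P scaleH j \<longleftrightarrow>
     locally_convex_space scaleH \<and>
     (\<forall>x\<in>carrier E. \<forall>y\<in>carrier E. j (x \<oplus>\<^bsub>E\<^esub> y) = j x + j y) \<and>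
     (\<forall>c. \<forall>x\<in>carrier E. j (c \<odot>\<^bsub>E\<^esub> x) = scaleH c (j x)) \<and>
     embedding_map (seminorm_topology E P) euclidean j \<and>
     closure (j ` carrier E) = UNIV"

text \<open>
  The completed \<open>n\<close>-fold projective tensor power.  The seminorms \<open>p\<^sup>n\<close> define the projective
  topology, since the continuous seminorms \<open>p\<close> are directed.
\<close>

definition is_completed_tensor_power ::
  "('k::real_normed_field \<Rightarrow> 'h::{ab_group_add,topological_space} \<Rightarrow> 'h) \<Rightarrow> nat \<Rightarrow>
   ('k \<Rightarrow> 'h2::{uniform_topological_group_add,ab_group_add,complete_uniform_space,t2_space} \<Rightarrow> 'h2) \<Rightarrow>
   (('k, 'h) tensor \<Rightarrow> 'h2) \<Rightarrow> bool" where
  "is_completed_tensor_power scaleH n scaleN jN \<longleftrightarrow>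
     is_completion (tensor_power (vec_mod scaleH) n)
       {projective_power (vec_mod scaleH) p n | p. continuous_seminorm scaleH p} scaleN jN"


section \<open>The universal enveloping algebra and the Gutt star product\<close>

definition uea_ideal ::
  "('k::field, 'a, 'm) module_scheme \<Rightarrow> ('a \<Rightarrow> 'a \<Rightarrow> 'a) \<Rightarrow> 'k \<Rightarrow> ('k, 'a) tensor set" where
  "uea_ideal M bracket z = genideal (tensor_algebra M)
     {tensor_sum M [(1, [x, y]), (- 1, [y, x]), (- z, [bracket x y])] | x y.
        x \<in> carrier M \<and> y \<in> carrier M}"

definition uea_class ::
  "('k::field, 'a, 'm) module_scheme \<Rightarrow> ('a \<Rightarrow> 'a \<Rightarrow> 'a) \<Rightarrow> 'k \<Rightarrow> ('k, 'a) tensor \<Rightarrow> ('k, 'a) tensor set" where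
  "uea_class M bracket z t = uea_ideal M bracket z +>\<^bsub>tensor_algebra M\<^esub> t"

definition uea ::
  "('k::field, 'a, 'm) module_scheme \<Rightarrow> ('a \<Rightarrow> 'a \<Rightarrow> 'a) \<Rightarrow> 'k \<Rightarrow> ('k, ('k, 'a) tensor set) module" where
  "uea M bracket z =
     (let Q = tensor_algebra M Quot uea_ideal M bracket z in
      \<lparr>carrier = carrier Q, mult = mult Q, one = one Q, zero = zero Q, add = add Q,
       smult = (\<lambda>c u. uea_class M bracket z (c \<odot>\<^bsub>tensor_algebra M\<^esub> \<one>\<^bsub>tensor_algebra M\<^esub>) \<otimes>\<^bsub>Q\<^esub> u)\<rparr>)"

definition algebra_hom ::
  "('k, 'a, 'm) module_scheme \<Rightarrow> ('k, 'b, 'n) module_scheme \<Rightarrow> ('a \<Rightarrow> 'b) \<Rightarrow> bool" where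
  "algebra_hom A B f \<longleftrightarrow>
     f \<in> ring_hom A B \<and> (\<forall>c. \<forall>x\<in>carrier A. f (c \<odot>\<^bsub>A\<^esub> x) = c \<odot>\<^bsub>B\<^esub> f x)"

definition uea_coproduct ::
  "('k::field, 'a, 'm) module_scheme \<Rightarrow> ('a \<Rightarrow> 'a \<Rightarrow> 'a) \<Rightarrow> 'k \<Rightarrow>
   ('k, 'a) tensor set \<Rightarrow> ('k, ('k, 'a) tensor set) tensor" where
  "uea_coproduct M bracket z =
     (let U = uea M bracket z; \<iota> = (\<lambda>x. uea_class M bracket z (tensor M [x])) in
      THE \<Delta>. \<Delta> \<in> extensional (carrier U) \<and> algebra_hom U (tensor_square_algebra U) \<Delta> \<and>
        (\<forall>x\<in>carrier M. \<Delta> (\<iota> x) =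
           tensor U [\<iota> x, \<one>\<^bsub>U\<^esub>] \<oplus>\<^bsub>tensor_square_algebra U\<^esub> tensor U [\<one>\<^bsub>U\<^esub>, \<iota> x]))"

definition uea_counit ::
  "('k::field, 'a, 'm) module_scheme \<Rightarrow> ('a \<Rightarrow> 'a \<Rightarrow> 'a) \<Rightarrow> 'k \<Rightarrow> ('k, 'a) tensor set \<Rightarrow> 'k" where
  "uea_counit M bracket z =
     (let U = uea M bracket z in
      THE \<epsilon>. \<epsilon> \<in> extensional (carrier U) \<and> algebra_hom U scalar_algebra \<epsilon> \<and>
        (\<forall>x\<in>carrier M. \<epsilon> (uea_class M bracket z (tensor M [x])) = 0))"

definition uea_antipode ::
  "('k::field, 'a, 'm) module_scheme \<Rightarrow> ('a \<Rightarrow> 'a \<Rightarrow> 'a) \<Rightarrow> 'k \<Rightarrow>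
   ('k, 'a) tensor set \<Rightarrow> ('k, 'a) tensor set" where
  "uea_antipode M bracket z =
     (let U = uea M bracket z; \<iota> = (\<lambda>x. uea_class M bracket z (tensor M [x])) in
      THE A. A \<in> extensional (carrier U) \<and>
        algebra_hom U (U\<lparr>mult := (\<lambda>u v. v \<otimes>\<^bsub>U\<^esub> u)\<rparr>) A \<and>
        (\<forall>x\<in>carrier M. A (\<iota> x) = \<ominus>\<^bsub>U\<^esub> \<iota> x))"

text \<open>
  Since \<open>x\<^sub>1 \<cdots> x\<^sub>n\<close> is the average of the tensors \<open>x\<^sub>\<sigma>\<^sub>(\<^sub>1\<^sub>) \<otimes> \<dots> \<otimes> x\<^sub>\<sigma>\<^sub>(\<^sub>n\<^sub>)\<close> inside the tensor algebra,
  the quantization map is the restriction of the quotient map to the symmetric tensors.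
\<close>

definition gutt_q ::
  "('k::field, 'a, 'm) module_scheme \<Rightarrow> ('a \<Rightarrow> 'a \<Rightarrow> 'a) \<Rightarrow> 'k \<Rightarrow> ('k, 'a) tensor \<Rightarrow> ('k, 'a) tensor set" where
  "gutt_q M bracket z f = uea_class M bracket z f"

definition gutt_q_inv ::
  "('k::field_char_0, 'a, 'm) module_scheme \<Rightarrow> ('a \<Rightarrow> 'a \<Rightarrow> 'a) \<Rightarrow> 'k \<Rightarrow>
   ('k, 'a) tensor set \<Rightarrow> ('k, 'a) tensor" where
  "gutt_q_inv M bracket z = inv_into (carrier (symmetric_tensors M)) (gutt_q M bracket z)"

definition gutt_star ::
  "('k::field_char_0, 'a, 'm) module_scheme \<Rightarrow> ('a \<Rightarrow> 'a \<Rightarrow> 'a) \<Rightarrow> 'k \<Rightarrow>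
   ('k, 'a) tensor \<Rightarrow> ('k, 'a) tensor \<Rightarrow> ('k, 'a) tensor" where
  "gutt_star M bracket z f g =
     gutt_q_inv M bracket z (gutt_q M bracket z f \<otimes>\<^bsub>uea M bracket z\<^esub> gutt_q M bracket z g)"

definition gutt_unit ::
  "('k::field_char_0, 'a, 'm) module_scheme \<Rightarrow> ('a \<Rightarrow> 'a \<Rightarrow> 'a) \<Rightarrow> 'k \<Rightarrow> ('k, 'a) tensor" where
  "gutt_unit M bracket z = gutt_q_inv M bracket z \<one>\<^bsub>uea M bracket z\<^esub>"

definition gutt_coproduct ::
  "('k::field_char_0, 'a, 'm) module_scheme \<Rightarrow> ('a \<Rightarrow> 'a \<Rightarrow> 'a) \<Rightarrow> 'k \<Rightarrow>
   ('k, 'a) tensor \<Rightarrow> ('k, ('k, 'a) tensor) tensor" where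
  "gutt_coproduct M bracket z f =
     inv_into (carrier (tensor_power (symmetric_tensors M) 2))
       (tensor_map (uea M bracket z) (gutt_q M bracket z))
       (uea_coproduct M bracket z (gutt_q M bracket z f))"

definition gutt_counit ::
  "('k::field_char_0, 'a, 'm) module_scheme \<Rightarrow> ('a \<Rightarrow> 'a \<Rightarrow> 'a) \<Rightarrow> 'k \<Rightarrow> ('k, 'a) tensor \<Rightarrow> 'k" where
  "gutt_counit M bracket z f = uea_counit M bracket z (gutt_q M bracket z f)"

definition gutt_antipode ::
  "('k::field_char_0, 'a, 'm) module_scheme \<Rightarrow> ('a \<Rightarrow> 'a \<Rightarrow> 'a) \<Rightarrow> 'k \<Rightarrow>
   ('k, 'a) tensor \<Rightarrow> ('k, 'a) tensor" where
  "gutt_antipode M bracket z f =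
     gutt_q_inv M bracket z (uea_antipode M bracket z (gutt_q M bracket z f))"


section \<open>Locally convex Hopf algebras\<close>

definition continuous_linear ::
  "('k::real_normed_field \<Rightarrow> 'a::{ab_group_add,topological_space} \<Rightarrow> 'a) \<Rightarrow>
   ('k \<Rightarrow> 'b::{ab_group_add,topological_space} \<Rightarrow> 'b) \<Rightarrow> ('a \<Rightarrow> 'b) \<Rightarrow> bool" where
  "continuous_linear s1 s2 f \<longleftrightarrow> Vector_Spaces.linear s1 s2 f \<and> continuous_on UNIV f"

definition continuous_bilinear ::
  "('k::real_normed_field \<Rightarrow> 'a::{ab_group_add,topological_space} \<Rightarrow> 'a) \<Rightarrow>
   ('k \<Rightarrow> 'b::{ab_group_add,topological_space} \<Rightarrow> 'b) \<Rightarrow>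
   ('k \<Rightarrow> 'c::{ab_group_add,topological_space} \<Rightarrow> 'c) \<Rightarrow> ('a \<Rightarrow> 'b \<Rightarrow> 'c) \<Rightarrow> bool" where
  "continuous_bilinear s1 s2 s3 f \<longleftrightarrow>
     (\<forall>x. Vector_Spaces.linear s2 s3 (f x)) \<and> (\<forall>y. Vector_Spaces.linear s1 s3 (\<lambda>x. f x y)) \<and>
     continuous_on UNIV (\<lambda>(x, y). f x y)"

text \<open>
  A Hopf algebra structure on \<open>H\<close> with continuous structure maps, where the coproduct takes values
  in the completed projective tensor square \<open>H2\<close>; \<open>H3\<close> is the completed third tensor power.  A map
  on \<open>H2\<close> written with a completed tensor product, such as \<open>\<epsilon> \<otimes> id\<close>, is the continuous linear map
  with the stated values on the elementary tensors (which span a dense subspace).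
\<close>

locale locally_convex_hopf_algebra = locally_convex_space scaleH
  for scaleH :: "'k::{real_normed_field,banach} \<Rightarrow>
        'h::{uniform_topological_group_add,ab_group_add,complete_uniform_space,t2_space} \<Rightarrow> 'h"
    and scaleH2 :: "'k \<Rightarrow>
        'h2::{uniform_topological_group_add,ab_group_add,complete_uniform_space,t2_space} \<Rightarrow> 'h2"
    and j2 :: "('k, 'h) tensor \<Rightarrow> 'h2"
    and scaleH3 :: "'k \<Rightarrow>
        'h3::{uniform_topological_group_add,ab_group_add,complete_uniform_space,t2_space} \<Rightarrow> 'h3"
    and j3 :: "('k, 'h) tensor \<Rightarrow> 'h3"
    and times :: "'h \<Rightarrow> 'h \<Rightarrow> 'h" and unit :: 'h
    and coproduct :: "'h \<Rightarrow> 'h2" and counit :: "'h \<Rightarrow> 'k" and antipode :: "'h \<Rightarrow> 'h" +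
  fixes tens2 :: "'h \<Rightarrow> 'h \<Rightarrow> 'h2" and tens3 :: "'h \<Rightarrow> 'h \<Rightarrow> 'h \<Rightarrow> 'h3"
  defines "tens2 x y \<equiv> j2 (tensor (vec_mod scaleH) [x, y])"
    and "tens3 x y w \<equiv> j3 (tensor (vec_mod scaleH) [x, y, w])"
  assumes tensor_square: "is_completed_tensor_power scaleH 2 scaleH2 j2"
    and tensor_cube: "is_completed_tensor_power scaleH 3 scaleH3 j3"
    and times_continuous: "continuous_bilinear scaleH scaleH scaleH times"
    and times_assoc: "times (times x y) w = times x (times y w)"
    and unit_left: "times unit x = x"
    and unit_right: "times x unit = x"
    and coproduct_continuous: "continuous_linear scaleH scaleH2 coproduct"
    and counit_continuous: "continuous_linear scaleH (*) counit"
    and antipode_continuous: "continuous_linear scaleH scaleH antipode"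
    and coassociative:
      "\<exists>tens21 tens12 coproduct_id id_coproduct.
         continuous_bilinear scaleH2 scaleH scaleH3 tens21 \<and>
         (\<forall>x y w. tens21 (tens2 x y) w = tens3 x y w) \<and>
         continuous_bilinear scaleH scaleH2 scaleH3 tens12 \<and>
         (\<forall>x y w. tens12 x (tens2 y w) = tens3 x y w) \<and>
         continuous_linear scaleH2 scaleH3 coproduct_id \<and>
         (\<forall>x y. coproduct_id (tens2 x y) = tens21 (coproduct x) y) \<and>
         continuous_linear scaleH2 scaleH3 id_coproduct \<and>
         (\<forall>x y. id_coproduct (tens2 x y) = tens12 x (coproduct y)) \<and>
         (\<forall>x. coproduct_id (coproduct x) = id_coproduct (coproduct x))"
    and counital:
      "\<exists>counit_id id_counit.
         continuous_linear scaleH2 scaleH counit_id \<and>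
         (\<forall>x y. counit_id (tens2 x y) = scaleH (counit x) y) \<and>
         continuous_linear scaleH2 scaleH id_counit \<and>
         (\<forall>x y. id_counit (tens2 x y) = scaleH (counit y) x) \<and>
         (\<forall>x. counit_id (coproduct x) = x \<and> id_counit (coproduct x) = x)"
    and coproduct_times:
      "\<exists>times2. continuous_bilinear scaleH2 scaleH2 scaleH2 times2 \<and>
         (\<forall>x y v w. times2 (tens2 x y) (tens2 v w) = tens2 (times x v) (times y w)) \<and>
         (\<forall>x y. coproduct (times x y) = times2 (coproduct x) (coproduct y))"
    and coproduct_unit: "coproduct unit = tens2 unit unit"
    and counit_times: "counit (times x y) = counit x * counit y"
    and counit_unit: "counit unit = 1"
    and antipode:
      "\<exists>times_antipode_id times_id_antipode.
         continuous_linear scaleH2 scaleH times_antipode_id \<and>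
         (\<forall>x y. times_antipode_id (tens2 x y) = times (antipode x) y) \<and>
         continuous_linear scaleH2 scaleH times_id_antipode \<and>
         (\<forall>x y. times_id_antipode (tens2 x y) = times x (antipode y)) \<and>
         (\<forall>x. times_antipode_id (coproduct x) = scaleH (counit x) unit \<and>
              times_id_antipode (coproduct x) = scaleH (counit x) unit)"

text \<open>
  The Hopf algebra structure of the symmetric tensor algebra extends along the completion \<open>j\<close> to
  a locally convex Hopf algebra.
\<close>

definition gutt_hopf_extends ::
  "('k::{real_normed_field,banach} \<Rightarrow> 'g::ab_group_add \<Rightarrow> 'g) \<Rightarrow> ('g \<Rightarrow> 'g \<Rightarrow> 'g) \<Rightarrow> 'k \<Rightarrow>
   ('k \<Rightarrow> 'h::{uniform_topological_group_add,ab_group_add,complete_uniform_space,t2_space} \<Rightarrow> 'h) \<Rightarrow>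
   (('k, 'g) tensor \<Rightarrow> 'h) \<Rightarrow>
   ('k \<Rightarrow> 'h2::{uniform_topological_group_add,ab_group_add,complete_uniform_space,t2_space} \<Rightarrow> 'h2) \<Rightarrow>
   (('k, 'h) tensor \<Rightarrow> 'h2) \<Rightarrow>
   ('k \<Rightarrow> 'h3::{uniform_topological_group_add,ab_group_add,complete_uniform_space,t2_space} \<Rightarrow> 'h3) \<Rightarrow>
   (('k, 'h) tensor \<Rightarrow> 'h3) \<Rightarrow> bool" where
  "gutt_hopf_extends scaleV bracket z scaleH j scaleH2 j2 scaleH3 j3 \<longleftrightarrow>
     (let M = vec_mod scaleV; S = carrier (symmetric_tensors M) in
      \<exists>times unit coproduct counit antipode.
        locally_convex_hopf_algebra scaleH scaleH2 j2 scaleH3 j3 times unit coproduct counit antipode \<and>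
        (\<forall>f\<in>S. \<forall>g\<in>S. times (j f) (j g) = j (gutt_star M bracket z f g)) \<and>
        unit = j (gutt_unit M bracket z) \<and>
        (\<forall>f\<in>S. coproduct (j f) =
           j2 (tensor_map (vec_mod scaleH) j (gutt_coproduct M bracket z f))) \<and>
        (\<forall>f\<in>S. counit (j f) = gutt_counit M bracket z f) \<and>
        (\<forall>f\<in>S. antipode (j f) = j (gutt_antipode M bracket z f)))"

end

theory Submission
  imports Defs "HOL-Combinatorics.Multiset_Permutations"
begin

text \<open>
  Multilinear forms \<open>\<phi>\<close> with \<open>\<phi>(\<dots> x y \<dots>) - \<phi>(\<dots> y x \<dots>) = z \<phi>(\<dots> [x, y] \<dots>)\<close> form the dual of the enveloping
  algebra.  Every multilinear form agrees with one of these on the symmetric tensors (the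
  Poincare-Birkhoff-Witt theorem), so each word \<open>x\<^sub>1 \<otimes> \<dots> \<otimes> x\<^sub>n\<close> is congruent to a unique symmetric tensor.
  On the resulting symmetric tensors, the product is concatenation of words, the coproduct is the sum over
  all splittings into complementary subwords and the antipode is signed reversal.  As projective
  seminorms are determined by their values on words, all structure maps extend to the completion, and
  the Hopf algebra axioms hold there by density, once the symmetric tensor congruent to a word is bounded.

  Rewriting a word of length \<open>n\<close> into symmetric products \<open>u\<^sub>1 \<cdots> u\<^sub>k\<close> of Lie words in its letters costs only
  \<open>c\<^sup>n n!\<close>, if the product \<open>u\<^sub>1 \<cdots> u\<^sub>k\<close> is assigned the size \<open>k!\<close>.  What remains is to compare the weights of
  degree \<open>k\<close> and \<open>n\<close>.  For \<open>R \<ge> 1\<close> this is \<open>k!\<^sup>R \<le> k! n!\<^sup>R\<^sup>-\<^sup>1\<close>.  If words of length greater than \<open>L\<close> vanish, then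
  \<open>n \<le> L k\<close> and \<open>n! \<le> c\<^sup>n k!\<^sup>L\<close>, which merely replaces \<open>1 - R\<close> by \<open>(1 - R) / L\<close>.  In the Banach case, either
  \<open>k\<close> is proportional to \<open>n\<close> and \<open>\<alpha>\<^sub>k\<close> is large, or long words occur, whose norms decay faster than exponentially.
\<close>

section \<open>Sums over splittings and over permutations\<close>

text \<open>No formula for the star product of two symmetric tensors, such as the
  Baker-Campbell-Hausdorff series, enters. Words are preferred to symmetric products because the
  structure maps contain no bracket on them; all brackets are confined to one estimate,
  \<open>rep_bound\<close>, for the symmetric representative of a word.

  The obstacle is R = 1. Moving a letter past a block of n letters creates n brackets, and a
  careless count of all rewritings of a word gives a bound like (n!)^2. The remedy is to keep the
  block symmetrized: the tensor with the letter in one place is compared with the average over all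
  places. By \<open>avg_coeff_sum\<close> the difference is a combination of n increments with
  coefficients at most 1, and each increment is an average of n brackets. One round thus costs a
  factor n and leaves one letter less, so passing from s letters to k costs about s!/k!, up to
  exponential factors; the size k! of a symmetric product completes this to s!.\<close>

primrec split_sum :: "'a list \<Rightarrow> ('a list \<Rightarrow> 'a list \<Rightarrow> 'b::comm_monoid_add) \<Rightarrow> 'b" where
  "split_sum [] = (\<lambda>F. F [] [])"
| "split_sum (x # xs) =
     (\<lambda>F. split_sum xs (\<lambda>ys zs. F (x # ys) zs) + split_sum xs (\<lambda>ys zs. F ys (x # zs)))"

lemma split_sum_append:
  "split_sum (xs @ ys) F = split_sum xs (\<lambda>a b. split_sum ys (\<lambda>c d. F (a @ c) (b @ d)))"
  by (induction xs arbitrary: F) auto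

lemma split_sum_add: "split_sum xs (\<lambda>a b. F a b + G a b) = split_sum xs F + split_sum xs G"
  by (induction xs arbitrary: F G) (auto simp: algebra_simps)

lemma split_sum_zero [simp]: "split_sum xs (\<lambda>a b. 0) = 0"
  by (induction xs) auto

lemma split_sum_hom:
  assumes "\<And>x y. f (x + y) = f x + f y"
  shows "f (split_sum xs F) = split_sum xs (\<lambda>a b. f (F a b))"
  by (induction xs arbitrary: F) (auto simp: assms)

lemma split_sum_swap:
  "split_sum xs (\<lambda>a b. split_sum ys (G a b)) = split_sum ys (\<lambda>c d. split_sum xs (\<lambda>a b. G a b c d))"
  by (induction xs arbitrary: G) (auto simp: split_sum_add)

text \<open>Both sides run over all distributions of the letters into three subwords.\<close>

lemma split_sum_coassoc:
  "split_sum xs (\<lambda>a c. split_sum a (\<lambda>b1 b2. F b1 b2 c)) =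
   split_sum xs (\<lambda>a c. split_sum c (\<lambda>c1 c2. F a c1 c2))"
  by (induction xs arbitrary: F) (auto simp: split_sum_add algebra_simps)

text \<open>Exactly one splitting has an empty first part.\<close>

lemma split_sum_counit_left: "split_sum xs (\<lambda>a b. if a = [] then F b else 0) = F xs"
  by (induction xs arbitrary: F) auto

lemma split_sum_counit_right: "split_sum xs (\<lambda>a b. if b = [] then F a else 0) = F xs"
  by (induction xs arbitrary: F) auto

lemma split_sum_mono:
  fixes F G :: "'a list \<Rightarrow> 'a list \<Rightarrow> 'b::ordered_comm_monoid_add"
  assumes "\<And>a b. mset a + mset b = mset xs \<Longrightarrow> F a b \<le> G a b"
  shows "split_sum xs F \<le> split_sum xs G"
  using assms
proof (induction xs arbitrary: F G)
  case (Cons x xs)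
  show ?case
    by (simp, intro add_mono Cons.IH Cons.prems) auto
qed auto

lemma split_sum_const: "split_sum xs (\<lambda>a b. c) = 2 ^ length xs * (c::'b::comm_semiring_1)"
  by (induction xs) (auto simp: algebra_simps mult_2)

text \<open>The first letter may go to either part, and \<open>rev (x # a) @ b\<close> is the word
  \<open>rev a @ x # b\<close>, so the two choices cancel by the sign. The sign (-1)^n is abstracted
  to \<open>s n\<close>, because in the application it acts through the scalar multiplication of the
  completion.\<close>

lemma split_sum_antipode_left:
  fixes G :: "'a list \<Rightarrow> 'b::ab_group_add"
  assumes s: "\<And>n x. s (Suc n) x = - s n x" and s0: "\<And>x. s 0 x = x"
    and s_add: "\<And>n x y. s n (x + y) = s n x + s n y"
  shows "split_sum xs (\<lambda>a b. s (length a) (G (rev a @ b))) = (if xs = [] then G [] else 0)"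
proof -
  have "split_sum xs (\<lambda>a b. s (length (x # a)) (F a b)) = - split_sum xs (\<lambda>a b. s (length a) (F a b))"
    for F x and xs :: "'a list"
    using split_sum_hom[of uminus xs "\<lambda>a b. s (length a) (F a b)"] by (simp add: s)
  then show ?thesis
    by (cases xs) (auto simp: s0)
qed

text \<open>Here the last letter changes sides: \<open>(a @ [y]) @ rev b\<close> and
  \<open>a @ rev (b @ [y])\<close> are the same word.\<close>

lemma split_sum_antipode_right:
  fixes G :: "'a list \<Rightarrow> 'b::ab_group_add"
  assumes s: "\<And>n x. s (Suc n) x = - s n x" and s0: "\<And>x. s 0 x = x"
  shows "split_sum xs (\<lambda>a b. s (length b) (G (a @ rev b))) = (if xs = [] then G [] else 0)"
proof (cases xs rule: rev_cases)
  case (snoc ys y)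
  have "split_sum ys (\<lambda>a b. s (length (y # b)) (F a b)) = - split_sum ys (\<lambda>a b. s (length b) (F a b))"
    for F
    using split_sum_hom[of uminus ys "\<lambda>a b. s (length b) (F a b)"] by (simp add: s)
  then show ?thesis
    by (simp add: snoc split_sum_append split_sum_add)
qed (simp add: s0)

section \<open>Sums over the orderings of a finite index set\<close>

lemma mset_insert_at: "mset (take m js @ l # drop m js) = mset (l # js)"
  by (metis append_take_drop_id mset.simps(2) mset_append union_mset_add_mset_right)

lemma set_distinct_insert_at:
  "set (take m js @ l # drop m js) = set (l # js)"
  "distinct (take m js @ l # drop m js) = distinct (l # js)"
  by (rule mset_eq_setD[OF mset_insert_at], rule mset_eq_imp_distinct_iff[OF mset_insert_at])

text \<open>Orderings are grouped by the entry \<open>l\<close> at place \<open>m\<close>, the rest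
  being an ordering of \<open>I - {l}\<close>. This is used where an exchange at place
  \<open>m\<close> replaces that entry by a bracket.\<close>

lemma sum_permutations_position:
  fixes F :: "'i list \<Rightarrow> 'b::comm_monoid_add"
  assumes "finite I" "m < card I"
  shows "sum F (permutations_of_set I) =
    (\<Sum>l\<in>I. \<Sum>js\<in>permutations_of_set (I - {l}). F (take m js @ l # drop m js))"
proof -
  have "(\<Sum>l\<in>I. \<Sum>js\<in>permutations_of_set (I - {l}). F (take m js @ l # drop m js)) =
     (\<Sum>(l, js)\<in>Sigma I (\<lambda>l. permutations_of_set (I - {l})). F (take m js @ l # drop m js))"
    using assms by (subst sum.Sigma) auto
  also have "\<dots> = sum F (permutations_of_set I)"
  proof (rule sum.reindex_bij_witness[where j = "\<lambda>(l, js). take m js @ l # drop m js"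
        and i = "\<lambda>is. (is ! m, take m is @ drop (Suc m) is)"])
    fix p assume "p \<in> Sigma I (\<lambda>l. permutations_of_set (I - {l}))"
    then obtain l js where p: "p = (l, js)" "l \<in> I" "set js = I - {l}" "distinct js"
      by (auto simp: permutations_of_set_def)
    then have len: "length js = card I - 1"
      using assms(1) distinct_card[of js] by simp
    then have m: "m \<le> length js" using assms(2) by simp
    show "(case p of (l, js) \<Rightarrow> take m js @ l # drop m js) \<in> permutations_of_set I"
    proof -
      note set_distinct_insert_at[of m js l]
      then show ?thesis using p by (auto simp: permutations_of_set_def simp del: set_append distinct_append)
    qed
    show "((case p of (l, js) \<Rightarrow> take m js @ l # drop m js) ! m,
          take m (case p of (l, js) \<Rightarrow> take m js @ l # drop m js) @
          drop (Suc m) (case p of (l, js) \<Rightarrow> take m js @ l # drop m js)) = p"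
      using m p by (auto simp: nth_append min_def)
    show "F (case p of (l, js) \<Rightarrow> take m js @ l # drop m js) =
        (case p of (l, js) \<Rightarrow> F (take m js @ l # drop m js))"
      using p by simp
  next
    fix js assume "js \<in> permutations_of_set I"
    then have js: "set js = I" "distinct js" by (auto simp: permutations_of_set_def)
    then have "m < length js" using assms distinct_card[of js] by simp
    then have eq: "take m js @ js ! m # drop (Suc m) js = js" by (simp add: id_take_nth_drop[symmetric])
    then have d: "distinct (take m js @ js ! m # drop (Suc m) js)" "set (take m js @ js ! m # drop (Suc m) js) = I"
      using js by auto
    then show "(js ! m, take m js @ drop (Suc m) js) \<in> (SIGMA l:I. permutations_of_set (I - {l}))"
      by (auto simp: permutations_of_set_def)
    show "(case (js ! m, take m js @ drop (Suc m) js) of (l, js) \<Rightarrow> take m js @ l # drop m js) = js"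
      using \<open>m < length js\<close> eq by (simp add: min_def)
  qed
  finally show ?thesis ..
qed

text \<open>Here the orderings are grouped by the place of one fixed entry, which \<open>pos\<close>
  recovers.\<close>

lemma sum_permutations_insert:
  fixes F :: "'i list \<Rightarrow> 'b::comm_monoid_add"
  assumes "finite I" "l \<notin> I"
  shows "sum F (permutations_of_set (insert l I)) =
    (\<Sum>m\<le>card I. \<Sum>js\<in>permutations_of_set I. F (take m js @ l # drop m js))"
proof -
  define pos where "pos js = length (takeWhile (\<lambda>x. x \<noteq> l) js)" for js
  have "(\<Sum>m\<le>card I. \<Sum>js\<in>permutations_of_set I. F (take m js @ l # drop m js)) =
     (\<Sum>(m, js)\<in>{..card I} \<times> permutations_of_set I. F (take m js @ l # drop m js))"
    by (simp add: sum.cartesian_product)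
  also have "\<dots> = sum F (permutations_of_set (insert l I))"
  proof (rule sum.reindex_bij_witness[where j = "\<lambda>(m, js). take m js @ l # drop m js"
        and i = "\<lambda>is. (pos is, remove1 l is)"])
    fix p assume "p \<in> {..card I} \<times> permutations_of_set I"
    then obtain m js where p: "p = (m, js)" "m \<le> card I" "set js = I" "distinct js"
      by (auto simp: permutations_of_set_def)
    then have m: "m \<le> length js" using distinct_card[of js] by simp
    show "(case p of (m, js) \<Rightarrow> take m js @ l # drop m js) \<in> permutations_of_set (insert l I)"
    proof -
      note set_distinct_insert_at[of m js l]
      then show ?thesis using p assms by (auto simp: permutations_of_set_def simp del: set_append distinct_append)
    qed
    have nin: "l \<notin> set (take m js)" using p assms by (auto dest: in_set_takeD)
    then have "pos (take m js @ l # drop m js) = m"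
      using m by (auto simp: pos_def takeWhile_append)
    moreover have "remove1 l (take m js @ l # drop m js) = js"
      using nin by (simp add: remove1_append)
    ultimately show "(pos (case p of (m, js) \<Rightarrow> take m js @ l # drop m js),
        remove1 l (case p of (m, js) \<Rightarrow> take m js @ l # drop m js)) = p"
      using p by simp
    show "F (case p of (m, js) \<Rightarrow> take m js @ l # drop m js) =
        (case p of (m, js) \<Rightarrow> F (take m js @ l # drop m js))"
      using p by simp
  next
    fix js assume "js \<in> permutations_of_set (insert l I)"
    then have js: "set js = insert l I" "distinct js" by (auto simp: permutations_of_set_def)
    then obtain as bs where ab: "js = as @ l # bs" by (metis insertI1 split_list)
    then have l: "l \<notin> set as" "l \<notin> set bs" using js by auto
    then have pos: "pos js = length as" unfolding pos_def ab by (subst takeWhile_append2) auto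
    have rem: "remove1 l js = as @ bs" using l by (simp add: ab remove1_append)
    have I: "set (as @ bs) = I" "distinct (as @ bs)" using js l assms by (auto simp: ab)
    then have "card I = length as + length bs" using distinct_card[of "as @ bs"] by simp
    then show "(pos js, remove1 l js) \<in> {..card I} \<times> permutations_of_set I"
      using I by (auto simp: pos rem permutations_of_set_def)
    show "(case (pos js, remove1 l js) of (m, js) \<Rightarrow> take m js @ l # drop m js) = js"
      unfolding prod.case pos rem by (simp add: ab)
  qed
  finally show ?thesis ..
qed

text \<open>Passes from permutations of places, as in \<open>sym_prod\<close>, to orderings of
  distinct indices. Indexing the letters keeps equal letters apart.\<close>

lemma sum_permute_list:
  fixes F :: "'a list \<Rightarrow> 'b::comm_monoid_add"
  assumes "distinct is"
  shows "(\<Sum>\<sigma> | \<sigma> permutes {..<length is}. F (permute_list \<sigma> (map x is))) =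
    (\<Sum>js\<in>permutations_of_set (set is). F (map x js))"
proof -
  have "bij_betw (\<lambda>\<sigma>. permute_list \<sigma> is) {\<sigma>. \<sigma> permutes {..<length is}} (permutations_of_set (set is))"
  proof (rule bij_betwI')
    fix \<sigma> \<tau> assume s: "\<sigma> \<in> {\<sigma>. \<sigma> permutes {..<length is}}" "\<tau> \<in> {\<sigma>. \<sigma> permutes {..<length is}}"
    show "(permute_list \<sigma> is = permute_list \<tau> is) = (\<sigma> = \<tau>)"
    proof
      assume eq: "permute_list \<sigma> is = permute_list \<tau> is"
      show "\<sigma> = \<tau>"
      proof
        fix i
        show "\<sigma> i = \<tau> i"
        proof (cases "i < length is")
          case True
          then have "is ! \<sigma> i = is ! \<tau> i"
            using eq s by (metis mem_Collect_eq permute_list_nth)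
          moreover have "\<sigma> i < length is" "\<tau> i < length is"
            using s True by (auto simp: permutes_in_image[of _ "{..<length is}", unfolded lessThan_iff])
          ultimately show ?thesis
            using assms by (simp add: nth_eq_iff_index_eq)
        next
          case False
          then show ?thesis using s by (simp add: permutes_def)
        qed
      qed
    qed simp
  next
    fix \<sigma> assume "\<sigma> \<in> {\<sigma>. \<sigma> permutes {..<length is}}"
    then show "permute_list \<sigma> is \<in> permutations_of_set (set is)"
      using assms by (simp add: permutations_of_set_def)
  next
    fix js assume "js \<in> permutations_of_set (set is)"
    then have "mset js = mset is"
      using assms set_eq_iff_mset_eq_distinct[of js "is"] by (simp add: permutations_of_set_def)
    then obtain \<sigma> where "\<sigma> permutes {..<length is}" "permute_list \<sigma> is = js"
      using mset_eq_permutation by metis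
    then show "\<exists>\<sigma>\<in>{\<sigma>. \<sigma> permutes {..<length is}}. js = permute_list \<sigma> is" by auto
  qed
  then have "(\<Sum>js\<in>permutations_of_set (set is). F (map x js)) =
      (\<Sum>\<sigma> | \<sigma> permutes {..<length is}. F (map x (permute_list \<sigma> is)))"
    by (rule sum.reindex_bij_betw[symmetric])
  also have "\<dots> = (\<Sum>\<sigma> | \<sigma> permutes {..<length is}. F (permute_list \<sigma> (map x is)))"
    by (intro sum.cong refl) (simp add: permute_list_map)
  finally show ?thesis ..
qed

text \<open>If \<tau> rearranges one list into the other, then composition with \<tau> permutes the
  summands.\<close>

lemma sum_permute_list_mset:
  fixes F :: "'a list \<Rightarrow> 'b::comm_monoid_add"
  assumes "mset xs = mset ys"
  shows "(\<Sum>\<sigma> | \<sigma> permutes {..<length xs}. F (permute_list \<sigma> xs)) =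
    (\<Sum>\<sigma> | \<sigma> permutes {..<length ys}. F (permute_list \<sigma> ys))"
proof -
  obtain \<tau> where t: "\<tau> permutes {..<length ys}" "permute_list \<tau> ys = xs"
    using assms mset_eq_permutation by metis
  have len: "length xs = length ys" using assms by (metis size_mset)
  have "(\<Sum>\<sigma> | \<sigma> permutes {..<length xs}. F (permute_list \<sigma> xs)) =
      (\<Sum>\<sigma> | \<sigma> permutes {..<length ys}. F (permute_list (\<tau> \<circ> \<sigma>) ys))"
    unfolding t(2)[symmetric] by (intro sum.cong) (auto simp: permute_list_compose)
  also have "\<dots> = (\<Sum>\<sigma> | \<sigma> permutes {..<length ys}. F (permute_list \<sigma> ys))"
  proof (rule sum.reindex_bij_witness[where j = "(\<circ>) \<tau>" and i = "(\<circ>) (Hilbert_Choice.inv \<tau>)"])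
    show "\<tau> \<circ> \<sigma> \<in> {\<sigma>. \<sigma> permutes {..<length ys}}" if "\<sigma> \<in> {\<sigma>. \<sigma> permutes {..<length ys}}" for \<sigma>
      using that t(1) by (auto intro: permutes_compose)
    show "Hilbert_Choice.inv \<tau> \<circ> \<sigma> \<in> {\<sigma>. \<sigma> permutes {..<length ys}}" if "\<sigma> \<in> {\<sigma>. \<sigma> permutes {..<length ys}}" for \<sigma>
      using that t(1) by (auto intro: permutes_compose permutes_inv)
  qed (auto simp: fun_eq_iff permutes_inverses[OF t(1)])
  finally show ?thesis .
qed

text \<open>
  The difference of one term to the average of a finite sequence is a combination of the
  increments, with coefficients in \<open>[-1, 1]\<close>.
\<close>

definition avg_coeff :: "nat \<Rightarrow> nat \<Rightarrow> nat \<Rightarrow> real" where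
  "avg_coeff n i m = (if m < i then real (m + 1) else - real (n - m)) / real (n + 1)"

lemma abs_avg_coeff: "m < n \<Longrightarrow> i \<le> n \<Longrightarrow> \<bar>avg_coeff n i m\<bar> \<le> 1"
  by (auto simp: avg_coeff_def field_simps)

text \<open>Telescope a_i - a_k and average over k. The increment at m < i is counted once for each
  of the m + 1 indices k \<le> m, and the increment at m \<ge> i negatively for each of the n - m
  indices k > m.\<close>

lemma avg_coeff_sum:
  fixes a :: "nat \<Rightarrow> 'b::real_vector"
  assumes "i \<le> n"
  shows "a i = (1 / real (n + 1)) *\<^sub>R (\<Sum>m\<le>n. a m) + (\<Sum>m<n. avg_coeff n i m *\<^sub>R (a (Suc m) - a m))"
proof -
  \<comment> \<open>The increments on the two sides of i are summed by parts separately.\<close>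
  have 1: "(\<Sum>m<i. real (m + 1) *\<^sub>R (a (Suc m) - a m)) = real i *\<^sub>R a i - (\<Sum>m<i. a m)" for i
    by (induction i) (auto simp: algebra_simps)
  have 2: "(\<Sum>m\<in>{i..<n}. real (n - m) *\<^sub>R (a (Suc m) - a m)) = (\<Sum>m\<in>{Suc i..n}. a m) - real (n - i) *\<^sub>R a i"
    if "i \<le> n" for n
    using that
  proof (induction n rule: dec_induct)
    case (step n)
    have "(\<Sum>m\<in>{i..<Suc n}. real (Suc n - m) *\<^sub>R (a (Suc m) - a m)) =
      (\<Sum>m\<in>{i..<n}. real (n - m) *\<^sub>R (a (Suc m) - a m)) + (\<Sum>m\<in>{i..<Suc n}. a (Suc m) - a m)"
      using step.hyps by (simp add: sum.distrib[symmetric] Suc_diff_le algebra_simps)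
    also have "(\<Sum>m\<in>{i..<Suc n}. a (Suc m) - a m) = a (Suc n) - a i"
      using step.hyps by (subst sum_Suc_diff') auto
    finally have "(\<Sum>m\<in>{i..<Suc n}. real (Suc n - m) *\<^sub>R (a (Suc m) - a m)) =
      (\<Sum>m\<in>{Suc i..n}. a m) - real (n - i) *\<^sub>R a i + (a (Suc n) - a i)"
      by (simp only: step.IH)
    moreover have "(\<Sum>m\<in>{Suc i..Suc n}. a m) = (\<Sum>m\<in>{Suc i..n}. a m) + a (Suc n)"
      using step.hyps by simp
    moreover have "real (Suc n - i) = real (n - i) + 1" using step.hyps by simp
    ultimately show ?case
      by (simp only:) (simp add: algebra_simps)
  qed auto
  have "real (n + 1) *\<^sub>R (\<Sum>m<n. avg_coeff n i m *\<^sub>R (a (Suc m) - a m)) =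
     (\<Sum>m<n. (if m < i then real (m + 1) else - real (n - m)) *\<^sub>R (a (Suc m) - a m))"
    by (simp add: scaleR_sum_right avg_coeff_def)
  also have "\<dots> = (\<Sum>m\<in>{..<i} \<union> {i..<n}. (if m < i then real (m + 1) else - real (n - m)) *\<^sub>R (a (Suc m) - a m))"
    using assms by (intro sum.cong) auto
  also have "\<dots> =
      (\<Sum>m<i. real (m + 1) *\<^sub>R (a (Suc m) - a m)) - (\<Sum>m\<in>{i..<n}. real (n - m) *\<^sub>R (a (Suc m) - a m))"
    by (subst sum.union_disjoint) (auto simp: sum_negf[symmetric] scaleR_minus_left[symmetric] intro!: sum.cong)
  also have "\<dots> = real i *\<^sub>R a i - (\<Sum>m<i. a m) - ((\<Sum>m\<in>{Suc i..n}. a m) - real (n - i) *\<^sub>R a i)"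
    by (simp only: 1 2[OF assms])
  also have "\<dots> = real (n + 1) *\<^sub>R a i - (\<Sum>m\<le>n. a m)"
  proof -
    have "{..n} = {..<i} \<union> {i} \<union> {Suc i..n}" using assms by auto
    then have "(\<Sum>m\<le>n. a m) = (\<Sum>m<i. a m) + a i + (\<Sum>m\<in>{Suc i..n}. a m)"
      by (simp add: sum.union_disjoint[of "{..<i}" "{Suc i..n}"] disjoint_iff ac_simps)
    moreover have "real (n + 1) *\<^sub>R a i = real i *\<^sub>R a i + a i + real (n - i) *\<^sub>R a i"
      using assms by (simp add: of_nat_diff algebra_simps)
    ultimately show ?thesis by simp
  qed
  finally have eq: "real (n + 1) *\<^sub>R (\<Sum>m<n. avg_coeff n i m *\<^sub>R (a (Suc m) - a m)) =
      real (n + 1) *\<^sub>R a i - (\<Sum>m\<le>n. a m)" .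
  have "(1 / real (n + 1)) *\<^sub>R (real (n + 1) *\<^sub>R (\<Sum>m<n. avg_coeff n i m *\<^sub>R (a (Suc m) - a m))) =
    a i - (1 / real (n + 1)) *\<^sub>R (\<Sum>m\<le>n. a m)"
    unfolding eq by (simp add: scaleR_diff_right)
  then show ?thesis by simp
qed

section \<open>Spans of functionals and multilinear forms\<close>

text \<open>The carriers of the tensor algebra, of the tensor powers and of the symmetric tensors
  all have this form, with \<open>g\<close> the tensor or the symmetric product of a word, and so
  share the closure and induction rules below.\<close>

definition lspan :: "('b \<Rightarrow> 'f \<Rightarrow> 'k::comm_ring_1) \<Rightarrow> 'b set \<Rightarrow> ('f \<Rightarrow> 'k) set" where
  "lspan g A = {(\<lambda>\<phi>. \<Sum>(c, x)\<leftarrow>L. c * g x \<phi>) | L. \<forall>(c, x)\<in>set L. x \<in> A}"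

lemma lspan_zero [simp]: "(\<lambda>\<phi>. 0) \<in> lspan g A"
  unfolding lspan_def by (auto intro: exI[of _ "[]"])

lemma lspan_base: "x \<in> A \<Longrightarrow> g x \<in> lspan g A"
  unfolding lspan_def by (auto intro!: exI[of _ "[(1, x)]"])

lemma lspan_add: "s \<in> lspan g A \<Longrightarrow> t \<in> lspan g A \<Longrightarrow> (\<lambda>\<phi>. s \<phi> + t \<phi>) \<in> lspan g A"
proof -
  assume "s \<in> lspan g A" "t \<in> lspan g A"
  then obtain L L' where "s = (\<lambda>\<phi>. \<Sum>(c, x)\<leftarrow>L. c * g x \<phi>)" "\<forall>(c, x)\<in>set L. x \<in> A"
      "t = (\<lambda>\<phi>. \<Sum>(c, x)\<leftarrow>L'. c * g x \<phi>)" "\<forall>(c, x)\<in>set L'. x \<in> A"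
    unfolding lspan_def by auto
  then show ?thesis
    unfolding lspan_def by (auto intro!: exI[of _ "L @ L'"])
qed

lemma lspan_scale: "s \<in> lspan g A \<Longrightarrow> (\<lambda>\<phi>. c * s \<phi>) \<in> lspan g A"
proof -
  assume "s \<in> lspan g A"
  then obtain L where L: "s = (\<lambda>\<phi>. \<Sum>(c, x)\<leftarrow>L. c * g x \<phi>)" "\<forall>(c, x)\<in>set L. x \<in> A"
    unfolding lspan_def by auto
  have "(\<lambda>\<phi>. c * s \<phi>) = (\<lambda>\<phi>. \<Sum>(d, x)\<leftarrow>map (\<lambda>(d, x). (c * d, x)) L. d * g x \<phi>)"
    unfolding L by (simp add: sum_list_const_mult[symmetric] o_def case_prod_unfold mult.assoc)
  then show ?thesis
    unfolding lspan_def using L(2) by (auto intro!: exI[of _ "map (\<lambda>(d, x). (c * d, x)) L"])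
qed

lemma lspan_uminus: "s \<in> lspan g A \<Longrightarrow> (\<lambda>\<phi>. - s \<phi>) \<in> lspan g A"
  using lspan_scale[of s g A "-1"] by simp

lemma lspan_diff: "s \<in> lspan g A \<Longrightarrow> t \<in> lspan g A \<Longrightarrow> (\<lambda>\<phi>. s \<phi> - t \<phi>) \<in> lspan g A"
  using lspan_add[OF _ lspan_uminus, of s g A t] by simp

lemma lspan_sum:
  assumes "\<And>i. i \<in> I \<Longrightarrow> f i \<in> lspan g A"
  shows "(\<lambda>\<phi>. \<Sum>i\<in>I. f i \<phi>) \<in> lspan g A"
  using assms by (induction I rule: infinite_finite_induct) (auto intro: lspan_add)

lemma lspan_split_sum:
  assumes "\<And>a b. mset a + mset b = mset xs \<Longrightarrow> f a b \<in> lspan g A"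
  shows "(\<lambda>\<phi>. split_sum xs (\<lambda>a b. f a b \<phi>)) \<in> lspan g A"
  using assms by (induction xs arbitrary: f) (auto intro: lspan_add)

lemma lspan_induct [consumes 1, case_names zero add]:
  assumes "t \<in> lspan g A" "P (\<lambda>\<phi>. 0)"
    "\<And>c x t. x \<in> A \<Longrightarrow> t \<in> lspan g A \<Longrightarrow> P t \<Longrightarrow> P (\<lambda>\<phi>. c * g x \<phi> + t \<phi>)"
  shows "P t"
proof -
  have "(\<lambda>\<phi>. \<Sum>(c, x)\<leftarrow>L. c * g x \<phi>) \<in> lspan g A \<and> P (\<lambda>\<phi>. \<Sum>(c, x)\<leftarrow>L. c * g x \<phi>)"
    if "\<forall>(c, x)\<in>set L. x \<in> A" for L
    using that
  proof (induction L)
    case (Cons p L)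
    obtain c x where p: "p = (c, x)" by fastforce
    show ?case
      using Cons assms(3)[of x "\<lambda>\<phi>. \<Sum>(c, x)\<leftarrow>L. c * g x \<phi>" c]
        lspan_add[OF lspan_scale[OF lspan_base[of x A g]], of "\<lambda>\<phi>. \<Sum>(c, x)\<leftarrow>L. c * g x \<phi>" c]
      by (simp add: p)
  qed (simp add: assms(2))
  then show ?thesis using assms(1) unfolding lspan_def by auto
qed

section \<open>Multilinear forms and the tensors evaluated at them\<close>

lemma multilinear_formI:
  assumes "\<And>us vs x y. set us \<subseteq> carrier M \<Longrightarrow> set vs \<subseteq> carrier M \<Longrightarrow> x \<in> carrier M \<Longrightarrow> y \<in> carrier M \<Longrightarrow>
      \<phi> (us @ (x \<oplus>\<^bsub>M\<^esub> y) # vs) = \<phi> (us @ x # vs) + \<phi> (us @ y # vs)"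
    "\<And>us vs c x. set us \<subseteq> carrier M \<Longrightarrow> set vs \<subseteq> carrier M \<Longrightarrow> x \<in> carrier M \<Longrightarrow>
      \<phi> (us @ (c \<odot>\<^bsub>M\<^esub> x) # vs) = c * \<phi> (us @ x # vs)"
  shows "multilinear_form M \<phi>"
  using assms unfolding multilinear_form_def by blast

lemma multilinear_formD:
  assumes "multilinear_form M \<phi>" "set us \<subseteq> carrier M" "set vs \<subseteq> carrier M" "x \<in> carrier M"
  shows "y \<in> carrier M \<Longrightarrow> \<phi> (us @ (x \<oplus>\<^bsub>M\<^esub> y) # vs) = \<phi> (us @ x # vs) + \<phi> (us @ y # vs)"
    "\<phi> (us @ (c \<odot>\<^bsub>M\<^esub> x) # vs) = c * \<phi> (us @ x # vs)"
  using assms unfolding multilinear_form_def by blast+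

lemma multilinear_form_zero [simp]: "multilinear_form M (\<lambda>xs. 0)"
  unfolding multilinear_form_def by auto

lemma multilinear_form_add:
  "multilinear_form M \<phi> \<Longrightarrow> multilinear_form M \<psi> \<Longrightarrow> multilinear_form M (\<lambda>xs. \<phi> xs + \<psi> xs)"
  unfolding multilinear_form_def by (auto simp: algebra_simps)

lemma multilinear_form_scale:
  "multilinear_form M \<phi> \<Longrightarrow> multilinear_form M (\<lambda>xs. c * \<phi> xs)"
  unfolding multilinear_form_def by (auto simp: algebra_simps)

lemma multilinear_form_diff:
  "multilinear_form M \<phi> \<Longrightarrow> multilinear_form M \<psi> \<Longrightarrow> multilinear_form M (\<lambda>xs. \<phi> xs - \<psi> xs)"
  unfolding multilinear_form_def by (auto simp: algebra_simps)

text \<open>Multilinearity only relates values on words of equal length, so forms can be altered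
  length by length.\<close>

lemma multilinear_form_length:
  "multilinear_form M \<phi> \<Longrightarrow> multilinear_form M (\<lambda>xs. if length xs = n then \<phi> xs else 0)"
  unfolding multilinear_form_def by auto

lemma multilinear_form_cases:
  "multilinear_form M \<phi> \<Longrightarrow> multilinear_form M \<psi> \<Longrightarrow>
   multilinear_form M (\<lambda>xs. if length xs \<le> n then \<phi> xs else \<psi> xs)"
  unfolding multilinear_form_def by auto

lemma multilinear_form_append:
  assumes "multilinear_form M \<phi>" "set as \<subseteq> carrier M" "set bs \<subseteq> carrier M"
  shows "multilinear_form M (\<lambda>xs. \<phi> (as @ xs @ bs))"
proof (rule multilinear_formI)
  fix us vs x y assume *: "set us \<subseteq> carrier M" "set vs \<subseteq> carrier M" "x \<in> carrier M" "y \<in> carrier M"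
  then show "\<phi> (as @ (us @ (x \<oplus>\<^bsub>M\<^esub> y) # vs) @ bs) = \<phi> (as @ (us @ x # vs) @ bs) + \<phi> (as @ (us @ y # vs) @ bs)"
    using multilinear_formD(1)[OF assms(1), of "as @ us" "vs @ bs" x y] assms by auto
next
  fix us vs x c assume *: "set us \<subseteq> carrier M" "set vs \<subseteq> carrier M" "x \<in> carrier M"
  then show "\<phi> (as @ (us @ (c \<odot>\<^bsub>M\<^esub> x) # vs) @ bs) = c * \<phi> (as @ (us @ x # vs) @ bs)"
    using multilinear_formD(2)[OF assms(1), of "as @ us" "vs @ bs" x c] assms by auto
qed

lemma carrier_tensor_algebra:
  "carrier (tensor_algebra M) = lspan (tensor M) {xs. set xs \<subseteq> carrier M}"
  by (auto simp: tensor_algebra_def lspan_def tensor_sum_def)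

lemma carrier_tensor_power:
  "carrier (tensor_power M n) = lspan (tensor M) {xs. length xs = n \<and> set xs \<subseteq> carrier M}"
  by (auto simp: tensor_power_def lspan_def tensor_sum_def)

lemma carrier_symmetric_tensors:
  "carrier (symmetric_tensors M) = lspan (sym_prod M) {xs. set xs \<subseteq> carrier M}"
  by (auto simp: symmetric_tensors_def lspan_def)

lemma tensor_power_subset: "carrier (tensor_power M n) \<subseteq> carrier (tensor_algebra M)"
  unfolding carrier_tensor_power carrier_tensor_algebra lspan_def by fastforce

lemma tensor_algebra_simps [simp]:
  "add (tensor_algebra M) = (\<lambda>s t \<phi>. s \<phi> + t \<phi>)" "zero (tensor_algebra M) = (\<lambda>\<phi>. 0)"
  "smult (tensor_algebra M) = (\<lambda>c t \<phi>. c * t \<phi>)" "one (tensor_algebra M) = tensor M []"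
  "mult (tensor_algebra M) =
    (\<lambda>s t \<phi>. if multilinear_form M \<phi> then s (\<lambda>xs. t (\<lambda>ys. \<phi> (xs @ ys))) else 0)"
  by (auto simp: tensor_algebra_def)

lemma tensor_power_simps [simp]:
  "add (tensor_power M n) = (\<lambda>s t \<phi>. s \<phi> + t \<phi>)" "zero (tensor_power M n) = (\<lambda>\<phi>. 0)"
  "smult (tensor_power M n) = (\<lambda>c t \<phi>. c * t \<phi>)"
  by (auto simp: tensor_power_def)

lemma symmetric_tensors_simps [simp]:
  "add (symmetric_tensors M) = (\<lambda>s t \<phi>. s \<phi> + t \<phi>)" "zero (symmetric_tensors M) = (\<lambda>\<phi>. 0)"
  "smult (symmetric_tensors M) = (\<lambda>c t \<phi>. c * t \<phi>)"
  by (auto simp: symmetric_tensors_def)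

text \<open>\<open>tensor M xs\<close> is set to zero off the multilinear forms, so equality of
  tensors only has to be tested on forms.\<close>

lemma tensor_algebra_not_multilinear:
  "t \<in> carrier (tensor_algebra M) \<Longrightarrow> \<not> multilinear_form M \<phi> \<Longrightarrow> t \<phi> = 0"
  unfolding carrier_tensor_algebra by (induction rule: lspan_induct) (auto simp: tensor_def)

lemma tensor_algebra_eqI:
  assumes "s \<in> carrier (tensor_algebra M)" "t \<in> carrier (tensor_algebra M)"
    "\<And>\<phi>. multilinear_form M \<phi> \<Longrightarrow> s \<phi> = t \<phi>"
  shows "s = t"
proof
  fix \<phi> show "s \<phi> = t \<phi>"
    using assms(3) tensor_algebra_not_multilinear[OF assms(1)] tensor_algebra_not_multilinear[OF assms(2)]
    by (cases "multilinear_form M \<phi>") auto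
qed

text \<open>A form is unconstrained on lists that leave the carrier, and tensors do not see these
  values. This matters when the carrier is a proper part of the type, as for the enveloping
  algebra.\<close>

lemma tensor_algebra_cong:
  assumes "t \<in> carrier (tensor_algebra M)" "multilinear_form M \<phi>" "multilinear_form M \<psi>"
    "\<And>xs. set xs \<subseteq> carrier M \<Longrightarrow> \<phi> xs = \<psi> xs"
  shows "t \<phi> = t \<psi>"
  using assms unfolding carrier_tensor_algebra by (induction rule: lspan_induct) (auto simp: tensor_def)

lemma tensor_algebra_eval_add:
  assumes "t \<in> carrier (tensor_algebra M)" "multilinear_form M \<phi>" "multilinear_form M \<psi>"
  shows "t (\<lambda>xs. \<phi> xs + \<psi> xs) = t \<phi> + t \<psi>"
  using assms unfolding carrier_tensor_algebra
  by (induction rule: lspan_induct) (auto simp: tensor_def multilinear_form_add algebra_simps)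

lemma tensor_algebra_eval_scale:
  assumes "t \<in> carrier (tensor_algebra M)" "multilinear_form M \<phi>"
  shows "t (\<lambda>xs. c * \<phi> xs) = c * t \<phi>"
  using assms unfolding carrier_tensor_algebra
  by (induction rule: lspan_induct) (auto simp: tensor_def multilinear_form_scale algebra_simps)

lemma tensor_algebra_eval_zero: "t \<in> carrier (tensor_algebra M) \<Longrightarrow> t (\<lambda>xs. 0) = 0"
  unfolding carrier_tensor_algebra by (induction rule: lspan_induct) (auto simp: tensor_def)

lemma tensor_eval [simp]: "multilinear_form M \<phi> \<Longrightarrow> tensor M xs \<phi> = \<phi> xs"
  by (simp add: tensor_def)

section \<open>The tensor algebra of a vector space as a ring\<close>

lemma vec_mod_simps [simp]:
  "carrier (vec_mod s) = UNIV" "add (vec_mod s) = (+)" "zero (vec_mod s) = 0" "smult (vec_mod s) = s"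
  by (auto simp: vec_mod_def)

lemma multilinear_form_vec_mod:
  "multilinear_form (vec_mod s) \<phi> \<longleftrightarrow>
    (\<forall>us vs. (\<forall>x y. \<phi> (us @ (x + y) # vs) = \<phi> (us @ x # vs) + \<phi> (us @ y # vs)) \<and>
      (\<forall>c x. \<phi> (us @ s c x # vs) = c * \<phi> (us @ x # vs)))"
  by (simp add: multilinear_form_def)

lemma tensor_in_carrier [simp]: "tensor (vec_mod s) xs \<in> carrier (tensor_algebra (vec_mod s))"
  unfolding carrier_tensor_algebra by (rule lspan_base) simp

lemma tensor_algebra_closed:
  assumes "s \<in> carrier (tensor_algebra M)"
  shows "t \<in> carrier (tensor_algebra M) \<Longrightarrow> (\<lambda>\<phi>. s \<phi> + t \<phi>) \<in> carrier (tensor_algebra M)"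
    "t \<in> carrier (tensor_algebra M) \<Longrightarrow> (\<lambda>\<phi>. s \<phi> - t \<phi>) \<in> carrier (tensor_algebra M)"
    "(\<lambda>\<phi>. c * s \<phi>) \<in> carrier (tensor_algebra M)"
    "(\<lambda>\<phi>. - s \<phi>) \<in> carrier (tensor_algebra M)"
  using assms unfolding carrier_tensor_algebra by (auto intro: lspan_add lspan_scale lspan_diff lspan_uminus)

lemma tensor_algebra_zero_closed [simp]: "(\<lambda>\<phi>. 0) \<in> carrier (tensor_algebra M)"
  unfolding carrier_tensor_algebra by simp

text \<open>The product evaluates one factor inside the other, and the outer factor returns zero
  unless the result of the inner evaluation is again a multilinear form.\<close>

lemma multilinear_form_inner:
  assumes "t \<in> carrier (tensor_algebra (vec_mod s))" "multilinear_form (vec_mod s) \<phi>"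
  shows "multilinear_form (vec_mod s) (\<lambda>xs. t (\<lambda>ys. \<phi> (xs @ ys)))"
proof -
  have app: "multilinear_form (vec_mod s) (\<lambda>ys. \<phi> (xs @ ys))" for xs
    using multilinear_form_append[OF assms(2), of xs "[]"] by simp
  have app': "multilinear_form (vec_mod s) (\<lambda>xs. \<phi> (xs @ ys))" for ys
    using multilinear_form_append[OF assms(2), of "[]" ys] by simp
  show ?thesis
    using assms(1) unfolding carrier_tensor_algebra
  proof (induction rule: lspan_induct)
    case (add c x t)
    then show ?case
      using multilinear_form_add[OF multilinear_form_scale[OF app'[of x], of c] add.IH]
      by (simp add: app)
  qed simp
qed

lemma tensor_mult:
  "multilinear_form (vec_mod s) \<phi> \<Longrightarrow>
   tensor (vec_mod s) xs (\<lambda>xs. tensor (vec_mod s) ys (\<lambda>ys. \<phi> (xs @ ys))) = \<phi> (xs @ ys)"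
  using multilinear_form_append[of "vec_mod s" \<phi>  _ "[]"]
    multilinear_form_append[of "vec_mod s" \<phi> "[]"] by simp

lemma tensor_algebra_mult_closed:
  assumes "u \<in> carrier (tensor_algebra (vec_mod s))" "t \<in> carrier (tensor_algebra (vec_mod s))"
  shows "u \<otimes>\<^bsub>tensor_algebra (vec_mod s)\<^esub> t \<in> carrier (tensor_algebra (vec_mod s))"
proof -
  let ?M = "vec_mod s"
  have app: "multilinear_form ?M (\<lambda>ys. \<phi> (xs @ ys))" if "multilinear_form ?M \<phi>" for xs \<phi>
    using multilinear_form_append[OF that, of xs "[]"] by simp
  have 1: "tensor ?M xs \<otimes>\<^bsub>tensor_algebra ?M\<^esub> t \<in> carrier (tensor_algebra ?M)" for xs
    using assms(2) unfolding carrier_tensor_algebra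
  proof (induction rule: lspan_induct)
    case (add c x t)
    have t: "t \<in> carrier (tensor_algebra ?M)" using add unfolding carrier_tensor_algebra by simp
    have "(tensor ?M xs \<otimes>\<^bsub>tensor_algebra ?M\<^esub> (\<lambda>\<phi>. c * tensor ?M x \<phi> + t \<phi>)) =
      (\<lambda>\<phi>. c * tensor ?M (xs @ x) \<phi> + (tensor ?M xs \<otimes>\<^bsub>tensor_algebra ?M\<^esub> t) \<phi>)"
    proof (rule ext)
      fix \<phi>
      show "(tensor ?M xs \<otimes>\<^bsub>tensor_algebra ?M\<^esub> (\<lambda>\<phi>. c * tensor ?M x \<phi> + t \<phi>)) \<phi> =
        c * tensor ?M (xs @ x) \<phi> + (tensor ?M xs \<otimes>\<^bsub>tensor_algebra ?M\<^esub> t) \<phi>"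
      proof (cases "multilinear_form ?M \<phi>")
        case True
        have "multilinear_form ?M (\<lambda>xs. c * \<phi> (xs @ x) + t (\<lambda>ys. \<phi> (xs @ ys)))"
          using multilinear_form_append[OF True, of "[]" x]
          by (intro multilinear_form_add multilinear_form_scale multilinear_form_inner[OF t True]) simp
        then show ?thesis
          using True multilinear_form_inner[OF t True] by (simp add: app)
      qed (simp add: tensor_def)
    qed
    moreover have "tensor ?M (xs @ x) \<in> lspan (tensor ?M) {xs. set xs \<subseteq> carrier ?M}"
      by (rule lspan_base) simp
    ultimately show ?case
      using add.IH by (auto intro!: lspan_add lspan_scale)
  qed (auto simp: tensor_def)
  show ?thesis
    using assms(1) unfolding carrier_tensor_algebra
  proof (induction rule: lspan_induct)
    case (add c x u)
    have "((\<lambda>\<phi>. c * tensor ?M x \<phi> + u \<phi>) \<otimes>\<^bsub>tensor_algebra ?M\<^esub> t) =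
      (\<lambda>\<phi>. c * (tensor ?M x \<otimes>\<^bsub>tensor_algebra ?M\<^esub> t) \<phi> + (u \<otimes>\<^bsub>tensor_algebra ?M\<^esub> t) \<phi>)"
      by (auto simp: fun_eq_iff)
    then show ?case
      using add.IH 1[of x] unfolding carrier_tensor_algebra by (auto intro!: lspan_add lspan_scale)
  qed auto
qed

lemma tensor_algebra_ring: "ring (tensor_algebra (vec_mod s))"
proof (rule ringI)
  let ?M = "vec_mod s" and ?T = "tensor_algebra (vec_mod s)"
  have app: "multilinear_form ?M (\<lambda>ys. \<phi> (xs @ ys))" if "multilinear_form ?M \<phi>" for xs \<phi>
    using multilinear_form_append[OF that, of xs "[]"] by simp
  show "abelian_group ?T"
    by (rule abelian_groupI)
      (auto simp: tensor_algebra_closed algebra_simps intro!: bexI[OF _ tensor_algebra_closed(4)])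
  show "monoid ?T"
  proof (rule monoidI)
    fix x y w assume *: "x \<in> carrier ?T" "y \<in> carrier ?T" "w \<in> carrier ?T"
    show "x \<otimes>\<^bsub>?T\<^esub> y \<in> carrier ?T" using *(1,2) by (rule tensor_algebra_mult_closed)
    have "x (\<lambda>xs. (if multilinear_form ?M (\<lambda>xs'. w (\<lambda>ys. \<phi> (xs' @ ys))) then
         y (\<lambda>ys. w (\<lambda>zs. \<phi> ((xs @ ys) @ zs))) else 0)) =
       x (\<lambda>xs. if multilinear_form ?M (\<lambda>ys. \<phi> (xs @ ys)) then y (\<lambda>ys. w (\<lambda>zs. \<phi> (xs @ ys @ zs))) else 0)"
      if "multilinear_form ?M \<phi>" for \<phi>
      using that multilinear_form_inner[OF *(3) that] app by simp
    then show "x \<otimes>\<^bsub>?T\<^esub> y \<otimes>\<^bsub>?T\<^esub> w = x \<otimes>\<^bsub>?T\<^esub> (y \<otimes>\<^bsub>?T\<^esub> w)"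
      using multilinear_form_inner[OF *(3)] app by (auto simp: fun_eq_iff)
  next
    show "\<one>\<^bsub>?T\<^esub> \<in> carrier ?T" by simp
  next
    fix x assume *: "x \<in> carrier ?T"
    show "\<one>\<^bsub>?T\<^esub> \<otimes>\<^bsub>?T\<^esub> x = x"
      using * multilinear_form_inner[OF *] tensor_algebra_not_multilinear[OF *] by (auto simp: fun_eq_iff)
    show "x \<otimes>\<^bsub>?T\<^esub> \<one>\<^bsub>?T\<^esub> = x"
      using * app tensor_algebra_not_multilinear[OF *] by (auto simp: fun_eq_iff)
  qed
  fix x y w assume *: "x \<in> carrier ?T" "y \<in> carrier ?T" "w \<in> carrier ?T"
  show "(x \<oplus>\<^bsub>?T\<^esub> y) \<otimes>\<^bsub>?T\<^esub> w = x \<otimes>\<^bsub>?T\<^esub> w \<oplus>\<^bsub>?T\<^esub> y \<otimes>\<^bsub>?T\<^esub> w"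
    by (auto simp: fun_eq_iff)
  show "w \<otimes>\<^bsub>?T\<^esub> (x \<oplus>\<^bsub>?T\<^esub> y) = w \<otimes>\<^bsub>?T\<^esub> x \<oplus>\<^bsub>?T\<^esub> w \<otimes>\<^bsub>?T\<^esub> y"
  proof (rule ext)
    fix \<phi> show "(w \<otimes>\<^bsub>?T\<^esub> (x \<oplus>\<^bsub>?T\<^esub> y)) \<phi> = (w \<otimes>\<^bsub>?T\<^esub> x \<oplus>\<^bsub>?T\<^esub> w \<otimes>\<^bsub>?T\<^esub> y) \<phi>"
      using tensor_algebra_eval_add[OF *(3) multilinear_form_inner[OF *(1), of \<phi>] multilinear_form_inner[OF *(2), of \<phi>]]
      by (cases "multilinear_form ?M \<phi>") simp_all
  qed
qed

text \<open>Equips the functions \<open>'f \<Rightarrow> 'k\<close> with the class of additive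
  groups, so that bases and linear extension for \<open>vector_space\<close> apply to spaces of
  tensors in \<open>J_iff\<close>.\<close>

typedef ('f, 'k) functional = "UNIV :: ('f \<Rightarrow> 'k) set"
  morphisms apply_functional Functional ..

setup_lifting type_definition_functional

instantiation functional :: (type, ab_group_add) ab_group_add
begin

lift_definition zero_functional :: "('a, 'b) functional" is "\<lambda>x. 0" .
lift_definition plus_functional :: "('a, 'b) functional \<Rightarrow> ('a, 'b) functional \<Rightarrow> ('a, 'b) functional"
  is "\<lambda>f g x. f x + g x" .
lift_definition minus_functional :: "('a, 'b) functional \<Rightarrow> ('a, 'b) functional \<Rightarrow> ('a, 'b) functional"
  is "\<lambda>f g x. f x - g x" .
lift_definition uminus_functional :: "('a, 'b) functional \<Rightarrow> ('a, 'b) functional"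
  is "\<lambda>f x. - f x" .

instance
  by (standard; transfer) (simp_all add: add.assoc add.commute fun_eq_iff)

end

lift_definition scale_functional :: "'k::field \<Rightarrow> ('f, 'k) functional \<Rightarrow> ('f, 'k) functional"
  is "\<lambda>c f x. c * f x" .

lemma vector_space_functional: "vector_space scale_functional"
  by (standard; transfer) (simp_all add: fun_eq_iff distrib_left distrib_right mult.assoc)

lemma vector_space_field: "vector_space ((*) :: 'k::field \<Rightarrow> 'k \<Rightarrow> 'k)"
  by standard (simp_all add: distrib_left distrib_right mult.assoc)

text \<open>The Lie algebra carries no topology here: the algebra and the word estimates only
  involve real functions on it. Bounds on Lie words do not depend on z, so they may be taken from
  the instance z = 0.\<close>

locale lie_algebra = vector_space scaleV
  for scaleV :: "'k::real_normed_field \<Rightarrow> 'g::ab_group_add \<Rightarrow> 'g" +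
  fixes bracket :: "'g \<Rightarrow> 'g \<Rightarrow> 'g" and z :: 'k
  assumes bracket_left: "Vector_Spaces.linear scaleV scaleV (\<lambda>x. bracket x y)"
    and bracket_right: "Vector_Spaces.linear scaleV scaleV (bracket x)"
    and bracket_self: "bracket x x = 0"
    and jacobi_identity: "bracket x (bracket y w) + bracket y (bracket w x) + bracket w (bracket x y) = 0"
begin

abbreviation "M \<equiv> vec_mod scaleV"
abbreviation "T \<equiv> tensor_algebra M"
abbreviation "J \<equiv> uea_ideal M bracket z"

text \<open>The forms in \<open>exchange\<close> are those that vanish on the ideal, that is, the dual of the enveloping algebra.\<close>

definition exchange :: "('g list \<Rightarrow> 'k) \<Rightarrow> bool" where
  "exchange \<phi> \<longleftrightarrow> multilinear_form M \<phi> \<and>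
    (\<forall>us x y vs. \<phi> (us @ x # y # vs) - \<phi> (us @ y # x # vs) = z * \<phi> (us @ bracket x y # vs))"

lemma exchange_multilinear: "exchange \<phi> \<Longrightarrow> multilinear_form M \<phi>"
  by (simp add: exchange_def)

lemma exchangeD: "exchange \<phi> \<Longrightarrow> \<phi> (us @ x # y # vs) - \<phi> (us @ y # x # vs) = z * \<phi> (us @ bracket x y # vs)"
  by (simp add: exchange_def)

lemma exchange_append: "exchange \<phi> \<Longrightarrow> exchange (\<lambda>xs. \<phi> (as @ xs @ bs))"
  unfolding exchange_def
proof (intro conjI allI)
  fix us x y vs
  assume *: "multilinear_form M \<phi> \<and>
     (\<forall>us x y vs. \<phi> (us @ x # y # vs) - \<phi> (us @ y # x # vs) = z * \<phi> (us @ bracket x y # vs))"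
  then show "multilinear_form M (\<lambda>xs. \<phi> (as @ xs @ bs))" by (auto intro: multilinear_form_append)
  from * have "\<phi> ((as @ us) @ x # y # vs @ bs) - \<phi> ((as @ us) @ y # x # vs @ bs) =
      z * \<phi> ((as @ us) @ bracket x y # vs @ bs)" by blast
  then show "\<phi> (as @ (us @ x # y # vs) @ bs) - \<phi> (as @ (us @ y # x # vs) @ bs) =
      z * \<phi> (as @ (us @ bracket x y # vs) @ bs)" by simp
qed

lemma ring_T: "ring T"
  by (rule tensor_algebra_ring)

definition generator :: "'g \<Rightarrow> 'g \<Rightarrow> ('k, 'g) tensor" where
  "generator x y = tensor_sum M [(1, [x, y]), (- 1, [y, x]), (- z, [bracket x y])]"

lemma generator_eval:
  "multilinear_form M \<phi> \<Longrightarrow> generator x y \<phi> = \<phi> [x, y] - \<phi> [y, x] - z * \<phi> [bracket x y]"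
  by (simp add: generator_def tensor_sum_def)

lemma generator_closed: "generator x y \<in> carrier T"
proof -
  have "carrier T = {tensor_sum M L | L. \<forall>(c, xs)\<in>set L. set xs \<subseteq> carrier M}"
    by (simp add: tensor_algebra_def)
  moreover have "generator x y \<in> {tensor_sum M L | L. \<forall>(c, xs)\<in>set L. set xs \<subseteq> carrier M}"
    unfolding generator_def by (rule CollectI, intro exI conjI, rule refl, simp)
  ultimately show ?thesis by simp
qed

lemma J_eq: "J = genideal T {generator x y | x y. True}"
  by (simp add: uea_ideal_def generator_def)

lemma J_ideal: "ideal J T"
  unfolding J_eq by (rule ring.genideal_ideal[OF ring_T]) (auto simp: generator_closed)

lemma J_subset: "J \<subseteq> carrier T"
  using J_ideal by (simp add: additive_subgroup.a_subset ideal.axioms(1))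

text \<open>The tensors annihilated by all exchange forms make up a two-sided ideal that contains
  the generators: if one factor of a product is evaluated against an exchange form, an exchange form
  in the other factor remains.\<close>

lemma J_vanishes:
  assumes "t \<in> J" "exchange \<phi>"
  shows "t \<phi> = 0"
proof -
  let ?I = "{t \<in> carrier T. \<forall>\<phi>. exchange \<phi> \<longrightarrow> t \<phi> = 0}"
  have app: "exchange (\<lambda>ys. \<phi> (xs @ ys))" "exchange (\<lambda>xs. \<phi> (xs @ ys))" if "exchange \<phi>" for xs ys \<phi>
    using exchange_append[OF that, of xs "[]"] exchange_append[OF that, of "[]" ys] by simp_all
  have "ideal ?I T"
  proof (rule idealI[OF ring_T])
    show "subgroup ?I (add_monoid T)"
    proof (rule group.subgroupI)
      show "Group.group (add_monoid T)"
        using ring_T abelian_group.a_group ring_def by blast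
      fix a assume "a \<in> ?I"
      moreover have "inv\<^bsub>add_monoid T\<^esub> a = (\<lambda>\<phi>. - a \<phi>)" if "a \<in> carrier T" for a
      proof -
        interpret ring T by (rule ring_T)
        have "\<ominus>\<^bsub>T\<^esub> a = (\<lambda>\<phi>. - a \<phi>)"
          using that by (intro minus_equality) (auto simp: tensor_algebra_closed)
        then show ?thesis by (simp add: a_inv_def)
      qed
      ultimately show "inv\<^bsub>add_monoid T\<^esub> a \<in> ?I"
        by (auto simp: tensor_algebra_closed)
    qed (auto simp: tensor_algebra_closed intro: exI[of _ "\<lambda>\<phi>. 0"])
  next
    fix a x assume a: "a \<in> ?I" and x: "x \<in> carrier T"
    show "x \<otimes>\<^bsub>T\<^esub> a \<in> ?I"
      using a x tensor_algebra_mult_closed[OF x, of a]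
      by (auto simp: app exchange_multilinear tensor_algebra_eval_zero[OF x])
    have "exchange (\<lambda>xs. x (\<lambda>ys. \<phi> (xs @ ys)))" if "exchange \<phi>" for \<phi>
      unfolding exchange_def
    proof (intro conjI allI)
      show "multilinear_form M (\<lambda>xs. x (\<lambda>ys. \<phi> (xs @ ys)))"
        using multilinear_form_inner[OF x] that by (simp add: exchange_def)
      fix us u v vs
      let ?f = "\<lambda>us ys. \<phi> (us @ ys)"
      have "x (?f (us @ u # v # vs)) = x (\<lambda>ys. ?f (us @ v # u # vs) ys + z * ?f (us @ bracket u v # vs) ys)"
      proof (rule arg_cong[where f = x], rule ext)
        fix ys
        show "\<phi> ((us @ u # v # vs) @ ys) = \<phi> ((us @ v # u # vs) @ ys) + z * \<phi> ((us @ bracket u v # vs) @ ys)"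
          using exchangeD[OF that, of us u v "vs @ ys"] by (simp add: algebra_simps)
      qed
      also have "\<dots> = x (?f (us @ v # u # vs)) + z * x (?f (us @ bracket u v # vs))"
        using exchange_multilinear[OF app(1)[OF that]]
        by (intro trans[OF tensor_algebra_eval_add[OF x]] arg_cong2[where f = plus] tensor_algebra_eval_scale[OF x]
            multilinear_form_scale refl)
      finally show "x (?f (us @ u # v # vs)) - x (?f (us @ v # u # vs)) = z * x (?f (us @ bracket u v # vs))"
        by simp
    qed
    then show "a \<otimes>\<^bsub>T\<^esub> x \<in> ?I"
      using a x tensor_algebra_mult_closed[OF _ x, of a] by (auto simp: exchange_multilinear)
  qed
  moreover have "{generator x y | x y. True} \<subseteq> ?I"
    using exchangeD[of _ "[]" _ _ "[]"]
    by (auto simp: generator_closed generator_eval exchange_multilinear)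
  ultimately have "J \<subseteq> ?I"
    unfolding J_eq by (rule ring.genideal_minimal[OF ring_T])
  then show ?thesis using assms by auto
qed

lemma J_closed:
  assumes "s \<in> J"
  shows "t \<in> J \<Longrightarrow> (\<lambda>\<phi>. s \<phi> + t \<phi>) \<in> J" "(\<lambda>\<phi>. c * s \<phi>) \<in> J"
    "t \<in> carrier T \<Longrightarrow> s \<otimes>\<^bsub>T\<^esub> t \<in> J" "t \<in> carrier T \<Longrightarrow> t \<otimes>\<^bsub>T\<^esub> s \<in> J"
proof -
  show "t \<in> carrier T \<Longrightarrow> s \<otimes>\<^bsub>T\<^esub> t \<in> J"
    by (rule ideal.I_r_closed[OF J_ideal assms])
  show "t \<in> carrier T \<Longrightarrow> t \<otimes>\<^bsub>T\<^esub> s \<in> J"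
    by (rule ideal.I_l_closed[OF J_ideal assms])
  show "t \<in> J \<Longrightarrow> (\<lambda>\<phi>. s \<phi> + t \<phi>) \<in> J"
    using additive_subgroup.a_closed[OF ideal.axioms(1)[OF J_ideal] assms, of t] by simp
  have c: "(\<lambda>\<phi>. c * tensor M [] \<phi>) \<in> carrier T"
    by (intro tensor_algebra_closed tensor_in_carrier)
  have s: "s \<in> carrier T" using assms J_subset by blast
  have "(\<lambda>\<phi>. c * tensor M [] \<phi>) \<otimes>\<^bsub>T\<^esub> s = (\<lambda>\<phi>. c * s \<phi>)"
    using multilinear_form_inner[OF s] tensor_algebra_not_multilinear[OF s]
    by (auto simp: fun_eq_iff)
  moreover have "(\<lambda>\<phi>. c * tensor M [] \<phi>) \<otimes>\<^bsub>T\<^esub> s \<in> J"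
    by (rule ideal.I_l_closed[OF J_ideal assms c])
  ultimately show "(\<lambda>\<phi>. c * s \<phi>) \<in> J" by simp
qed

lemma J_zero: "(\<lambda>\<phi>. 0) \<in> J"
proof -
  show ?thesis
    using additive_subgroup.zero_closed[OF ideal.axioms(1)[OF J_ideal]] by simp
qed

text \<open>The converse of \<open>J_vanishes\<close> needs enough linear functionals on the tensor algebra.\<close>

lemma J_iff:
  assumes "t \<in> carrier T"
  shows "t \<in> J \<longleftrightarrow> (\<forall>\<phi>. exchange \<phi> \<longrightarrow> t \<phi> = 0)"
proof
  assume t: "\<forall>\<phi>. exchange \<phi> \<longrightarrow> t \<phi> = 0"
  show "t \<in> J"
  proof (rule ccontr)
    assume nt: "t \<notin> J"
    interpret V: vector_space "scale_functional :: 'k \<Rightarrow> ('g list \<Rightarrow> 'k, 'k) functional \<Rightarrow> _"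
      by (rule vector_space_functional)
    interpret VP: vector_space_pair "scale_functional :: 'k \<Rightarrow> ('g list \<Rightarrow> 'k, 'k) functional \<Rightarrow> _" "(*) :: 'k \<Rightarrow> 'k \<Rightarrow> 'k"
      by (rule vector_space_pair.intro[OF vector_space_functional vector_space_field])
    define J' where "J' = Functional ` J"
    have sub: "V.subspace J'"
      unfolding J'_def V.subspace_def
      using J_zero J_closed(1,2) by (auto simp: zero_functional_def plus_functional.abs_eq scale_functional.abs_eq)
    have nt': "Functional t \<notin> J'"
      using nt by (auto simp: J'_def Functional_inject)
    obtain B where B: "B \<subseteq> J'" "V.independent B" "J' \<subseteq> V.span B"
      using V.basis_exists by metis
    have "V.span B = J'"
      using B sub by (simp add: V.span_minimal subset_antisym)
    \<comment> \<open>A basis of the ideal, extended by t, yields a linear functional with value 1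
      at t and 0 on the ideal.\<close>
    then have "V.independent (insert (Functional t) B)"
      using nt' B by (simp add: V.independent_insertI)
    then obtain f' where f': "Vector_Spaces.linear scale_functional (*) f'"
        "\<And>x. x \<in> insert (Functional t) B \<Longrightarrow> f' x = (if x = Functional t then 1 else 0)"
      using VP.linear_independent_extend[of _ "\<lambda>x. if x = Functional t then 1 else 0"] by metis
    define f where "f u = f' (Functional u)" for u
    have f_add: "f (\<lambda>\<phi>. u \<phi> + v \<phi>) = f u + f v" for u v
      using VP.linear_add[OF f'(1), of "Functional u" "Functional v"] by (simp add: f_def plus_functional.abs_eq)
    have f_scale: "f (\<lambda>\<phi>. c * u \<phi>) = c * f u" for c u
      using VP.linear_scale[OF f'(1), of c "Functional u"] by (simp add: f_def scale_functional.abs_eq)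
    have fJ: "f u = 0" if "u \<in> J" for u
      unfolding f_def
    proof (rule VP.linear_eq_0_on_span[OF f'(1)])
      show "f' x = 0" if "x \<in> B" for x
        using f'(2)[of x] that B nt' by auto
      show "Functional u \<in> V.span B" using B that by (auto simp: J'_def)
    qed
    \<comment> \<open>On words this functional is a multilinear form, and it satisfies the exchange
      relation because a generator multiplied by words from both sides stays in the ideal.
      Evaluating t at \<psi> returns f t = 1, against the assumption.\<close>
    define \<psi> where "\<psi> xs = f (tensor M xs)" for xs
    have "tensor M (us @ (x + y) # vs) = (\<lambda>\<phi>. tensor M (us @ x # vs) \<phi> + tensor M (us @ y # vs) \<phi>)" for us x y vs
      by (auto simp: tensor_def multilinear_form_vec_mod fun_eq_iff)
    moreover have "tensor M (us @ scaleV c x # vs) = (\<lambda>\<phi>. c * tensor M (us @ x # vs) \<phi>)" for us c x vs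
      by (auto simp: tensor_def multilinear_form_vec_mod fun_eq_iff)
    ultimately have ml: "multilinear_form M \<psi>"
      unfolding multilinear_form_vec_mod \<psi>_def by (auto simp: f_add f_scale)
    have "\<psi> (us @ x # y # vs) - \<psi> (us @ y # x # vs) = z * \<psi> (us @ bracket x y # vs)" for us x y vs
    proof -
      let ?u = "tensor M us \<otimes>\<^bsub>T\<^esub> (generator x y \<otimes>\<^bsub>T\<^esub> tensor M vs)"
      have "generator x y \<in> J"
        unfolding J_eq by (rule subsetD[OF ring.genideal_self[OF ring_T]]) (auto simp: generator_closed)
      then have "?u \<in> J"
        by (intro J_closed(4) J_closed(3)) auto
      moreover have "?u = (\<lambda>\<phi>. tensor M (us @ x # y # vs) \<phi> + ((- 1) * tensor M (us @ y # x # vs) \<phi> +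
         (- z) * tensor M (us @ bracket x y # vs) \<phi>))"
      proof (rule tensor_algebra_eqI)
        show "?u \<in> carrier T"
          by (intro tensor_algebra_mult_closed generator_closed tensor_in_carrier)
        show "(\<lambda>\<phi>. tensor M (us @ x # y # vs) \<phi> + ((- 1) * tensor M (us @ y # x # vs) \<phi> +
         (- z) * tensor M (us @ bracket x y # vs) \<phi>)) \<in> carrier T"
          by (intro tensor_algebra_closed tensor_in_carrier)
        fix \<phi> assume ml: "multilinear_form M \<phi>"
        have app: "multilinear_form M (\<lambda>ys. \<phi> (as @ ys))" "multilinear_form M (\<lambda>ys. \<phi> (ys @ as))"
            "multilinear_form M (\<lambda>ys. \<phi> (as @ ys @ bs))" for as bs
          using multilinear_form_append[OF ml, of as "[]"] multilinear_form_append[OF ml, of "[]" as]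
            multilinear_form_append[OF ml, of as bs] by simp_all
        have tvs: "tensor M vs (\<lambda>ys. \<phi> (as @ bs @ ys)) = \<phi> (as @ bs @ vs)" for as bs
          using app(1)[of "as @ bs"] by simp
        have "multilinear_form M (\<lambda>xs. \<phi> (xs @ x # y # vs) - \<phi> (xs @ y # x # vs) - z * \<phi> (xs @ bracket x y # vs))"
          by (intro multilinear_form_diff multilinear_form_scale app)
        then have "tensor M us (\<lambda>xs. generator x y (\<lambda>xs'. tensor M vs (\<lambda>ys. \<phi> (xs @ xs' @ ys)))) =
            \<phi> (us @ x # y # vs) - \<phi> (us @ y # x # vs) - z * \<phi> (us @ bracket x y # vs)"
          by (simp add: tvs generator_eval app)
        then show "?u \<phi> = tensor M (us @ x # y # vs) \<phi> + ((- 1) * tensor M (us @ y # x # vs) \<phi> +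
          (- z) * tensor M (us @ bracket x y # vs) \<phi>)"
          using ml by (simp add: app)
      qed
      ultimately have "f (\<lambda>\<phi>. tensor M (us @ x # y # vs) \<phi> + ((- 1) * tensor M (us @ y # x # vs) \<phi> +
         (- z) * tensor M (us @ bracket x y # vs) \<phi>)) = 0" using fJ by metis
      then show ?thesis by (simp only: f_add f_scale \<psi>_def[symmetric]) (simp add: algebra_simps)
    qed
    then have "exchange \<psi>" using ml by (simp add: exchange_def)
    then have "t \<psi> = 0" using t by blast
    moreover have "t \<psi> = f t"
      using assms unfolding carrier_tensor_algebra
    proof (induction rule: lspan_induct)
      case zero
      then show ?case using f_scale[of 0 "\<lambda>\<phi>. 0"] by simp
    next
      case (add c x u)
      have "f (tensor M x) = \<psi> x" by (simp add: \<psi>_def)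
      with add show ?case using ml by (simp add: f_add f_scale)
    qed
    ultimately show False using f'(2)[of "Functional t"] by (simp add: f_def)
  qed
qed (use J_vanishes in blast)

end

section \<open>Symmetric tensors embed into the enveloping algebra\<close>

text \<open>In \<open>solve_exchange\<close> each letter behind a given place is in turn exchanged
  with the letter at that place.\<close>

primrec sel_sum :: "'a list \<Rightarrow> ('a \<Rightarrow> 'a list \<Rightarrow> 'b::comm_monoid_add) \<Rightarrow> 'b" where
  "sel_sum [] = (\<lambda>E. 0)"
| "sel_sum (y # ys) = (\<lambda>E. E y ys + sel_sum ys (\<lambda>w ws. E w (y # ws)))"

text \<open>Selecting \<open>x\<close> leaves the same remaining word on both sides, and likewise
  for \<open>y\<close>; in all other terms the two letters stay adjacent.\<close>

lemma sel_sum_swap: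
  assumes "\<And>w as x y bs. E w (as @ x # y # bs) = E w (as @ y # x # bs)"
  shows "sel_sum (as @ x # y # bs) E = sel_sum (as @ y # x # bs) E"
  using assms
proof (induction as arbitrary: E)
  case Nil
  show ?case using Nil[of _ "[]"] by (simp add: ac_simps)
next
  case (Cons a as)
  have "sel_sum (as @ x # y # bs) (\<lambda>w ws. E w (a # ws)) = sel_sum (as @ y # x # bs) (\<lambda>w ws. E w (a # ws))"
    by (rule Cons.IH) (use Cons.prems[of _ "a # _"] in simp)
  then show ?case using Cons.prems by simp
qed

lemma sel_sum_diff:
  fixes E F :: "_ \<Rightarrow> _ \<Rightarrow> 'b::ab_group_add"
  shows "sel_sum xs (\<lambda>w ws. E w ws - F w ws) = sel_sum xs E - sel_sum xs F"
  by (induction xs arbitrary: E F) (auto simp: algebra_simps)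

text \<open>A symmetric F does not notice which letter is brought to the front.\<close>

lemma sel_sum_Cons:
  fixes F :: "'a list \<Rightarrow> 'b::semiring_1"
  assumes "\<And>as x y bs. F (as @ x # y # bs) = F (as @ y # x # bs)"
  shows "sel_sum vs (\<lambda>w ws. F (w # ws)) = of_nat (length vs) * F vs"
  using assms
proof (induction vs arbitrary: F)
  case (Cons v vs)
  have "sel_sum vs (\<lambda>w ws. F (w # v # ws)) = sel_sum vs (\<lambda>w ws. F (v # w # ws))"
    using Cons.prems[of "[]"] by (intro arg_cong[where f = "sel_sum vs"]) (simp add: fun_eq_iff)
  also have "\<dots> = of_nat (length vs) * F (v # vs)"
    by (rule Cons.IH[of "\<lambda>ws. F (v # ws)"]) (use Cons.prems[of "v # _"] in simp)
  finally show ?case by (simp add: algebra_simps)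
qed simp

text \<open>A fixed permutation carries a given slot to one other slot, so permuting the arguments
  of a form keeps it linear in each of them.\<close>

lemma permute_list_slot:
  assumes "\<sigma> permutes {..<length us + length vs + 1}"
  shows "\<exists>as bs. \<forall>x. permute_list \<sigma> (us @ x # vs) = as @ x # bs"
proof -
  let ?n = "length us + length vs + 1"
  define j where "j = Hilbert_Choice.inv \<sigma> (length us)"
  have sj: "\<sigma> j = length us" using permutes_inverses[OF assms] by (simp add: j_def)
  have j: "j < ?n"
    using permutes_in_image[OF assms, of j] sj by simp
  have *: "(us @ x # vs) ! \<sigma> i = (us @ y # vs) ! \<sigma> i" if "i \<noteq> j" for i x y
  proof -
    have "\<sigma> i \<noteq> length us" using that sj permutes_inj[OF assms] by (metis injD)
    then show ?thesis by (simp add: nth_append nth_Cons')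
  qed
  define as where "as = map (\<lambda>i. (us @ undefined # vs) ! \<sigma> i) [0..<j]"
  define bs where "bs = map (\<lambda>i. (us @ undefined # vs) ! \<sigma> i) [Suc j..<?n]"
  have "permute_list \<sigma> (us @ x # vs) = as @ x # bs" for x
  proof -
    have "[0..<?n] = [0..<j] @ j # [Suc j..<?n]"
      using j upt_add_eq_append[of 0 j "?n - j"] upt_conv_Cons[of j ?n] by simp
    then have "permute_list \<sigma> (us @ x # vs) = map (\<lambda>i. (us @ x # vs) ! \<sigma> i) ([0..<j] @ j # [Suc j..<?n])"
      by (simp add: permute_list_def)
    also have "\<dots> = as @ x # bs"
      using *[of _ x undefined] by (auto simp: as_def bs_def sj)
    finally show ?thesis .
  qed
  then show ?thesis by blast
qed

context lie_algebra
begin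

lemma bracket_add [simp]:
  "bracket (x + y) w = bracket x w + bracket y w" "bracket w (x + y) = bracket w x + bracket w y"
  using bracket_left[of w] bracket_right[of w] by (auto simp: Vector_Spaces.linear_iff)

lemma bracket_scale [simp]:
  "bracket (scaleV c x) w = scaleV c (bracket x w)" "bracket w (scaleV c x) = scaleV c (bracket w x)"
  using bracket_left[of w] bracket_right[of w] by (auto simp: Vector_Spaces.linear_iff)

lemma bracket_zero [simp]: "bracket w 0 = 0"
  using bracket_scale(1)[of 0 0 w] bracket_scale(2)[of w 0 0] by simp_all

lemma bracket_minus [simp]: "bracket (- x) w = - bracket x w" "bracket w (- x) = - bracket w x"
  using bracket_scale(1)[of "-1" x w] bracket_scale(2)[of w "-1" x] by simp_all

lemma bracket_swap: "bracket y x = - bracket x y"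
proof -
  have "bracket x y + bracket y x = 0"
    using bracket_self[of "x + y"] unfolding bracket_add by (simp add: bracket_self add.commute)
  then show ?thesis by (simp add: add_eq_0_iff)
qed

text \<open>Multilinearity is rephrased as linearity in every single slot, a property that can be
  followed through sums and through \<open>sel_sum\<close>.\<close>

definition slot_linear :: "('g \<Rightarrow> 'k) \<Rightarrow> bool" where
  "slot_linear f \<longleftrightarrow> (\<forall>x y. f (x + y) = f x + f y) \<and> (\<forall>c x. f (scaleV c x) = c * f x)"

lemma multilinear_iff_slot: "multilinear_form M \<phi> \<longleftrightarrow> (\<forall>us vs. slot_linear (\<lambda>x. \<phi> (us @ x # vs)))"
  by (auto simp: multilinear_form_vec_mod slot_linear_def)

lemma slot_linear_0 [simp]: "slot_linear (\<lambda>x. 0)"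
  by (simp add: slot_linear_def)

lemma slot_linear_add: "slot_linear f \<Longrightarrow> slot_linear g \<Longrightarrow> slot_linear (\<lambda>x. f x + g x)"
  by (simp add: slot_linear_def algebra_simps)

lemma slot_linear_diff: "slot_linear f \<Longrightarrow> slot_linear g \<Longrightarrow> slot_linear (\<lambda>x. f x - g x)"
  by (simp add: slot_linear_def algebra_simps)

lemma slot_linear_mult: "slot_linear f \<Longrightarrow> slot_linear (\<lambda>x. c * f x)"
  by (simp add: slot_linear_def algebra_simps)

lemma slot_linear_uminus: "slot_linear f \<Longrightarrow> slot_linear (\<lambda>x. - f x)"
  by (simp add: slot_linear_def)

lemma slot_linear_sum: "(\<And>i. i \<in> I \<Longrightarrow> slot_linear (f i)) \<Longrightarrow> slot_linear (\<lambda>x. \<Sum>i\<in>I. f i x)"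
  by (induction I rule: infinite_finite_induct) (auto intro: slot_linear_add)

lemma slot_linear_sel_sum:
  "(\<And>w ws. slot_linear (\<lambda>x. E x w ws)) \<Longrightarrow> slot_linear (\<lambda>x. sel_sum vs (E x))"
proof (induction vs arbitrary: E)
  case (Cons v vs)
  show ?case by (auto intro!: slot_linear_add Cons)
qed simp

lemma slot_linear_sel_sum_slot:
  assumes "\<And>w as bs. slot_linear (\<lambda>x. E w (as @ x # bs))" "\<And>ws. slot_linear (\<lambda>x. E x ws)"
  shows "slot_linear (\<lambda>x. sel_sum (us @ x # vs) E)"
  using assms
proof (induction us arbitrary: E)
  case Nil
  have "slot_linear (\<lambda>x. E x vs + sel_sum vs ((\<lambda>x w ws. E w (x # ws)) x))"
    by (intro slot_linear_add slot_linear_sel_sum) (use Nil Nil(1)[of _ "[]"] in auto)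
  then show ?case by simp
next
  case (Cons u us)
  have "slot_linear (\<lambda>x. sel_sum (us @ x # vs) (\<lambda>w ws. E w (u # ws)))"
    by (rule Cons.IH) (use Cons.prems(1)[of _ "u # _"] Cons.prems(2) in auto)
  then show ?case using Cons.prems by (auto intro: slot_linear_add)
qed

text \<open>
  A function \<open>g\<close> with prescribed differences \<open>D\<close> under adjacent transpositions exists as soon as
  \<open>D\<close> respects the Coxeter relations.  Transpositions of the last letters are treated
  first; a further letter is accommodated by averaging the remaining defect \<open>e\<close>, which is a cocycle
  in its two distinguished letters.
\<close>

lemma solve_exchange:
  fixes D :: "'g list \<Rightarrow> 'g \<Rightarrow> 'g \<Rightarrow> 'g list \<Rightarrow> 'k"
  assumes anti: "\<And>us x y vs. D us y x vs = - D us x y vs"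
    and square: "\<And>us a b v c d w. D us a b (v @ c # d # w) - D us a b (v @ d # c # w) =
        D (us @ a # b # v) c d w - D (us @ b # a # v) c d w"
    and hexagon: "\<And>us a b c vs. D us a b (c # vs) + D (us @ [b]) a c vs + D us b c (a # vs) =
        D (us @ [a]) b c vs + D us a c (b # vs) + D (us @ [c]) a b vs"
    and lin1: "\<And>as bs x y vs. slot_linear (\<lambda>u. D (as @ u # bs) x y vs)"
    and lin2: "\<And>us y vs. slot_linear (\<lambda>x. D us x y vs)"
    and lin3: "\<And>us x y as bs. slot_linear (\<lambda>v. D us x y (as @ v # bs))"
    and vanish: "\<And>us x y vs. length us + length vs + 2 \<noteq> n \<Longrightarrow> D us x y vs = 0"
  shows "\<exists>g. multilinear_form M g \<and> (\<forall>us x y vs. g (us @ x # y # vs) - g (us @ y # x # vs) = D us x y vs)"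
proof -
  \<comment> \<open>Downward induction on i: the differences are correct for transpositions at
    places \<ge> i. For i = n no such transposition exists in the only length where D can be
    nonzero.\<close>
  have "\<exists>g. multilinear_form M g \<and>
      (\<forall>us x y vs. length us \<ge> i \<longrightarrow> g (us @ x # y # vs) - g (us @ y # x # vs) = D us x y vs)"
    if "i \<le> n" for i
    using that
  proof (induction i rule: inc_induct)
    case base
    show ?case using vanish by (intro exI[of _ "\<lambda>xs. 0"]) auto
  next
    case (step i)
    then obtain g0 where g0: "multilinear_form M g0"
        "\<And>us x y vs. length us > i \<Longrightarrow> D us x y vs = g0 (us @ x # y # vs) - g0 (us @ y # x # vs)"
      by (metis Suc_le_eq)
    define e where "e us x y vs = D us x y vs - (g0 (us @ x # y # vs) - g0 (us @ y # x # vs))" for us x y vs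
    \<comment> \<open>The letter at place i is compared with every later letter. Under the
      transposition at place i, the neighbouring pair contributes 2 e by antisymmetry and each of
      the n - i - 2 remaining letters contributes e by the cocycle identity; this explains the
      divisor n - i.\<close>
    define h where "h xs = sel_sum (drop (Suc i) xs) (e (take i xs) (xs ! i)) / of_nat (n - i)" for xs
    define g where "g xs = (if length xs = n then g0 xs + h xs else 0)" for xs
    have slot: "slot_linear (\<lambda>x. g0 (us @ x # vs))" for us vs
      using g0(1) by (simp add: multilinear_iff_slot)
    have e_anti: "e us y x vs = - e us x y vs" for us x y vs
      by (simp add: e_def anti[of us x y])
    have e1: "slot_linear (\<lambda>u. e (as @ u # bs) x y vs)" for as bs x y vs
      unfolding e_def using slot[of as "bs @ _"] by (auto intro!: slot_linear_diff lin1)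
    have e2: "slot_linear (\<lambda>x. e us x y vs)" for us y vs
      unfolding e_def using slot[of us] slot[of "us @ [y]" vs] by (auto intro!: slot_linear_diff lin2)
    have e2': "slot_linear (\<lambda>y. e us x y vs)" for us x vs
      using slot_linear_uminus[OF e2[of us x vs]] by (simp add: e_anti[of us x])
    have e3: "slot_linear (\<lambda>v. e us x y (as @ v # bs))" for us x y as bs
      unfolding e_def using slot[of "us @ x # y # as" bs] slot[of "us @ y # x # as" bs]
      by (auto intro!: slot_linear_diff lin3)
    \<comment> \<open>A transposition behind the pair changes both terms of e by the same amount, by
      \<open>square\<close> and because g0 is already correct there.\<close>
    have e_swap: "e us x y (as @ c # d # bs) = e us x y (as @ d # c # bs)" if "length us = i" for us x y as c d bs
      using square[of us x y as c d bs] that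
      by (simp add: e_def g0(2) algebra_simps)
    \<comment> \<open>This is \<open>hexagon\<close>, with the differences at the place after i
      expressed by g0.\<close>
    have e_cocycle: "e us x w (y # ws) - e us y w (x # ws) = e us x y (w # ws)" if "length us = i" for us x y w ws
      using hexagon[of us x y w ws] that
      by (simp add: e_def g0(2) algebra_simps)
    have h_lin: "slot_linear (\<lambda>x. h (us @ x # vs))" for us vs
    proof -
      have "slot_linear (\<lambda>x. sel_sum (drop (Suc i) (us @ x # vs)) (e (take i (us @ x # vs)) ((us @ x # vs) ! i)))"
      proof -
        consider "length us < i" | "length us = i" | "length us > i" by linarith
        then show ?thesis
        proof cases
          case 1
          then have *: "take i (us @ x # vs) = us @ x # take (i - length us - 1) vs"
            "(us @ x # vs) ! i = vs ! (i - length us - 1)"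
            "drop (Suc i) (us @ x # vs) = drop (i - length us) vs" for x
            by (auto simp: take_Cons' nth_append Suc_diff_le)
          show ?thesis unfolding * by (rule slot_linear_sel_sum) (rule e1)
        next
          case 2
          then show ?thesis by (auto intro!: slot_linear_sel_sum e2)
        next
          case 3
          then have *: "take i (us @ x # vs) = take i us" "(us @ x # vs) ! i = us ! i"
            "drop (Suc i) (us @ x # vs) = drop (Suc i) us @ x # vs" for x
            by (auto simp: nth_append)
          show ?thesis unfolding * by (rule slot_linear_sel_sum_slot) (rule e3 e2')+
        qed
      qed
      from slot_linear_mult[OF this, of "1 / of_nat (n - i)"]
      show ?thesis by (simp add: h_def)
    qed
    have "multilinear_form M g"
      unfolding multilinear_iff_slot
    proof (intro allI)
      fix us vs
      show "slot_linear (\<lambda>x. g (us @ x # vs))"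
        by (cases "length us + length vs + 1 = n") (auto simp: g_def intro!: slot_linear_add slot h_lin)
    qed
    moreover have "g (us @ x # y # vs) - g (us @ y # x # vs) = D us x y vs" if us: "length us \<ge> i" for us x y vs
    proof (cases "length us + length vs + 2 = n")
      case False
      then show ?thesis using vanish[of us vs x y] by (simp add: g_def)
    next
      case len: True
      have "h (us @ x # y # vs) - h (us @ y # x # vs) = D us x y vs - (g0 (us @ x # y # vs) - g0 (us @ y # x # vs))"
      proof (cases "length us = i")
        case True
        have n: "n - i = length vs + 2" using len True by simp
        have h1: "of_nat (n - i) * h (us @ x # y # vs) = e us x y vs + sel_sum vs (\<lambda>w ws. e us x w (y # ws))" for x y
        proof -
          have "(us @ x # y # vs) ! i = x" by (simp add: True[symmetric])
          then show ?thesis using True n by (simp add: h_def del: of_nat_add of_nat_Suc add_2_eq_Suc')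
        qed
        have "of_nat (n - i) * (h (us @ x # y # vs) - h (us @ y # x # vs)) =
            2 * e us x y vs + sel_sum vs (\<lambda>w ws. e us x w (y # ws) - e us y w (x # ws))"
          unfolding right_diff_distrib h1 sel_sum_diff e_anti[of us x y] by simp
        also have "sel_sum vs (\<lambda>w ws. e us x w (y # ws) - e us y w (x # ws)) = sel_sum vs (\<lambda>w ws. e us x y (w # ws))"
          by (simp add: e_cocycle[OF True])
        also have "\<dots> = of_nat (length vs) * e us x y vs"
          by (rule sel_sum_Cons) (rule e_swap[OF True])
        finally have "of_nat (n - i) * (h (us @ x # y # vs) - h (us @ y # x # vs)) = of_nat (n - i) * e us x y vs"
          by (simp add: n algebra_simps)
        moreover have "of_nat (n - i) \<noteq> (0::'k)" using n by (simp del: of_nat_add of_nat_Suc)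
        ultimately show ?thesis unfolding e_def[symmetric] by (metis mult_left_cancel)
      next
        case False
        then have us: "length us > i" using us by simp
        \<comment> \<open>Behind place i the new term is symmetric, so what g0 achieved is
          kept.\<close>
        have "h (us @ x # y # vs) = h (us @ y # x # vs)"
          using us e_swap[of "take i us"] by (simp add: h_def nth_append sel_sum_swap)
        then show ?thesis using g0(2)[OF us] by simp
      qed
      then show ?thesis using len by (simp add: g_def algebra_simps)
    qed
    ultimately show ?case by blast
  qed
  from this[of 0] show ?thesis by auto
qed

section \<open>Symmetric averages and the extension of forms from length n to n + 1\<close>

definition symavg :: "('g list \<Rightarrow> 'k) \<Rightarrow> 'g list \<Rightarrow> 'k" where
  "symavg \<phi> xs = (\<Sum>\<sigma> | \<sigma> permutes {..<length xs}. \<phi> (permute_list \<sigma> xs)) / fact (length xs)"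

lemma sym_prod_eval: "multilinear_form M \<phi> \<Longrightarrow> sym_prod M xs \<phi> = symavg \<phi> xs"
  by (simp add: sym_prod_def symavg_def)

lemma symavg_mset: "mset xs = mset ys \<Longrightarrow> symavg \<phi> xs = symavg \<phi> ys"
  using sum_permute_list_mset[of xs ys \<phi>] size_mset[of xs] size_mset[of ys]
  by (simp add: symavg_def)

lemma symavg_cong:
  "(\<And>ys. length ys = length xs \<Longrightarrow> \<phi> ys = \<psi> ys) \<Longrightarrow> symavg \<phi> xs = symavg \<psi> xs"
  by (simp add: symavg_def)

lemma symavg_add: "symavg (\<lambda>xs. \<phi> xs + \<psi> xs) xs = symavg \<phi> xs + symavg \<psi> xs"
  by (simp add: symavg_def sum.distrib add_divide_distrib)

lemma symavg_diff: "symavg (\<lambda>xs. \<phi> xs - \<psi> xs) xs = symavg \<phi> xs - symavg \<psi> xs"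
  by (simp add: symavg_def sum_subtractf diff_divide_distrib)

lemma symavg_idem: "symavg (symavg \<phi>) xs = symavg \<phi> xs"
proof -
  have "symavg (symavg \<phi>) xs = (\<Sum>\<sigma> | \<sigma> permutes {..<length xs}. symavg \<phi> xs) / fact (length xs)"
    unfolding symavg_def[of "symavg \<phi>" xs]
    by (intro arg_cong2[where f = divide] sum.cong refl symavg_mset) auto
  then show ?thesis by (simp add: card_permutations[OF refl])
qed

lemma multilinear_symavg:
  assumes "multilinear_form M \<phi>"
  shows "multilinear_form M (symavg \<phi>)"
  unfolding multilinear_iff_slot
proof (intro allI)
  fix us vs
  have "slot_linear (\<lambda>x. \<phi> (permute_list \<sigma> (us @ x # vs)))" if perm: "\<sigma> permutes {..<length us + length vs + 1}" for \<sigma>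
  proof -
    obtain as bs where "\<And>x. permute_list \<sigma> (us @ x # vs) = as @ x # bs"
      using permute_list_slot[OF perm] by blast
    then show ?thesis using assms by (simp add: multilinear_iff_slot)
  qed
  then have "slot_linear (\<lambda>x. (1 / fact (length us + length vs + 1)) *
      (\<Sum>\<sigma> | \<sigma> permutes {..<length us + length vs + 1}. \<phi> (permute_list \<sigma> (us @ x # vs))))"
    by (intro slot_linear_mult slot_linear_sum) simp
  then show "slot_linear (\<lambda>x. symavg \<phi> (us @ x # vs))"
    by (simp add: symavg_def)
qed

text \<open>The relation couples two consecutive lengths; the bound refers to the longer
  words.\<close>

definition exchange_upto :: "nat \<Rightarrow> ('g list \<Rightarrow> 'k) \<Rightarrow> bool" where
  "exchange_upto n \<phi> \<longleftrightarrow> multilinear_form M \<phi> \<and> (\<forall>us x y vs. length us + length vs + 2 \<le> n \<longrightarrow>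
     \<phi> (us @ x # y # vs) - \<phi> (us @ y # x # vs) = z * \<phi> (us @ bracket x y # vs))"

text \<open>In length n + 1 the relation prescribes differences in terms of the values of \<phi> in
  length n. For two disjoint pairs, \<open>square\<close> follows from the relation already known in
  length n, and \<open>hexagon\<close> is the Jacobi identity. Adding the symmetric form
  \<open>r\<close> does not affect differences and adjusts the symmetric average to that of
  \<psi>.\<close>

lemma exchange_step:
  assumes \<phi>: "exchange_upto n \<phi>" and \<psi>: "multilinear_form M \<psi>"
  shows "\<exists>\<phi>'. exchange_upto (Suc n) \<phi>' \<and> (\<forall>xs. length xs \<le> n \<longrightarrow> \<phi>' xs = \<phi> xs) \<and>
    (\<forall>xs. length xs = Suc n \<longrightarrow> symavg \<phi>' xs = symavg \<psi> xs)"
proof -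
  have ml: "multilinear_form M \<phi>" using \<phi> by (simp add: exchange_upto_def)
  have ex: "\<phi> (us @ x # y # vs) - \<phi> (us @ y # x # vs) = z * \<phi> (us @ bracket x y # vs)"
    if "length us + length vs + 2 \<le> n" for us x y vs
    using \<phi> that by (simp add: exchange_upto_def)
  have slot: "slot_linear (\<lambda>x. \<phi> (us @ x # vs))" for us vs
    using ml by (simp add: multilinear_iff_slot)
  have slotD: "\<phi> (us @ (x + y) # vs) = \<phi> (us @ x # vs) + \<phi> (us @ y # vs)"
      "\<phi> (us @ (- x) # vs) = - \<phi> (us @ x # vs)" "\<phi> (us @ 0 # vs) = 0" for us x y vs
  proof -
    show 1: "\<phi> (us @ (x + y) # vs) = \<phi> (us @ x # vs) + \<phi> (us @ y # vs)" for x y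
      using slot by (simp add: slot_linear_def)
    show 0: "\<phi> (us @ 0 # vs) = 0" using 1[of 0 0] by simp
    show "\<phi> (us @ (- x) # vs) = - \<phi> (us @ x # vs)"
      using 1[of x "- x"] 0 by (simp add: eq_neg_iff_add_eq_0 add.commute)
  qed
  define D where "D us x y vs = (if length us + length vs + 2 = Suc n then z * \<phi> (us @ bracket x y # vs) else 0)"
    for us x y vs
  have "\<exists>g. multilinear_form M g \<and> (\<forall>us x y vs. g (us @ x # y # vs) - g (us @ y # x # vs) = D us x y vs)"
  proof (rule solve_exchange[where n = "Suc n"])
    fix us x y vs show "D us y x vs = - D us x y vs"
      using bracket_swap[of y x] by (simp add: D_def slotD)
  next
    fix us a b v c d w
    show "D us a b (v @ c # d # w) - D us a b (v @ d # c # w) =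
        D (us @ a # b # v) c d w - D (us @ b # a # v) c d w"
    proof (cases "length us + length v + length w + 4 = Suc n")
      case True
      have "z * \<phi> (us @ bracket a b # v @ c # d # w) - z * \<phi> (us @ bracket a b # v @ d # c # w) =
          z * \<phi> ((us @ a # b # v) @ bracket c d # w) - z * \<phi> ((us @ b # a # v) @ bracket c d # w)"
        using ex[of "us @ bracket a b # v" w c d] ex[of us "v @ bracket c d # w" a b] True
        by (simp add: right_diff_distrib[symmetric])
      then show ?thesis using True by (simp add: D_def)
    qed (auto simp: D_def)
  next
    fix us a b c vs
    show "D us a b (c # vs) + D (us @ [b]) a c vs + D us b c (a # vs) =
        D (us @ [a]) b c vs + D us a c (b # vs) + D (us @ [c]) a b vs"
    proof (cases "length us + length vs + 3 = Suc n")
      case True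
      let ?f = "\<lambda>x. \<phi> (us @ x # vs)"
      have 1: "\<phi> (us @ bracket a b # c # vs) - \<phi> (us @ c # bracket a b # vs) = z * ?f (bracket (bracket a b) c)"
        "\<phi> (us @ b # bracket a c # vs) - \<phi> (us @ bracket a c # b # vs) = z * ?f (bracket b (bracket a c))"
        "\<phi> (us @ bracket b c # a # vs) - \<phi> (us @ a # bracket b c # vs) = z * ?f (bracket (bracket b c) a)"
        using True by (auto intro!: ex)
      have "bracket (bracket a b) c + bracket b (bracket a c) + bracket (bracket b c) a = 0"
      proof -
        have eqs: "bracket (bracket a b) c = - bracket c (bracket a b)" "bracket a c = - bracket c a"
          "bracket (bracket b c) a = - bracket a (bracket b c)"
          by (rule bracket_swap)+
        have "bracket (bracket a b) c + bracket b (bracket a c) + bracket (bracket b c) a =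
            - (bracket a (bracket b c) + bracket b (bracket c a) + bracket c (bracket a b))"
          unfolding eqs by simp
        then show ?thesis by (simp only: jacobi_identity minus_zero)
      qed
      then have "?f (bracket (bracket a b) c) + ?f (bracket b (bracket a c)) + ?f (bracket (bracket b c) a) = 0"
        using slotD by metis
      then have "z * (z * ?f (bracket (bracket a b) c)) + z * (z * ?f (bracket b (bracket a c))) +
          z * (z * ?f (bracket (bracket b c) a)) = 0"
        by (metis distrib_left mult_zero_right)
      then show ?thesis using True unfolding 1[symmetric] by (simp add: D_def algebra_simps)
    qed (auto simp: D_def)
  next
    fix as bs x y vs show "slot_linear (\<lambda>u. D (as @ u # bs) x y vs)"
      using slot_linear_mult[OF slot[of as "bs @ bracket x y # vs"], of z]
      by (cases "length as + length bs + length vs + 3 = Suc n") (simp_all add: D_def)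
  next
    fix us y vs show "slot_linear (\<lambda>x. D us x y vs)"
      using slot[of us vs] by (auto simp: D_def slot_linear_def algebra_simps)
  next
    fix us x y as bs show "slot_linear (\<lambda>v. D us x y (as @ v # bs))"
      using slot_linear_mult[OF slot[of "us @ bracket x y # as" bs], of z]
      by (cases "length us + length as + length bs + 3 = Suc n") (simp_all add: D_def)
  next
    fix us vs :: "'g list" and x y assume "length us + length vs + 2 \<noteq> Suc n"
    then show "D us x y vs = 0" by (simp add: D_def)
  qed
  then obtain g where g: "multilinear_form M g"
      "\<And>us x y vs. g (us @ x # y # vs) - g (us @ y # x # vs) = D us x y vs" by blast
  define r where "r = symavg (\<lambda>xs. \<psi> xs - g xs)"
  have r: "multilinear_form M r"
    unfolding r_def by (intro multilinear_symavg multilinear_form_diff \<psi> g)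
  have r_swap: "r (us @ x # y # vs) = r (us @ y # x # vs)" for us x y vs
    unfolding r_def by (rule symavg_mset) simp
  define \<phi>' where "\<phi>' xs = (if length xs \<le> n then \<phi> xs else g xs + r xs)" for xs
  have "multilinear_form M \<phi>'"
    unfolding \<phi>'_def by (intro multilinear_form_cases ml multilinear_form_add g r)
  moreover have "\<phi>' (us @ x # y # vs) - \<phi>' (us @ y # x # vs) = z * \<phi>' (us @ bracket x y # vs)"
    if len: "length us + length vs + 2 \<le> Suc n" for us x y vs
  proof (cases "length us + length vs + 2 = Suc n")
    case True
    then show ?thesis using g(2)[of us x y vs] r_swap[of us x y vs] by (simp add: \<phi>'_def D_def)
  next
    case False
    then show ?thesis using len ex[of us vs x y] by (simp add: \<phi>'_def)
  qed
  moreover have "symavg \<phi>' xs = symavg \<psi> xs" if "length xs = Suc n" for xs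
  proof -
    have "symavg \<phi>' xs = symavg (\<lambda>xs. g xs + r xs) xs"
      using that by (intro symavg_cong) (simp add: \<phi>'_def)
    then show ?thesis by (simp add: symavg_add r_def symavg_idem symavg_diff)
  qed
  ultimately show ?thesis
    by (intro exI[of _ \<phi>']) (auto simp: exchange_upto_def \<phi>'_def)
qed

text \<open>The extension runs through the lengths. Since stage n + 1 leaves the values on words of
  length \<le> n alone, the stages fit together to a single form.\<close>

theorem exchange_extension:
  assumes \<psi>: "multilinear_form M \<psi>"
  obtains \<phi> where "exchange \<phi>" "\<And>f. f \<in> carrier (symmetric_tensors M) \<Longrightarrow> f \<phi> = f \<psi>"
proof -
  have "\<exists>f. \<forall>n. (exchange_upto n (f n) \<and> (\<forall>xs. length xs \<le> n \<longrightarrow> symavg (f n) xs = symavg \<psi> xs)) \<and>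
      (\<forall>xs. length xs \<le> n \<longrightarrow> f (Suc n) xs = f n xs)"
  proof (rule dependent_nat_choice)
    show "\<exists>\<phi>. exchange_upto 0 \<phi> \<and> (\<forall>xs. length xs \<le> 0 \<longrightarrow> symavg \<phi> xs = symavg \<psi> xs)"
      using \<psi> by (auto simp: exchange_upto_def)
  next
    fix \<phi> n assume *: "exchange_upto n \<phi> \<and> (\<forall>xs. length xs \<le> n \<longrightarrow> symavg \<phi> xs = symavg \<psi> xs)"
    then obtain \<phi>' where \<phi>': "exchange_upto (Suc n) \<phi>'" "\<And>xs. length xs \<le> n \<Longrightarrow> \<phi>' xs = \<phi> xs"
        "\<And>xs. length xs = Suc n \<Longrightarrow> symavg \<phi>' xs = symavg \<psi> xs"
      using exchange_step[OF _ \<psi>] by metis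
    have "symavg \<phi>' xs = symavg \<psi> xs" if "length xs \<le> Suc n" for xs
    proof (cases "length xs = Suc n")
      case False
      then have "symavg \<phi>' xs = symavg \<phi> xs" using that \<phi>'(2) by (intro symavg_cong) simp
      then show ?thesis using * that False by simp
    qed (use \<phi>' in simp)
    then show "\<exists>\<phi>'. (exchange_upto (Suc n) \<phi>' \<and> (\<forall>xs. length xs \<le> Suc n \<longrightarrow> symavg \<phi>' xs = symavg \<psi> xs)) \<and>
        (\<forall>xs. length xs \<le> n \<longrightarrow> \<phi>' xs = \<phi> xs)"
      using \<phi>' by blast
  qed
  then obtain f where f: "\<And>n. exchange_upto n (f n)"
      "\<And>n xs. length xs \<le> n \<Longrightarrow> symavg (f n) xs = symavg \<psi> xs"
      "\<And>n xs. length xs \<le> n \<Longrightarrow> f (Suc n) xs = f n xs" by blast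
  define \<phi> where "\<phi> xs = f (length xs) xs" for xs
  have \<phi>: "f n xs = \<phi> xs" if "length xs \<le> n" for n xs
    using that by (induction n rule: dec_induct) (auto simp: \<phi>_def f(3))
  have ml: "multilinear_form M (f n)" for n using f(1) by (simp add: exchange_upto_def)
  then have "slot_linear (\<lambda>x. f (length us + length vs + 1) (us @ x # vs))" for us vs
    by (simp add: multilinear_iff_slot)
  then have m: "multilinear_form M \<phi>"
    by (simp add: multilinear_iff_slot \<phi>)
  moreover have "\<phi> (us @ x # y # vs) - \<phi> (us @ y # x # vs) = z * \<phi> (us @ bracket x y # vs)" for us x y vs
    using f(1)[of "length us + length vs + 2"] by (auto simp: exchange_upto_def \<phi>)
  ultimately have "exchange \<phi>" by (simp add: exchange_def)
  moreover have "s \<phi> = s \<psi>" if "s \<in> carrier (symmetric_tensors M)" for s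
    using that unfolding carrier_symmetric_tensors
  proof (induction rule: lspan_induct)
    case (add c xs t)
    have "symavg \<phi> xs = symavg (f (length xs)) xs" by (rule symavg_cong) (simp add: \<phi>_def)
    then show ?case using add f(2)[of xs "length xs"] by (simp add: sym_prod_eval m \<psi>)
  qed simp
  ultimately show ?thesis using that by blast
qed

end

section \<open>Rewriting tensors into symmetric products modulo the ideal\<close>

context lie_algebra
begin

text \<open>
  \<open>inner_avg xs i I \<eta> \<zeta>\<close> is the average of the tensors \<open>xs \<otimes> \<eta>\<^sub>\<sigma>\<^sub>1 \<otimes> \<dots> \<otimes> \<zeta> \<otimes> \<dots> \<otimes> \<eta>\<^sub>\<sigma>\<^sub>n\<close> with \<open>\<zeta>\<close> preceded by
  \<open>i\<close> of the letters \<open>\<eta>\<close>.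
\<close>

definition inner_avg :: "'g list \<Rightarrow> nat \<Rightarrow> nat set \<Rightarrow> (nat \<Rightarrow> 'g) \<Rightarrow> 'g \<Rightarrow> ('k, 'g) tensor" where
  "inner_avg xs i I \<eta> \<zeta> = (\<lambda>\<phi>. (1 / fact (card I)) *
     (\<Sum>is\<in>permutations_of_set I. tensor M (xs @ map \<eta> (take i is) @ \<zeta> # map \<eta> (drop i is)) \<phi>))"

text \<open>The same average without \<zeta>; for empty \<open>xs\<close> it is the symmetric
  product. Letters are indexed by a set of numbers, so that adding or removing one of them is a set
  operation even among equal letters.\<close>

definition tail_avg :: "'g list \<Rightarrow> nat set \<Rightarrow> (nat \<Rightarrow> 'g) \<Rightarrow> ('k, 'g) tensor" where
  "tail_avg xs I \<eta> = (\<lambda>\<phi>. (1 / fact (card I)) *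
     (\<Sum>is\<in>permutations_of_set I. tensor M (xs @ map \<eta> is) \<phi>))"

lemma inner_avg_closed: "inner_avg xs i I \<eta> \<zeta> \<in> carrier T"
  unfolding inner_avg_def carrier_tensor_algebra by (intro lspan_scale lspan_sum lspan_base) auto

lemma tail_avg_closed: "tail_avg xs I \<eta> \<in> carrier T"
  unfolding tail_avg_def carrier_tensor_algebra by (intro lspan_scale lspan_sum lspan_base) auto

lemma tail_avg_snoc: "tail_avg (xs @ [x]) I \<eta> = inner_avg xs 0 I \<eta> x"
  by (simp add: tail_avg_def inner_avg_def)

lemma tail_avg_Nil:
  assumes "finite I"
  shows "tail_avg [] I \<eta> = sym_prod M (map \<eta> (sorted_list_of_set I))"
proof
  fix \<phi>
  show "tail_avg [] I \<eta> \<phi> = sym_prod M (map \<eta> (sorted_list_of_set I)) \<phi>"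
    using sum_permute_list[of "sorted_list_of_set I" "\<lambda>xs. tensor M xs \<phi>" \<eta>] assms
    by (simp add: tail_avg_def sym_prod_def)
qed

lemma map_fun_upd_insert:
  "l \<notin> set js \<Longrightarrow> map (\<eta>(l := \<zeta>)) (take m js @ l # drop m js) = map \<eta> (take m js) @ \<zeta> # map \<eta> (drop m js)"
  by (auto dest: in_set_takeD in_set_dropD)

text \<open>Symmetrizing over one more letter means averaging over the places that it can take among
  the others.\<close>

lemma tail_avg_insert:
  assumes "finite I" "l \<notin> I"
  shows "tail_avg xs (insert l I) (\<eta>(l := \<zeta>)) \<phi> = (1 / of_nat (card I + 1)) * (\<Sum>i\<le>card I. inner_avg xs i I \<eta> \<zeta> \<phi>)"
proof -
  have "(\<Sum>is\<in>permutations_of_set (insert l I). tensor M (xs @ map (\<eta>(l := \<zeta>)) is) \<phi>) =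
    (\<Sum>m\<le>card I. \<Sum>js\<in>permutations_of_set I.
       tensor M (xs @ map (\<eta>(l := \<zeta>)) (take m js @ l # drop m js)) \<phi>)"
    by (rule sum_permutations_insert[OF assms])
  also have "\<dots> = (\<Sum>m\<le>card I. \<Sum>js\<in>permutations_of_set I.
       tensor M (xs @ map \<eta> (take m js) @ \<zeta> # map \<eta> (drop m js)) \<phi>)"
  proof (intro sum.cong refl)
    fix m js assume "js \<in> permutations_of_set I"
    then have "l \<notin> set js" using assms by (auto simp: permutations_of_set_def)
    then show "tensor M (xs @ map (\<eta>(l := \<zeta>)) (take m js @ l # drop m js)) \<phi> =
        tensor M (xs @ map \<eta> (take m js) @ \<zeta> # map \<eta> (drop m js)) \<phi>"
      using map_fun_upd_insert[of l js \<eta> \<zeta> m] by argo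
  qed
  also have "\<dots> = (\<Sum>m\<le>card I. fact (card I) * inner_avg xs m I \<eta> \<zeta> \<phi>)"
    by (simp add: inner_avg_def)
  also have "\<dots> = fact (card I) * (\<Sum>m\<le>card I. inner_avg xs m I \<eta> \<zeta> \<phi>)"
    by (simp add: sum_distrib_left)
  finally have eq: "(\<Sum>is\<in>permutations_of_set (insert l I). tensor M (xs @ map (\<eta>(l := \<zeta>)) is) \<phi>) =
      fact (card I) * (\<Sum>m\<le>card I. inner_avg xs m I \<eta> \<zeta> \<phi>)" .
  have nz: "of_nat (card I + 1) \<noteq> (0::'k)" by (simp del: of_nat_add of_nat_Suc)
  have card: "fact (card (insert l I)) = of_nat (card I + 1) * (fact (card I) :: 'k)"
    using assms by simp
  show ?thesis
    unfolding tail_avg_def eq card using nz by (simp del: of_nat_add of_nat_Suc)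
qed

text \<open>By \<open>avg_coeff_sum\<close>, \<zeta> at place i is compared with the average over
  all places, which is the symmetrized tensor. Modulo the ideal, the increment at place m merges
  \<zeta> with its neighbour into \<open>bracket (\<eta> j) \<zeta>\<close>; over all orderings
  every j is this neighbour equally often, which gives the factor 1 / \<open>card I\<close>.\<close>

lemma inner_avg_step:
  assumes \<phi>: "exchange \<phi>" and I: "finite I" and i: "i \<le> card I" and l: "l \<notin> I"
  shows "inner_avg xs i I \<eta> \<zeta> \<phi> = tail_avg xs (insert l I) (\<eta>(l := \<zeta>)) \<phi> +
    (\<Sum>m<card I. \<Sum>j\<in>I. (of_real (avg_coeff (card I) i m) * z / of_nat (card I)) *
       inner_avg xs m (I - {j}) \<eta> (bracket (\<eta> j) \<zeta>) \<phi>)"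
proof -
  let ?n = "card I" and ?P = "permutations_of_set I"
  have ml: "multilinear_form M \<phi>" using \<phi> by (rule exchange_multilinear)
  define a where "a is m = \<phi> (xs @ map \<eta> (take m is) @ \<zeta> # map \<eta> (drop m is))" for "is" m
  have a_avg: "(\<Sum>is\<in>?P. a is m) = fact ?n * inner_avg xs m I \<eta> \<zeta> \<phi>" for m
    by (simp add: inner_avg_def a_def ml)
  have diff: "(\<Sum>is\<in>?P. a is (Suc m) - a is m) =
      fact ?n * (\<Sum>j\<in>I. (z / of_nat ?n) * inner_avg xs m (I - {j}) \<eta> (bracket (\<eta> j) \<zeta>) \<phi>)"
    if m: "m < ?n" for m
  proof -
    have "(\<Sum>is\<in>?P. a is (Suc m) - a is m) =
      (\<Sum>is\<in>?P. z * \<phi> (xs @ map \<eta> (take m is) @ bracket (\<eta> (is ! m)) \<zeta> # map \<eta> (drop (Suc m) is)))"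
    proof (intro sum.cong refl)
      fix "is" assume "is \<in> ?P"
      then have "m < length is" using m by (simp add: length_finite_permutations_of_set)
      then have "a is (Suc m) = \<phi> ((xs @ map \<eta> (take m is)) @ \<eta> (is ! m) # \<zeta> # map \<eta> (drop (Suc m) is))"
        "a is m = \<phi> ((xs @ map \<eta> (take m is)) @ \<zeta> # \<eta> (is ! m) # map \<eta> (drop (Suc m) is))"
        by (simp_all add: a_def take_Suc_conv_app_nth Cons_nth_drop_Suc[symmetric])
      then show "a is (Suc m) - a is m =
          z * \<phi> (xs @ map \<eta> (take m is) @ bracket (\<eta> (is ! m)) \<zeta> # map \<eta> (drop (Suc m) is))"
        by (simp add: exchangeD[OF \<phi>] del: append_assoc) simp
    qed
    also have "\<dots> = z * (\<Sum>j\<in>I. \<Sum>js\<in>permutations_of_set (I - {j}).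
        \<phi> (xs @ map \<eta> (take m js) @ bracket (\<eta> j) \<zeta> # map \<eta> (drop m js)))"
    proof -
      have *: "\<phi> (xs @ map \<eta> (take m (take m js @ j # drop m js)) @
          bracket (\<eta> ((take m js @ j # drop m js) ! m)) \<zeta> # map \<eta> (drop (Suc m) (take m js @ j # drop m js))) =
        \<phi> (xs @ map \<eta> (take m js) @ bracket (\<eta> j) \<zeta> # map \<eta> (drop m js))"
        if "j \<in> I" "js \<in> permutations_of_set (I - {j})" for j js
      proof -
        have "length js = ?n - 1"
          using that I by (simp add: length_finite_permutations_of_set)
        then have "m \<le> length js" using m by simp
        then show ?thesis by (simp add: nth_append min_def)
      qed
      show ?thesis
        unfolding sum_distrib_left[symmetric]
        by (subst sum_permutations_position[OF I m])
          (intro arg_cong[where f = "\<lambda>x. z * x"] sum.cong refl *)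
    qed
    also have "\<dots> = z * (\<Sum>j\<in>I. fact (?n - 1) * inner_avg xs m (I - {j}) \<eta> (bracket (\<eta> j) \<zeta>) \<phi>)"
      using I by (intro arg_cong[where f = "\<lambda>x. z * x"] sum.cong refl) (simp add: inner_avg_def ml)
    also have "\<dots> = fact ?n * (\<Sum>j\<in>I. (z / of_nat ?n) * inner_avg xs m (I - {j}) \<eta> (bracket (\<eta> j) \<zeta>) \<phi>)"
    proof -
      have "fact ?n = of_nat ?n * (fact (?n - 1) :: 'k)" "of_nat ?n \<noteq> (0::'k)"
        using m by (auto simp: fact_reduce)
      then show ?thesis
        by (simp add: sum_distrib_left field_simps)
    qed
    finally show ?thesis .
  qed
  have "fact ?n * inner_avg xs i I \<eta> \<zeta> \<phi> =
    (\<Sum>is\<in>?P. (1 / real (?n + 1)) *\<^sub>R (\<Sum>m\<le>?n. a is m) + (\<Sum>m<?n. avg_coeff ?n i m *\<^sub>R (a is (Suc m) - a is m)))"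
    unfolding a_avg[symmetric] by (intro sum.cong refl avg_coeff_sum[OF i])
  also have "\<dots> = (1 / real (?n + 1)) *\<^sub>R (\<Sum>m\<le>?n. \<Sum>is\<in>?P. a is m) +
      (\<Sum>m<?n. avg_coeff ?n i m *\<^sub>R (\<Sum>is\<in>?P. a is (Suc m) - a is m))"
    by (simp add: sum.distrib scaleR_sum_right sum.swap[of _ ?P])
  also have "\<dots> = fact ?n * (tail_avg xs (insert l I) (\<eta>(l := \<zeta>)) \<phi> +
    (\<Sum>m<?n. \<Sum>j\<in>I. (of_real (avg_coeff ?n i m) * z / of_nat ?n) *
       inner_avg xs m (I - {j}) \<eta> (bracket (\<eta> j) \<zeta>) \<phi>))"
    unfolding tail_avg_insert[OF I l] a_avg
    by (simp add: diff distrib_left scaleR_conv_of_real sum_distrib_left mult_ac)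
  finally show ?thesis by simp
qed

text \<open>
  \<open>Q t b\<close> is to be read as ``\<open>t\<close> has size at most \<open>b\<close>'', and \<open>W\<close> controls which multisets of
  elements of the Lie algebra occur.  The factor \<open>s!\<close> rather than \<open>(s!)\<^sup>2\<close> is essential for the case \<open>R = 1\<close>.
\<close>

lemma tensor_bound_induct:
  fixes Q :: "('k, 'g) tensor \<Rightarrow> real \<Rightarrow> bool" and W :: "'g multiset \<Rightarrow> bool"
  assumes cong: "\<And>s t b. s \<in> carrier T \<Longrightarrow> t \<in> carrier T \<Longrightarrow> (\<And>\<phi>. exchange \<phi> \<Longrightarrow> s \<phi> = t \<phi>) \<Longrightarrow> Q s b \<Longrightarrow> Q t b"
    and add: "\<And>s t b c. s \<in> carrier T \<Longrightarrow> t \<in> carrier T \<Longrightarrow> Q s b \<Longrightarrow> Q t c \<Longrightarrow> Q (\<lambda>\<phi>. s \<phi> + t \<phi>) (b + c)"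
    and scale: "\<And>s b c. s \<in> carrier T \<Longrightarrow> Q s b \<Longrightarrow> Q (\<lambda>\<phi>. c * s \<phi>) (norm c * b)"
    and mono: "\<And>s b c. Q s b \<Longrightarrow> b \<le> c \<Longrightarrow> Q s c"
    and zero: "Q (\<lambda>\<phi>. 0) 0"
    and sym: "\<And>ws. W (mset ws) \<Longrightarrow> Q (sym_prod M ws) (B * fact (length ws))"
    and br: "\<And>u v m. W (add_mset u (add_mset v m)) \<Longrightarrow> W (add_mset (bracket u v) m)"
    and B: "B \<ge> 0" and Z: "Z \<ge> 1" "norm z \<le> Z"
    and W: "W (mset xs)" and ne: "xs \<noteq> []"
  shows "Q (tensor M xs) (B * (4 * Z) ^ length xs * fact (length xs))"
proof -
  have Q_sum: "Q (\<lambda>\<phi>. \<Sum>k\<in>K. f k \<phi>) (\<Sum>k\<in>K. b k)"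
    if "finite K" "\<And>k. k \<in> K \<Longrightarrow> f k \<in> carrier T" "\<And>k. k \<in> K \<Longrightarrow> Q (f k) (b k)"
    for K :: "'x set" and f b
    using that
  proof (induction K rule: finite_induct)
    case (insert k K)
    have "(\<lambda>\<phi>. \<Sum>k\<in>K. f k \<phi>) \<in> carrier T"
      unfolding carrier_tensor_algebra
      by (rule lspan_sum) (use insert.prems(1) in \<open>auto simp: carrier_tensor_algebra\<close>)
    then show ?case using insert by (auto intro!: add)
  qed (simp add: zero)
  \<comment> \<open>The budget for r prefix letters, the letter \<zeta> and n symmetrized letters, n
    + r + 1 in all. A factor 2 per symmetrized letter lets each inner step divide the budget into
    two halves, and a prefix letter carries one factor 2 more, which is spent when it becomes the
    next \<zeta>.\<close>
  define E :: "nat \<Rightarrow> nat \<Rightarrow> real" where "E r n = Z ^ (n + r + 1) * 2 ^ (2 * r + n + 1) * fact (n + r + 1)" for r n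
  \<comment> \<open>Induction on the size of the block with the prefix fixed; \<open>tail\<close>
    supplies the bound once \<zeta> has been absorbed into the block.\<close>
  have inner: "Q (inner_avg xs i I \<eta> \<zeta>) (B * E r (card I))"
    if tail: "\<And>I \<eta>. finite I \<Longrightarrow> I \<noteq> {} \<Longrightarrow> W (mset xs + image_mset \<eta> (mset_set I)) \<Longrightarrow>
        Q (tail_avg xs I \<eta>) (B * (E r (card I - 1) / 2))"
      and "finite I" "i \<le> card I" "W (mset xs + add_mset \<zeta> (image_mset \<eta> (mset_set I)))" for xs r i I \<eta> \<zeta>
    using that(2-)
  proof (induction "card I" arbitrary: i I \<eta> \<zeta>)
    case n: (0 I i \<eta> \<zeta>)
    then have I: "I = {}" by simp
    have "W (mset xs + image_mset (\<eta>(0 := \<zeta>)) (mset_set {0}))" using n I by simp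
    then have "Q (tail_avg xs {0} (\<eta>(0 := \<zeta>))) (B * (E r 0 / 2))"
      using tail[of "{0}" "\<eta>(0 := \<zeta>)"] by simp
    moreover have "B * (E r 0 / 2) \<le> B * E r (card I)"
      using B Z by (intro mult_left_mono) (auto simp: I E_def)
    moreover have "tail_avg xs {0} (\<eta>(0 := \<zeta>)) \<phi> = inner_avg xs i I \<eta> \<zeta> \<phi>" if "exchange \<phi>" for \<phi>
      using inner_avg_step[OF that, of I i 0 xs \<eta> \<zeta>] n I by simp
    ultimately show ?case
      using cong[OF tail_avg_closed inner_avg_closed] mono by blast
  next
    case n: (Suc n I i \<eta> \<zeta>)
    obtain l where l: "l \<notin> I" using \<open>finite I\<close> ex_new_if_finite[OF infinite_UNIV_nat] by blast
    let ?c = "\<lambda>m. of_real (avg_coeff (card I) i m) * z / of_nat (card I) :: 'k"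
    let ?f = "\<lambda>m j. inner_avg xs m (I - {j}) \<eta> (bracket (\<eta> j) \<zeta>)"
    have "image_mset (\<eta>(l := \<zeta>)) (mset_set (insert l I)) = add_mset \<zeta> (image_mset \<eta> (mset_set I))"
      using l n by (auto intro!: image_mset_cong)
    then have "W (mset xs + image_mset (\<eta>(l := \<zeta>)) (mset_set (insert l I)))" using n by simp
    then have 1: "Q (tail_avg xs (insert l I) (\<eta>(l := \<zeta>))) (B * (E r (Suc n) / 2))"
      using tail[of "insert l I" "\<eta>(l := \<zeta>)"] n l by simp
    have f: "Q (?f m j) (B * E r n)" if "m < card I" "j \<in> I" for m j
    proof -
      have card_I: "card (I - {j}) = n" "m \<le> n"
        using that(1) card_Diff_singleton[OF that(2)] n(2) by linarith+
      have "mset_set I = add_mset j (mset_set (I - {j}))"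
        using that n by (simp add: mset_set.remove)
      then have "W (add_mset (\<eta> j) (add_mset \<zeta> (mset xs + image_mset \<eta> (mset_set (I - {j})))))"
        using n by (simp add: add_mset_commute)
      then have "W (mset xs + add_mset (bracket (\<eta> j) \<zeta>) (image_mset \<eta> (mset_set (I - {j}))))"
        using br by simp
      then show ?thesis
        using n that n(1)[of "I - {j}" m "bracket (\<eta> j) \<zeta>" \<eta>] card_I by simp
    qed
    have cf: "Q (\<lambda>\<phi>. ?c m * ?f m j \<phi>) (Z / card I * (B * E r n))" if "m < card I" "j \<in> I" for m j
    proof (rule mono[OF scale[OF inner_avg_closed f[OF that]]])
      have "norm (?c m) = \<bar>avg_coeff (card I) i m\<bar> * (norm z / card I)"
        by (simp add: norm_mult norm_divide)
      also have "\<dots> \<le> 1 * (Z / card I)"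
        using abs_avg_coeff[of m "card I" i] that n Z by (intro mult_mono divide_right_mono) auto
      finally show "norm (?c m) * (B * E r n) \<le> Z / card I * (B * E r n)"
        using B Z by (intro mult_right_mono) (auto simp: E_def)
    qed
    have cfT: "(\<lambda>\<phi>. ?c m * ?f m j \<phi>) \<in> carrier T" for m j
      using inner_avg_closed tensor_algebra_closed(3) by blast
    have 2: "Q (\<lambda>\<phi>. \<Sum>m<card I. \<Sum>j\<in>I. ?c m * ?f m j \<phi>) (\<Sum>m<card I. \<Sum>j\<in>I. Z / card I * (B * E r n))"
    proof (intro Q_sum cf)
      show "(\<lambda>\<phi>. \<Sum>j\<in>I. ?c m * ?f m j \<phi>) \<in> carrier T" for m
        unfolding carrier_tensor_algebra
        by (rule lspan_sum) (use cfT in \<open>simp add: carrier_tensor_algebra\<close>)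
    qed (use n cfT in auto)
    have sum_closed: "(\<lambda>\<phi>. \<Sum>m<card I. \<Sum>j\<in>I. ?c m * ?f m j \<phi>) \<in> carrier T"
      unfolding carrier_tensor_algebra
      by (intro lspan_sum) (use cfT in \<open>simp add: carrier_tensor_algebra\<close>)
    \<comment> \<open>The number of terms is the square of \<open>card I\<close> and each has weight
      \<open>Z / card I\<close>, so the total cost is a factor \<open>Z\<close> times
      \<open>card I\<close>; the factorial in E absorbs the latter.\<close>
    have "(\<Sum>m<card I. \<Sum>j\<in>I. Z / card I * (B * E r n)) = B * (card I * Z * E r n)"
    proof -
      have "card I \<noteq> 0" using n(2) by linarith
      then show ?thesis by simp
    qed
    also have "\<dots> \<le> B * (E r (Suc n) / 2)"
    proof (intro mult_left_mono B)
      have "real (card I) * (fact (n + r + 1) :: real) \<le> real (n + r + 2) * fact (n + r + 1)"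
        using n(2) by (intro mult_right_mono) auto
      also have "\<dots> = fact (n + r + 2)"
        by (simp add: algebra_simps)
      finally have f: "real (card I) * (fact (n + r + 1) :: real) \<le> fact (n + r + 2)" .
      have "card I * Z * E r n = Z ^ (n + r + 2) * 2 ^ (2 * r + n + 1) * (real (card I) * fact (n + r + 1))"
        by (simp add: E_def mult_ac del: fact_Suc)
      also have "\<dots> \<le> Z ^ (n + r + 2) * 2 ^ (2 * r + n + 1) * fact (n + r + 2)"
        using Z by (intro mult_left_mono f) simp
      also have "\<dots> = E r (Suc n) / 2" by (simp add: E_def)
      finally show "card I * Z * E r n \<le> E r (Suc n) / 2" .
    qed
    finally have "Q (\<lambda>\<phi>. tail_avg xs (insert l I) (\<eta>(l := \<zeta>)) \<phi> + (\<Sum>m<card I. \<Sum>j\<in>I. ?c m * ?f m j \<phi>))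
       (B * (E r (Suc n) / 2) + B * (E r (Suc n) / 2))"
      by (intro add tail_avg_closed sum_closed 1 mono[OF 2])
    then have "Q (\<lambda>\<phi>. tail_avg xs (insert l I) (\<eta>(l := \<zeta>)) \<phi> + (\<Sum>m<card I. \<Sum>j\<in>I. ?c m * ?f m j \<phi>))
       (B * E r (card I))"
      using n(2) by simp
    then show ?case
      by (rule cong[rotated 3])
        (use inner_avg_step[OF _ n(3,4) l] tensor_algebra_closed(1)[OF tail_avg_closed sum_closed] inner_avg_closed in auto)
  qed
  have main: "Q (inner_avg xs i I \<eta> \<zeta>) (B * E (length xs) (card I))"
    if "finite I" "i \<le> card I" "W (mset xs + add_mset \<zeta> (image_mset \<eta> (mset_set I)))" for xs i I \<eta> \<zeta>
    using that
  proof (induction xs arbitrary: i I \<eta> \<zeta> rule: rev_induct)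
    case Nil
    show ?case
    proof (rule inner)
      fix I :: "nat set" and \<eta> assume I: "finite I" "I \<noteq> {}" "W (mset [] + image_mset \<eta> (mset_set I))"
      have "mset (map \<eta> (sorted_list_of_set I)) = image_mset \<eta> (mset_set I)"
        using mset_set_set[of "sorted_list_of_set I"] I by simp
      then have "Q (tail_avg [] I \<eta>) (B * fact (card I))"
        using sym[of "map \<eta> (sorted_list_of_set I)"] I by (simp add: tail_avg_Nil)
      moreover have "fact (card I) \<le> E (length []) (card I - 1) / 2"
      proof -
        obtain k where k: "card I = Suc k" using I by (metis card_gt_0_iff gr0_conv_Suc)
        have "(1::real) \<le> Z ^ Suc k * 2 ^ k"
          using Z one_le_power[of Z "Suc k"] one_le_power[of "2::real" k] mult_mono[of 1 "Z ^ Suc k" 1 "2 ^ k"] by simp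
        then show ?thesis using mult_right_mono[of 1 "Z ^ Suc k * 2 ^ k" "fact (Suc k)"]
          by (simp add: E_def k del: fact_Suc power_Suc) (simp add: mult_ac)
      qed
      ultimately show "Q (tail_avg [] I \<eta>) (B * (E (length []) (card I - 1) / 2))"
        using B by (elim mono) (intro mult_left_mono)
    qed (use Nil in auto)
  next
    \<comment> \<open>The last prefix letter stands directly in front of the block and takes the
      role of \<zeta> at place 0.\<close>
    case (snoc x xs)
    show ?case
    proof (rule inner)
      fix I :: "nat set" and \<eta> assume I: "finite I" "I \<noteq> {}" "W (mset (xs @ [x]) + image_mset \<eta> (mset_set I))"
      obtain k where k: "card I = Suc k" using I by (metis card_gt_0_iff gr0_conv_Suc)
      have "Q (inner_avg xs 0 I \<eta> x) (B * E (length xs) (card I))"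
        using I by (intro snoc.IH) auto
      moreover have "E (length xs) (card I) = E (length (xs @ [x])) (card I - 1) / 2"
        by (simp add: E_def k)
      ultimately show "Q (tail_avg (xs @ [x]) I \<eta>) (B * (E (length (xs @ [x])) (card I - 1) / 2))"
        by (simp add: tail_avg_snoc)
    qed (use snoc.prems in auto)
  qed
  obtain ys y where xs: "xs = ys @ [y]" using ne by (metis rev_exhaust)
  have "Q (inner_avg ys 0 {} (\<lambda>_. 0) y) (B * E (length ys) (card ({} :: nat set)))"
    by (rule main) (use W xs in auto)
  moreover have "inner_avg ys 0 {} (\<lambda>_. 0) y = tensor M xs"
    by (simp add: inner_avg_def xs)
  moreover have "E (length ys) 0 \<le> (4 * Z) ^ length xs * fact (length xs)"
  proof -
    have "E (length ys) 0 * 2 = (4 * Z) ^ length xs * fact (length xs)"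
      by (simp add: E_def xs power_mult power_mult_distrib)
    moreover have "E (length ys) 0 \<ge> 0" using Z by (simp add: E_def)
    ultimately show ?thesis by linarith
  qed
  ultimately show ?thesis
    using B by (auto elim!: mono simp: mult.assoc intro!: mult_left_mono)
qed

end

section \<open>The enveloping algebra and its Hopf structure on words\<close>

declare tensor_algebra_simps(5) [simp del]
lemmas tensor_algebra_mult = tensor_algebra_simps(5)

lemma multilinear_form_eval:
  assumes t: "t \<in> carrier (tensor_algebra (vec_mod s))"
    and F: "\<And>xs. multilinear_form (vec_mod s) (F xs)" "\<And>ys. multilinear_form (vec_mod s) (\<lambda>xs. F xs ys)"
  shows "multilinear_form (vec_mod s) (\<lambda>xs. t (F xs))"
  using t unfolding carrier_tensor_algebra
proof (induction rule: lspan_induct)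
  case (add c x t)
  show ?case
    using multilinear_form_add[OF multilinear_form_scale[OF F(2)[of x], of c] add.IH] by (simp add: F(1))
qed simp

lemma tensor_fubini:
  assumes u: "u \<in> carrier (tensor_algebra (vec_mod s))" and t: "t \<in> carrier (tensor_algebra (vec_mod s))"
    and F: "\<And>xs. multilinear_form (vec_mod s) (F xs)" "\<And>ys. multilinear_form (vec_mod s) (\<lambda>xs. F xs ys)"
  shows "u (\<lambda>xs. t (\<lambda>ys. F xs ys)) = t (\<lambda>ys. u (\<lambda>xs. F xs ys))"
  using u unfolding carrier_tensor_algebra
proof (induction rule: lspan_induct)
  case zero
  then show ?case using tensor_algebra_eval_zero[OF t] by simp
next
  case (add c x u)
  have ml: "multilinear_form (vec_mod s) (\<lambda>xs. t (F xs))"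
    by (rule multilinear_form_eval[OF t F])
  have mlu: "multilinear_form (vec_mod s) (\<lambda>ys. u (\<lambda>xs. F xs ys))"
    using add.hyps by (intro multilinear_form_eval[OF _ F(2,1)]) (simp add: carrier_tensor_algebra)
  have "t (\<lambda>ys. c * tensor (vec_mod s) x (\<lambda>xs. F xs ys) + u (\<lambda>xs. F xs ys)) =
      t (\<lambda>ys. c * F x ys + u (\<lambda>xs. F xs ys))"
    by (simp add: F(2))
  also have "\<dots> = t (\<lambda>ys. c * F x ys) + t (\<lambda>ys. u (\<lambda>xs. F xs ys))"
    by (rule tensor_algebra_eval_add[OF t multilinear_form_scale[OF F(1)] mlu])
  also have "t (\<lambda>ys. c * F x ys) = c * t (F x)"
    by (rule tensor_algebra_eval_scale[OF t F(1)])
  finally show ?case using ml add.IH by simp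
qed

lemma multilinear_form_split_sum:
  assumes "\<And>a b. mset a + mset b = mset xs \<Longrightarrow> multilinear_form M (G a b)"
  shows "multilinear_form M (\<lambda>ys. split_sum xs (\<lambda>a b. G a b ys))"
  using assms
proof (induction xs arbitrary: G)
  case (Cons x xs)
  show ?case by (simp, intro multilinear_form_add Cons.IH Cons.prems) auto
qed simp

lemma tensor_eval_split_sum:
  assumes t: "t \<in> carrier (tensor_algebra M)" and "\<And>a b. multilinear_form M (G a b)"
  shows "t (\<lambda>ys. split_sum xs (\<lambda>a b. G a b ys)) = split_sum xs (\<lambda>a b. t (G a b))"
  using assms(2)
proof (induction xs arbitrary: G)
  case (Cons x xs)
  have "t (\<lambda>ys. split_sum xs (\<lambda>a b. G (x # a) b ys) + split_sum xs (\<lambda>a b. G a (x # b) ys)) =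
      t (\<lambda>ys. split_sum xs (\<lambda>a b. G (x # a) b ys)) + t (\<lambda>ys. split_sum xs (\<lambda>a b. G a (x # b) ys))"
    by (rule tensor_algebra_eval_add[OF t]) (intro multilinear_form_split_sum Cons.prems)+
  then show ?case using Cons.IH[of "\<lambda>a b. G (x # a) b"] Cons.IH[of "\<lambda>a b. G a (x # b)"] Cons.prems by simp
qed simp

text \<open>Bilinear functions enter as forms concentrated in length 2, which is the length
  evaluated by elements of a tensor square.\<close>

lemma multilinear_form_pair:
  fixes M :: "('k::field, 'a, 'm) module_scheme"
  assumes "\<And>x y v. x \<in> carrier M \<Longrightarrow> y \<in> carrier M \<Longrightarrow> v \<in> carrier M \<Longrightarrow> f (x \<oplus>\<^bsub>M\<^esub> y) v = f x v + f y v"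
    "\<And>c x v. x \<in> carrier M \<Longrightarrow> v \<in> carrier M \<Longrightarrow> f (c \<odot>\<^bsub>M\<^esub> x) v = c * f x v"
    "\<And>x y v. x \<in> carrier M \<Longrightarrow> y \<in> carrier M \<Longrightarrow> v \<in> carrier M \<Longrightarrow> f v (x \<oplus>\<^bsub>M\<^esub> y) = f v x + f v y"
    "\<And>c x v. x \<in> carrier M \<Longrightarrow> v \<in> carrier M \<Longrightarrow> f v (c \<odot>\<^bsub>M\<^esub> x) = c * f v x"
  shows "multilinear_form M (\<lambda>as. if length as = 2 then f (as ! 0) (as ! 1) else 0)"
proof (rule multilinear_formI)
  have len2: "length us + length vs = 1 \<longleftrightarrow> (us = [] \<and> (\<exists>v. vs = [v])) \<or> (vs = [] \<and> (\<exists>u. us = [u]))"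
    for us vs :: "'a list"
    by (cases us; cases vs) auto
  fix us vs x
  assume *: "set us \<subseteq> carrier M" "set vs \<subseteq> carrier M" "x \<in> carrier M"
  show "(if length (us @ (x \<oplus>\<^bsub>M\<^esub> y) # vs) = 2
        then f ((us @ (x \<oplus>\<^bsub>M\<^esub> y) # vs) ! 0) ((us @ (x \<oplus>\<^bsub>M\<^esub> y) # vs) ! 1) else 0) =
       (if length (us @ x # vs) = 2 then f ((us @ x # vs) ! 0) ((us @ x # vs) ! 1) else 0) +
       (if length (us @ y # vs) = 2 then f ((us @ y # vs) ! 0) ((us @ y # vs) ! 1) else 0)"
    if "y \<in> carrier M" for y
    using * that assms(1,3) len2[of us vs] by (cases "length us + length vs = 1") auto
  show "(if length (us @ (c \<odot>\<^bsub>M\<^esub> x) # vs) = 2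
        then f ((us @ (c \<odot>\<^bsub>M\<^esub> x) # vs) ! 0) ((us @ (c \<odot>\<^bsub>M\<^esub> x) # vs) ! 1) else 0) =
       c * (if length (us @ x # vs) = 2 then f ((us @ x # vs) ! 0) ((us @ x # vs) ! 1) else 0)" for c
    using * assms(2,4) len2[of us vs] by (cases "length us + length vs = 1") auto
qed

context lie_algebra
begin

section \<open>Classes in the enveloping algebra and their symmetric representatives\<close>

abbreviation "U \<equiv> uea M bracket z"
abbreviation "S \<equiv> symmetric_tensors M"
abbreviation "cl \<equiv> uea_class M bracket z"

lemma cl_def: "cl t = {\<lambda>\<phi>. h \<phi> + t \<phi> | h. h \<in> J}"
  by (auto simp: uea_class_def a_r_coset_def')

text \<open>By \<open>J_iff\<close> the exchange forms separate classes, so equality of cosets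
  becomes a matter of evaluation.\<close>

lemma cl_eq_iff:
  assumes "s \<in> carrier T" "t \<in> carrier T"
  shows "cl s = cl t \<longleftrightarrow> (\<forall>\<phi>. exchange \<phi> \<longrightarrow> s \<phi> = t \<phi>)"
proof
  assume "cl s = cl t"
  moreover have "s \<in> cl s" unfolding cl_def using J_zero by force
  ultimately obtain h where "h \<in> J" "s = (\<lambda>\<phi>. h \<phi> + t \<phi>)" by (auto simp: cl_def)
  then show "\<forall>\<phi>. exchange \<phi> \<longrightarrow> s \<phi> = t \<phi>" using J_vanishes by simp
next
  have sub: "cl s \<subseteq> cl t" if "s \<in> carrier T" "t \<in> carrier T" "\<forall>\<phi>. exchange \<phi> \<longrightarrow> s \<phi> = t \<phi>" for s t
  proof
    fix u assume "u \<in> cl s"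
    then obtain h where h: "h \<in> J" "u = (\<lambda>\<phi>. h \<phi> + s \<phi>)" by (auto simp: cl_def)
    have "(\<lambda>\<phi>. s \<phi> - t \<phi>) \<in> J"
      using that J_iff[OF tensor_algebra_closed(2)[OF that(1,2)]] by simp
    then have "(\<lambda>\<phi>. h \<phi> + (s \<phi> - t \<phi>)) \<in> J" using J_closed(1)[OF h(1)] by simp
    moreover have "u = (\<lambda>\<phi>. (h \<phi> + (s \<phi> - t \<phi>)) + t \<phi>)" by (simp add: h)
    ultimately show "u \<in> cl t"
      unfolding cl_def by (intro CollectI exI[of _ "\<lambda>\<phi>. h \<phi> + (s \<phi> - t \<phi>)"]) auto
  qed
  assume "\<forall>\<phi>. exchange \<phi> \<longrightarrow> s \<phi> = t \<phi>"
  then show "cl s = cl t" using sub[of s t] sub[of t s] assms by auto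
qed

lemma cl_ring_hom: "cl \<in> ring_hom T (T Quot J)"
  using ideal.rcos_ring_hom[OF J_ideal] by (simp add: uea_class_def[abs_def])

lemma uea_carrier: "carrier U = cl ` carrier T"
  by (auto simp: uea_def Let_def FactRing_def A_RCOSETS_def' uea_class_def)

lemma cl_closed [simp]: "t \<in> carrier T \<Longrightarrow> cl t \<in> carrier U"
  by (auto simp: uea_carrier)

lemma cl_add: "s \<in> carrier T \<Longrightarrow> t \<in> carrier T \<Longrightarrow> cl s \<oplus>\<^bsub>U\<^esub> cl t = cl (\<lambda>\<phi>. s \<phi> + t \<phi>)"
  using ring_hom_memE(3)[OF cl_ring_hom, of s t] by (simp add: uea_def Let_def)

lemma cl_mult: "s \<in> carrier T \<Longrightarrow> t \<in> carrier T \<Longrightarrow> cl s \<otimes>\<^bsub>U\<^esub> cl t = cl (s \<otimes>\<^bsub>T\<^esub> t)"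
  using ring_hom_memE(2)[OF cl_ring_hom, of s t] by (simp add: uea_def Let_def)

lemma cl_one: "cl (tensor M []) = \<one>\<^bsub>U\<^esub>"
  using ring_hom_memE(4)[OF cl_ring_hom] by (simp add: uea_def Let_def)

lemma cl_scale: "t \<in> carrier T \<Longrightarrow> c \<odot>\<^bsub>U\<^esub> cl t = cl (\<lambda>\<phi>. c * t \<phi>)"
proof -
  assume t: "t \<in> carrier T"
  have c: "(\<lambda>\<phi>. c * tensor M [] \<phi>) \<in> carrier T"
    by (intro tensor_algebra_closed tensor_in_carrier)
  have "(\<lambda>\<phi>. c * tensor M [] \<phi>) \<otimes>\<^bsub>T\<^esub> t = (\<lambda>\<phi>. c * t \<phi>)"
    using multilinear_form_inner[OF t] tensor_algebra_not_multilinear[OF t]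
    by (auto simp: fun_eq_iff tensor_algebra_mult)
  moreover have "c \<odot>\<^bsub>U\<^esub> cl t = cl (\<lambda>\<phi>. c * tensor M [] \<phi>) \<otimes>\<^bsub>U\<^esub> cl t"
    by (simp add: uea_def Let_def)
  ultimately show ?thesis using cl_mult[OF c t] by simp
qed

lemma sym_prod_closed [simp]: "sym_prod M xs \<in> carrier T"
proof -
  have "sym_prod M xs = (\<lambda>\<phi>. (1 / fact (length xs)) * (\<Sum>\<sigma> | \<sigma> permutes {..<length xs}. tensor M (permute_list \<sigma> xs) \<phi>))"
    by (simp add: sym_prod_def)
  also have "\<dots> \<in> carrier T"
    unfolding carrier_tensor_algebra by (intro lspan_scale lspan_sum lspan_base) auto
  finally show ?thesis .
qed

lemma S_subset: "f \<in> carrier S \<Longrightarrow> f \<in> carrier T"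
  unfolding carrier_symmetric_tensors
proof (induction rule: lspan_induct)
  case (add c x t)
  then show ?case by (intro tensor_algebra_closed sym_prod_closed)
qed simp

lemma S_closed:
  assumes "f \<in> carrier S"
  shows "g \<in> carrier S \<Longrightarrow> (\<lambda>\<phi>. f \<phi> + g \<phi>) \<in> carrier S" "(\<lambda>\<phi>. c * f \<phi>) \<in> carrier S"
  using assms by (simp_all add: carrier_symmetric_tensors lspan_add lspan_scale)

lemma sym_prod_S [simp]: "sym_prod M xs \<in> carrier S"
  unfolding carrier_symmetric_tensors by (rule lspan_base) simp

text \<open>Surjectivity of the quantization map. Every rewriting step of
  \<open>tensor_bound_induct\<close> is an identity modulo the ideal, so the predicate
  \<open>Q\<close> may just assert congruence to some symmetric tensor.\<close>

lemma S_spans: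
  assumes "t \<in> carrier T"
  shows "\<exists>f\<in>carrier S. \<forall>\<phi>. exchange \<phi> \<longrightarrow> t \<phi> = f \<phi>"
proof -
  have word: "\<exists>f\<in>carrier S. \<forall>\<phi>. exchange \<phi> \<longrightarrow> tensor M xs \<phi> = f \<phi>" for xs
  proof (cases "xs = []")
    case True
    have "tensor M [] \<phi> = sym_prod M [] \<phi>" for \<phi>
      using sum_permute_list[of "[]" "\<lambda>xs. tensor M xs \<phi>"] by (simp add: sym_prod_def)
    then show ?thesis using sym_prod_S[of "[]"] True by auto
  next
    case False
    show ?thesis
    proof (rule tensor_bound_induct[where Q = "\<lambda>t b. \<exists>f\<in>carrier S. \<forall>\<phi>. exchange \<phi> \<longrightarrow> t \<phi> = f \<phi>"
          and W = "\<lambda>_. True" and B = 0 and Z = "max 1 (norm z)"])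
      show "\<exists>f\<in>carrier S. \<forall>\<phi>. exchange \<phi> \<longrightarrow> s \<phi> + t \<phi> = f \<phi>"
        if "\<exists>f\<in>carrier S. \<forall>\<phi>. exchange \<phi> \<longrightarrow> s \<phi> = f \<phi>" "\<exists>f\<in>carrier S. \<forall>\<phi>. exchange \<phi> \<longrightarrow> t \<phi> = f \<phi>" for s t
        using that S_closed(1) by (metis (no_types, lifting))
      show "\<exists>f\<in>carrier S. \<forall>\<phi>. exchange \<phi> \<longrightarrow> c * s \<phi> = f \<phi>"
        if "\<exists>f\<in>carrier S. \<forall>\<phi>. exchange \<phi> \<longrightarrow> s \<phi> = f \<phi>" for s c
        using that S_closed(2) by (metis (no_types, lifting))
      show "\<exists>f\<in>carrier S. \<forall>\<phi>. exchange \<phi> \<longrightarrow> 0 = f \<phi>"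
        by (rule bexI[of _ "\<lambda>\<phi>. 0"]) (auto simp: carrier_symmetric_tensors)
      show "\<exists>f\<in>carrier S. \<forall>\<phi>. exchange \<phi> \<longrightarrow> sym_prod M ws \<phi> = f \<phi>" for ws
        by (rule bexI[of _ "sym_prod M ws"]) auto
    qed (use False in auto)
  qed
  show ?thesis
    using assms unfolding carrier_tensor_algebra
  proof (induction rule: lspan_induct)
    case zero
    then show ?case by (intro bexI[of _ "\<lambda>\<phi>. 0"]) (auto simp: carrier_symmetric_tensors)
  next
    case (add c x t)
    obtain f g where "f \<in> carrier S" "\<And>\<phi>. exchange \<phi> \<Longrightarrow> tensor M x \<phi> = f \<phi>"
        "g \<in> carrier S" "\<And>\<phi>. exchange \<phi> \<Longrightarrow> t \<phi> = g \<phi>"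
      using word[of x] add.IH by blast
    then show ?case
      by (intro bexI[of _ "\<lambda>\<phi>. c * f \<phi> + g \<phi>"]) (auto intro: S_closed)
  qed
qed

text \<open>Injectivity of the quantization map: by \<open>exchange_extension\<close>, a form that
  separates f from g may be replaced by an exchange form with the same values on symmetric
  tensors.\<close>

lemma S_separated:
  assumes "f \<in> carrier S" "g \<in> carrier S" "\<And>\<phi>. exchange \<phi> \<Longrightarrow> f \<phi> = g \<phi>"
  shows "f = g"
proof (rule tensor_algebra_eqI[OF S_subset S_subset])
  fix \<psi> assume "multilinear_form M \<psi>"
  then obtain \<phi> where "exchange \<phi>" "\<And>f. f \<in> carrier S \<Longrightarrow> f \<phi> = f \<psi>"
    using exchange_extension by blast
  then show "f \<psi> = g \<psi>" using assms by metis
qed (use assms in auto)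

text \<open>The normal form of a tensor modulo the ideal. By \<open>sym_rep_unique\<close> it is
  recognized from its values at exchange forms.\<close>

definition sym_rep :: "('k, 'g) tensor \<Rightarrow> ('k, 'g) tensor" where
  "sym_rep t = gutt_q_inv M bracket z (cl t)"

lemma q_image: "t \<in> carrier T \<Longrightarrow> cl t \<in> gutt_q M bracket z ` carrier S"
  using S_spans[of t] S_subset cl_eq_iff by (auto simp: gutt_q_def image_iff Bex_def)

lemma sym_rep_S [simp]: "t \<in> carrier T \<Longrightarrow> sym_rep t \<in> carrier S"
  unfolding sym_rep_def gutt_q_inv_def by (rule inv_into_into[OF q_image])

lemma cl_sym_rep: "t \<in> carrier T \<Longrightarrow> cl (sym_rep t) = cl t"
  using f_inv_into_f[OF q_image, of t] by (simp add: sym_rep_def gutt_q_inv_def gutt_q_def)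

lemma sym_rep_eval: "t \<in> carrier T \<Longrightarrow> exchange \<phi> \<Longrightarrow> sym_rep t \<phi> = t \<phi>"
  using cl_sym_rep[of t] cl_eq_iff[of "sym_rep t" t] S_subset[of "sym_rep t"] by auto

lemma sym_rep_unique:
  "t \<in> carrier T \<Longrightarrow> f \<in> carrier S \<Longrightarrow> (\<And>\<phi>. exchange \<phi> \<Longrightarrow> f \<phi> = t \<phi>) \<Longrightarrow> sym_rep t = f"
  by (rule S_separated) (auto simp: sym_rep_eval)

lemma sym_rep_id: "f \<in> carrier S \<Longrightarrow> sym_rep f = f"
  by (rule sym_rep_unique) (auto intro: S_subset)

lemma sym_rep_cong:
  "s \<in> carrier T \<Longrightarrow> t \<in> carrier T \<Longrightarrow> (\<And>\<phi>. exchange \<phi> \<Longrightarrow> s \<phi> = t \<phi>) \<Longrightarrow> sym_rep s = sym_rep t"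
  by (rule sym_rep_unique) (auto simp: sym_rep_eval)

lemma sym_rep_add:
  "s \<in> carrier T \<Longrightarrow> t \<in> carrier T \<Longrightarrow> sym_rep (\<lambda>\<phi>. s \<phi> + t \<phi>) = (\<lambda>\<phi>. sym_rep s \<phi> + sym_rep t \<phi>)"
  by (rule sym_rep_unique) (auto simp: sym_rep_eval intro: S_closed tensor_algebra_closed)

lemma sym_rep_scale: "t \<in> carrier T \<Longrightarrow> sym_rep (\<lambda>\<phi>. c * t \<phi>) = (\<lambda>\<phi>. c * sym_rep t \<phi>)"
  by (rule sym_rep_unique) (auto simp: sym_rep_eval intro: S_closed tensor_algebra_closed)

lemma gutt_star_eq:
  "f \<in> carrier S \<Longrightarrow> g \<in> carrier S \<Longrightarrow> gutt_star M bracket z f g = sym_rep (f \<otimes>\<^bsub>T\<^esub> g)"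
  unfolding gutt_star_def sym_rep_def gutt_q_def by (subst cl_mult) (auto intro: S_subset)

lemma gutt_unit_eq: "gutt_unit M bracket z = sym_rep (tensor M [])"
  by (simp add: gutt_unit_def sym_rep_def cl_one)

lemma tensor_append: "tensor M (xs @ ys) = tensor M xs \<otimes>\<^bsub>T\<^esub> tensor M ys"
proof
  fix \<phi> show "tensor M (xs @ ys) \<phi> = (tensor M xs \<otimes>\<^bsub>T\<^esub> tensor M ys) \<phi>"
    using tensor_mult[of scaleV \<phi> xs ys]
    by (cases "multilinear_form M \<phi>") (simp_all add: tensor_algebra_mult, simp add: tensor_def)
qed

text \<open>The enveloping algebra is generated by the classes of single letters.\<close>

lemma algebra_hom_on_words:
  assumes f: "algebra_hom U B f" and g: "algebra_hom U B g"
    and gen: "\<And>x. f (cl (tensor M [x])) = g (cl (tensor M [x]))" and t: "t \<in> carrier T"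
  shows "f (cl t) = g (cl t)"
proof -
  have hom: "h (cl (\<lambda>\<phi>. s \<phi> + t \<phi>)) = h (cl s) \<oplus>\<^bsub>B\<^esub> h (cl t)" "h (cl (s \<otimes>\<^bsub>T\<^esub> t)) = h (cl s) \<otimes>\<^bsub>B\<^esub> h (cl t)"
    "h (cl (\<lambda>\<phi>. c * t \<phi>)) = c \<odot>\<^bsub>B\<^esub> h (cl t)" "h (cl (tensor M [])) = \<one>\<^bsub>B\<^esub>"
    if h: "algebra_hom U B h" and "s \<in> carrier T" "t \<in> carrier T" for h s t c
    using that ring_hom_memE[of h U B]
    by (auto simp: algebra_hom_def cl_add[symmetric] cl_mult[symmetric] cl_scale[symmetric] cl_one)
  have words: "f (cl (tensor M xs)) = g (cl (tensor M xs))" for xs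
  proof (induction xs)
    case Nil
    show ?case using hom(4)[OF f, of "tensor M []" "tensor M []"] hom(4)[OF g, of "tensor M []" "tensor M []"] by simp
  next
    case (Cons x xs)
    have "tensor M (x # xs) = tensor M [x] \<otimes>\<^bsub>T\<^esub> tensor M xs"
      by (rule tensor_append[of "[x]" xs, simplified])
    then show ?case
      using hom(2)[OF f, of "tensor M [x]" "tensor M xs"] hom(2)[OF g, of "tensor M [x]" "tensor M xs"]
        gen[of x] Cons.IH by simp
  qed
  show ?thesis
    using t unfolding carrier_tensor_algebra
  proof (induction rule: lspan_induct)
    case zero
    show ?case
      using hom(3)[OF f, of "tensor M []" "tensor M []" 0] hom(3)[OF g, of "tensor M []" "tensor M []" 0] words[of "[]"]
      by simp
  next
    case (add c x t)
    have "t \<in> carrier T" using add.hyps by (simp add: carrier_tensor_algebra)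
    then show ?case
      using hom(1)[OF f, of "\<lambda>\<phi>. c * tensor M x \<phi>" t] hom(1)[OF g, of "\<lambda>\<phi>. c * tensor M x \<phi>" t]
        hom(3)[OF f, of t "tensor M x" c] hom(3)[OF g, of t "tensor M x" c] words[of x] add.IH
        tensor_algebra_closed(3)[OF tensor_in_carrier, of c scaleV x]
      by simp
  qed
qed

text \<open>A multiplicative linear map on tensors that depends only on the class descends to the
  enveloping algebra, and being determined by its values on letters it is the map selected by
  \<open>THE\<close>. Coproduct, counit and antipode are all computed from this, with
  \<open>D\<close> explicit on words.\<close>

lemma the_algebra_hom:
  assumes closed: "\<And>t. t \<in> carrier T \<Longrightarrow> D t \<in> carrier B"
    and add: "\<And>s t. s \<in> carrier T \<Longrightarrow> t \<in> carrier T \<Longrightarrow> D (\<lambda>\<phi>. s \<phi> + t \<phi>) = D s \<oplus>\<^bsub>B\<^esub> D t"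
    and scale: "\<And>c t. t \<in> carrier T \<Longrightarrow> D (\<lambda>\<phi>. c * t \<phi>) = c \<odot>\<^bsub>B\<^esub> D t"
    and mult: "\<And>s t. s \<in> carrier T \<Longrightarrow> t \<in> carrier T \<Longrightarrow> D (s \<otimes>\<^bsub>T\<^esub> t) = D s \<otimes>\<^bsub>B\<^esub> D t"
    and one: "D (tensor M []) = \<one>\<^bsub>B\<^esub>"
    and cong: "\<And>s t. s \<in> carrier T \<Longrightarrow> t \<in> carrier T \<Longrightarrow> (\<And>\<phi>. exchange \<phi> \<Longrightarrow> s \<phi> = t \<phi>) \<Longrightarrow> D s = D t"
    and gen: "\<And>x. D (tensor M [x]) = d x"
    and t: "t \<in> carrier T"
  shows "(THE h. h \<in> extensional (carrier U) \<and> algebra_hom U B h \<and> (\<forall>x\<in>carrier M. h (cl (tensor M [x])) = d x)) (cl t) = D t"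
proof -
  define h where "h = restrict (\<lambda>u. D (SOME t. t \<in> carrier T \<and> cl t = u)) (carrier U)"
  have h: "h (cl t) = D t" if "t \<in> carrier T" for t
  proof -
    have "\<exists>s. s \<in> carrier T \<and> cl s = cl t" using that by blast
    then have "(SOME s. s \<in> carrier T \<and> cl s = cl t) \<in> carrier T \<and> cl (SOME s. s \<in> carrier T \<and> cl s = cl t) = cl t"
      by (rule someI_ex)
    then have "D (SOME s. s \<in> carrier T \<and> cl s = cl t) = D t"
      using that cl_eq_iff by (intro cong) auto
    then show ?thesis using that by (simp add: h_def)
  qed
  have hom: "algebra_hom U B h"
    unfolding algebra_hom_def
  proof (intro conjI ballI allI ring_hom_memI)
    show "h \<one>\<^bsub>U\<^esub> = \<one>\<^bsub>B\<^esub>" by (simp add: cl_one[symmetric] h one)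
  qed (auto simp: uea_carrier cl_add cl_mult cl_scale h closed add mult scale
      tensor_algebra_closed(1,3) tensor_algebra_mult_closed)
  have "(THE h. h \<in> extensional (carrier U) \<and> algebra_hom U B h \<and> (\<forall>x\<in>carrier M. h (cl (tensor M [x])) = d x)) = h"
  proof (rule the_equality)
    show "h \<in> extensional (carrier U) \<and> algebra_hom U B h \<and> (\<forall>x\<in>carrier M. h (cl (tensor M [x])) = d x)"
      using hom h gen by (auto simp: h_def)
  next
    fix g assume g: "g \<in> extensional (carrier U) \<and> algebra_hom U B g \<and> (\<forall>x\<in>carrier M. g (cl (tensor M [x])) = d x)"
    show "g = h"
    proof (rule extensionalityI[of _ "carrier U"])
      fix u assume "u \<in> carrier U"
      then obtain t where "t \<in> carrier T" "u = cl t" by (auto simp: uea_carrier)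
      then show "g u = h u"
        using algebra_hom_on_words[OF _ hom, of g t] g h gen by simp
    qed (use g in \<open>auto simp: h_def\<close>)
  qed
  then show ?thesis using h t by simp
qed

end

lemma multilinear_form_map:
  assumes "multilinear_form B \<psi>" "g ` carrier A \<subseteq> carrier B"
    "\<And>x y. x \<in> carrier A \<Longrightarrow> y \<in> carrier A \<Longrightarrow> g (x \<oplus>\<^bsub>A\<^esub> y) = g x \<oplus>\<^bsub>B\<^esub> g y"
    "\<And>c x. x \<in> carrier A \<Longrightarrow> g (c \<odot>\<^bsub>A\<^esub> x) = c \<odot>\<^bsub>B\<^esub> g x"
  shows "multilinear_form A (\<lambda>us. \<psi> (map g us))"
proof (rule multilinear_formI)
  fix us vs x assume *: "set us \<subseteq> carrier A" "set vs \<subseteq> carrier A" "x \<in> carrier A"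
  then have **: "set (map g us) \<subseteq> carrier B" "set (map g vs) \<subseteq> carrier B" "g x \<in> carrier B"
    using assms(2) by auto
  show "\<psi> (map g (us @ (x \<oplus>\<^bsub>A\<^esub> y) # vs)) = \<psi> (map g (us @ x # vs)) + \<psi> (map g (us @ y # vs))"
    if "y \<in> carrier A" for y
    using multilinear_formD(1)[OF assms(1) **, of "g y"] that assms(2,3) * by auto
  show "\<psi> (map g (us @ (c \<odot>\<^bsub>A\<^esub> x) # vs)) = c * \<psi> (map g (us @ x # vs))" for c
    using multilinear_formD(2)[OF assms(1) **] assms(4) * by auto
qed

context lie_algebra
begin

section \<open>The coproduct on words\<close>

definition multilinear_map :: "('k, 'a, 'm) module_scheme \<Rightarrow> ('g list \<Rightarrow> 'a) \<Rightarrow> bool" where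
  "multilinear_map A f \<longleftrightarrow> (\<forall>xs. f xs \<in> carrier A) \<and>
     (\<forall>us vs x y. f (us @ (x + y) # vs) = f (us @ x # vs) \<oplus>\<^bsub>A\<^esub> f (us @ y # vs)) \<and>
     (\<forall>us vs c x. f (us @ scaleV c x # vs) = c \<odot>\<^bsub>A\<^esub> f (us @ x # vs))"

lemma multilinear_map_form:
  assumes "multilinear_map A f" "multilinear_form A \<psi>" "v \<in> carrier A"
  shows "multilinear_form M (\<lambda>a. \<psi> [f a, v])" "multilinear_form M (\<lambda>b. \<psi> [v, f b])"
  using assms(1) multilinear_formD[OF assms(2), of "[]" "[v]"] multilinear_formD[OF assms(2), of "[v]" "[]"] assms(3)
  by (auto simp: multilinear_form_vec_mod multilinear_map_def)

lemma multilinear_split_sum: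
  assumes "\<And>a. multilinear_form M (\<lambda>b. E a b)" "\<And>b. multilinear_form M (\<lambda>a. E a b)"
  shows "multilinear_form M (\<lambda>xs. split_sum xs E)"
proof -
  have 1: "slot_linear (\<lambda>x. split_sum xs (E x))" if "\<And>a b. slot_linear (\<lambda>x. E x a b)" for xs and E :: "'g \<Rightarrow> 'g list \<Rightarrow> 'g list \<Rightarrow> 'k"
    using that
  proof (induction xs arbitrary: E)
    case (Cons x xs)
    show ?case by (simp, intro slot_linear_add Cons.IH Cons.prems)
  qed simp
  show ?thesis
    unfolding multilinear_iff_slot split_sum_append
  proof (intro allI 1)
    fix us vs a b
    show "slot_linear (\<lambda>x. split_sum (x # vs) (\<lambda>c d. E (a @ c) (b @ d)))"
      unfolding split_sum.simps
      by (intro slot_linear_add 1) (use assms in \<open>simp_all add: multilinear_iff_slot\<close>)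
  qed
qed

text \<open>Letters are primitive. In the difference of the two words, the splittings that separate
  x from y cancel in pairs; in the others both letters lie in the same part, where the relation for
  that argument applies. This makes the coproduct well defined modulo the ideal.\<close>

lemma exchange_split_sum:
  assumes "\<And>a. exchange (\<lambda>b. E a b)" "\<And>b. exchange (\<lambda>a. E a b)"
  shows "exchange (\<lambda>xs. split_sum xs E)"
  unfolding exchange_def
proof (intro conjI allI)
  show "multilinear_form M (\<lambda>xs. split_sum xs E)"
    by (rule multilinear_split_sum) (use assms exchange_multilinear in auto)
  fix us x y vs
  have diff: "split_sum xs F - split_sum xs G = split_sum xs (\<lambda>a b. F a b - G a b)" for xs and F G :: "'g list \<Rightarrow> 'g list \<Rightarrow> 'k"
    using split_sum_add[of xs "\<lambda>a b. F a b - G a b" G] by simp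
  have eq: "E (a @ x # y # c) b - E (a @ y # x # c) b = z * E (a @ bracket x y # c) b"
    "E a (b @ x # y # d) - E a (b @ y # x # d) = z * E a (b @ bracket x y # d)" for a b c d
    using exchangeD[OF assms(2)] exchangeD[OF assms(1)] by blast+
  have "split_sum (x # y # vs) (\<lambda>c d. E (a @ c) (b @ d)) - split_sum (y # x # vs) (\<lambda>c d. E (a @ c) (b @ d)) =
     z * split_sum (bracket x y # vs) (\<lambda>c d. E (a @ c) (b @ d))" for a b
  proof -
    have "split_sum (x # y # vs) (\<lambda>c d. E (a @ c) (b @ d)) - split_sum (y # x # vs) (\<lambda>c d. E (a @ c) (b @ d)) =
       (split_sum vs (\<lambda>c d. E (a @ x # y # c) (b @ d)) - split_sum vs (\<lambda>c d. E (a @ y # x # c) (b @ d))) +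
       (split_sum vs (\<lambda>c d. E (a @ c) (b @ x # y # d)) - split_sum vs (\<lambda>c d. E (a @ c) (b @ y # x # d)))"
      by simp
    also have "\<dots> = split_sum vs (\<lambda>c d. z * E (a @ bracket x y # c) (b @ d)) +
        split_sum vs (\<lambda>c d. z * E (a @ c) (b @ bracket x y # d))"
      unfolding diff eq ..
    also have "\<dots> = z * split_sum (bracket x y # vs) (\<lambda>c d. E (a @ c) (b @ d))"
      using split_sum_hom[of "\<lambda>w. z * w" vs] by (simp add: distrib_left)
    finally show ?thesis .
  qed
  then show "split_sum (us @ x # y # vs) E - split_sum (us @ y # x # vs) E = z * split_sum (us @ bracket x y # vs) E"
    using split_sum_hom[of "\<lambda>w. z * w" us] unfolding split_sum_append diff by (simp add: distrib_left)
qed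

text \<open>The unshuffle coproduct, followed by \<open>f\<close> on both parts. The target is a
  parameter since the formula is needed in the tensor squares of the enveloping algebra, of the
  symmetric tensors and of the completion.\<close>

definition cop :: "('k, 'a, 'm) module_scheme \<Rightarrow> ('g list \<Rightarrow> 'a) \<Rightarrow> ('k, 'g) tensor \<Rightarrow> ('k, 'a) tensor" where
  "cop A f t = (\<lambda>\<psi>. if multilinear_form A \<psi> then t (\<lambda>xs. split_sum xs (\<lambda>a b. \<psi> [f a, f b])) else 0)"

lemma cop_form:
  assumes "multilinear_map A f" "multilinear_form A \<psi>"
  shows "multilinear_form M (\<lambda>xs. split_sum xs (\<lambda>a b. \<psi> [f a, f b]))"
  by (rule multilinear_split_sum) (use multilinear_map_form[OF assms] assms(1) in \<open>auto simp: multilinear_map_def\<close>)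

lemma cop_tensor:
  assumes "multilinear_map A f"
  shows "cop A f (tensor M xs) = (\<lambda>\<psi>. split_sum xs (\<lambda>a b. tensor A [f a, f b] \<psi>))"
  using cop_form[OF assms] by (auto simp: cop_def fun_eq_iff tensor_def)

lemma cop_closed:
  assumes f: "multilinear_map A f" and t: "t \<in> carrier T"
  shows "cop A f t \<in> carrier (tensor_power A 2)"
  using t unfolding carrier_tensor_algebra
proof (induction rule: lspan_induct)
  case zero
  show ?case by (simp add: cop_def carrier_tensor_power)
next
  case (add c x t)
  have "cop A f (\<lambda>\<phi>. c * tensor M x \<phi> + t \<phi>) = (\<lambda>\<psi>. c * cop A f (tensor M x) \<psi> + cop A f t \<psi>)"
    by (auto simp: cop_def fun_eq_iff)
  moreover have "cop A f (tensor M x) \<in> carrier (tensor_power A 2)"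
    unfolding cop_tensor[OF f] carrier_tensor_power
    by (intro lspan_split_sum lspan_base) (use f in \<open>auto simp: multilinear_map_def\<close>)
  ultimately show ?case
    using add.IH by (auto simp: carrier_tensor_power intro: lspan_add lspan_scale)
qed

lemma tensor_map_cop:
  assumes f: "multilinear_map A f" and t: "t \<in> carrier T" and g: "g ` carrier A \<subseteq> carrier B"
    "\<And>x y. x \<in> carrier A \<Longrightarrow> y \<in> carrier A \<Longrightarrow> g (x \<oplus>\<^bsub>A\<^esub> y) = g x \<oplus>\<^bsub>B\<^esub> g y"
    "\<And>c x. x \<in> carrier A \<Longrightarrow> g (c \<odot>\<^bsub>A\<^esub> x) = c \<odot>\<^bsub>B\<^esub> g x"
  shows "tensor_map B g (cop A f t) = cop B (\<lambda>xs. g (f xs)) t"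
  using multilinear_form_map[OF _ g] by (auto simp: tensor_map_def cop_def fun_eq_iff)

definition iota :: "'g list \<Rightarrow> ('k, 'g) tensor set" where
  "iota xs = cl (tensor M xs)"

definition rep :: "'g list \<Rightarrow> ('k, 'g) tensor" where
  "rep xs = sym_rep (tensor M xs)"

lemma tensor_slot:
  "tensor M (us @ (x + y) # vs) = (\<lambda>\<phi>. tensor M (us @ x # vs) \<phi> + tensor M (us @ y # vs) \<phi>)"
  "tensor M (us @ scaleV c x # vs) = (\<lambda>\<phi>. c * tensor M (us @ x # vs) \<phi>)"
  by (auto simp: tensor_def multilinear_form_vec_mod fun_eq_iff)

lemma multilinear_iota: "multilinear_map U iota"
  by (simp add: multilinear_map_def iota_def tensor_slot cl_add cl_scale)

lemma multilinear_rep: "multilinear_map S rep"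
  by (simp add: multilinear_map_def rep_def tensor_slot sym_rep_add sym_rep_scale)

lemma iota_append: "iota (xs @ ys) = iota xs \<otimes>\<^bsub>U\<^esub> iota ys"
  by (simp add: iota_def tensor_append cl_mult)

lemma iota_exchange: "iota (us @ x # y # vs) = iota (us @ y # x # vs) \<oplus>\<^bsub>U\<^esub> z \<odot>\<^bsub>U\<^esub> iota (us @ bracket x y # vs)"
proof -
  have "cl (tensor M (us @ x # y # vs)) =
      cl (\<lambda>\<phi>. tensor M (us @ y # x # vs) \<phi> + z * tensor M (us @ bracket x y # vs) \<phi>)"
    by (subst cl_eq_iff)
      (auto intro!: tensor_algebra_closed simp: exchange_multilinear exchangeD[symmetric])
  then show ?thesis
    by (simp add: iota_def cl_add cl_scale tensor_algebra_closed)
qed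

lemma uea_add_closed: "u \<in> carrier U \<Longrightarrow> v \<in> carrier U \<Longrightarrow> u \<oplus>\<^bsub>U\<^esub> v \<in> carrier U"
  and uea_mult_closed: "u \<in> carrier U \<Longrightarrow> v \<in> carrier U \<Longrightarrow> u \<otimes>\<^bsub>U\<^esub> v \<in> carrier U"
  and uea_scale_closed: "u \<in> carrier U \<Longrightarrow> c \<odot>\<^bsub>U\<^esub> u \<in> carrier U"
  by (auto simp: uea_carrier cl_add cl_mult cl_scale intro!: imageI tensor_algebra_closed tensor_algebra_mult_closed)

lemma uea_distrib:
  assumes "u \<in> carrier U" "v \<in> carrier U" "w \<in> carrier U"
  shows "(u \<oplus>\<^bsub>U\<^esub> v) \<otimes>\<^bsub>U\<^esub> w = u \<otimes>\<^bsub>U\<^esub> w \<oplus>\<^bsub>U\<^esub> v \<otimes>\<^bsub>U\<^esub> w" "w \<otimes>\<^bsub>U\<^esub> (u \<oplus>\<^bsub>U\<^esub> v) = w \<otimes>\<^bsub>U\<^esub> u \<oplus>\<^bsub>U\<^esub> w \<otimes>\<^bsub>U\<^esub> v"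
proof -
  have "ring (T Quot J)" by (rule ideal.quotient_is_ring[OF J_ideal])
  from ring.ring_simprules(13,23)[OF this] assms
  show "(u \<oplus>\<^bsub>U\<^esub> v) \<otimes>\<^bsub>U\<^esub> w = u \<otimes>\<^bsub>U\<^esub> w \<oplus>\<^bsub>U\<^esub> v \<otimes>\<^bsub>U\<^esub> w" "w \<otimes>\<^bsub>U\<^esub> (u \<oplus>\<^bsub>U\<^esub> v) = w \<otimes>\<^bsub>U\<^esub> u \<oplus>\<^bsub>U\<^esub> w \<otimes>\<^bsub>U\<^esub> v"
    by (simp_all add: uea_def Let_def)
qed

lemma uea_scale_mult:
  assumes "u \<in> carrier U" "v \<in> carrier U"
  shows "(c \<odot>\<^bsub>U\<^esub> u) \<otimes>\<^bsub>U\<^esub> v = c \<odot>\<^bsub>U\<^esub> (u \<otimes>\<^bsub>U\<^esub> v)" "u \<otimes>\<^bsub>U\<^esub> (c \<odot>\<^bsub>U\<^esub> v) = c \<odot>\<^bsub>U\<^esub> (u \<otimes>\<^bsub>U\<^esub> v)"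
proof -
  obtain s t where st: "s \<in> carrier T" "t \<in> carrier T" "u = cl s" "v = cl t"
    using assms by (auto simp: uea_carrier)
  have 1: "(\<lambda>\<phi>. c * s \<phi>) \<otimes>\<^bsub>T\<^esub> t = (\<lambda>\<phi>. c * (s \<otimes>\<^bsub>T\<^esub> t) \<phi>)"
    by (auto simp: tensor_algebra_mult fun_eq_iff)
  have 2: "s \<otimes>\<^bsub>T\<^esub> (\<lambda>\<phi>. c * t \<phi>) = (\<lambda>\<phi>. c * (s \<otimes>\<^bsub>T\<^esub> t) \<phi>)"
    by (auto simp: tensor_algebra_mult fun_eq_iff tensor_algebra_eval_scale[OF st(1) multilinear_form_inner[OF st(2)]])
  show "(c \<odot>\<^bsub>U\<^esub> u) \<otimes>\<^bsub>U\<^esub> v = c \<odot>\<^bsub>U\<^esub> (u \<otimes>\<^bsub>U\<^esub> v)" "u \<otimes>\<^bsub>U\<^esub> (c \<odot>\<^bsub>U\<^esub> v) = c \<odot>\<^bsub>U\<^esub> (u \<otimes>\<^bsub>U\<^esub> v)"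
    using st by (simp_all add: cl_scale cl_mult tensor_algebra_closed(3) tensor_algebra_mult_closed 1 2)
qed

lemma exchange_iota:
  assumes "multilinear_form U \<psi>" "v \<in> carrier U"
  shows "exchange (\<lambda>a. \<psi> [iota a, v])" "exchange (\<lambda>b. \<psi> [v, iota b])"
proof -
  have c: "iota xs \<in> carrier U" for xs by (simp add: iota_def)
  show "exchange (\<lambda>a. \<psi> [iota a, v])"
    unfolding exchange_def
  proof (intro conjI allI)
    show "multilinear_form M (\<lambda>a. \<psi> [iota a, v])"
      by (rule multilinear_map_form(1)[OF multilinear_iota assms])
    show "\<psi> [iota (us @ x # y # vs), v] - \<psi> [iota (us @ y # x # vs), v] = z * \<psi> [iota (us @ bracket x y # vs), v]"
      for us x y vs
      using multilinear_formD(1)[OF assms(1), of "[]" "[v]" "iota (us @ y # x # vs)" "z \<odot>\<^bsub>U\<^esub> iota (us @ bracket x y # vs)"]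
        multilinear_formD(2)[OF assms(1), of "[]" "[v]" "iota (us @ bracket x y # vs)" z] assms(2) c
      unfolding iota_exchange[of us x y] by (simp add: uea_scale_closed)
  qed
  show "exchange (\<lambda>b. \<psi> [v, iota b])"
    unfolding exchange_def
  proof (intro conjI allI)
    show "multilinear_form M (\<lambda>b. \<psi> [v, iota b])"
      by (rule multilinear_map_form(2)[OF multilinear_iota assms])
    show "\<psi> [v, iota (us @ x # y # vs)] - \<psi> [v, iota (us @ y # x # vs)] = z * \<psi> [v, iota (us @ bracket x y # vs)]"
      for us x y vs
      using multilinear_formD(1)[OF assms(1), of "[v]" "[]" "iota (us @ y # x # vs)" "z \<odot>\<^bsub>U\<^esub> iota (us @ bracket x y # vs)"]
        multilinear_formD(2)[OF assms(1), of "[v]" "[]" "iota (us @ bracket x y # vs)" z] assms(2) c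
      unfolding iota_exchange[of us x y] by (simp add: uea_scale_closed)
  qed
qed

text \<open>On words: to split a concatenation is to split both factors
  (\<open>split_sum_append\<close>), and \<open>iota\<close> turns concatenation into the product.
  The bulk of the proof shows that the intermediate functions are multilinear forms, since tensors
  return zero elsewhere.\<close>

lemma cop_iota_mult:
  assumes s: "s \<in> carrier T" and t: "t \<in> carrier T"
  shows "cop U iota (s \<otimes>\<^bsub>T\<^esub> t) = cop U iota s \<otimes>\<^bsub>tensor_square_algebra U\<^esub> cop U iota t"
proof
  fix \<psi>
  have c: "iota xs \<in> carrier U" for xs by (simp add: iota_def)
  show "cop U iota (s \<otimes>\<^bsub>T\<^esub> t) \<psi> = (cop U iota s \<otimes>\<^bsub>tensor_square_algebra U\<^esub> cop U iota t) \<psi>"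
  proof (cases "multilinear_form U \<psi>")
    case ml: True
    define \<theta> where "\<theta> u v = (\<lambda>bs. if length bs = 2 then \<psi> [u \<otimes>\<^bsub>U\<^esub> (bs ! 0), v \<otimes>\<^bsub>U\<^esub> (bs ! 1)] else 0)" for u v
    note D1 = multilinear_formD[OF ml, of "[]" "[_]", simplified]
    note D2 = multilinear_formD[OF ml, of "[_]" "[]", simplified]
    have ml\<theta>: "multilinear_form U (\<theta> u v)" if "u \<in> carrier U" "v \<in> carrier U" for u v
      unfolding \<theta>_def
      by (rule multilinear_form_pair)
        (use that in \<open>simp_all add: uea_distrib uea_scale_mult uea_mult_closed D1 D2\<close>)
    have app: "\<theta> u v [iota c, iota d] = \<psi> [u \<otimes>\<^bsub>U\<^esub> iota c, v \<otimes>\<^bsub>U\<^esub> iota d]" for u v c d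
      by (simp add: \<theta>_def)
    have mlc: "multilinear_form M (\<lambda>ys. split_sum ys (\<lambda>c d. \<psi> [u \<otimes>\<^bsub>U\<^esub> iota c, v \<otimes>\<^bsub>U\<^esub> iota d]))"
      if "u \<in> carrier U" "v \<in> carrier U" for u v
      using cop_form[OF multilinear_iota ml\<theta>[OF that]] by (simp add: app)
    \<comment> \<open>The coproduct of t evaluated after multiplication from the left by a given
      pair, as a form in this pair.\<close>
    define \<Omega> where "\<Omega> = (\<lambda>as. if length as = 2
        then (\<lambda>u v. t (\<lambda>ys. split_sum ys (\<lambda>c d. \<psi> [u \<otimes>\<^bsub>U\<^esub> iota c, v \<otimes>\<^bsub>U\<^esub> iota d]))) (as ! 0) (as ! 1) else 0)"
    have ml\<Omega>: "multilinear_form U \<Omega>"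
      unfolding \<Omega>_def
    proof (rule multilinear_form_pair)
      fix x y v assume *: "x \<in> carrier U" "y \<in> carrier U" "v \<in> carrier U"
      show "t (\<lambda>ys. split_sum ys (\<lambda>c d. \<psi> [(x \<oplus>\<^bsub>U\<^esub> y) \<otimes>\<^bsub>U\<^esub> iota c, v \<otimes>\<^bsub>U\<^esub> iota d])) =
        t (\<lambda>ys. split_sum ys (\<lambda>c d. \<psi> [x \<otimes>\<^bsub>U\<^esub> iota c, v \<otimes>\<^bsub>U\<^esub> iota d])) +
        t (\<lambda>ys. split_sum ys (\<lambda>c d. \<psi> [y \<otimes>\<^bsub>U\<^esub> iota c, v \<otimes>\<^bsub>U\<^esub> iota d]))"
        using * by (simp add: tensor_algebra_eval_add[OF t mlc mlc, symmetric] split_sum_add[symmetric]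
            uea_distrib uea_mult_closed c D1)
      show "t (\<lambda>ys. split_sum ys (\<lambda>c d. \<psi> [v \<otimes>\<^bsub>U\<^esub> iota c, (x \<oplus>\<^bsub>U\<^esub> y) \<otimes>\<^bsub>U\<^esub> iota d])) =
        t (\<lambda>ys. split_sum ys (\<lambda>c d. \<psi> [v \<otimes>\<^bsub>U\<^esub> iota c, x \<otimes>\<^bsub>U\<^esub> iota d])) +
        t (\<lambda>ys. split_sum ys (\<lambda>c d. \<psi> [v \<otimes>\<^bsub>U\<^esub> iota c, y \<otimes>\<^bsub>U\<^esub> iota d]))"
        using * by (simp add: tensor_algebra_eval_add[OF t mlc mlc, symmetric] split_sum_add[symmetric]
            uea_distrib uea_mult_closed c D2)
    next
      fix k x v assume *: "x \<in> carrier U" "v \<in> carrier U"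
      show "t (\<lambda>ys. split_sum ys (\<lambda>c d. \<psi> [(k \<odot>\<^bsub>U\<^esub> x) \<otimes>\<^bsub>U\<^esub> iota c, v \<otimes>\<^bsub>U\<^esub> iota d])) =
        k * t (\<lambda>ys. split_sum ys (\<lambda>c d. \<psi> [x \<otimes>\<^bsub>U\<^esub> iota c, v \<otimes>\<^bsub>U\<^esub> iota d]))"
        using * by (simp add: tensor_algebra_eval_scale[OF t mlc, symmetric] split_sum_hom[of "\<lambda>w. k * w"] distrib_left
            uea_scale_mult uea_mult_closed c D1)
      show "t (\<lambda>ys. split_sum ys (\<lambda>c d. \<psi> [v \<otimes>\<^bsub>U\<^esub> iota c, (k \<odot>\<^bsub>U\<^esub> x) \<otimes>\<^bsub>U\<^esub> iota d])) =
        k * t (\<lambda>ys. split_sum ys (\<lambda>c d. \<psi> [v \<otimes>\<^bsub>U\<^esub> iota c, x \<otimes>\<^bsub>U\<^esub> iota d]))"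
        using * by (simp add: tensor_algebra_eval_scale[OF t mlc, symmetric] split_sum_hom[of "\<lambda>w. k * w"] distrib_left
            uea_scale_mult uea_mult_closed c D2)
    qed
    have mlS: "multilinear_form M (\<lambda>xs. split_sum xs (\<lambda>a b. \<psi> [iota a, iota b]))"
      by (rule cop_form[OF multilinear_iota ml])
    have "cop U iota (s \<otimes>\<^bsub>T\<^esub> t) \<psi> = s (\<lambda>xs. t (\<lambda>ys. split_sum (xs @ ys) (\<lambda>a b. \<psi> [iota a, iota b])))"
      using ml mlS by (simp add: cop_def tensor_algebra_mult)
    also have "\<dots> = s (\<lambda>xs. t (\<lambda>ys. split_sum xs (\<lambda>a b. split_sum ys
        (\<lambda>c d. \<psi> [iota a \<otimes>\<^bsub>U\<^esub> iota c, iota b \<otimes>\<^bsub>U\<^esub> iota d]))))"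
      by (simp add: split_sum_append iota_append)
    also have "\<dots> = s (\<lambda>xs. split_sum xs (\<lambda>a b. \<Omega> [iota a, iota b]))"
      by (simp add: tensor_eval_split_sum[OF t mlc[OF c c]] \<Omega>_def)
    also have "\<dots> = cop U iota s \<Omega>"
      using ml\<Omega> by (simp add: cop_def)
    also have "\<dots> = cop U iota s (\<lambda>as. if length as = 2 then cop U iota t (\<lambda>bs. if length bs = 2 then \<psi> (map2 (mult U) as bs) else 0) else 0)"
    proof -
      \<comment> \<open>This is the function as it is written in
        \<open>tensor_square_algebra\<close>. Its agreement with \<Omega> is available on lists over
        the carrier, which is all that \<open>tensor_algebra_cong\<close> asks for.\<close>
      let ?G = "\<lambda>as. if length as = 2 then cop U iota t (\<lambda>bs. if length bs = 2 then \<psi> (map2 (mult U) as bs) else 0) else 0"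
      have len2: "\<exists>a b. xs = [a, b]" if "length xs = 2" for xs :: "('k, 'g) tensor set list"
        using that by (auto simp: numeral_2_eq_2 length_Suc_conv)
      have eq: "\<Omega> as = ?G as" if as: "set as \<subseteq> carrier U" for as
      proof (cases "length as = 2")
        case True
        then obtain u v where uv: "as = [u, v]" using len2 by blast
        have "(\<lambda>bs. if length bs = 2 then \<psi> (map2 (mult U) as bs) else 0) = \<theta> u v"
          using len2 by (force simp: \<theta>_def uv fun_eq_iff)
        then show ?thesis
          using ml\<theta>[of u v] as by (simp add: uv \<Omega>_def cop_def app)
      qed (simp add: \<Omega>_def)
      have cl2: "set (us @ x # vs) \<subseteq> carrier U" if "set us \<subseteq> carrier U" "set vs \<subseteq> carrier U" "x \<in> carrier U" for us x vs
        using that by simp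
      have "multilinear_form U ?G"
      proof (rule multilinear_formI)
        fix us vs x y assume *: "set us \<subseteq> carrier U" "set vs \<subseteq> carrier U" "x \<in> carrier U" "y \<in> carrier U"
        show "?G (us @ (x \<oplus>\<^bsub>U\<^esub> y) # vs) = ?G (us @ x # vs) + ?G (us @ y # vs)"
          unfolding eq[symmetric, OF cl2[OF *(1,2) uea_add_closed[OF *(3,4)]]] eq[symmetric, OF cl2[OF *(1,2,3)]]
            eq[symmetric, OF cl2[OF *(1,2,4)]]
          by (rule multilinear_formD(1)[OF ml\<Omega> *])
      next
        fix us vs x k assume *: "set us \<subseteq> carrier U" "set vs \<subseteq> carrier U" "x \<in> carrier U"
        show "?G (us @ (k \<odot>\<^bsub>U\<^esub> x) # vs) = k * ?G (us @ x # vs)"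
          unfolding eq[symmetric, OF cl2[OF *(1,2) uea_scale_closed[OF *(3)]]] eq[symmetric, OF cl2[OF *]]
          by (rule multilinear_formD(2)[OF ml\<Omega> *])
      qed
      note mlG = this
      have cs: "cop U iota s \<in> carrier (tensor_algebra U)"
        using cop_closed[OF multilinear_iota s] tensor_power_subset by (rule subsetD[rotated])
      show ?thesis by (rule tensor_algebra_cong[OF cs ml\<Omega> mlG eq])
    qed
    also have "\<dots> = (cop U iota s \<otimes>\<^bsub>tensor_square_algebra U\<^esub> cop U iota t) \<psi>"
      using ml by (simp add: tensor_square_algebra_def)
    finally show ?thesis .
  qed (simp add: cop_def tensor_square_algebra_def)
qed

lemma uea_coproduct_eq:
  assumes t: "t \<in> carrier T"
  shows "uea_coproduct M bracket z (cl t) = cop U iota t"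
  unfolding uea_coproduct_def Let_def
proof (rule the_algebra_hom[OF _ _ _ _ _ _ _ t])
  fix s t assume st: "s \<in> carrier T" "t \<in> carrier T"
  show "cop U iota t \<in> carrier (tensor_square_algebra U)"
    using cop_closed[OF multilinear_iota st(2)] by (simp add: tensor_square_algebra_def)
  show "cop U iota (s \<otimes>\<^bsub>T\<^esub> t) = cop U iota s \<otimes>\<^bsub>tensor_square_algebra U\<^esub> cop U iota t"
    by (rule cop_iota_mult[OF st])
  show "cop U iota s = cop U iota t" if "\<And>\<phi>. exchange \<phi> \<Longrightarrow> s \<phi> = t \<phi>"
    using that exchange_split_sum exchange_iota by (auto simp: cop_def fun_eq_iff iota_def)
next
  show "cop U iota (tensor M []) = \<one>\<^bsub>tensor_square_algebra U\<^esub>"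
    by (simp add: cop_tensor[OF multilinear_iota] tensor_square_algebra_def iota_def cl_one)
next
  fix x
  show "cop U iota (tensor M [x]) = tensor U [cl (tensor M [x]), \<one>\<^bsub>U\<^esub>] \<oplus>\<^bsub>tensor_square_algebra U\<^esub> tensor U [\<one>\<^bsub>U\<^esub>, cl (tensor M [x])]"
    by (simp add: cop_tensor[OF multilinear_iota] tensor_square_algebra_def iota_def cl_one)
qed (auto simp: cop_def tensor_square_algebra_def fun_eq_iff)

text \<open>The tensor square of the quantization map is injective, because forms on the symmetric
  tensors pull back along its inverse to forms on the enveloping algebra. It is therefore enough to
  compare images, and there \<open>rep xs\<close> becomes \<open>iota xs\<close>.\<close>

lemma gutt_coproduct_eq:
  assumes f: "f \<in> carrier S"
  shows "gutt_coproduct M bracket z f = cop S rep f"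
proof -
  have fT: "f \<in> carrier T" using f by (rule S_subset)
  have cl_S: "cl ` carrier S \<subseteq> carrier U" using S_subset by auto
  have cl_lin: "cl (x \<oplus>\<^bsub>S\<^esub> y) = cl x \<oplus>\<^bsub>U\<^esub> cl y" "cl (c \<odot>\<^bsub>S\<^esub> x) = c \<odot>\<^bsub>U\<^esub> cl x"
    if "x \<in> carrier S" "y \<in> carrier S" for x y c
    using that S_subset by (simp_all add: cl_add cl_scale)
  have iota_rep: "cl (rep xs) = iota xs" for xs
    by (simp add: rep_def iota_def cl_sym_rep)
  have "tensor_map U cl (cop S rep f) = cop U (\<lambda>xs. cl (rep xs)) f"
    by (rule tensor_map_cop[OF multilinear_rep fT cl_S]) (use cl_lin in auto)
  then have map: "tensor_map U (gutt_q M bracket z) (cop S rep f) = uea_coproduct M bracket z (gutt_q M bracket z f)"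
    by (simp add: iota_rep gutt_q_def[abs_def] uea_coproduct_eq[OF fT])
  have "inj_on (tensor_map U (gutt_q M bracket z)) (carrier (tensor_power S 2))"
  proof (rule inj_onI)
    fix s s' assume s: "s \<in> carrier (tensor_power S 2)" "s' \<in> carrier (tensor_power S 2)"
      "tensor_map U (gutt_q M bracket z) s = tensor_map U (gutt_q M bracket z) s'"
    have T: "s \<in> carrier (tensor_algebra S)" "s' \<in> carrier (tensor_algebra S)"
      using s tensor_power_subset[of S 2] by auto
    show "s = s'"
    proof (rule tensor_algebra_eqI[OF T])
      fix \<phi> assume ml: "multilinear_form S \<phi>"
      have inv: "gutt_q_inv M bracket z (cl t) = sym_rep t" for t by (simp add: sym_rep_def)
      have mlU: "multilinear_form U (\<lambda>us. \<phi> (map (gutt_q_inv M bracket z) us))"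
        by (rule multilinear_form_map[OF ml])
          (auto simp: uea_carrier cl_add cl_scale inv sym_rep_add sym_rep_scale)
      have mlS: "multilinear_form S (\<lambda>us. \<phi> (map (gutt_q_inv M bracket z) (map cl us)))"
        by (rule multilinear_form_map[OF mlU cl_S]) (use cl_lin in auto)
      have "\<phi> us = \<phi> (map (gutt_q_inv M bracket z) (map cl us))" if "set us \<subseteq> carrier S" for us
        using that by (intro arg_cong[where f = \<phi>]) (auto simp: inv sym_rep_id intro!: map_idI[symmetric])
      then have eq: "u \<phi> = tensor_map U (gutt_q M bracket z) u (\<lambda>us. \<phi> (map (gutt_q_inv M bracket z) us))"
        if "u \<in> carrier (tensor_algebra S)" for u
        using tensor_algebra_cong[OF that ml mlS] mlU by (simp add: tensor_map_def gutt_q_def[abs_def])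
      show "s \<phi> = s' \<phi>" using eq[OF T(1)] eq[OF T(2)] s(3) by simp
    qed
  qed
  then show ?thesis
    unfolding gutt_coproduct_def map[symmetric]
    by (rule inv_into_f_f) (rule cop_closed[OF multilinear_rep fT])
qed

section \<open>Counit and antipode on words\<close>

definition counit_form :: "'g list \<Rightarrow> 'k" where
  "counit_form xs = (if xs = [] then 1 else 0)"

lemma exchange_counit_form: "exchange counit_form"
  by (simp add: exchange_def counit_form_def multilinear_form_vec_mod)

text \<open>Evaluation in degree 0 is an exchange form, as all words in the relation are nonempty.
  It is multiplicative because a concatenation is empty only if both words are.\<close>

lemma gutt_counit_eq:
  assumes f: "f \<in> carrier S"
  shows "gutt_counit M bracket z f = f counit_form"
  unfolding gutt_counit_def gutt_q_def uea_counit_def Let_def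
proof (rule the_algebra_hom[OF _ _ _ _ _ _ _ S_subset[OF f]])
  fix s t assume st: "s \<in> carrier T" "t \<in> carrier T"
  have ml: "multilinear_form M counit_form" by (rule exchange_multilinear[OF exchange_counit_form])
  have "t (\<lambda>ys. counit_form (xs @ ys)) = t counit_form * counit_form xs" for xs
    using tensor_algebra_eval_zero[OF st(2)] by (simp add: counit_form_def[abs_def])
  then have "s (\<lambda>xs. t (\<lambda>ys. counit_form (xs @ ys))) = s (\<lambda>xs. t counit_form * counit_form xs)"
    by simp
  then show "(s \<otimes>\<^bsub>T\<^esub> t) counit_form = s counit_form \<otimes>\<^bsub>scalar_algebra\<^esub> t counit_form"
    using tensor_algebra_eval_scale[OF st(1) ml] by (simp add: tensor_algebra_mult ml scalar_algebra_def)
next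
  show "tensor M [] counit_form = \<one>\<^bsub>scalar_algebra\<^esub>"
    using exchange_multilinear[OF exchange_counit_form] by (simp add: counit_form_def scalar_algebra_def)
  show "tensor M [x] counit_form = 0" for x
    using exchange_multilinear[OF exchange_counit_form] by (simp add: counit_form_def)
qed (auto simp: scalar_algebra_def exchange_counit_form)

definition antipode :: "('k, 'g) tensor \<Rightarrow> ('k, 'g) tensor" where
  "antipode t = (\<lambda>\<phi>. if multilinear_form M \<phi> then t (\<lambda>xs. (- 1) ^ length xs * \<phi> (rev xs)) else 0)"

lemma multilinear_antipode:
  "multilinear_form M \<phi> \<Longrightarrow> multilinear_form M (\<lambda>xs. (- 1) ^ length xs * \<phi> (rev xs))"
  by (simp add: multilinear_form_vec_mod algebra_simps)

lemma exchange_antipode: "exchange \<phi> \<Longrightarrow> exchange (\<lambda>xs. (- 1) ^ length xs * \<phi> (rev xs))"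
  unfolding exchange_def
proof (intro conjI allI)
  fix us x y vs
  assume *: "multilinear_form M \<phi> \<and>
     (\<forall>us x y vs. \<phi> (us @ x # y # vs) - \<phi> (us @ y # x # vs) = z * \<phi> (us @ bracket x y # vs))"
  then show "multilinear_form M (\<lambda>xs. (- 1) ^ length xs * \<phi> (rev xs))"
    by (intro multilinear_antipode) auto
  have "\<phi> (rev vs @ y # x # rev us) - \<phi> (rev vs @ x # y # rev us) = z * \<phi> (rev vs @ bracket y x # rev us)"
    using * by blast
  moreover have "\<phi> (rev vs @ bracket y x # rev us) = - \<phi> (rev vs @ bracket x y # rev us)"
  proof -
    have "\<phi> (rev vs @ scaleV (- 1) (bracket x y) # rev us) = - 1 * \<phi> (rev vs @ bracket x y # rev us)"
      using * unfolding multilinear_form_vec_mod by blast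
    then show ?thesis using bracket_swap[of y x] by simp
  qed
  ultimately show "(- 1) ^ length (us @ x # y # vs) * \<phi> (rev (us @ x # y # vs)) -
      (- 1) ^ length (us @ y # x # vs) * \<phi> (rev (us @ y # x # vs)) =
      z * ((- 1) ^ length (us @ bracket x y # vs) * \<phi> (rev (us @ bracket x y # vs)))"
    by (simp add: right_diff_distrib[symmetric])
qed

lemma antipode_tensor: "antipode (tensor M xs) = (\<lambda>\<phi>. (- 1) ^ length xs * tensor M (rev xs) \<phi>)"
  by (auto simp: antipode_def fun_eq_iff multilinear_antipode tensor_def)

lemma antipode_closed: "t \<in> carrier T \<Longrightarrow> antipode t \<in> carrier T"
  unfolding carrier_tensor_algebra
proof (induction rule: lspan_induct)
  case zero
  show ?case by (simp add: antipode_def)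
next
  case (add c x t)
  have "antipode (\<lambda>\<phi>. c * tensor M x \<phi> + t \<phi>) = (\<lambda>\<psi>. c * antipode (tensor M x) \<psi> + antipode t \<psi>)"
    by (auto simp: antipode_def fun_eq_iff)
  then show ?case
    using add.IH unfolding antipode_tensor by (auto intro!: lspan_add lspan_scale lspan_base)
qed

text \<open>Reversal of a concatenation exchanges the two words, so the order of the two evaluations
  has to be interchanged by \<open>tensor_fubini\<close>.\<close>

lemma antipode_mult:
  assumes s: "s \<in> carrier T" and t: "t \<in> carrier T"
  shows "antipode (s \<otimes>\<^bsub>T\<^esub> t) = antipode t \<otimes>\<^bsub>T\<^esub> antipode s"
proof
  fix \<phi>
  show "antipode (s \<otimes>\<^bsub>T\<^esub> t) \<phi> = (antipode t \<otimes>\<^bsub>T\<^esub> antipode s) \<phi>"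
  proof (cases "multilinear_form M \<phi>")
    case ml: True
    have app: "multilinear_form M (\<lambda>ys. \<phi> (as @ ys))" "multilinear_form M (\<lambda>ys. \<phi> (ys @ as))" for as
      using multilinear_form_append[OF ml, of as "[]"] multilinear_form_append[OF ml, of "[]" as] by simp_all
    define F where "F xs ys = (- 1) ^ length ys * ((- 1) ^ length xs * \<phi> (rev ys @ rev xs))" for xs ys
    have F: "multilinear_form M (F xs)" "multilinear_form M (\<lambda>xs. F xs ys)" for xs ys
      unfolding F_def using multilinear_antipode[OF app(1)[of "rev ys"]]
        multilinear_antipode[OF multilinear_form_scale[OF app(2)[of "rev xs"], of "(- 1) ^ length xs"]]
      by (auto intro: multilinear_form_scale)
    have "antipode (s \<otimes>\<^bsub>T\<^esub> t) \<phi> = s (\<lambda>xs. t (\<lambda>ys. F xs ys))"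
      using ml multilinear_antipode[OF ml]
      by (simp add: antipode_def tensor_algebra_mult F_def power_add mult_ac)
    also have "\<dots> = t (\<lambda>ys. s (\<lambda>xs. F xs ys))"
      by (rule tensor_fubini[OF s t F])
    also have "\<dots> = t (\<lambda>ys. (- 1) ^ length ys * antipode s (\<lambda>xs. \<phi> (rev ys @ xs)))"
      unfolding F_def
      by (simp add: antipode_def app tensor_algebra_eval_scale[OF s multilinear_antipode[OF app(1)]])
    also have "\<dots> = (antipode t \<otimes>\<^bsub>T\<^esub> antipode s) \<phi>"
      using ml multilinear_form_inner[OF antipode_closed[OF s] ml]
      by (simp add: antipode_def tensor_algebra_mult)
    finally show ?thesis .
  qed (simp add: antipode_def tensor_algebra_mult)
qed

text \<open>An antihomomorphism is a homomorphism into the opposite algebra, which brings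
  \<open>the_algebra_hom\<close> into play.\<close>

lemma gutt_antipode_eq:
  assumes f: "f \<in> carrier S"
  shows "gutt_antipode M bracket z f = sym_rep (antipode f)"
proof -
  have "uea_antipode M bracket z (cl f) = cl (antipode f)"
    unfolding uea_antipode_def Let_def
  proof (rule the_algebra_hom[OF _ _ _ _ _ _ _ S_subset[OF f]])
    fix s t assume st: "s \<in> carrier T" "t \<in> carrier T"
    show "cl (antipode t) \<in> carrier (U\<lparr>mult := \<lambda>u v. v \<otimes>\<^bsub>U\<^esub> u\<rparr>)"
      using antipode_closed[OF st(2)] by simp
    have "antipode (\<lambda>\<phi>. s \<phi> + t \<phi>) = (\<lambda>\<phi>. antipode s \<phi> + antipode t \<phi>)"
      by (auto simp: antipode_def)
    then show "cl (antipode (\<lambda>\<phi>. s \<phi> + t \<phi>)) = cl (antipode s) \<oplus>\<^bsub>U\<lparr>mult := \<lambda>u v. v \<otimes>\<^bsub>U\<^esub> u\<rparr>\<^esub> cl (antipode t)"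
      by (simp add: cl_add antipode_closed st)
    have "antipode (\<lambda>\<phi>. c * t \<phi>) = (\<lambda>\<phi>. c * antipode t \<phi>)" for c
      by (auto simp: antipode_def)
    then show "cl (antipode (\<lambda>\<phi>. c * t \<phi>)) = c \<odot>\<^bsub>U\<lparr>mult := \<lambda>u v. v \<otimes>\<^bsub>U\<^esub> u\<rparr>\<^esub> cl (antipode t)" for c
      by (simp add: cl_scale antipode_closed st)
    show "cl (antipode (s \<otimes>\<^bsub>T\<^esub> t)) = cl (antipode s) \<otimes>\<^bsub>U\<lparr>mult := \<lambda>u v. v \<otimes>\<^bsub>U\<^esub> u\<rparr>\<^esub> cl (antipode t)"
      by (simp add: cl_mult antipode_closed st antipode_mult)
    show "cl (antipode s) = cl (antipode t)" if "\<And>\<phi>. exchange \<phi> \<Longrightarrow> s \<phi> = t \<phi>"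
      unfolding cl_eq_iff[OF antipode_closed[OF st(1)] antipode_closed[OF st(2)]]
      using that exchange_antipode by (auto simp: antipode_def)
  next
    have "antipode (tensor M []) = tensor M []" by (simp add: antipode_tensor)
    then show "cl (antipode (tensor M [])) = \<one>\<^bsub>U\<lparr>mult := \<lambda>u v. v \<otimes>\<^bsub>U\<^esub> u\<rparr>\<^esub>" by (simp add: cl_one)
  next
    fix x
    have closed: "(\<lambda>\<phi>. - tensor M [x] \<phi>) \<in> carrier T"
      by (intro tensor_algebra_closed tensor_in_carrier)
    \<comment> \<open>Negatives are computed in the quotient ring, with which the enveloping algebra
      shares carrier and addition.\<close>
    have carrier: "carrier (T Quot J) = cl ` carrier T"
      using uea_carrier by (simp add: uea_def Let_def)
    have "abelian_group (T Quot J)"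
      using ideal.quotient_is_ring[OF J_ideal] by (simp add: ring_def)
    then have "\<ominus>\<^bsub>T Quot J\<^esub> cl (tensor M [x]) = cl (\<lambda>\<phi>. - tensor M [x] \<phi>)"
    proof (rule abelian_group.minus_equality)
      have "cl (\<lambda>\<phi>. - tensor M [x] \<phi>) \<oplus>\<^bsub>U\<^esub> cl (tensor M [x]) = cl (\<lambda>\<phi>. 0)"
        by (simp add: cl_add closed)
      also have "\<dots> = \<zero>\<^bsub>T Quot J\<^esub>"
        by (simp add: cl_def FactRing_def)
      finally show "cl (\<lambda>\<phi>. - tensor M [x] \<phi>) \<oplus>\<^bsub>T Quot J\<^esub> cl (tensor M [x]) = \<zero>\<^bsub>T Quot J\<^esub>"
        by (simp add: uea_def Let_def)
    qed (use closed in \<open>auto simp: carrier\<close>)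
    moreover have "\<ominus>\<^bsub>U\<^esub> cl (tensor M [x]) = \<ominus>\<^bsub>T Quot J\<^esub> cl (tensor M [x])"
      by (simp add: a_inv_def m_inv_def uea_def Let_def)
    moreover have "antipode (tensor M [x]) = (\<lambda>\<phi>. - tensor M [x] \<phi>)"
      by (simp add: antipode_tensor)
    ultimately show "cl (antipode (tensor M [x])) = \<ominus>\<^bsub>U\<^esub> cl (tensor M [x])"
      by simp
  qed
  then show ?thesis
    by (simp add: gutt_antipode_def gutt_q_def sym_rep_def)
qed

end

section \<open>Locally convex spaces, dense subspaces and completions\<close>

text \<open>Turns an inclusion of balls into an inequality of seminorms. If P = 0, every multiple
  meets the premise, which forces R \<le> 0; otherwise t = e / (2 P) is inserted, where the 2 makes
  the premise strict.\<close>

lemma real_scaling_bound: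
  fixes P R e :: real
  assumes "P \<ge> 0" "e > 0" "\<And>t. t > 0 \<Longrightarrow> t * P < e \<Longrightarrow> t * R < 1"
  shows "R \<le> (2 / e) * P"
proof (cases "P = 0")
  case True
  have "R \<le> 0"
  proof (rule ccontr)
    assume "\<not> R \<le> 0"
    then have "1 / R > 0" "1 / R * P < e" using True assms by auto
    then show False using assms(3)[of "1 / R"] \<open>\<not> R \<le> 0\<close> by simp
  qed
  then show ?thesis using True by simp
next
  case False
  then have P: "P > 0" using assms by simp
  have "e / (2 * P) * R < 1"
    using P assms(2) by (intro assms(3)) (auto simp: field_simps)
  then show ?thesis using P assms(2) by (simp add: field_simps)
qed

context locally_convex_space
begin

lemma continuous_seminorm_zero [simp]: "continuous_seminorm scaleV p \<Longrightarrow> p 0 = 0"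
  using scale_zero_left[of 0] unfolding continuous_seminorm_def seminorm_def by (metis mult_zero_left norm_zero)

lemma continuous_seminorm_minus: "continuous_seminorm scaleV p \<Longrightarrow> p (- x) = p x"
  using scale_minus_left[of 1 x] unfolding continuous_seminorm_def seminorm_def
  by (metis mult_1 norm_minus_cancel norm_one scale_one)

lemma continuous_seminorm_triangle: "continuous_seminorm scaleV p \<Longrightarrow> p (x + y) \<le> p x + p y"
  by (simp add: continuous_seminorm_def seminorm_def)

lemma continuous_seminorm_scale: "continuous_seminorm scaleV p \<Longrightarrow> p (scaleV c x) = norm c * p x"
  by (simp add: continuous_seminorm_def seminorm_def)

lemma continuous_seminorm_nonneg: "continuous_seminorm scaleV p \<Longrightarrow> 0 \<le> p x"
  using continuous_seminorm_triangle[of p x "- x"] continuous_seminorm_minus[of p x] by simp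

lemma continuous_seminorm_diff: "continuous_seminorm scaleV p \<Longrightarrow> p (x - y) \<le> p x + p y"
  using continuous_seminorm_triangle[of p x "- y"] continuous_seminorm_minus[of p y] by simp

lemma continuous_seminorm_const [simp]: "continuous_seminorm scaleV (\<lambda>x. 0)"
  by (simp add: continuous_seminorm_def seminorm_def)

lemma continuous_seminorm_add:
  "continuous_seminorm scaleV p \<Longrightarrow> continuous_seminorm scaleV q \<Longrightarrow> continuous_seminorm scaleV (\<lambda>x. p x + q x)"
  unfolding continuous_seminorm_def seminorm_def
  by (auto simp: algebra_simps intro: continuous_on_add) (smt (verit))

lemma continuous_seminorm_mult:
  "continuous_seminorm scaleV p \<Longrightarrow> c \<ge> 0 \<Longrightarrow> continuous_seminorm scaleV (\<lambda>x. c * p x)"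
  unfolding continuous_seminorm_def seminorm_def
  by (auto simp: distrib_left[symmetric] mult_left_mono intro: continuous_on_mult_left)

lemma continuous_seminorm_open:
  assumes "continuous_seminorm scaleV p"
  shows "open {y. p (y - x) < e}"
proof -
  have c: "continuous_on UNIV p" using assms by (simp add: continuous_seminorm_def)
  have "continuous_on UNIV (\<lambda>y. p (y - x))"
    by (rule continuous_on_compose2[OF c])
      (auto intro!: continuous_on_diff continuous_on_id continuous_on_const)
  then show ?thesis by (rule open_Collect_less[OF _ continuous_on_const])
qed

lemma eventually_nhds_seminorm:
  "eventually P (nhds x) \<longleftrightarrow> (\<exists>p. continuous_seminorm scaleV p \<and> (\<forall>y. p (y - x) < 1 \<longrightarrow> P y))"
proof
  assume "eventually P (nhds x)"
  then obtain W where W: "open W" "x \<in> W" "\<forall>y\<in>W. P y" by (auto simp: eventually_nhds)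
  have "open ((\<lambda>y. y + x) -` W)"
    using W(1) by (intro open_vimage continuous_on_add continuous_on_id continuous_on_const)
  then obtain p where p: "continuous_seminorm scaleV p" "{y. p y < 1} \<subseteq> (\<lambda>y. y + x) -` W"
    using seminorm_neighbourhood[of "(\<lambda>y. y + x) -` W"] W(2) by auto
  have "P y" if "p (y - x) < 1" for y
  proof -
    have "y - x \<in> (\<lambda>y. y + x) -` W" using p that by blast
    then show ?thesis using W by simp
  qed
  then show "\<exists>p. continuous_seminorm scaleV p \<and> (\<forall>y. p (y - x) < 1 \<longrightarrow> P y)" using p by blast
next
  assume "\<exists>p. continuous_seminorm scaleV p \<and> (\<forall>y. p (y - x) < 1 \<longrightarrow> P y)"
  then obtain p where p: "continuous_seminorm scaleV p" "\<forall>y. p (y - x) < 1 \<longrightarrow> P y" by blast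
  then show "eventually P (nhds x)"
    unfolding eventually_nhds
    by (intro exI[of _ "{y. p (y - x) < 1}"]) (auto intro: continuous_seminorm_open)
qed

lemma eventually_seminorm_less:
  "continuous_seminorm scaleV p \<Longrightarrow> e > 0 \<Longrightarrow> eventually (\<lambda>y. p (y - x) < e) (nhds x)"
  using continuous_seminorm_open[of p x e] by (auto simp: eventually_nhds intro!: exI[of _ "{y. p (y - x) < e}"])

lemma tendsto_seminormI:
  assumes "\<And>p. continuous_seminorm scaleV p \<Longrightarrow> eventually (\<lambda>i. p (f i - l) < 1) F"
  shows "(f \<longlongrightarrow> l) F"
  unfolding filterlim_iff
proof (intro allI impI)
  fix P assume "eventually P (nhds l)"
  then obtain p where "continuous_seminorm scaleV p" "\<forall>y. p (y - l) < 1 \<longrightarrow> P y"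
    unfolding eventually_nhds_seminorm by blast
  then show "eventually (\<lambda>i. P (f i)) F" using assms[of p] by (auto elim: eventually_mono)
qed

lemma continuous_scale_right: "continuous_on UNIV (scaleV c)"
proof -
  have "continuous_on UNIV (\<lambda>x. (\<lambda>(c, x). scaleV c x) (c, x))"
    by (rule continuous_on_compose2[OF continuous_scale]) (auto intro!: continuous_intros)
  then show ?thesis by simp
qed

end

section \<open>Continuous linear and bilinear maps and their extension from dense subspaces\<close>

lemma continuous_linearI:
  assumes lc: "locally_convex_space s1" "locally_convex_space s2"
    and add: "\<And>x y. f (x + y) = f x + f y" and scale: "\<And>c x. f (s1 c x) = s2 c (f x)"
    and bound: "\<And>r. continuous_seminorm s2 r \<Longrightarrow> \<exists>p. continuous_seminorm s1 p \<and> (\<forall>x. r (f x) \<le> p x)"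
  shows "continuous_linear s1 s2 f"
  unfolding continuous_linear_def
proof
  interpret L1: locally_convex_space s1 by fact
  interpret L2: locally_convex_space s2 by fact
  show "Vector_Spaces.linear s1 s2 f"
    unfolding Vector_Spaces.linear_iff using L1.vector_space_axioms L2.vector_space_axioms add scale by blast
  have diff: "f y - f x = f (y - x)" for x y
    using add[of "y - x" x] by simp
  have "(f \<longlongrightarrow> f x) (nhds x)" for x
  proof (rule L2.tendsto_seminormI)
    fix r assume "continuous_seminorm s2 r"
    then obtain p where p: "continuous_seminorm s1 p" "\<forall>x. r (f x) \<le> p x" using bound by blast
    show "\<forall>\<^sub>F y in nhds x. r (f y - f x) < 1"
      using L1.eventually_seminorm_less[OF p(1), of 1 x] p(2)
      by (auto elim!: eventually_mono simp: diff intro: le_less_trans)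
  qed
  then show "continuous_on UNIV f"
    by (intro continuous_at_imp_continuous_on ballI) (auto simp: isCont_def intro: tendsto_mono[OF at_within_le_nhds])
qed

lemma continuous_linearD:
  assumes "continuous_linear s1 s2 f"
  shows "f (x + y) = f x + f y" "f (s1 c x) = s2 c (f x)" "continuous_on UNIV f"
  using assms by (auto simp: continuous_linear_def Vector_Spaces.linear_iff)

lemma continuous_linear_0: "continuous_linear s1 s2 f \<Longrightarrow> f 0 = 0"
  using continuous_linearD(1)[of s1 s2 f 0 0] by simp

lemma continuous_linear_seminorm:
  assumes "continuous_linear s1 s2 f" "continuous_seminorm s2 r"
  shows "continuous_seminorm s1 (\<lambda>x. r (f x))"
  using assms continuous_on_compose2[of UNIV r UNIV f]
  by (auto simp: continuous_seminorm_def seminorm_def continuous_linearD[OF assms(1)])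

lemma continuous_linear_compose:
  assumes "continuous_linear s1 s2 f" "continuous_linear s2 s3 g"
  shows "continuous_linear s1 s3 (\<lambda>x. g (f x))"
  using assms continuous_on_compose2[of UNIV g UNIV f]
  by (auto simp: continuous_linear_def Vector_Spaces.linear_iff)

lemma continuous_bilinearI:
  assumes lc: "locally_convex_space s1" "locally_convex_space s2" "locally_convex_space s3"
    and add: "\<And>x y w. f (x + y) w = f x w + f y w" "\<And>x y w. f w (x + y) = f w x + f w y"
    and scale: "\<And>c x w. f (s1 c x) w = s3 c (f x w)" "\<And>c x w. f w (s2 c x) = s3 c (f w x)"
    and bound: "\<And>r. continuous_seminorm s3 r \<Longrightarrow>
      \<exists>p q. continuous_seminorm s1 p \<and> continuous_seminorm s2 q \<and> (\<forall>x y. r (f x y) \<le> p x * q y)"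
  shows "continuous_bilinear s1 s2 s3 f"
  unfolding continuous_bilinear_def
proof (intro conjI allI)
  interpret L1: locally_convex_space s1 by fact
  interpret L2: locally_convex_space s2 by fact
  interpret L3: locally_convex_space s3 by fact
  show "Vector_Spaces.linear s2 s3 (f x)" "Vector_Spaces.linear s1 s3 (\<lambda>x. f x y)" for x y
    unfolding Vector_Spaces.linear_iff
    using L1.vector_space_axioms L2.vector_space_axioms L3.vector_space_axioms add scale by blast+
  have diff: "f x' y' - f x y = f (x' - x) (y' - y) + (f (x' - x) y + f x (y' - y))" for x y x' y'
    using add(1)[of "x' - x" x] add(2)[of x "y' - y" y] add(2)[of "x' - x" "y' - y" y] by simp
  have "((\<lambda>(x, y). f x y) \<longlongrightarrow> f x y) (nhds (x, y))" for x y
  proof (rule L3.tendsto_seminormI)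
    fix r assume r: "continuous_seminorm s3 r"
    then obtain p q where p: "continuous_seminorm s1 p" and q: "continuous_seminorm s2 q"
      and pq: "\<forall>x y. r (f x y) \<le> p x * q y" using bound by blast
    \<comment> \<open>If both increments are smaller than e \<le> 1, the three terms in
      \<open>diff\<close> sum up to at most e (1 + p x + q y) = 1 / 2.\<close>
    define e where "e = 1 / (2 * (1 + p x + q y))"
    have pos: "p x \<ge> 0" "q y \<ge> 0" using L1.continuous_seminorm_nonneg[OF p] L2.continuous_seminorm_nonneg[OF q] by auto
    then have e: "0 < e" "e \<le> 1" by (auto simp: e_def field_simps)
    have small: "r (f x' y' - f x y) < 1" if "p (x' - x) < e" "q (y' - y) < e" for x' y'
    proof -
      have n: "p (x' - x) \<ge> 0" "q (y' - y) \<ge> 0"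
        using L1.continuous_seminorm_nonneg[OF p] L2.continuous_seminorm_nonneg[OF q] by auto
      have "r (f x' y' - f x y) \<le> r (f (x' - x) (y' - y)) + (r (f (x' - x) y) + r (f x (y' - y)))"
        unfolding diff using L3.continuous_seminorm_triangle[OF r] by (meson add_left_mono order_trans)
      also have "\<dots> \<le> p (x' - x) * q (y' - y) + (p (x' - x) * q y + p x * q (y' - y))"
        by (intro add_mono pq[rule_format])
      also have "\<dots> \<le> e * 1 + (e * q y + p x * e)"
        using that n pos e by (intro add_mono mult_mono) auto
      also have "\<dots> = e * (1 + p x + q y)" by (simp add: algebra_simps)
      also have "\<dots> = 1 / 2"
      proof -
        have "1 + p x + q y \<noteq> 0" using pos by linarith
        then show ?thesis by (simp add: e_def)
      qed
      finally show ?thesis by simp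
    qed
    have "\<forall>\<^sub>F z in nhds x \<times>\<^sub>F nhds y. p (fst z - x) < e \<and> q (snd z - y) < e"
      using eventually_prodI[OF L1.eventually_seminorm_less[OF p e(1), of x] L2.eventually_seminorm_less[OF q e(1), of y]]
      by simp
    then show "\<forall>\<^sub>F z in nhds (x, y). r ((case z of (x, y) \<Rightarrow> f x y) - f x y) < 1"
      unfolding nhds_prod by eventually_elim (auto simp: small split: prod.splits)
  qed
  then show "continuous_on UNIV (\<lambda>(x, y). f x y)"
    by (intro continuous_at_imp_continuous_on ballI) (auto simp: isCont_def intro: tendsto_mono[OF at_within_le_nhds])
qed

lemma continuous_bilinear_partial:
  assumes "continuous_bilinear s1 s2 s3 f"
  shows "continuous_linear s1 s3 (\<lambda>x. f x y)" "continuous_linear s2 s3 (f x)"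
proof -
  have c: "continuous_on UNIV (\<lambda>(x, y). f x y)" using assms by (simp add: continuous_bilinear_def)
  have "continuous_on UNIV (\<lambda>x. (\<lambda>(x, y). f x y) (x, y))" "continuous_on UNIV (\<lambda>y. (\<lambda>(x, y). f x y) (x, y))"
    by (rule continuous_on_compose2[OF c]; auto intro!: continuous_intros)+
  then show "continuous_linear s1 s3 (\<lambda>x. f x y)" "continuous_linear s2 s3 (f x)"
    using assms by (simp_all add: continuous_bilinear_def continuous_linear_def)
qed

lemma continuous_eq_on_dense:
  fixes f g :: "'a::topological_space \<Rightarrow> 'b::t2_space"
  assumes "continuous_on UNIV f" "continuous_on UNIV g" "closure D = UNIV" "\<And>x. x \<in> D \<Longrightarrow> f x = g x"
  shows "f x = g x"
proof -
  have "closure D \<subseteq> {x. f x = g x}"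
    by (rule closure_minimal) (use assms closed_Collect_eq in auto)
  then show ?thesis using assms(3) by auto
qed

lemma continuous_le_on_dense:
  fixes f g :: "'a::topological_space \<Rightarrow> real"
  assumes "continuous_on UNIV f" "continuous_on UNIV g" "closure D = UNIV" "\<And>x. x \<in> D \<Longrightarrow> f x \<le> g x"
  shows "f x \<le> g x"
proof -
  have "closure D \<subseteq> {x. f x \<le> g x}"
    by (rule closure_minimal) (use assms closed_Collect_le in auto)
  then show ?thesis using assms(3) by auto
qed

lemma continuous_linear_bound_dense:
  assumes "continuous_linear s1 s2 g" "continuous_seminorm s2 r" "continuous_seminorm s1 p" "closure D = UNIV"
    "\<And>x. x \<in> D \<Longrightarrow> r (g x) \<le> p x"
  shows "r (g x) \<le> p x"
  by (rule continuous_le_on_dense[OF _ _ assms(4,5)])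
    (use continuous_linear_seminorm[OF assms(1,2)] assms(3) in \<open>auto simp: continuous_seminorm_def\<close>)

text \<open>The value at x is the limit of f along the trace on D of the neighbourhood filter at x.
  The seminorm bounds make the image of this trace a Cauchy filter.\<close>

lemma linear_extension:
  fixes s1 :: "'k::real_normed_field \<Rightarrow> 'a::{topological_group_add,ab_group_add,t2_space} \<Rightarrow> 'a"
    and s2 :: "'k \<Rightarrow> 'b::{uniform_topological_group_add,ab_group_add,complete_uniform_space,t2_space} \<Rightarrow> 'b"
  assumes lc: "locally_convex_space s1" "locally_convex_space s2"
    and D: "\<And>x y. x \<in> D \<Longrightarrow> y \<in> D \<Longrightarrow> x + y \<in> D" "\<And>c x. x \<in> D \<Longrightarrow> s1 c x \<in> D"
    and dense: "closure D = UNIV"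
    and f: "\<And>x y. x \<in> D \<Longrightarrow> y \<in> D \<Longrightarrow> f (x + y) = f x + f y" "\<And>c x. x \<in> D \<Longrightarrow> f (s1 c x) = s2 c (f x)"
    and bound: "\<And>r. continuous_seminorm s2 r \<Longrightarrow> \<exists>p. continuous_seminorm s1 p \<and> (\<forall>x\<in>D. r (f x) \<le> p x)"
  obtains g where "continuous_linear s1 s2 g" "\<And>x. x \<in> D \<Longrightarrow> g x = f x"
proof -
  interpret L1: locally_convex_space s1 by fact
  interpret L2: locally_convex_space s2 by fact
  define N where "N x = inf (nhds x) (principal D)" for x
  have N_bot: "N x \<noteq> bot" for x
  proof
    assume "N x = bot"
    then obtain W where "open W" "x \<in> W" "\<forall>y\<in>W. y \<notin> D"
      by (auto simp: N_def trivial_limit_def eventually_inf_principal eventually_nhds)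
    moreover have "x \<in> closure D" using dense by simp
    ultimately show False unfolding closure_iff_nhds_not_empty by blast
  qed
  have N_D: "eventually (\<lambda>a. a \<in> D) (N x)" for x by (simp add: N_def eventually_inf_principal)
  have D_minus: "- x \<in> D" if "x \<in> D" for x using D(2)[OF that, of "-1"] by simp
  have D_diff: "x - y \<in> D" if "x \<in> D" "y \<in> D" for x y using D(1)[OF that(1) D_minus[OF that(2)]] by simp
  have f_diff: "f x - f y = f (x - y)" if "x \<in> D" "y \<in> D" for x y
    using f(1)[OF D_diff[OF that] that(2)] by simp
  have "\<exists>l. (f \<longlongrightarrow> l) (N x)" for x
  proof -
    have "cauchy_filter (filtermap f (N x))"
      unfolding cauchy_filter_def le_filter_def
    proof (intro allI impI)
      fix P :: "'b \<times> 'b \<Rightarrow> bool" assume "eventually P uniformity"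
      then obtain Q where Q: "eventually Q (nhds (0::'b))" "\<And>a b. Q (b - a) \<Longrightarrow> P (a, b)"
        unfolding cauchy_seq_finset_iff_vanishing eventually_filtercomap by auto
      then obtain r where r: "continuous_seminorm s2 r" "\<And>y. r y < 1 \<Longrightarrow> Q y"
        unfolding L2.eventually_nhds_seminorm by auto
      obtain p where p: "continuous_seminorm s1 p" "\<And>x. x \<in> D \<Longrightarrow> r (f x) \<le> p x"
        using bound[OF r(1)] by blast
      let ?R = "\<lambda>a. a \<in> D \<and> p (a - x) < 1 / 2"
      have ev: "eventually ?R (N x)"
        using L1.eventually_seminorm_less[OF p(1), of "1 / 2" x]
        by (auto simp: N_def eventually_inf_principal elim: eventually_mono)
      have "P (f a, f b)" if "?R a" "?R b" for a b
      proof -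
        have "r (f b - f a) \<le> p (b - a)" using that f_diff D_diff p(2) by simp
        also have "b - a = (b - x) - (a - x)" by simp
        also have "p \<dots> \<le> p (b - x) + p (a - x)" by (rule L1.continuous_seminorm_diff[OF p(1)])
        finally have "r (f b - f a) < 1" using that by simp
        then show ?thesis using Q r by blast
      qed
      then show "eventually P (filtermap f (N x) \<times>\<^sub>F filtermap f (N x))"
        unfolding eventually_prod_filter eventually_filtermap
        by (intro exI[of _ "\<lambda>y. \<exists>a. ?R a \<and> y = f a"] conjI eventually_mono[OF ev]) auto
    qed
    then have "convergent_filter (filtermap f (N x))" by (rule cauchy_filter_convergent)
    then show ?thesis by (simp add: convergent_filter_iff filterlim_def)
  qed
  then obtain g where g: "\<And>x. (f \<longlongrightarrow> g x) (N x)" by metis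
  have unique: "g x = l" if "(f \<longlongrightarrow> l) (N x)" for x l
    using tendsto_unique[OF N_bot g that] .
  have bound': "r (g x) \<le> p x"
    if "continuous_seminorm s2 r" "continuous_seminorm s1 p" "\<forall>x\<in>D. r (f x) \<le> p x" for r p x
  proof (rule tendsto_le[OF N_bot])
    have "isCont p x" "isCont r (g x)"
      using that by (auto simp: continuous_seminorm_def continuous_on_eq_continuous_at)
    then show "((\<lambda>a. r (f a)) \<longlongrightarrow> r (g x)) (N x)"
      using isCont_tendsto_compose[OF _ g] by blast
    show "(p \<longlongrightarrow> p x) (N x)"
      using \<open>isCont p x\<close> unfolding N_def isCont_def tendsto_at_iff_tendsto_nhds by (rule tendsto_mono[OF inf_le1])
    show "\<forall>\<^sub>F a in N x. r (f a) \<le> p a" using that(3) N_D[of x] by (auto elim: eventually_mono)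
  qed
  have g_D: "g x = f x" if x: "x \<in> D" for x
  proof (rule unique, rule L2.tendsto_seminormI)
    fix r assume "continuous_seminorm s2 r"
    then obtain p where p: "continuous_seminorm s1 p" "\<And>x. x \<in> D \<Longrightarrow> r (f x) \<le> p x"
      using bound by blast
    have "eventually (\<lambda>a. a \<in> D \<and> p (a - x) < 1) (N x)"
      using L1.eventually_seminorm_less[OF p(1), of 1 x]
      by (auto simp: N_def eventually_inf_principal elim: eventually_mono)
    then show "\<forall>\<^sub>F a in N x. r (f a - f x) < 1"
    proof eventually_elim
      case (elim a)
      then show ?case
        using p(2)[OF D_diff[OF _ x, of a]] f_diff[OF _ x, of a] by simp
    qed
  qed
  \<comment> \<open>Both sides are limits of the same function along the product of the two
    traces.\<close>
  have g_add: "g (x + y) = g x + g y" for x y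
  proof -
    have ev: "\<forall>\<^sub>F z in N x \<times>\<^sub>F N y. fst z \<in> D \<and> snd z \<in> D"
      using eventually_prodI[OF N_D[of x] N_D[of y]] .
    have "((\<lambda>z. fst z + snd z) \<longlongrightarrow> x + y) (nhds x \<times>\<^sub>F nhds y)"
      using tendsto_add_Pair[of x y] by (simp add: nhds_prod)
    then have "((\<lambda>z. fst z + snd z) \<longlongrightarrow> x + y) (N x \<times>\<^sub>F N y)"
      by (rule tendsto_mono[rotated]) (auto simp: N_def intro: prod_filter_mono)
    then have "filterlim (\<lambda>z. fst z + snd z) (N (x + y)) (N x \<times>\<^sub>F N y)"
      unfolding N_def[of "x + y"] filterlim_inf filterlim_principal
      using ev by (auto elim!: eventually_mono intro: D)
    from filterlim_compose[OF g this]
    have 1: "((\<lambda>z. f (fst z + snd z)) \<longlongrightarrow> g (x + y)) (N x \<times>\<^sub>F N y)" .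
    have "((\<lambda>z. f (fst z) + f (snd z)) \<longlongrightarrow> g x + g y) (N x \<times>\<^sub>F N y)"
      by (intro tendsto_add filterlim_compose[OF g] filterlim_fst filterlim_snd)
    moreover have "\<forall>\<^sub>F z in N x \<times>\<^sub>F N y. f (fst z) + f (snd z) = f (fst z + snd z)"
      using ev by eventually_elim (simp add: f)
    ultimately have 2: "((\<lambda>z. f (fst z + snd z)) \<longlongrightarrow> g x + g y) (N x \<times>\<^sub>F N y)"
      by (rule Lim_transform_eventually)
    show ?thesis
      by (rule tendsto_unique[OF _ 1 2]) (simp add: prod_filter_eq_bot N_bot)
  qed
  have g_scale: "g (s1 c x) = s2 c (g x)" for c x
  proof -
    have "(s1 c \<longlongrightarrow> s1 c x) (nhds x)"
      using L1.continuous_scale_right[of c]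
      by (simp add: continuous_on_eq_continuous_at isCont_def tendsto_at_iff_tendsto_nhds)
    then have "(s1 c \<longlongrightarrow> s1 c x) (N x)"
      by (rule tendsto_mono[rotated]) (simp add: N_def)
    then have "filterlim (s1 c) (N (s1 c x)) (N x)"
      unfolding N_def[of "s1 c x"] filterlim_inf filterlim_principal
      using N_D[of x] by (auto elim!: eventually_mono intro: D)
    from filterlim_compose[OF g this]
    have 1: "((\<lambda>a. f (s1 c a)) \<longlongrightarrow> g (s1 c x)) (N x)" .
    have "isCont (s2 c) (g x)"
      using L2.continuous_scale_right[of c] by (simp add: continuous_on_eq_continuous_at)
    then have "((\<lambda>a. s2 c (f a)) \<longlongrightarrow> s2 c (g x)) (N x)"
      by (rule isCont_tendsto_compose[OF _ g])
    moreover have "\<forall>\<^sub>F a in N x. s2 c (f a) = f (s1 c a)"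
      using N_D[of x] by eventually_elim (simp add: f)
    ultimately have 2: "((\<lambda>a. f (s1 c a)) \<longlongrightarrow> s2 c (g x)) (N x)"
      by (rule Lim_transform_eventually)
    show ?thesis by (rule tendsto_unique[OF N_bot 1 2])
  qed
  have "continuous_linear s1 s2 g"
  proof (rule continuous_linearI)
    show "locally_convex_space s1" "locally_convex_space s2" by (rule lc)+
    show "g (x + y) = g x + g y" for x y by (rule g_add)
    show "g (s1 c x) = s2 c (g x)" for c x by (rule g_scale)
    fix r assume r: "continuous_seminorm s2 r"
    from bound[OF r] obtain p where p: "continuous_seminorm s1 p" "\<forall>x\<in>D. r (f x) \<le> p x" by blast
    have "\<forall>x. r (g x) \<le> p x" using bound'[OF r p] by simp
    then show "\<exists>p. continuous_seminorm s1 p \<and> (\<forall>x. r (g x) \<le> p x)" using p(1) by blast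
  qed
  then show ?thesis using that g_D by blast
qed

section \<open>Completions of spaces of functionals\<close>

definition function_module :: "('k::comm_ring_1, 'f \<Rightarrow> 'k, 'm) module_scheme \<Rightarrow> bool" where
  "function_module E \<longleftrightarrow> add E = (\<lambda>s t \<phi>. s \<phi> + t \<phi>) \<and> smult E = (\<lambda>c t \<phi>. c * t \<phi>) \<and> zero E = (\<lambda>\<phi>. 0) \<and>
     (\<lambda>\<phi>. 0) \<in> carrier E \<and> (\<forall>s\<in>carrier E. \<forall>t\<in>carrier E. (\<lambda>\<phi>. s \<phi> + t \<phi>) \<in> carrier E) \<and>
     (\<forall>c. \<forall>t\<in>carrier E. (\<lambda>\<phi>. c * t \<phi>) \<in> carrier E)"

text \<open>The negative in a record structure is a definite description and has to be identified
  with the pointwise one before balls in \<open>seminorm_topology\<close> can be computed.\<close>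

lemma function_module_minus:
  assumes E: "function_module E" and xy: "x \<in> carrier E" "y \<in> carrier E"
  shows "y \<ominus>\<^bsub>E\<^esub> x = (\<lambda>\<phi>. y \<phi> - x \<phi>)" "(\<lambda>\<phi>. y \<phi> - x \<phi>) \<in> carrier E"
proof -
  have m: "(\<lambda>\<phi>. - x \<phi>) \<in> carrier E"
    using E xy(1) unfolding function_module_def by (metis (no_types, lifting) ext mult_minus1)
  have "\<ominus>\<^bsub>E\<^esub> x = (\<lambda>\<phi>. - x \<phi>)"
    unfolding a_inv_def m_inv_def
    by (rule the_equality) (use E xy m in \<open>auto simp: function_module_def fun_eq_iff eq_neg_iff_add_eq_0 add.commute\<close>)
  then show "y \<ominus>\<^bsub>E\<^esub> x = (\<lambda>\<phi>. y \<phi> - x \<phi>)"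
    using E by (simp add: a_minus_def function_module_def)
  show "(\<lambda>\<phi>. y \<phi> - x \<phi>) \<in> carrier E"
    using E xy(2) m unfolding function_module_def by fastforce
qed

definition seminorm_on :: "('k::real_normed_field, 'f \<Rightarrow> 'k, 'm) module_scheme \<Rightarrow> (('f \<Rightarrow> 'k) \<Rightarrow> real) \<Rightarrow> bool" where
  "seminorm_on E p \<longleftrightarrow>
     (\<forall>s\<in>carrier E. \<forall>t\<in>carrier E. p (\<lambda>\<phi>. s \<phi> + t \<phi>) \<le> p s + p t) \<and>
     (\<forall>c. \<forall>t\<in>carrier E. p (\<lambda>\<phi>. c * t \<phi>) = norm c * p t)"

lemma seminorm_onD:
  assumes "function_module E" "seminorm_on E p" "s \<in> carrier E"
  shows "t \<in> carrier E \<Longrightarrow> p (\<lambda>\<phi>. s \<phi> + t \<phi>) \<le> p s + p t" "p (\<lambda>\<phi>. c * s \<phi>) = norm c * p s" "p s \<ge> 0" "p (\<lambda>\<phi>. 0) = 0"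
proof -
  show 1: "t \<in> carrier E \<Longrightarrow> p (\<lambda>\<phi>. s \<phi> + t \<phi>) \<le> p s + p t" for t
    using assms by (simp add: seminorm_on_def)
  show 2: "p (\<lambda>\<phi>. c * s \<phi>) = norm c * p s" for c
    using assms by (simp add: seminorm_on_def)
  have m: "(\<lambda>\<phi>. (- 1) * s \<phi>) \<in> carrier E"
    using assms(1,3) unfolding function_module_def by blast
  show "p (\<lambda>\<phi>. 0) = 0" using 2[of 0] by simp
  then show "p s \<ge> 0" using 1[OF m] 2[of "-1"] by simp
qed

text \<open>Directedness makes the balls of single seminorms a neighbourhood base, and
  \<open>nontrivial\<close> serves to exclude an empty family P.\<close>

locale completion =
  fixes E :: "('k::real_normed_field, 'f \<Rightarrow> 'k, 'm) module_scheme"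
    and P :: "(('f \<Rightarrow> 'k) \<Rightarrow> real) set"
    and scaleH :: "'k \<Rightarrow> 'h::{uniform_topological_group_add,ab_group_add,complete_uniform_space,t2_space} \<Rightarrow> 'h"
    and j :: "('f \<Rightarrow> 'k) \<Rightarrow> 'h"
  assumes completion: "is_completion E P scaleH j"
    and module: "function_module E"
    and seminorms: "p \<in> P \<Longrightarrow> seminorm_on E p"
    and directed: "p \<in> P \<Longrightarrow> q \<in> P \<Longrightarrow> \<exists>r\<in>P. \<forall>x\<in>carrier E. p x \<le> r x \<and> q x \<le> r x"
    and nontrivial: "P = {} \<Longrightarrow> \<exists>x\<in>carrier E. x \<noteq> (\<lambda>\<phi>. 0)"
begin

sublocale locally_convex_space scaleH
  using completion by (simp add: is_completion_def)

lemma closed: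
  "(\<lambda>\<phi>. 0) \<in> carrier E" "s \<in> carrier E \<Longrightarrow> t \<in> carrier E \<Longrightarrow> (\<lambda>\<phi>. s \<phi> + t \<phi>) \<in> carrier E"
  "t \<in> carrier E \<Longrightarrow> (\<lambda>\<phi>. c * t \<phi>) \<in> carrier E"
  using module by (auto simp: function_module_def)

lemma j_add: "s \<in> carrier E \<Longrightarrow> t \<in> carrier E \<Longrightarrow> j (\<lambda>\<phi>. s \<phi> + t \<phi>) = j s + j t"
  using completion module by (simp add: is_completion_def function_module_def)

lemma j_scale: "t \<in> carrier E \<Longrightarrow> j (\<lambda>\<phi>. c * t \<phi>) = scaleH c (j t)"
  using completion module by (simp add: is_completion_def function_module_def)

lemma j_zero: "j (\<lambda>\<phi>. 0) = 0"
  using j_scale[OF closed(1), of 0] by simp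

lemma dense: "closure (j ` carrier E) = UNIV"
  using completion by (simp add: is_completion_def)

lemma embedding: "embedding_map (seminorm_topology E P) euclidean j"
  using completion by (simp add: is_completion_def)

lemma topspace: "topspace (seminorm_topology E P) = carrier E"
  unfolding seminorm_topology_def topology_generated_by_topspace by auto

lemma inj: "inj_on j (carrier E)"
  using embedding_imp_closed_map_eq[of "seminorm_topology E P" euclidean j] embedding
    homeomorphic_imp_injective_map[of "seminorm_topology E P" _ j]
  by (auto simp: embedding_map_def topspace)

text \<open>The balls only generate the topology, so the proof follows the generation: directedness
  deals with intersections, and the triangle inequality shifts the centre of a ball to x.\<close>

lemma basic_neighbourhood:
  assumes "openin (seminorm_topology E P) W" "x \<in> W" "P \<noteq> {}"
  shows "\<exists>p\<in>P. \<exists>e>0. \<forall>y\<in>carrier E. p (\<lambda>\<phi>. y \<phi> - x \<phi>) < e \<longrightarrow> y \<in> W"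
proof -
  let ?B = "insert (carrier E) {{y \<in> carrier E. p (y \<ominus>\<^bsub>E\<^esub> x) < e} | x p e. x \<in> carrier E \<and> p \<in> P \<and> e > 0}"
  have "generate_topology_on ?B W"
    using assms(1) by (simp add: seminorm_topology_def openin_topology_generated_by_iff)
  then show ?thesis using assms(2)
  proof (induction arbitrary: x rule: generate_topology_on.induct)
    case (Int a b)
    obtain p e where 1: "p \<in> P" "e > 0" "\<forall>y\<in>carrier E. p (\<lambda>\<phi>. y \<phi> - x \<phi>) < e \<longrightarrow> y \<in> a"
      using Int.IH(1)[of x] Int.prems by auto
    obtain q d where 2: "q \<in> P" "d > 0" "\<forall>y\<in>carrier E. q (\<lambda>\<phi>. y \<phi> - x \<phi>) < d \<longrightarrow> y \<in> b"
      using Int.IH(2)[of x] Int.prems by auto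
    obtain r where r: "r \<in> P" "\<forall>x\<in>carrier E. p x \<le> r x \<and> q x \<le> r x" using directed 1 2 by blast
    have "generate_topology_on ?B (a \<inter> b)" by (rule generate_topology_on.Int) (use Int in auto)
    then have "openin (seminorm_topology E P) (a \<inter> b)"
      by (simp add: seminorm_topology_def openin_topology_generated_by_iff)
    then have "x \<in> carrier E" using Int.prems openin_subset topspace by fastforce
    then have "\<forall>y\<in>carrier E. r (\<lambda>\<phi>. y \<phi> - x \<phi>) < min e d \<longrightarrow> y \<in> a \<inter> b"
    proof (intro ballI impI)
      fix y assume y: "y \<in> carrier E" "r (\<lambda>\<phi>. y \<phi> - x \<phi>) < min e d"
      have "(\<lambda>\<phi>. y \<phi> - x \<phi>) \<in> carrier E"
        by (rule function_module_minus(2)[OF module \<open>x \<in> carrier E\<close> y(1)])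
      then have "p (\<lambda>\<phi>. y \<phi> - x \<phi>) < e" "q (\<lambda>\<phi>. y \<phi> - x \<phi>) < d"
        using r(2) y(2) by (auto intro: le_less_trans)
      then show "y \<in> a \<inter> b" using 1(3) 2(3) y(1) by blast
    qed
    then show ?case using r(1) 1(2) 2(2) by (intro bexI[of _ r] exI[of _ "min e d"]) auto
  next
    case (UN K)
    then obtain k where k: "k \<in> K" "x \<in> k" by blast
    from UN.IH[OF k] obtain p e where "p \<in> P" "e > 0" "\<forall>y\<in>carrier E. p (\<lambda>\<phi>. y \<phi> - x \<phi>) < e \<longrightarrow> y \<in> k"
      by blast
    then show ?case using k(1) by blast
  next
    case (Basis s)
    from Basis(1) consider "s = carrier E" |
      x0 p e where "s = {y \<in> carrier E. p (y \<ominus>\<^bsub>E\<^esub> x0) < e}" "x0 \<in> carrier E" "p \<in> P" "e > 0" by blast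
    then show ?case
    proof cases
      case 1
      obtain p where "p \<in> P" using assms(3) by blast
      then show ?thesis using 1 by (intro bexI[of _ p] exI[of _ 1]) auto
    next
      case 2
      have x: "x \<in> carrier E" "p (\<lambda>\<phi>. x \<phi> - x0 \<phi>) < e"
        using Basis(2) 2 function_module_minus[OF module] by auto
      have "y \<in> s" if y: "y \<in> carrier E" "p (\<lambda>\<phi>. y \<phi> - x \<phi>) < e - p (\<lambda>\<phi>. x \<phi> - x0 \<phi>)" for y
      proof -
        have "p (\<lambda>\<phi>. y \<phi> - x0 \<phi>) \<le> p (\<lambda>\<phi>. y \<phi> - x \<phi>) + p (\<lambda>\<phi>. x \<phi> - x0 \<phi>)"
          using seminorm_onD(1)[OF module seminorms[OF 2(3)] function_module_minus(2)[OF module x(1) y(1)]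
              function_module_minus(2)[OF module 2(2) x(1)]] by simp
        then show ?thesis using y 2 function_module_minus(1)[OF module 2(2) y(1)] by simp
      qed
      then show ?thesis using x(2) 2(3) by (intro bexI[of _ p] exI[of _ "e - p (\<lambda>\<phi>. x \<phi> - x0 \<phi>)"]) auto
    qed
  qed simp
qed

lemma open_preimage: "open W \<Longrightarrow> openin (seminorm_topology E P) {x \<in> carrier E. j x \<in> W}"
  using openin_continuous_map_preimage[OF continuous_map_into_fulltopology[OF
      homeomorphic_imp_continuous_map[OF embedding[unfolded embedding_map_def]]], of W]
  by (simp add: topspace)

text \<open>Otherwise only the empty set and the carrier would be open, whereas an open set of the
  Hausdorff completion separates the image of 0 from that of another vector.\<close>

lemma P_nonempty: "P \<noteq> {}"
proof
  assume P: "P = {}"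
  then obtain x where x: "x \<in> carrier E" "x \<noteq> (\<lambda>\<phi>. 0)" using nontrivial by blast
  then have "j x \<noteq> 0" using inj closed(1) j_zero by (metis inj_onD)
  then obtain W where W: "open W" "0 \<in> W" "j x \<notin> W" by (metis separation_t1)
  have all: "W' = {} \<or> W' = carrier E" if "generate_topology_on {carrier E} W'" for W'
    using that
  proof induction
    case (UN K)
    show ?case
    proof (cases "\<exists>k\<in>K. k = carrier E")
      case True
      have "\<Union>K \<subseteq> carrier E" using UN.IH by blast
      then show ?thesis using True by blast
    next
      case False
      then have "\<forall>k\<in>K. k = {}" using UN.IH by blast
      then show ?thesis by blast
    qed
  qed auto
  have "generate_topology_on {carrier E} {x \<in> carrier E. j x \<in> W}"
    using open_preimage[OF W(1)] by (simp add: seminorm_topology_def P openin_topology_generated_by_iff)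
  from all[OF this] show False
    using W x closed(1) j_zero by auto
qed

text \<open>Together with \<open>seminorm_le\<close> this is the dictionary between the defining
  seminorms and the continuous seminorms of the completion, through which all later estimates
  pass.\<close>

lemma continuous_seminorm_le:
  assumes r: "continuous_seminorm scaleH r"
  obtains p C where "p \<in> P" "C \<ge> 0" "\<And>x. x \<in> carrier E \<Longrightarrow> r (j x) \<le> C * p x"
proof -
  have "open {y. r (y - 0) < 1}" by (rule continuous_seminorm_open[OF r])
  then have "openin (seminorm_topology E P) {x \<in> carrier E. j x \<in> {y. r (y - 0) < 1}}"
    by (rule open_preimage)
  then obtain p e where p: "p \<in> P" "e > 0" "\<And>y. y \<in> carrier E \<Longrightarrow> p y < e \<Longrightarrow> r (j y) < 1"
    using basic_neighbourhood[of "{x \<in> carrier E. j x \<in> {y. r (y - 0) < 1}}" "\<lambda>\<phi>. 0"] P_nonempty closed(1) j_zero r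
    by auto
  have "r (j x) \<le> (2 / e) * p x" if x: "x \<in> carrier E" for x
  proof (rule real_scaling_bound)
    show "p x \<ge> 0" by (rule seminorm_onD(3)[OF module seminorms[OF p(1)] x])
    fix t :: real assume t: "t > 0" "t * p x < e"
    then have "p (\<lambda>\<phi>. of_real t * x \<phi>) < e"
      by (simp add: seminorm_onD(2)[OF module seminorms[OF p(1)] x])
    then have "r (j (\<lambda>\<phi>. of_real t * x \<phi>)) < 1" by (intro p(3) closed x)
    then show "t * r (j x) < 1" using t x by (simp add: j_scale continuous_seminorm_scale[OF r])
  qed fact
  then show ?thesis using that[of p "2 / e"] p by auto
qed

text \<open>This direction needs that j is an embedding: the image of the ball of p is the trace of
  an open set of the completion, which contains a seminorm ball.\<close>

lemma seminorm_le:
  assumes p: "p \<in> P"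
  obtains r where "continuous_seminorm scaleH r" "\<And>x. x \<in> carrier E \<Longrightarrow> p x \<le> r (j x)"
proof -
  have "openin (seminorm_topology E P) {y \<in> carrier E. p (y \<ominus>\<^bsub>E\<^esub> (\<lambda>\<phi>. 0)) < 1}"
    unfolding seminorm_topology_def openin_topology_generated_by_iff
    by (rule generate_topology_on.Basis) (use p closed(1) in \<open>auto intro!: exI[of _ "\<lambda>\<phi>. 0"] exI[of _ p] exI[of _ 1]\<close>)
  then have "openin (seminorm_topology E P) {y \<in> carrier E. p y < 1}"
    using function_module_minus(1)[OF module closed(1)] by (simp cong: conj_cong)
  then have "openin (subtopology euclidean (j ` carrier E)) (j ` {y \<in> carrier E. p y < 1})"
    using embedding homeomorphic_imp_open_map[of "seminorm_topology E P" _ j]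
    by (auto simp: embedding_map_def open_map_def topspace)
  then obtain W where W: "open W" "j ` {y \<in> carrier E. p y < 1} = W \<inter> j ` carrier E"
    by (auto simp: openin_subtopology)
  have "(\<lambda>\<phi>. 0) \<in> {y \<in> carrier E. p y < 1}"
    using closed(1) seminorm_onD(4)[OF module seminorms[OF p] closed(1)] by simp
  then have "0 \<in> W" using W(2) j_zero by force
  then obtain r where r: "continuous_seminorm scaleH r" "{x. r x < 1} \<subseteq> W"
    using seminorm_neighbourhood[OF W(1)] by blast
  have small: "p x < 1" if "x \<in> carrier E" "r (j x) < 1" for x
  proof -
    have "j x \<in> j ` {y \<in> carrier E. p y < 1}" using W(2) r that by auto
    then show ?thesis using inj that(1) by (auto dest: inj_onD)
  qed
  have "p x \<le> (2 / 1) * r (j x)" if x: "x \<in> carrier E" for x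
  proof (rule real_scaling_bound)
    fix t :: real assume t: "t > 0" "t * r (j x) < 1"
    then have "r (j (\<lambda>\<phi>. of_real t * x \<phi>)) < 1"
      using x by (simp add: j_scale continuous_seminorm_scale[OF r(1)])
    then have "p (\<lambda>\<phi>. of_real t * x \<phi>) < 1" by (intro small closed x)
    then show "t * p x < 1" using t by (simp add: seminorm_onD(2)[OF module seminorms[OF p] x])
  qed (use continuous_seminorm_nonneg[OF r(1)] in auto)
  then show ?thesis using that[of "\<lambda>x. 2 * r x"] continuous_seminorm_mult[OF r(1)] by simp
qed

end

section \<open>Projective tensor powers\<close>

lemma function_module_tensor_power: "function_module (tensor_power M n)"
  by (auto simp: function_module_def carrier_tensor_power lspan_add lspan_scale)

lemma function_module_symmetric: "function_module (symmetric_tensors M)"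
  by (auto simp: function_module_def carrier_symmetric_tensors lspan_add lspan_scale)

lemma function_module_tensor_algebra: "function_module (tensor_algebra M)"
  by (auto simp: function_module_def carrier_tensor_algebra lspan_add lspan_scale)

text \<open>A representation as a finite sum of words of length n; \<open>projective_power\<close>
  is the infimum of \<open>rep_cost\<close> over these.\<close>

definition tensor_rep :: "('k::field, 'a, 'm) module_scheme \<Rightarrow> nat \<Rightarrow> ('k \<times> 'a list) list \<Rightarrow> bool" where
  "tensor_rep M n L \<longleftrightarrow> (\<forall>(c, xs)\<in>set L. length xs = n \<and> set xs \<subseteq> carrier M)"

definition rep_cost :: "('a \<Rightarrow> real) \<Rightarrow> ('k::real_normed_field \<times> 'a list) list \<Rightarrow> real" where
  "rep_cost p L = (\<Sum>(c, xs)\<leftarrow>L. norm c * prod_list (map p xs))"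

lemma tensor_rep_append: "tensor_rep M n (L @ L') \<longleftrightarrow> tensor_rep M n L \<and> tensor_rep M n L'"
  unfolding tensor_rep_def by (simp add: ball_Un)

lemma tensor_rep_Cons: "tensor_rep M n ((c, xs) # L) \<longleftrightarrow> length xs = n \<and> set xs \<subseteq> carrier M \<and> tensor_rep M n L"
  by (auto simp: tensor_rep_def)

lemma tensor_sum_append: "tensor_sum M (L @ L') = (\<lambda>\<phi>. tensor_sum M L \<phi> + tensor_sum M L' \<phi>)"
  by (simp add: tensor_sum_def)

lemma tensor_sum_Cons: "tensor_sum M ((c, xs) # L) = (\<lambda>\<phi>. c * tensor M xs \<phi> + tensor_sum M L \<phi>)"
  by (simp add: tensor_sum_def)

lemma tensor_sum_Nil: "tensor_sum M [] = (\<lambda>\<phi>. 0)"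
  by (simp add: tensor_sum_def)

lemma tensor_sum_map_scale: "tensor_sum M (map (\<lambda>(d, xs). (c * d, xs)) L) = (\<lambda>\<phi>. c * tensor_sum M L \<phi>)"
  by (induction L) (auto simp: tensor_sum_Nil tensor_sum_Cons algebra_simps)

lemma tensor_rep_map_scale: "tensor_rep M n (map (\<lambda>(d, xs). (c * d, xs)) L) \<longleftrightarrow> tensor_rep M n L"
  by (auto simp: tensor_rep_def)

lemma rep_cost_append: "rep_cost p (L @ L') = rep_cost p L + rep_cost p L'"
  by (simp add: rep_cost_def)

lemma rep_cost_map_scale: "rep_cost p (map (\<lambda>(d, xs). (c * d, xs)) L) = norm c * rep_cost p L"
  by (induction L) (auto simp: rep_cost_def norm_mult algebra_simps)

lemma tensor_power_rep:
  "t \<in> carrier (tensor_power M n) \<longleftrightarrow> (\<exists>L. tensor_rep M n L \<and> t = tensor_sum M L)"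
  by (auto simp: tensor_power_def tensor_rep_def)

lemma projective_power_alt:
  "projective_power M p n t = Inf {rep_cost p L | L. tensor_rep M n L \<and> t = tensor_sum M L}"
  by (simp add: projective_power_def tensor_rep_def rep_cost_def)

lemma prod_list_map_nonneg: "(\<And>x. x \<in> set xs \<Longrightarrow> (0::real) \<le> p x) \<Longrightarrow> 0 \<le> prod_list (map p xs)"
  by (induction xs) auto

lemma prod_list_map_mono:
  "(\<And>x. x \<in> set xs \<Longrightarrow> (0::real) \<le> p x \<and> p x \<le> q x) \<Longrightarrow> prod_list (map p xs) \<le> prod_list (map q xs)"
proof (induction xs)
  case (Cons x xs)
  then show ?case using prod_list_map_nonneg[of xs p] by (auto intro!: mult_mono intro: order_trans)
qed simp

lemma rep_cost_nonneg: "(\<And>x. 0 \<le> p x) \<Longrightarrow> 0 \<le> rep_cost p L"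
  by (induction L) (auto simp: rep_cost_def intro!: add_nonneg_nonneg mult_nonneg_nonneg prod_list_map_nonneg)

lemma projective_power_le:
  assumes "\<And>x. 0 \<le> p x" "tensor_rep M n L"
  shows "projective_power M p n (tensor_sum M L) \<le> rep_cost p L"
  unfolding projective_power_alt
  by (rule cInf_lower) (use assms rep_cost_nonneg[of p] in \<open>auto simp: bdd_below_def intro!: exI[of _ 0]\<close>)

lemma projective_power_greatest:
  assumes "t \<in> carrier (tensor_power M n)" "\<And>L. tensor_rep M n L \<Longrightarrow> t = tensor_sum M L \<Longrightarrow> r \<le> rep_cost p L"
  shows "r \<le> projective_power M p n t"
  unfolding projective_power_alt
  by (rule cInf_greatest) (use assms tensor_power_rep in blast)+

lemma projective_power_nonneg:
  assumes "\<And>x. 0 \<le> p x" "t \<in> carrier (tensor_power M n)"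
  shows "0 \<le> projective_power M p n t"
  by (rule projective_power_greatest[OF assms(2)]) (rule rep_cost_nonneg[OF assms(1)])

lemma projective_power_zero:
  assumes "\<And>x. 0 \<le> p x"
  shows "projective_power M p n (\<lambda>\<phi>. 0) = 0"
proof (rule antisym)
  show "projective_power M p n (\<lambda>\<phi>. 0) \<le> 0"
    using projective_power_le[of p M n "[]", OF assms] by (simp add: tensor_rep_def tensor_sum_Nil rep_cost_def)
  show "0 \<le> projective_power M p n (\<lambda>\<phi>. 0)"
    by (rule projective_power_nonneg[OF assms]) (simp add: carrier_tensor_power)
qed

lemma projective_power_add:
  assumes p: "\<And>x. 0 \<le> p x" and s: "s \<in> carrier (tensor_power M n)" and t: "t \<in> carrier (tensor_power M n)"
  shows "projective_power M p n (\<lambda>\<phi>. s \<phi> + t \<phi>) \<le> projective_power M p n s + projective_power M p n t"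
proof -
  have "projective_power M p n (\<lambda>\<phi>. s \<phi> + t \<phi>) - projective_power M p n s \<le> rep_cost p L'"
    if L': "tensor_rep M n L'" "t = tensor_sum M L'" for L'
  proof -
    have "projective_power M p n (\<lambda>\<phi>. s \<phi> + t \<phi>) - rep_cost p L' \<le> rep_cost p L"
      if "tensor_rep M n L" "s = tensor_sum M L" for L
      using projective_power_le[of p M n "L @ L'", OF p] that L'
      by (simp add: tensor_rep_append tensor_sum_append rep_cost_append)
    then have "projective_power M p n (\<lambda>\<phi>. s \<phi> + t \<phi>) - rep_cost p L' \<le> projective_power M p n s"
      by (rule projective_power_greatest[OF s])
    then show ?thesis by simp
  qed
  then have "projective_power M p n (\<lambda>\<phi>. s \<phi> + t \<phi>) - projective_power M p n s \<le> projective_power M p n t"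
    by (rule projective_power_greatest[OF t])
  then show ?thesis by simp
qed

lemma projective_power_scale:
  assumes p: "\<And>x. 0 \<le> p x" and t: "t \<in> carrier (tensor_power M n)"
  shows "projective_power M p n (\<lambda>\<phi>. c * t \<phi>) = norm c * projective_power M p n t"
proof (cases "c = 0")
  case True
  then show ?thesis by (simp add: projective_power_zero[of p, OF p])
next
  case c: False
  have le: "projective_power M p n (\<lambda>\<phi>. c * t \<phi>) \<le> norm c * projective_power M p n t"
    if c: "c \<noteq> 0" and t: "t \<in> carrier (tensor_power M n)" for c t
  proof -
    have "projective_power M p n (\<lambda>\<phi>. c * t \<phi>) / norm c \<le> projective_power M p n t"
    proof (rule projective_power_greatest[OF t])
      fix L assume L: "tensor_rep M n L" "t = tensor_sum M L"
      have "projective_power M p n (\<lambda>\<phi>. c * t \<phi>) \<le> norm c * rep_cost p L"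
        using projective_power_le[of p M n "map (\<lambda>(d, xs). (c * d, xs)) L", OF p] L
        by (simp add: tensor_rep_map_scale tensor_sum_map_scale rep_cost_map_scale)
      then show "projective_power M p n (\<lambda>\<phi>. c * t \<phi>) / norm c \<le> rep_cost p L"
        using c by (simp add: field_simps)
    qed
    then show ?thesis using c by (simp add: field_simps)
  qed
  have "projective_power M p n t = projective_power M p n (\<lambda>\<phi>. inverse c * (c * t \<phi>))"
    using c by (simp add: mult.assoc[symmetric])
  also have "\<dots> \<le> norm (inverse c) * projective_power M p n (\<lambda>\<phi>. c * t \<phi>)"
    using c t by (intro le) (auto simp: carrier_tensor_power lspan_scale)
  finally have "norm c * projective_power M p n t \<le> projective_power M p n (\<lambda>\<phi>. c * t \<phi>)"
    using c by (simp add: norm_inverse norm_divide field_simps)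
  then show ?thesis using le[OF c t] by simp
qed

lemma seminorm_on_projective_power:
  "(\<And>x. 0 \<le> p x) \<Longrightarrow> seminorm_on (tensor_power M n) (projective_power M p n)"
  by (simp add: seminorm_on_def projective_power_add projective_power_scale)

lemma projective_power_tensor:
  assumes "\<And>x. 0 \<le> p x" "length xs = n" "set xs \<subseteq> carrier M"
  shows "projective_power M p n (tensor M xs) \<le> prod_list (map p xs)"
  using projective_power_le[of p M n "[(1, xs)]", OF assms(1)] assms(2,3)
  by (simp add: tensor_rep_def tensor_sum_Cons tensor_sum_Nil rep_cost_def)

text \<open>The universal property of the projective seminorm: by subadditivity a bound on words
  carries over to the cost of every representation, and hence to the infimum.\<close>

lemma seminorm_le_projective_power:
  assumes \<rho>: "seminorm_on (tensor_power M n) \<rho>" and K: "K \<ge> 0"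
    and words: "\<And>xs. length xs = n \<Longrightarrow> set xs \<subseteq> carrier M \<Longrightarrow> \<rho> (tensor M xs) \<le> K * prod_list (map p xs)"
    and t: "t \<in> carrier (tensor_power M n)" and p: "\<And>x. 0 \<le> p x"
  shows "\<rho> t \<le> K * projective_power M p n t"
proof -
  have rep: "\<rho> (tensor_sum M L) \<le> K * rep_cost p L" if "tensor_rep M n L" for L
    using that
  proof (induction L)
    case Nil
    show ?case
      using seminorm_onD(4)[OF function_module_tensor_power \<rho> t] by (simp add: tensor_sum_Nil rep_cost_def)
  next
    case (Cons a L)
    obtain c xs where a: "a = (c, xs)" by fastforce
    have xs: "length xs = n" "set xs \<subseteq> carrier M" "tensor_rep M n L"
      using Cons.prems by (auto simp: a tensor_rep_Cons)
    have cl: "tensor M xs \<in> carrier (tensor_power M n)" "tensor_sum M L \<in> carrier (tensor_power M n)"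
      using xs by (auto simp: carrier_tensor_power intro!: lspan_base) (use xs(3) in \<open>auto simp: tensor_power_rep carrier_tensor_power[symmetric]\<close>)
    have "\<rho> (tensor_sum M (a # L)) \<le> norm c * \<rho> (tensor M xs) + \<rho> (tensor_sum M L)"
      using seminorm_onD(1)[OF function_module_tensor_power \<rho>, of "\<lambda>\<phi>. c * tensor M xs \<phi>" "tensor_sum M L"]
        seminorm_onD(2)[OF function_module_tensor_power \<rho> cl(1), of c] cl
      by (simp add: a tensor_sum_Cons carrier_tensor_power lspan_scale)
    also have "\<dots> \<le> norm c * (K * prod_list (map p xs)) + K * rep_cost p L"
      using xs Cons.IH by (intro add_mono mult_left_mono words) auto
    also have "\<dots> = K * rep_cost p (a # L)" by (simp add: a rep_cost_def algebra_simps)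
    finally show ?case .
  qed
  show ?thesis
  proof (cases "K = 0")
    \<comment> \<open>Division by K is impossible here, but the bound from a single representation
      already reads \<rho> t \<le> 0.\<close>
    case True
    obtain L where "tensor_rep M n L" "t = tensor_sum M L" using t tensor_power_rep by blast
    then show ?thesis using rep True by fastforce
  next
    case False
    have "\<rho> t / K \<le> projective_power M p n t"
      using t by (rule projective_power_greatest) (use rep K False in \<open>auto simp: field_simps\<close>)
    then show ?thesis using K False by (simp add: field_simps)
  qed
qed

lemma projective_power_mono:
  assumes "\<And>x. 0 \<le> p x" "\<And>x. p x \<le> q x" "t \<in> carrier (tensor_power M n)"
  shows "projective_power M p n t \<le> projective_power M q n t"
proof -
  have q: "0 \<le> q x" for x using assms(1,2) order_trans by blast
  have "projective_power M p n t \<le> 1 * projective_power M q n t"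
  proof (rule seminorm_le_projective_power[OF seminorm_on_projective_power[OF assms(1)] _ _ assms(3) q])
    show "projective_power M p n (tensor M xs) \<le> 1 * prod_list (map q xs)"
      if "length xs = n" "set xs \<subseteq> carrier M" for xs
      using projective_power_tensor[of p xs n M] prod_list_map_mono[of xs p q] assms(1,2) that by fastforce
  qed simp
  then show ?thesis by simp
qed

lemma completion_tensor_power:
  assumes lc: "locally_convex_space s" and c: "is_completed_tensor_power s n sN jN"
  shows "completion (tensor_power (vec_mod s) n) {projective_power (vec_mod s) p n | p. continuous_seminorm s p} sN jN"
proof
  interpret locally_convex_space s by fact
  let ?P = "{projective_power (vec_mod s) p n | p. continuous_seminorm s p}"
  show "is_completion (tensor_power (vec_mod s) n) ?P sN jN"
    using c by (simp add: is_completed_tensor_power_def)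
  show "function_module (tensor_power (vec_mod s) n)" by (rule function_module_tensor_power)
  show "seminorm_on (tensor_power (vec_mod s) n) p" if "p \<in> ?P" for p
    using that continuous_seminorm_nonneg by (auto intro: seminorm_on_projective_power)
  show "\<exists>r\<in>?P. \<forall>x\<in>carrier (tensor_power (vec_mod s) n). p x \<le> r x \<and> q x \<le> r x"
    if pq: "p \<in> ?P" "q \<in> ?P" for p q
  proof -
    obtain p' q' where *: "continuous_seminorm s p'" "continuous_seminorm s q'"
      "p = projective_power (vec_mod s) p' n" "q = projective_power (vec_mod s) q' n" using pq by blast
    have "projective_power (vec_mod s) (\<lambda>x. p' x + q' x) n \<in> ?P"
      using continuous_seminorm_add *(1,2) by blast
    then show ?thesis
      using continuous_seminorm_nonneg[OF *(1)] continuous_seminorm_nonneg[OF *(2)]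
      by (auto intro!: bexI[of _ "projective_power (vec_mod s) (\<lambda>x. p' x + q' x) n"] projective_power_mono simp: *)
  qed
  show "\<exists>x\<in>carrier (tensor_power (vec_mod s) n). x \<noteq> (\<lambda>\<phi>. 0)" if "?P = {}"
    using that continuous_seminorm_const by blast
qed

section \<open>Continuous multilinear maps on completed tensor squares\<close>

lemma locally_convex_space_field: "locally_convex_space ((*) :: 'k::real_normed_field \<Rightarrow> 'k \<Rightarrow> 'k)"
proof (rule locally_convex_space.intro[OF vector_space_field], unfold_locales)
  show "continuous_on UNIV (\<lambda>(c :: 'k, x). c * x)"
    by (auto simp: case_prod_unfold intro!: continuous_intros)
next
  fix W :: "'k set" assume "open W" "0 \<in> W"
  then obtain e where e: "e > 0" "ball 0 e \<subseteq> W" by (auto simp: open_contains_ball)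
  have "continuous_seminorm (*) (\<lambda>x :: 'k. norm x / e)"
    unfolding continuous_seminorm_def seminorm_def using e(1)
    by (auto simp: norm_mult add_divide_distrib[symmetric] divide_right_mono norm_triangle_ineq intro!: continuous_intros)
  moreover have "{x :: 'k. norm x / e < 1} \<subseteq> W"
    using e by (auto simp: ball_def dist_norm field_simps)
  ultimately show "\<exists>p. continuous_seminorm (*) p \<and> {x. p x < 1} \<subseteq> W" by blast
qed

lemma continuous_seminorm_norm: "continuous_seminorm ((*) :: 'k::real_normed_field \<Rightarrow> 'k \<Rightarrow> 'k) norm"
  by (auto simp: continuous_seminorm_def seminorm_def norm_mult norm_triangle_ineq intro!: continuous_intros)

lemma linear_functional_separates:
  assumes "vector_space s" "v \<noteq> (0 :: 'v::ab_group_add)"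
  obtains f where "\<And>x y. f (x + y) = f x + f y" "\<And>c x. f (s c x) = (c::'k::field) * f x" "f v \<noteq> 0"
proof -
  interpret V: vector_space s by fact
  interpret VP: vector_space_pair s "(*) :: 'k \<Rightarrow> 'k \<Rightarrow> 'k"
    by (rule vector_space_pair.intro[OF assms(1) vector_space_field])
  have "V.independent {v}" using assms(2) by simp
  then obtain f where "Vector_Spaces.linear s (*) f" "\<forall>x\<in>{v}. f x = (1::'k)"
    using VP.linear_independent_extend[of "{v}" "\<lambda>_. 1"] by blast
  then show ?thesis using that[of f] VP.linear_add VP.linear_scale by force
qed

text \<open>Joint continuity is replaced by an estimate with a product of seminorms, the form in
  which it can be compared with projective seminorms.\<close>

definition bounded_bilinear_map ::
  "('k::real_normed_field \<Rightarrow> 'a::{ab_group_add,topological_space} \<Rightarrow> 'a) \<Rightarrow>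
   ('k \<Rightarrow> 'b::{ab_group_add,topological_space} \<Rightarrow> 'b) \<Rightarrow>
   ('k \<Rightarrow> 'c::{ab_group_add,topological_space} \<Rightarrow> 'c) \<Rightarrow> ('a \<Rightarrow> 'b \<Rightarrow> 'c) \<Rightarrow> bool" where
  "bounded_bilinear_map s1 s2 s3 f \<longleftrightarrow>
     (\<forall>x y w. f (x + y) w = f x w + f y w) \<and> (\<forall>x y w. f w (x + y) = f w x + f w y) \<and>
     (\<forall>c x w. f (s1 c x) w = s3 c (f x w)) \<and> (\<forall>c x w. f w (s2 c x) = s3 c (f w x)) \<and>
     (\<forall>r. continuous_seminorm s3 r \<longrightarrow>
        (\<exists>p q. continuous_seminorm s1 p \<and> continuous_seminorm s2 q \<and> (\<forall>x y. r (f x y) \<le> p x * q y)))"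

lemma bounded_bilinear_mapD:
  assumes "bounded_bilinear_map s1 s2 s3 f"
  shows "f (x + y) w = f x w + f y w" "f w' (x' + y') = f w' x' + f w' y'"
    "f (s1 c x) w = s3 c (f x w)" "f w' (s2 c x') = s3 c (f w' x')"
  using assms by (auto simp: bounded_bilinear_map_def)

lemma bounded_bilinear_map_bound:
  assumes "bounded_bilinear_map s1 s2 s3 f" "continuous_seminorm s3 r"
  obtains p q where "continuous_seminorm s1 p" "continuous_seminorm s2 q" "\<And>x y. r (f x y) \<le> p x * q y"
  using assms unfolding bounded_bilinear_map_def by blast

lemma bounded_bilinear_map_continuous:
  assumes "locally_convex_space s1" "locally_convex_space s2" "locally_convex_space s3" "bounded_bilinear_map s1 s2 s3 f"
  shows "continuous_bilinear s1 s2 s3 f"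
proof (rule continuous_bilinearI[OF assms(1-3)])
  fix r assume r: "continuous_seminorm s3 r"
  show "\<exists>p q. continuous_seminorm s1 p \<and> continuous_seminorm s2 q \<and> (\<forall>x y. r (f x y) \<le> p x * q y)"
    using assms(4) r unfolding bounded_bilinear_map_def by blast
qed (use bounded_bilinear_mapD[OF assms(4)] in auto)

lemma bounded_bilinear_map_left:
  assumes f: "bounded_bilinear_map s1 s2 s3 f" and g: "continuous_linear s0 s1 g"
  shows "bounded_bilinear_map s0 s2 s3 (\<lambda>x y. f (g x) y)"
  unfolding bounded_bilinear_map_def
proof (intro conjI allI impI)
  fix r assume "continuous_seminorm s3 r"
  then obtain p q where "continuous_seminorm s1 p" "continuous_seminorm s2 q" "\<And>x y. r (f x y) \<le> p x * q y"
    using bounded_bilinear_map_bound[OF f] by blast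
  then show "\<exists>p q. continuous_seminorm s0 p \<and> continuous_seminorm s2 q \<and> (\<forall>x y. r (f (g x) y) \<le> p x * q y)"
    using continuous_linear_seminorm[OF g] by blast
qed (simp_all add: continuous_linearD[OF g] bounded_bilinear_mapD[OF f])

lemma bounded_bilinear_map_right:
  assumes f: "bounded_bilinear_map s1 s2 s3 f" and g: "continuous_linear s0 s2 g"
  shows "bounded_bilinear_map s1 s0 s3 (\<lambda>x y. f x (g y))"
  unfolding bounded_bilinear_map_def
proof (intro conjI allI impI)
  fix r assume "continuous_seminorm s3 r"
  then obtain p q where "continuous_seminorm s1 p" "continuous_seminorm s2 q" "\<And>x y. r (f x y) \<le> p x * q y"
    using bounded_bilinear_map_bound[OF f] by blast
  then show "\<exists>p q. continuous_seminorm s1 p \<and> continuous_seminorm s0 q \<and> (\<forall>x y. r (f x (g y)) \<le> p x * q y)"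
    using continuous_linear_seminorm[OF g] by blast
qed (simp_all add: continuous_linearD[OF g] bounded_bilinear_mapD[OF f])

lemma bounded_bilinear_map_swap:
  assumes "bounded_bilinear_map s1 s2 s3 f"
  shows "bounded_bilinear_map s2 s1 s3 (\<lambda>x y. f y x)"
  using assms unfolding bounded_bilinear_map_def by (simp add: mult.commute) (metis mult.commute)

lemma bounded_bilinear_map_scale:
  assumes lc: "locally_convex_space s"
  shows "bounded_bilinear_map (*) s s (\<lambda>c x. s (c::'k::real_normed_field) x)"
proof -
  interpret locally_convex_space s by fact
  show ?thesis
    unfolding bounded_bilinear_map_def
  proof (intro conjI allI impI)
    fix r assume r: "continuous_seminorm s r"
    then show "\<exists>p q. continuous_seminorm (*) p \<and> continuous_seminorm s q \<and> (\<forall>(x::'k) y. r (s x y) \<le> p x * q y)"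
      using continuous_seminorm_norm continuous_seminorm_scale[OF r]
      by (intro exI[of _ norm] exI[of _ r]) simp
  qed (auto simp: algebra_simps scale_left_distrib scale_right_distrib)
qed

locale tensor_square = locally_convex_space scaleH
  for scaleH :: "'k::real_normed_field \<Rightarrow>
        'h::{uniform_topological_group_add,ab_group_add,complete_uniform_space,t2_space} \<Rightarrow> 'h" +
  fixes scaleH2 :: "'k \<Rightarrow>
        'h2::{uniform_topological_group_add,ab_group_add,complete_uniform_space,t2_space} \<Rightarrow> 'h2"
    and j2 :: "('k, 'h) tensor \<Rightarrow> 'h2"
  assumes square: "is_completed_tensor_power scaleH 2 scaleH2 j2"
begin

abbreviation "MH \<equiv> vec_mod scaleH"

definition tens2 :: "'h \<Rightarrow> 'h \<Rightarrow> 'h2" where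
  "tens2 x y = j2 (tensor MH [x, y])"

sublocale C2: completion "tensor_power MH 2" "{projective_power MH p 2 | p. continuous_seminorm scaleH p}" scaleH2 j2
  by (rule completion_tensor_power[OF locally_convex_space_axioms square])

lemma pair_closed: "tensor MH [x, y] \<in> carrier (tensor_power MH 2)"
  unfolding carrier_tensor_power by (rule lspan_base) simp

text \<open>The constant C is absorbed into the seminorm by passing from p to (C + 1) p, as C \<le>
  (C + 1)^2.\<close>

lemma tens2_bound:
  assumes "continuous_seminorm scaleH2 r"
  obtains p where "continuous_seminorm scaleH p"
    "\<And>t. t \<in> carrier (tensor_power MH 2) \<Longrightarrow> r (j2 t) \<le> projective_power MH p 2 t"
    "\<And>x y. r (tens2 x y) \<le> p x * p y"
proof -
  obtain q C where C: "q \<in> {projective_power MH p 2 | p. continuous_seminorm scaleH p}" "C \<ge> 0"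
      "\<And>t. t \<in> carrier (tensor_power MH 2) \<Longrightarrow> r (j2 t) \<le> C * q t"
    using C2.continuous_seminorm_le[OF assms] by blast
  then obtain p where p: "continuous_seminorm scaleH p" "q = projective_power MH p 2" by blast
  define p' where "p' x = (C + 1) * p x" for x
  have p': "continuous_seminorm scaleH p'"
    unfolding p'_def by (rule continuous_seminorm_mult[OF p(1)]) (use C in simp)
  have nn: "0 \<le> p x" "0 \<le> p' x" for x using continuous_seminorm_nonneg p(1) p' by auto
  have words: "C * projective_power MH p 2 (tensor MH xs) \<le> 1 * prod_list (map p' xs)"
    if len: "length xs = 2" "set xs \<subseteq> carrier MH" for xs
  proof -
    obtain x y where xs: "xs = [x, y]" using len by (auto simp: numeral_2_eq_2 length_Suc_conv)
    have "C * projective_power MH p 2 (tensor MH xs) \<le> C * (p x * p y)"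
      using projective_power_tensor[of p xs 2 MH] nn len C by (intro mult_left_mono) (auto simp: xs)
    also have "\<dots> \<le> (C + 1) * (C + 1) * (p x * p y)"
      using nn C by (intro mult_right_mono) (auto simp: algebra_simps)
    also have "\<dots> = 1 * prod_list (map p' xs)" by (simp add: xs p'_def)
    finally show ?thesis .
  qed
  have sem: "seminorm_on (tensor_power MH 2) (\<lambda>t. C * projective_power MH p 2 t)"
    using seminorm_on_projective_power[of p MH 2] nn C(2)
    by (auto simp: seminorm_on_def distrib_left[symmetric] mult_left_mono)
  have b: "r (j2 t) \<le> projective_power MH p' 2 t" if t: "t \<in> carrier (tensor_power MH 2)" for t
    using C(3)[OF t] seminorm_le_projective_power[OF sem _ words t nn(2)] p(2) by simp
  have "r (tens2 x y) \<le> p' x * p' y" for x y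
    using b[OF pair_closed[of x y]] projective_power_tensor[of p' "[x, y]" 2 MH] nn by (simp add: tens2_def)
  then show ?thesis using that[OF p' b] by blast
qed

lemma tens2_linear:
  "tens2 (x + y) w = tens2 x w + tens2 y w" "tens2 w (x + y) = tens2 w x + tens2 w y"
  "tens2 (scaleH c x) w = scaleH2 c (tens2 x w)" "tens2 w (scaleH c x) = scaleH2 c (tens2 w x)"
proof -
  have "tensor MH [x + y, w] = (\<lambda>\<phi>. tensor MH [x, w] \<phi> + tensor MH [y, w] \<phi>)"
    "tensor MH [w, x + y] = (\<lambda>\<phi>. tensor MH [w, x] \<phi> + tensor MH [w, y] \<phi>)"
    "tensor MH [scaleH c x, w] = (\<lambda>\<phi>. c * tensor MH [x, w] \<phi>)"
    "tensor MH [w, scaleH c x] = (\<lambda>\<phi>. c * tensor MH [w, x] \<phi>)"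
    using multilinear_formD[of MH _ "[]" "[w]"] multilinear_formD[of MH _ "[w]" "[]"]
    by (auto simp: tensor_def fun_eq_iff)
  then show "tens2 (x + y) w = tens2 x w + tens2 y w" "tens2 w (x + y) = tens2 w x + tens2 w y"
    "tens2 (scaleH c x) w = scaleH2 c (tens2 x w)" "tens2 w (scaleH c x) = scaleH2 c (tens2 w x)"
    by (simp_all add: tens2_def C2.j_add C2.j_scale pair_closed)
qed

lemma tens2_dense_eq:
  assumes f: "continuous_linear scaleH2 s3 f" and g: "continuous_linear scaleH2 s3 g"
    and eq: "\<And>x y. f (tens2 x y) = g (tens2 x y)"
  shows "f \<tau> = (g \<tau> :: 'c::{ab_group_add,t2_space})"
proof (rule continuous_eq_on_dense[OF continuous_linearD(3)[OF f] continuous_linearD(3)[OF g] C2.dense])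
  fix v assume "v \<in> j2 ` carrier (tensor_power MH 2)"
  then obtain t where t: "t \<in> carrier (tensor_power MH 2)" "v = j2 t" by blast
  have "f (j2 t) = g (j2 t)"
    using t(1) unfolding carrier_tensor_power
  proof (induction rule: lspan_induct)
    case zero
    show ?case by (simp add: C2.j_zero continuous_linear_0[OF f] continuous_linear_0[OF g])
  next
    case (add c xs t)
    obtain x y where xs: "xs = [x, y]" using add(1) by (auto simp: numeral_2_eq_2 length_Suc_conv)
    have "j2 (\<lambda>\<phi>. c * tensor MH xs \<phi> + t \<phi>) = scaleH2 c (tens2 x y) + j2 t"
      using add.hyps pair_closed[of x y]
      by (simp add: C2.j_add C2.j_scale C2.closed carrier_tensor_power xs tens2_def lspan_scale)
    then show ?case
      using add.IH eq by (simp add: continuous_linearD[OF f] continuous_linearD[OF g])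
  qed
  then show "f v = g v" by (simp add: t)
qed

text \<open>The universal property of the completed tensor square. The quantitative clause is there
  for \<open>tensor_square_extension_param\<close>, where K varies with the parameters.\<close>

lemma tensor_square_extension:
  fixes s3 :: "'k \<Rightarrow> 'c::{uniform_topological_group_add,ab_group_add,complete_uniform_space,t2_space} \<Rightarrow> 'c"
  assumes lc3: "locally_convex_space s3" and b: "bounded_bilinear_map scaleH scaleH s3 b"
  obtains B where "continuous_linear scaleH2 s3 B" "\<And>x y. B (tens2 x y) = b x y"
    "\<And>r p K t. continuous_seminorm s3 r \<Longrightarrow> continuous_seminorm scaleH p \<Longrightarrow> K \<ge> 0 \<Longrightarrow>
      (\<And>x y. r (b x y) \<le> K * (p x * p y)) \<Longrightarrow> t \<in> carrier (tensor_power MH 2) \<Longrightarrow>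
      r (B (j2 t)) \<le> K * projective_power MH p 2 t"
proof -
  interpret L3: locally_convex_space s3 by fact
  define val where "val L = (\<Sum>(c, xs)\<leftarrow>L. s3 c (b (xs ! 0) (xs ! 1)))" for L
  \<comment> \<open>If two representations of one tensor had different values, a linear functional
    would distinguish these; composed with b it would be a bilinear form at which the two sums
    differ.\<close>
  have val_unique: "val L = val L'"
    if "tensor_rep MH 2 L" "tensor_rep MH 2 L'" "tensor_sum MH L = tensor_sum MH L'" for L L'
  proof (rule ccontr)
    assume "val L \<noteq> val L'"
    then have "val L - val L' \<noteq> 0" by simp
    then obtain f where f: "\<And>x y. f (x + y) = f x + f y" "\<And>c x. f (s3 c x) = c * f x" "f (val L - val L') \<noteq> 0"
      using linear_functional_separates[OF L3.vector_space_axioms] by blast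
    have f0: "f 0 = 0" using f(2)[of 0 0] by simp
    define \<psi> where "\<psi> = (\<lambda>xs. if length xs = 2 then f (b (xs ! 0) (xs ! 1)) else 0)"
    have ml: "multilinear_form MH \<psi>"
      unfolding \<psi>_def by (rule multilinear_form_pair) (auto simp: bounded_bilinear_mapD[OF b] f)
    have eval: "tensor_sum MH L \<psi> = f (val L)" if "tensor_rep MH 2 L" for L
      using that
    proof (induction L)
      case (Cons a L)
      obtain c xs where a: "a = (c, xs)" by fastforce
      show ?case using Cons ml by (simp add: a tensor_sum_Cons tensor_rep_Cons val_def f \<psi>_def)
    qed (simp add: tensor_sum_Nil val_def f0)
    have "f (val L) = f (val L')" using eval that by metis
    then show False using f(1)[of "val L - val L'" "val L'"] f(3) by simp
  qed
  define F where "F t = val (SOME L. tensor_rep MH 2 L \<and> t = tensor_sum MH L)" for t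
  have F: "F (tensor_sum MH L) = val L" if "tensor_rep MH 2 L" for L
  proof -
    have "\<exists>L'. tensor_rep MH 2 L' \<and> tensor_sum MH L = tensor_sum MH L'" using that by blast
    from someI_ex[OF this] show ?thesis
      unfolding F_def by (intro val_unique) (use that in auto)
  qed
  have F_add: "F (\<lambda>\<phi>. s \<phi> + t \<phi>) = F s + F t" and F_scale: "F (\<lambda>\<phi>. c * s \<phi>) = s3 c (F s)"
    if st: "s \<in> carrier (tensor_power MH 2)" "t \<in> carrier (tensor_power MH 2)" for s t c
  proof -
    obtain L L' where L: "tensor_rep MH 2 L" "s = tensor_sum MH L" "tensor_rep MH 2 L'" "t = tensor_sum MH L'"
      using st unfolding tensor_power_rep by blast
    show "F (\<lambda>\<phi>. s \<phi> + t \<phi>) = F s + F t"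
      using F[of "L @ L'"] F L by (simp add: tensor_sum_append tensor_rep_append val_def)
    have "val (map (\<lambda>(d, xs). (c * d, xs)) L) = s3 c (val L)"
      by (induction L) (auto simp: val_def L3.scale_right_distrib)
    then show "F (\<lambda>\<phi>. c * s \<phi>) = s3 c (F s)"
      using F[of "map (\<lambda>(d, xs). (c * d, xs)) L"] F[of L] L by (simp add: tensor_sum_map_scale tensor_rep_map_scale)
  qed
  have F_pair: "F (tensor MH [x, y]) = b x y" for x y
    using F[of "[(1, [x, y])]"] by (simp add: tensor_sum_Cons tensor_sum_Nil tensor_rep_def val_def)
  have F_bound: "r (F t) \<le> K * projective_power MH p 2 t"
    if r: "continuous_seminorm s3 r" and p: "continuous_seminorm scaleH p" and K: "K \<ge> 0"
      and bd: "\<And>x y. r (b x y) \<le> K * (p x * p y)" and t: "t \<in> carrier (tensor_power MH 2)" for r p K t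
  proof (rule seminorm_le_projective_power[OF _ K _ t])
    show "seminorm_on (tensor_power MH 2) (\<lambda>t. r (F t))"
      using L3.continuous_seminorm_triangle[OF r] L3.continuous_seminorm_scale[OF r]
      by (simp add: seminorm_on_def F_add F_scale)
    show "r (F (tensor MH xs)) \<le> K * prod_list (map p xs)" if len: "length xs = 2" for xs
    proof -
      obtain x y where "xs = [x, y]" using len by (auto simp: numeral_2_eq_2 length_Suc_conv)
      then show ?thesis using bd[of x y] by (simp add: F_pair)
    qed
  qed (rule continuous_seminorm_nonneg[OF p])
  define f where "f v = F (inv_into (carrier (tensor_power MH 2)) j2 v)" for v
  have f: "f (j2 t) = F t" if "t \<in> carrier (tensor_power MH 2)" for t
    using that by (simp add: f_def inv_into_f_f[OF C2.inj])
  let ?D = "j2 ` carrier (tensor_power MH 2)"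
  obtain B where B: "continuous_linear scaleH2 s3 B" "\<And>v. v \<in> ?D \<Longrightarrow> B v = f v"
  proof (rule linear_extension[OF C2.locally_convex_space_axioms lc3, of ?D f])
    show "x + y \<in> ?D" if "x \<in> ?D" "y \<in> ?D" for x y
      using that C2.closed(2) by (auto simp flip: C2.j_add)
    show "scaleH2 c x \<in> ?D" if "x \<in> ?D" for c x
      using that C2.closed(3) by (auto simp flip: C2.j_scale)
    show "closure ?D = UNIV" by (rule C2.dense)
    show "f (x + y) = f x + f y" if "x \<in> ?D" "y \<in> ?D" for x y
      using that C2.closed(2) by (auto simp flip: C2.j_add simp: f F_add)
    show "f (scaleH2 c x) = s3 c (f x)" if "x \<in> ?D" for c x
      using that C2.closed(3) by (auto simp flip: C2.j_scale simp: f F_scale)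
    fix r assume r: "continuous_seminorm s3 r"
    obtain p q where pq: "continuous_seminorm scaleH p" "continuous_seminorm scaleH q" "\<And>x y. r (b x y) \<le> p x * q y"
      using bounded_bilinear_map_bound[OF b r] by blast
    let ?p = "\<lambda>x. p x + q x"
    have p: "continuous_seminorm scaleH ?p" by (rule continuous_seminorm_add[OF pq(1,2)])
    have "r (b x y) \<le> 1 * (?p x * ?p y)" for x y
    proof -
      have "p x * q y \<le> ?p x * ?p y"
        using continuous_seminorm_nonneg pq by (intro mult_mono) auto
      then show ?thesis using pq(3)[of x y] by simp
    qed
    then have 1: "r (F t) \<le> projective_power MH ?p 2 t" if "t \<in> carrier (tensor_power MH 2)" for t
      using F_bound[OF r p, of 1 t] that by simp
    obtain r2 where r2: "continuous_seminorm scaleH2 r2"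
        "\<And>t. t \<in> carrier (tensor_power MH 2) \<Longrightarrow> projective_power MH ?p 2 t \<le> r2 (j2 t)"
      using C2.seminorm_le[of "projective_power MH ?p 2"] p by blast
    then show "\<exists>p. continuous_seminorm scaleH2 p \<and> (\<forall>x\<in>?D. r (f x) \<le> p x)"
    proof (intro exI[of _ r2] conjI ballI r2(1))
      fix x assume "x \<in> ?D"
      then obtain t where t: "t \<in> carrier (tensor_power MH 2)" "x = j2 t" by blast
      show "r (f x) \<le> r2 x"
        using order_trans[OF 1[OF t(1)] r2(2)[OF t(1)]] by (simp add: t(2) f[OF t(1)])
    qed
  qed blast
  show ?thesis
  proof (rule that[OF B(1)])
    show "B (tens2 x y) = b x y" for x y
      using B(2)[of "tens2 x y"] f[OF pair_closed] pair_closed by (simp add: tens2_def F_pair)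
    show "r (B (j2 t)) \<le> K * projective_power MH p 2 t"
      if "continuous_seminorm s3 r" "continuous_seminorm scaleH p" "K \<ge> 0"
        "\<And>x y. r (b x y) \<le> K * (p x * p y)" "t \<in> carrier (tensor_power MH 2)" for r p K t
      using F_bound[OF that] B(2) f that(5) by simp
  qed
qed

text \<open>For fixed parameters b is extended by \<open>tensor_square_extension\<close>. By density
  of the elementary tensors the extensions depend linearly on the parameters, and taking K = q v *
  q' w gives a bound with one seminorm on the square for all parameters.\<close>

lemma tensor_square_extension_param:
  fixes s3 :: "'k \<Rightarrow> 'c::{uniform_topological_group_add,ab_group_add,complete_uniform_space,t2_space} \<Rightarrow> 'c"
    and b :: "'h \<Rightarrow> 'h \<Rightarrow> 'v::{topological_group_add,ab_group_add,t2_space} \<Rightarrow> 'w::{topological_group_add,ab_group_add,t2_space} \<Rightarrow> 'c"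
  assumes lc: "locally_convex_space s3" "locally_convex_space sv" "locally_convex_space sw"
    and add: "\<And>x y u v w. b (x + y) u v w = b x u v w + b y u v w" "\<And>x y u v w. b u (x + y) v w = b u x v w + b u y v w"
      "\<And>x y u v w. b u v (x + y) w = b u v x w + b u v y w" "\<And>x y u v w. b u v w (x + y) = b u v w x + b u v w y"
    and scale: "\<And>c x u v w. b (scaleH c x) u v w = s3 c (b x u v w)" "\<And>c x u v w. b u (scaleH c x) v w = s3 c (b u x v w)"
      "\<And>c x u v w. b u v (sv c x) w = s3 c (b u v x w)" "\<And>c x u v w. b u v w (sw c x) = s3 c (b u v w x)"
    and bound: "\<And>r. continuous_seminorm s3 r \<Longrightarrow> \<exists>p q q'. continuous_seminorm scaleH p \<and> continuous_seminorm sv q \<and>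
      continuous_seminorm sw q' \<and> (\<forall>x y v w. r (b x y v w) \<le> (q v * q' w) * (p x * p y))"
  obtains B where
    "\<And>x y v w. B (x + y) v w = B x v w + B y v w" "\<And>c x v w. B (scaleH2 c x) v w = s3 c (B x v w)"
    "\<And>x y \<tau> w. B \<tau> (x + y) w = B \<tau> x w + B \<tau> y w" "\<And>c x \<tau> w. B \<tau> (sv c x) w = s3 c (B \<tau> x w)"
    "\<And>x y \<tau> v. B \<tau> v (x + y) = B \<tau> v x + B \<tau> v y" "\<And>c x \<tau> v. B \<tau> v (sw c x) = s3 c (B \<tau> v x)"
    "\<And>x y v w. B (tens2 x y) v w = b x y v w"
    "\<And>r. continuous_seminorm s3 r \<Longrightarrow> \<exists>p q q'. continuous_seminorm scaleH2 p \<and> continuous_seminorm sv q \<and>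
      continuous_seminorm sw q' \<and> (\<forall>\<tau> v w. r (B \<tau> v w) \<le> p \<tau> * (q v * q' w))"
proof -
  interpret L3: locally_convex_space s3 by fact
  interpret LV: locally_convex_space sv by fact
  interpret LW: locally_convex_space sw by fact
  have bil: "bounded_bilinear_map scaleH scaleH s3 (\<lambda>x y. b x y v w)" for v w
    unfolding bounded_bilinear_map_def
  proof (intro conjI allI impI)
    fix r assume "continuous_seminorm s3 r"
    then obtain p q q' where *: "continuous_seminorm scaleH p" "continuous_seminorm sv q" "continuous_seminorm sw q'"
      "\<forall>x y v w. r (b x y v w) \<le> (q v * q' w) * (p x * p y)" using bound by blast
    have "continuous_seminorm scaleH (\<lambda>x. (q v * q' w) * p x)"
      using * LV.continuous_seminorm_nonneg LW.continuous_seminorm_nonneg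
      by (intro continuous_seminorm_mult mult_nonneg_nonneg) auto
    then show "\<exists>p q. continuous_seminorm scaleH p \<and> continuous_seminorm scaleH q \<and> (\<forall>x y. r (b x y v w) \<le> p x * q y)"
      using * by (intro exI[of _ "\<lambda>x. (q v * q' w) * p x"] exI[of _ p]) (auto simp: mult.assoc)
  qed (auto simp: add scale)
  have "\<exists>B. continuous_linear scaleH2 s3 B \<and> (\<forall>x y. B (tens2 x y) = b x y v w) \<and>
      (\<forall>r p K t. continuous_seminorm s3 r \<longrightarrow> continuous_seminorm scaleH p \<longrightarrow> K \<ge> 0 \<longrightarrow>
        (\<forall>x y. r (b x y v w) \<le> K * (p x * p y)) \<longrightarrow> t \<in> carrier (tensor_power MH 2) \<longrightarrow>
        r (B (j2 t)) \<le> K * projective_power MH p 2 t)" for v w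
    using tensor_square_extension[OF lc(1) bil[of v w]] by metis
  then obtain B' where B': "\<And>v w. continuous_linear scaleH2 s3 (B' v w)" "\<And>v w x y. B' v w (tens2 x y) = b x y v w"
      "\<And>v w r p K t. continuous_seminorm s3 r \<Longrightarrow> continuous_seminorm scaleH p \<Longrightarrow> K \<ge> 0 \<Longrightarrow>
        (\<And>x y. r (b x y v w) \<le> K * (p x * p y)) \<Longrightarrow> t \<in> carrier (tensor_power MH 2) \<Longrightarrow>
        r (B' v w (j2 t)) \<le> K * projective_power MH p 2 t"
    by metis
  have cl_add: "continuous_linear scaleH2 s3 (\<lambda>\<tau>. f \<tau> + g \<tau>)"
    if f: "continuous_linear scaleH2 s3 f" and g: "continuous_linear scaleH2 s3 g" for f g
  proof (rule continuous_linearI[OF C2.locally_convex_space_axioms lc(1)])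
    fix r assume r: "continuous_seminorm s3 r"
    show "\<exists>p. continuous_seminorm scaleH2 p \<and> (\<forall>x. r (f x + g x) \<le> p x)"
      by (intro exI[of _ "\<lambda>x. r (f x) + r (g x)"] conjI allI C2.continuous_seminorm_add
          continuous_linear_seminorm[OF f r] continuous_linear_seminorm[OF g r] L3.continuous_seminorm_triangle[OF r])
  qed (auto simp: continuous_linearD[OF f] continuous_linearD[OF g] L3.scale_right_distrib)
  have cl_scale: "continuous_linear scaleH2 s3 (\<lambda>\<tau>. s3 c (f \<tau>))"
    if f: "continuous_linear scaleH2 s3 f" for f c
  proof (rule continuous_linearI[OF C2.locally_convex_space_axioms lc(1)])
    fix r assume r: "continuous_seminorm s3 r"
    show "\<exists>p. continuous_seminorm scaleH2 p \<and> (\<forall>x. r (s3 c (f x)) \<le> p x)"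
      by (intro exI[of _ "\<lambda>x. norm c * r (f x)"] conjI allI C2.continuous_seminorm_mult
          continuous_linear_seminorm[OF f r]) (auto simp: L3.continuous_seminorm_scale[OF r])
  qed (auto simp: continuous_linearD[OF f] L3.scale_right_distrib mult.commute)
  have B'_lin: "B' (v + v') w \<tau> = B' v w \<tau> + B' v' w \<tau>" "B' (sv c v) w \<tau> = s3 c (B' v w \<tau>)"
    "B' v (w + w') \<tau> = B' v w \<tau> + B' v w' \<tau>" "B' v (sw c w) \<tau> = s3 c (B' v w \<tau>)" for v v' w w' c \<tau>
  proof -
    show "B' (v + v') w \<tau> = B' v w \<tau> + B' v' w \<tau>"
      by (rule tens2_dense_eq[OF B'(1) cl_add[OF B'(1) B'(1)]]) (simp add: B'(2) add)
    show "B' (sv c v) w \<tau> = s3 c (B' v w \<tau>)"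
      by (rule tens2_dense_eq[OF B'(1) cl_scale[OF B'(1)]]) (simp add: B'(2) scale)
    show "B' v (w + w') \<tau> = B' v w \<tau> + B' v w' \<tau>"
      by (rule tens2_dense_eq[OF B'(1) cl_add[OF B'(1) B'(1)]]) (simp add: B'(2) add)
    show "B' v (sw c w) \<tau> = s3 c (B' v w \<tau>)"
      by (rule tens2_dense_eq[OF B'(1) cl_scale[OF B'(1)]]) (simp add: B'(2) scale)
  qed
  show ?thesis
  proof (rule that[of "\<lambda>\<tau> v w. B' v w \<tau>"])
    fix r assume r: "continuous_seminorm s3 r"
    then obtain p q q' where *: "continuous_seminorm scaleH p" "continuous_seminorm sv q" "continuous_seminorm sw q'"
      "\<And>x y v w. r (b x y v w) \<le> (q v * q' w) * (p x * p y)" using bound by blast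
    obtain r2 where r2: "continuous_seminorm scaleH2 r2"
        "\<And>t. t \<in> carrier (tensor_power MH 2) \<Longrightarrow> projective_power MH p 2 t \<le> r2 (j2 t)"
      using C2.seminorm_le[of "projective_power MH p 2"] *(1) by blast
    have nn: "0 \<le> q v * q' w" for v w
      using * LV.continuous_seminorm_nonneg LW.continuous_seminorm_nonneg by (intro mult_nonneg_nonneg) auto
    have "r (B' v w \<tau>) \<le> (q v * q' w) * r2 \<tau>" for \<tau> v w
    proof (rule continuous_linear_bound_dense[OF B'(1) r C2.continuous_seminorm_mult[OF r2(1) nn] C2.dense])
      fix x assume "x \<in> j2 ` carrier (tensor_power MH 2)"
      then obtain t where t: "t \<in> carrier (tensor_power MH 2)" "x = j2 t" by blast
      have "r (B' v w (j2 t)) \<le> (q v * q' w) * projective_power MH p 2 t"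
        by (rule B'(3)[OF r *(1) nn *(4) t(1)])
      also have "\<dots> \<le> (q v * q' w) * r2 (j2 t)" by (intro mult_left_mono r2 t nn)
      finally show "r (B' v w x) \<le> (q v * q' w) * r2 x" by (simp add: t)
    qed
    then show "\<exists>p q q'. continuous_seminorm scaleH2 p \<and> continuous_seminorm sv q \<and>
      continuous_seminorm sw q' \<and> (\<forall>\<tau> v w. r (B' v w \<tau>) \<le> p \<tau> * (q v * q' w))"
      using r2(1) *(2,3) by (intro exI[of _ r2] exI[of _ q] exI[of _ q']) (auto simp: mult.commute)
  qed (auto simp: B'(2) B'_lin continuous_linearD[OF B'(1)])
qed

text \<open>The case of one parameter; the second one is a scalar multiplying the value, set to 1 at
  the end.\<close>

lemma tensor_square_extension1:
  fixes s3 :: "'k \<Rightarrow> 'c::{uniform_topological_group_add,ab_group_add,complete_uniform_space,t2_space} \<Rightarrow> 'c"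
    and b :: "'h \<Rightarrow> 'h \<Rightarrow> 'v::{topological_group_add,ab_group_add,t2_space} \<Rightarrow> 'c"
  assumes lc: "locally_convex_space s3" "locally_convex_space sv"
    and add: "\<And>x y u v. b (x + y) u v = b x u v + b y u v" "\<And>x y u v. b u (x + y) v = b u x v + b u y v"
      "\<And>x y u v. b u v (x + y) = b u v x + b u v y"
    and scale: "\<And>c x u v. b (scaleH c x) u v = s3 c (b x u v)" "\<And>c x u v. b u (scaleH c x) v = s3 c (b u x v)"
      "\<And>c x u v. b u v (sv c x) = s3 c (b u v x)"
    and bound: "\<And>r. continuous_seminorm s3 r \<Longrightarrow> \<exists>p q. continuous_seminorm scaleH p \<and> continuous_seminorm sv q \<and>
      (\<forall>x y v. r (b x y v) \<le> q v * (p x * p y))"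
  obtains B where "bounded_bilinear_map scaleH2 sv s3 B" "\<And>x y v. B (tens2 x y) v = b x y v"
proof -
  interpret L3: locally_convex_space s3 by fact
  obtain B where B:
    "\<And>x y v w. B (x + y) v w = B x v w + B y v w" "\<And>c x v w. B (scaleH2 c x) v w = s3 c (B x v w)"
    "\<And>x y \<tau> w. B \<tau> (x + y) w = B \<tau> x w + B \<tau> y w" "\<And>c x \<tau> w. B \<tau> (sv c x) w = s3 c (B \<tau> x w)"
    "\<And>x y \<tau> v. B \<tau> v (x + y) = B \<tau> v x + B \<tau> v y" "\<And>c x \<tau> v. B \<tau> v (c * x) = s3 c (B \<tau> v x)"
    "\<And>x y v w. B (tens2 x y) v w = s3 w (b x y v)"
    "\<And>r. continuous_seminorm s3 r \<Longrightarrow> \<exists>p q q'. continuous_seminorm scaleH2 p \<and> continuous_seminorm sv q \<and>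
      continuous_seminorm (*) q' \<and> (\<forall>\<tau> v w. r (B \<tau> v w) \<le> p \<tau> * (q v * q' w))"
  proof (rule tensor_square_extension_param[OF lc locally_convex_space_field, of "\<lambda>x y v w. s3 w (b x y v)"])
    fix r assume r: "continuous_seminorm s3 r"
    then obtain p q where *: "continuous_seminorm scaleH p" "continuous_seminorm sv q"
      "\<forall>x y v. r (b x y v) \<le> q v * (p x * p y)" using bound by blast
    have "r (s3 w (b x y v)) \<le> (q v * norm w) * (p x * p y)" for x y v w
      using mult_left_mono[OF *(3)[rule_format, of x y v], of "norm w"]
      by (simp add: L3.continuous_seminorm_scale[OF r] mult_ac)
    then show "\<exists>p q q'. continuous_seminorm scaleH p \<and> continuous_seminorm sv q \<and> continuous_seminorm (*) q' \<and>
        (\<forall>x y v w. r (s3 w (b x y v)) \<le> (q v * q' w) * (p x * p y))"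
      using *(1,2) continuous_seminorm_norm by (intro exI[of _ p] exI[of _ q] exI[of _ norm]) auto
  qed ((simp add: add scale L3.scale_right_distrib L3.scale_left_distrib mult.commute; fail) | blast)+
  have "bounded_bilinear_map scaleH2 sv s3 (\<lambda>\<tau> v. B \<tau> v 1)"
    unfolding bounded_bilinear_map_def
  proof (intro conjI allI impI)
    fix r assume "continuous_seminorm s3 r"
    then obtain p q q' where *: "continuous_seminorm scaleH2 p" "continuous_seminorm sv q" "continuous_seminorm (*) (q' :: 'k \<Rightarrow> real)"
      "\<forall>\<tau> v w. r (B \<tau> v w) \<le> p \<tau> * (q v * q' w)" using B(8) by blast
    have "0 \<le> q' 1" by (rule locally_convex_space.continuous_seminorm_nonneg[OF locally_convex_space_field *(3)])
    then have "continuous_seminorm scaleH2 (\<lambda>\<tau>. q' 1 * p \<tau>)" by (rule C2.continuous_seminorm_mult[OF *(1)])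
    then show "\<exists>p q. continuous_seminorm scaleH2 p \<and> continuous_seminorm sv q \<and> (\<forall>x y. r (B x y 1) \<le> p x * q y)"
      using *(2,4) by (intro exI[of _ "\<lambda>\<tau>. q' 1 * p \<tau>"] exI[of _ q]) (auto simp: mult_ac)
  qed (simp_all add: B(1-4))
  then show ?thesis using that B(7) by simp
qed

end

section \<open>Hopf algebras with a dense set of words\<close>

locale tensor_cube = tensor_square scaleH scaleH2 j2
  for scaleH :: "'k::{real_normed_field,banach} \<Rightarrow>
        'h::{uniform_topological_group_add,ab_group_add,complete_uniform_space,t2_space} \<Rightarrow> 'h"
    and scaleH2 :: "'k \<Rightarrow>
        'h2::{uniform_topological_group_add,ab_group_add,complete_uniform_space,t2_space} \<Rightarrow> 'h2"
    and j2 :: "('k, 'h) tensor \<Rightarrow> 'h2" +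
  fixes scaleH3 :: "'k \<Rightarrow>
        'h3::{uniform_topological_group_add,ab_group_add,complete_uniform_space,t2_space} \<Rightarrow> 'h3"
    and j3 :: "('k, 'h) tensor \<Rightarrow> 'h3"
  assumes cube: "is_completed_tensor_power scaleH 3 scaleH3 j3"
begin

sublocale C3: completion "tensor_power MH 3" "{projective_power MH p 3 | p. continuous_seminorm scaleH p}" scaleH3 j3
  by (rule completion_tensor_power[OF locally_convex_space_axioms cube])

definition tens3 :: "'h \<Rightarrow> 'h \<Rightarrow> 'h \<Rightarrow> 'h3" where
  "tens3 x y w = j3 (tensor MH [x, y, w])"

lemma triple_closed: "tensor MH [x, y, w] \<in> carrier (tensor_power MH 3)"
  unfolding carrier_tensor_power by (rule lspan_base) simp

lemma tens3_bound:
  assumes "continuous_seminorm scaleH3 r"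
  obtains p where "continuous_seminorm scaleH p" "\<And>x y w. r (tens3 x y w) \<le> p x * p y * p w"
proof -
  obtain q C where C: "q \<in> {projective_power MH p 3 | p. continuous_seminorm scaleH p}" "C \<ge> 0"
      "\<And>t. t \<in> carrier (tensor_power MH 3) \<Longrightarrow> r (j3 t) \<le> C * q t"
    using C3.continuous_seminorm_le[OF assms] by blast
  then obtain p where p: "continuous_seminorm scaleH p" "q = projective_power MH p 3" by blast
  have p': "continuous_seminorm scaleH (\<lambda>x. (C + 1) * p x)"
    by (rule continuous_seminorm_mult[OF p(1)]) (use C in simp)
  have nn: "0 \<le> p x" for x using continuous_seminorm_nonneg p(1) by auto
  have "r (tens3 x y w) \<le> ((C + 1) * p x) * ((C + 1) * p y) * ((C + 1) * p w)" for x y w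
  proof -
    have "r (tens3 x y w) \<le> C * projective_power MH p 3 (tensor MH [x, y, w])"
      using C(3)[OF triple_closed] p by (simp add: tens3_def)
    also have "\<dots> \<le> C * (p x * p y * p w)"
      using projective_power_tensor[of p "[x, y, w]" 3 MH] nn C(2) by (intro mult_left_mono) (auto simp: mult.assoc)
    also have "\<dots> \<le> ((C + 1) * (C + 1) * (C + 1)) * (p x * p y * p w)"
      using nn C(2) by (intro mult_right_mono mult_nonneg_nonneg) (auto simp: algebra_simps)
    finally show ?thesis by (simp add: mult_ac)
  qed
  then show ?thesis using that[OF p'] by blast
qed

lemma tens3_linear:
  "tens3 (x + y) v w = tens3 x v w + tens3 y v w" "tens3 v (x + y) w = tens3 v x w + tens3 v y w"
  "tens3 v w (x + y) = tens3 v w x + tens3 v w y"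
  "tens3 (scaleH c x) v w = scaleH3 c (tens3 x v w)" "tens3 v (scaleH c x) w = scaleH3 c (tens3 v x w)"
  "tens3 v w (scaleH c x) = scaleH3 c (tens3 v w x)"
proof -
  have "tensor MH [x + y, v, w] = (\<lambda>\<phi>. tensor MH [x, v, w] \<phi> + tensor MH [y, v, w] \<phi>)"
    "tensor MH [v, x + y, w] = (\<lambda>\<phi>. tensor MH [v, x, w] \<phi> + tensor MH [v, y, w] \<phi>)"
    "tensor MH [v, w, x + y] = (\<lambda>\<phi>. tensor MH [v, w, x] \<phi> + tensor MH [v, w, y] \<phi>)"
    "tensor MH [scaleH c x, v, w] = (\<lambda>\<phi>. c * tensor MH [x, v, w] \<phi>)"
    "tensor MH [v, scaleH c x, w] = (\<lambda>\<phi>. c * tensor MH [v, x, w] \<phi>)"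
    "tensor MH [v, w, scaleH c x] = (\<lambda>\<phi>. c * tensor MH [v, w, x] \<phi>)"
    using multilinear_formD[of MH _ "[]" "[v, w]"] multilinear_formD[of MH _ "[v]" "[w]"]
      multilinear_formD[of MH _ "[v, w]" "[]"]
    by (auto simp: tensor_def fun_eq_iff)
  then show "tens3 (x + y) v w = tens3 x v w + tens3 y v w" "tens3 v (x + y) w = tens3 v x w + tens3 v y w"
    "tens3 v w (x + y) = tens3 v w x + tens3 v w y"
    "tens3 (scaleH c x) v w = scaleH3 c (tens3 x v w)" "tens3 v (scaleH c x) w = scaleH3 c (tens3 v x w)"
    "tens3 v w (scaleH c x) = scaleH3 c (tens3 v w x)"
    by (simp_all add: tens3_def C3.j_add C3.j_scale triple_closed)
qed

text \<open>Continuous linear maps that agree on words agree everywhere (\<open>words\<close>), so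
  each axiom reduces to a law of \<open>split_sum\<close> and of concatenation. In identities with
  several variables, words are replaced by arbitrary elements one variable at a time.\<close>

lemma hopf_algebra_from_words:
  fixes e :: "'x list \<Rightarrow> 'h" and times :: "'h \<Rightarrow> 'h \<Rightarrow> 'h" and \<Delta> :: "'h \<Rightarrow> 'h2"
    and \<epsilon> :: "'h \<Rightarrow> 'k" and A :: "'h \<Rightarrow> 'h"
  assumes dense: "closure (span (range e)) = UNIV"
    and times: "bounded_bilinear_map scaleH scaleH scaleH times"
    and times_e: "\<And>xs ys. times (e xs) (e ys) = e (xs @ ys)"
    and \<Delta>: "continuous_linear scaleH scaleH2 \<Delta>"
    and \<Delta>_e: "\<And>xs. \<Delta> (e xs) = split_sum xs (\<lambda>a b. tens2 (e a) (e b))"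
    and \<epsilon>: "continuous_linear scaleH (*) \<epsilon>"
    and \<epsilon>_e: "\<And>xs. \<epsilon> (e xs) = (if xs = [] then 1 else 0)"
    and A: "continuous_linear scaleH scaleH A"
    and A_e: "\<And>xs. A (e xs) = scaleH ((- 1) ^ length xs) (e (rev xs))"
  shows "locally_convex_hopf_algebra scaleH scaleH2 j2 scaleH3 j3 times (e []) \<Delta> \<epsilon> A"
proof -
  note lc = locally_convex_space_axioms and lc2 = C2.locally_convex_space_axioms and lc3 = C3.locally_convex_space_axioms
  have words: "f x = g x" if f: "continuous_linear scaleH s f" and g: "continuous_linear scaleH s g"
    and eq: "\<And>xs. f (e xs) = g (e xs)" for f g x and s :: "'k \<Rightarrow> 'c::{ab_group_add,t2_space} \<Rightarrow> 'c"
  proof (rule continuous_eq_on_dense[OF continuous_linearD(3)[OF f] continuous_linearD(3)[OF g] dense])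
    fix x assume "x \<in> span (range e)"
    then show "f x = g x"
    proof (rule span_induct)
      show "subspace {x. f x = g x}"
        by (auto simp: subspace_def continuous_linearD[OF f] continuous_linearD[OF g]
            continuous_linear_0[OF f] continuous_linear_0[OF g])
    qed (use eq in auto)
  qed
  have times_cont: "continuous_bilinear scaleH scaleH scaleH times"
    by (rule bounded_bilinear_map_continuous[OF lc lc lc times])
  note timesL = continuous_bilinear_partial(1)[OF times_cont] and timesR = continuous_bilinear_partial(2)[OF times_cont]
  have id: "continuous_linear scaleH scaleH (\<lambda>x. x)"
    by (rule continuous_linearI[OF lc lc]) auto
  have scale_cont: "continuous_linear (*) scaleH (\<lambda>c. scaleH c x)" for x
    by (rule continuous_bilinear_partial(1)[OF bounded_bilinear_map_continuous[OF locally_convex_space_field lc lc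
            bounded_bilinear_map_scale[OF lc]]])
  have mult_cont: "continuous_bilinear (*) (*) (*) (\<lambda>c (d::'k). c * d)"
    by (rule bounded_bilinear_map_continuous[OF locally_convex_space_field locally_convex_space_field
          locally_convex_space_field bounded_bilinear_map_scale[OF locally_convex_space_field]])
  have assoc: "times (times x y) w = times x (times y w)" for x y w
  proof -
    have 1: "times (times (e xs) (e ys)) w = times (e xs) (times (e ys) w)" for xs ys w
      by (rule words[OF timesR continuous_linear_compose[OF timesR timesR]]) (simp add: times_e)
    have 2: "times (times (e xs) y) w = times (e xs) (times y w)" for xs y w
      by (rule words[OF continuous_linear_compose[OF timesR timesL] continuous_linear_compose[OF timesL timesR]]) (rule 1)
    show ?thesis
      by (rule words[OF continuous_linear_compose[OF timesL timesL] timesL]) (rule 2)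
  qed
  have unit: "times (e []) x = x" "times x (e []) = x" for x
    by (rule words[OF timesR id], simp add: times_e) (rule words[OF timesL id], simp add: times_e)
  obtain tens21 where tens21: "bounded_bilinear_map scaleH2 scaleH scaleH3 tens21"
      "\<And>x y w. tens21 (tens2 x y) w = tens3 x y w"
  proof (rule tensor_square_extension1[OF lc3 lc, of tens3])
    show "\<exists>p q. continuous_seminorm scaleH p \<and> continuous_seminorm scaleH q \<and>
        (\<forall>x y v. r (tens3 x y v) \<le> q v * (p x * p y))" if "continuous_seminorm scaleH3 r" for r
      using tens3_bound[OF that] by (metis mult.commute)
  qed ((rule that; assumption) | (simp add: tens3_linear))+
  \<comment> \<open>The parameter comes last in \<open>tensor_square_extension1\<close>, so the
    arguments are permuted here and put back in \<open>tens12\<close>.\<close>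
  obtain tens12' where tens12': "bounded_bilinear_map scaleH2 scaleH scaleH3 tens12'"
      "\<And>y w x. tens12' (tens2 y w) x = tens3 x y w"
  proof (rule tensor_square_extension1[OF lc3 lc, of "\<lambda>y w x. tens3 x y w"])
    show "\<exists>p q. continuous_seminorm scaleH p \<and> continuous_seminorm scaleH q \<and>
        (\<forall>x y v. r (tens3 v x y) \<le> q v * (p x * p y))" if "continuous_seminorm scaleH3 r" for r
      using tens3_bound[OF that] by (metis mult.assoc)
  qed ((rule that; assumption) | (simp add: tens3_linear))+
  define tens12 where "tens12 x \<tau> = tens12' \<tau> x" for x \<tau>
  have tens12: "bounded_bilinear_map scaleH scaleH2 scaleH3 tens12" "\<And>x y w. tens12 x (tens2 y w) = tens3 x y w"
    unfolding tens12_def[abs_def] using bounded_bilinear_map_swap[OF tens12'(1)] tens12'(2) by auto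
  obtain \<Delta>1 where \<Delta>1: "continuous_linear scaleH2 scaleH3 \<Delta>1" "\<And>x y. \<Delta>1 (tens2 x y) = tens21 (\<Delta> x) y"
    using tensor_square_extension[OF lc3 bounded_bilinear_map_left[OF tens21(1) \<Delta>]] by metis
  obtain \<Delta>2 where \<Delta>2: "continuous_linear scaleH2 scaleH3 \<Delta>2" "\<And>x y. \<Delta>2 (tens2 x y) = tens12 x (\<Delta> y)"
    using tensor_square_extension[OF lc3 bounded_bilinear_map_right[OF tens12(1) \<Delta>]] by metis
  have coassoc: "\<Delta>1 (\<Delta> x) = \<Delta>2 (\<Delta> x)" for x
  proof (rule words[OF continuous_linear_compose[OF \<Delta> \<Delta>1(1)] continuous_linear_compose[OF \<Delta> \<Delta>2(1)]])
    fix xs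
    have "\<Delta>1 (\<Delta> (e xs)) = split_sum xs (\<lambda>a b. split_sum a (\<lambda>c d. tens3 (e c) (e d) (e b)))"
      by (simp add: \<Delta>_e split_sum_hom[of \<Delta>1] split_sum_hom[of "\<lambda>\<tau>. tens21 \<tau> _"] continuous_linearD[OF \<Delta>1(1)]
          \<Delta>1(2) bounded_bilinear_mapD[OF tens21(1)] tens21(2))
    also have "\<dots> = split_sum xs (\<lambda>a b. split_sum b (\<lambda>c d. tens3 (e a) (e c) (e d)))"
      by (rule split_sum_coassoc)
    also have "\<dots> = \<Delta>2 (\<Delta> (e xs))"
      by (simp add: \<Delta>_e split_sum_hom[of \<Delta>2] split_sum_hom[of "tens12 _"] continuous_linearD[OF \<Delta>2(1)]
          \<Delta>2(2) bounded_bilinear_mapD[OF tens12(1)] tens12(2))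
    finally show "\<Delta>1 (\<Delta> (e xs)) = \<Delta>2 (\<Delta> (e xs))" .
  qed
  have bl: "bounded_bilinear_map scaleH scaleH scaleH (\<lambda>x y. scaleH (\<epsilon> x) y)"
    by (rule bounded_bilinear_map_left[OF bounded_bilinear_map_scale[OF lc] \<epsilon>])
  obtain \<epsilon>1 where \<epsilon>1: "continuous_linear scaleH2 scaleH \<epsilon>1" "\<And>x y. \<epsilon>1 (tens2 x y) = scaleH (\<epsilon> x) y"
    using tensor_square_extension[OF lc bl] by metis
  obtain \<epsilon>2 where \<epsilon>2: "continuous_linear scaleH2 scaleH \<epsilon>2" "\<And>x y. \<epsilon>2 (tens2 x y) = scaleH (\<epsilon> y) x"
    using tensor_square_extension[OF lc bounded_bilinear_map_swap[OF bl]] by metis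
  have counital: "\<epsilon>1 (\<Delta> x) = x" "\<epsilon>2 (\<Delta> x) = x" for x
  proof -
    have if_scale: "scaleH (if b then 1 else 0) y = (if b then y else 0)" for b y by simp
    show "\<epsilon>1 (\<Delta> x) = x"
      by (rule words[OF continuous_linear_compose[OF \<Delta> \<epsilon>1(1)] id])
        (simp add: \<Delta>_e split_sum_hom[of \<epsilon>1] continuous_linearD[OF \<epsilon>1(1)] \<epsilon>1(2) \<epsilon>_e if_scale split_sum_counit_left)
    show "\<epsilon>2 (\<Delta> x) = x"
      by (rule words[OF continuous_linear_compose[OF \<Delta> \<epsilon>2(1)] id])
        (simp add: \<Delta>_e split_sum_hom[of \<epsilon>2] continuous_linearD[OF \<epsilon>2(1)] \<epsilon>2(2) \<epsilon>_e if_scale split_sum_counit_right)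
  qed
  \<comment> \<open>The product on the square arises in two steps. First its right factor x
    \<otimes> y is completed, with v and w as parameters; then v \<otimes> w is completed, with an
    element of the completed square as parameter.\<close>
  obtain B where B:
    "\<And>x y v w. B (x + y) v w = B x v w + B y v w" "\<And>c x v w. B (scaleH2 c x) v w = scaleH2 c (B x v w)"
    "\<And>x y \<tau> w. B \<tau> (x + y) w = B \<tau> x w + B \<tau> y w" "\<And>c x \<tau> w. B \<tau> (scaleH c x) w = scaleH2 c (B \<tau> x w)"
    "\<And>x y \<tau> v. B \<tau> v (x + y) = B \<tau> v x + B \<tau> v y" "\<And>c x \<tau> v. B \<tau> v (scaleH c x) = scaleH2 c (B \<tau> v x)"
    "\<And>x y v w. B (tens2 x y) v w = tens2 (times v x) (times w y)"
    "\<And>r. continuous_seminorm scaleH2 r \<Longrightarrow> \<exists>p q q'. continuous_seminorm scaleH2 p \<and> continuous_seminorm scaleH q \<and>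
      continuous_seminorm scaleH q' \<and> (\<forall>\<tau> v w. r (B \<tau> v w) \<le> p \<tau> * (q v * q' w))"
  proof (rule tensor_square_extension_param[OF lc2 lc lc, of "\<lambda>x y v w. tens2 (times v x) (times w y)"])
    fix r assume r: "continuous_seminorm scaleH2 r"
    obtain p where p: "continuous_seminorm scaleH p" "\<And>x y. r (tens2 x y) \<le> p x * p y"
      using tens2_bound[OF r] by metis
    obtain q q' where q: "continuous_seminorm scaleH q" "continuous_seminorm scaleH q'" "\<And>x y. p (times x y) \<le> q x * q' y"
      using bounded_bilinear_map_bound[OF times p(1)] by blast
    have "r (tens2 (times v x) (times w y)) \<le> (q v * q w) * (q' x * q' y)" for x y v w
    proof -
      have "r (tens2 (times v x) (times w y)) \<le> p (times v x) * p (times w y)" by (rule p(2))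
      also have "\<dots> \<le> (q v * q' x) * (q w * q' y)"
        by (intro mult_mono q mult_nonneg_nonneg continuous_seminorm_nonneg[OF p(1)]
            continuous_seminorm_nonneg[OF q(1)] continuous_seminorm_nonneg[OF q(2)])
      finally show ?thesis by (simp add: mult_ac)
    qed
    then show "\<exists>p q q'. continuous_seminorm scaleH p \<and> continuous_seminorm scaleH q \<and> continuous_seminorm scaleH q' \<and>
        (\<forall>x y v w. r (tens2 (times v x) (times w y)) \<le> (q v * q' w) * (p x * p y))"
      using q(1,2) by blast
  qed ((rule that; assumption) | (simp add: tens2_linear bounded_bilinear_mapD[OF times]))+
  obtain times2 where times2: "bounded_bilinear_map scaleH2 scaleH2 scaleH2 times2" "\<And>x y \<tau>. times2 (tens2 x y) \<tau> = B \<tau> x y"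
  proof (rule tensor_square_extension1[OF lc2 lc2, of "\<lambda>x y \<tau>. B \<tau> x y"])
    fix r assume "continuous_seminorm scaleH2 r"
    then obtain p q q' where *: "continuous_seminorm scaleH2 p" "continuous_seminorm scaleH q" "continuous_seminorm scaleH q'"
        "\<And>\<tau> v w. r (B \<tau> v w) \<le> p \<tau> * (q v * q' w)" using B(8) by blast
    have "r (B v x y) \<le> p v * ((q x + q' x) * (q y + q' y))" for x y v
    proof -
      have nn: "0 \<le> q x" "0 \<le> q' x" "0 \<le> p v" for x v
        using * continuous_seminorm_nonneg C2.continuous_seminorm_nonneg by auto
      have "q x * q' y \<le> (q x + q' x) * (q y + q' y)"
        using nn by (intro mult_mono) auto
      then have "p v * (q x * q' y) \<le> p v * ((q x + q' x) * (q y + q' y))" using nn by (intro mult_left_mono)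
      then show ?thesis using *(4)[of v x y] by linarith
    qed
    then show "\<exists>p q. continuous_seminorm scaleH p \<and> continuous_seminorm scaleH2 q \<and>
        (\<forall>x y v. r (B v x y) \<le> q v * (p x * p y))"
      using *(1) continuous_seminorm_add[OF *(2,3)]
      by (intro exI[of _ "\<lambda>x. q x + q' x"] exI[of _ p]) auto
  qed ((rule that; assumption) | (simp add: B(1-6)))+
  have times2_tens: "times2 (tens2 x y) (tens2 v w) = tens2 (times x v) (times y w)" for x y v w
    by (simp add: times2(2) B(7))
  have times2_cont: "continuous_bilinear scaleH2 scaleH2 scaleH2 times2"
    by (rule bounded_bilinear_map_continuous[OF lc2 lc2 lc2 times2(1)])
  note times2L = continuous_bilinear_partial(1)[OF times2_cont] and times2R = continuous_bilinear_partial(2)[OF times2_cont]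
  have \<Delta>_times: "\<Delta> (times x y) = times2 (\<Delta> x) (\<Delta> y)" for x y
  proof -
    have 1: "\<Delta> (times (e xs) (e ys)) = times2 (\<Delta> (e xs)) (\<Delta> (e ys))" for xs ys
      by (simp add: times_e \<Delta>_e split_sum_append split_sum_hom[of "times2 _"] split_sum_hom[of "\<lambda>\<tau>. times2 \<tau> _"]
          bounded_bilinear_mapD[OF times2(1)] times2_tens) (rule split_sum_swap)
    have 2: "\<Delta> (times (e xs) y) = times2 (\<Delta> (e xs)) (\<Delta> y)" for xs y
      by (rule words[OF continuous_linear_compose[OF timesR \<Delta>] continuous_linear_compose[OF \<Delta> times2R]]) (rule 1)
    show ?thesis
      by (rule words[OF continuous_linear_compose[OF timesL \<Delta>] continuous_linear_compose[OF \<Delta> times2L]]) (rule 2)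
  qed
  have \<epsilon>_times: "\<epsilon> (times x y) = \<epsilon> x * \<epsilon> y" for x y
  proof -
    note mL = continuous_bilinear_partial(1)[OF mult_cont] and mR = continuous_bilinear_partial(2)[OF mult_cont]
    have 2: "\<epsilon> (times (e xs) y) = \<epsilon> (e xs) * \<epsilon> y" for xs y
      by (rule words[OF continuous_linear_compose[OF timesR \<epsilon>] continuous_linear_compose[OF \<epsilon> mR]]) (simp add: times_e \<epsilon>_e)
    show ?thesis
      by (rule words[OF continuous_linear_compose[OF timesL \<epsilon>] continuous_linear_compose[OF \<epsilon> mL]]) (rule 2)
  qed
  obtain A1 where A1: "continuous_linear scaleH2 scaleH A1" "\<And>x y. A1 (tens2 x y) = times (A x) y"
    using tensor_square_extension[OF lc bounded_bilinear_map_left[OF times A]] by metis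
  obtain A2 where A2: "continuous_linear scaleH2 scaleH A2" "\<And>x y. A2 (tens2 x y) = times x (A y)"
    using tensor_square_extension[OF lc bounded_bilinear_map_right[OF times A]] by metis
  have antipode: "A1 (\<Delta> x) = scaleH (\<epsilon> x) (e [])" "A2 (\<Delta> x) = scaleH (\<epsilon> x) (e [])" for x
  proof -
    have l: "split_sum xs (\<lambda>a b. scaleH ((- 1) ^ length a) (e (rev a @ b))) = (if xs = [] then e [] else 0)" for xs
      by (rule split_sum_antipode_left[where s = "\<lambda>n. scaleH ((- 1) ^ n)"]) (auto simp: scale_right_distrib)
    have r: "split_sum xs (\<lambda>a b. scaleH ((- 1) ^ length b) (e (a @ rev b))) = (if xs = [] then e [] else 0)" for xs
      by (rule split_sum_antipode_right[where s = "\<lambda>n. scaleH ((- 1) ^ n)"]) auto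
    show "A1 (\<Delta> x) = scaleH (\<epsilon> x) (e [])"
      by (rule words[OF continuous_linear_compose[OF \<Delta> A1(1)] continuous_linear_compose[OF \<epsilon> scale_cont]])
        (simp add: \<Delta>_e split_sum_hom[of A1] continuous_linearD[OF A1(1)] A1(2) A_e bounded_bilinear_mapD[OF times] times_e \<epsilon>_e l)
    show "A2 (\<Delta> x) = scaleH (\<epsilon> x) (e [])"
      by (rule words[OF continuous_linear_compose[OF \<Delta> A2(1)] continuous_linear_compose[OF \<epsilon> scale_cont]])
        (simp add: \<Delta>_e split_sum_hom[of A2] continuous_linearD[OF A2(1)] A2(2) A_e bounded_bilinear_mapD[OF times] times_e \<epsilon>_e r)
  qed
  show ?thesis
    unfolding locally_convex_hopf_algebra_def locally_convex_hopf_algebra_axioms_def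
      tens2_def[symmetric] tens3_def[symmetric]
  proof (intro conjI allI)
    show "is_completed_tensor_power scaleH 2 scaleH2 j2" by (rule square)
    show "is_completed_tensor_power scaleH 3 scaleH3 j3" by (rule cube)
    show "\<exists>tens21 tens12 coproduct_id id_coproduct.
         continuous_bilinear scaleH2 scaleH scaleH3 tens21 \<and>
         (\<forall>x y w. tens21 (tens2 x y) w = tens3 x y w) \<and>
         continuous_bilinear scaleH scaleH2 scaleH3 tens12 \<and>
         (\<forall>x y w. tens12 x (tens2 y w) = tens3 x y w) \<and>
         continuous_linear scaleH2 scaleH3 coproduct_id \<and>
         (\<forall>x y. coproduct_id (tens2 x y) = tens21 (\<Delta> x) y) \<and>
         continuous_linear scaleH2 scaleH3 id_coproduct \<and>
         (\<forall>x y. id_coproduct (tens2 x y) = tens12 x (\<Delta> y)) \<and>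
         (\<forall>x. coproduct_id (\<Delta> x) = id_coproduct (\<Delta> x))"
      using tens21(2) tens12(2) \<Delta>1 \<Delta>2 coassoc bounded_bilinear_map_continuous[OF lc2 lc lc3 tens21(1)]
        bounded_bilinear_map_continuous[OF lc lc2 lc3 tens12(1)]
      by (intro exI[of _ tens21] exI[of _ tens12] exI[of _ \<Delta>1] exI[of _ \<Delta>2]) simp
    show "\<exists>counit_id id_counit.
         continuous_linear scaleH2 scaleH counit_id \<and>
         (\<forall>x y. counit_id (tens2 x y) = scaleH (\<epsilon> x) y) \<and>
         continuous_linear scaleH2 scaleH id_counit \<and>
         (\<forall>x y. id_counit (tens2 x y) = scaleH (\<epsilon> y) x) \<and>
         (\<forall>x. counit_id (\<Delta> x) = x \<and> id_counit (\<Delta> x) = x)"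
      using \<epsilon>1 \<epsilon>2 counital by (intro exI[of _ \<epsilon>1] exI[of _ \<epsilon>2]) simp
    show "\<exists>times2. continuous_bilinear scaleH2 scaleH2 scaleH2 times2 \<and>
         (\<forall>x y v w. times2 (tens2 x y) (tens2 v w) = tens2 (times x v) (times y w)) \<and>
         (\<forall>x y. \<Delta> (times x y) = times2 (\<Delta> x) (\<Delta> y))"
      using times2_cont times2_tens \<Delta>_times by blast
    show "\<exists>times_antipode_id times_id_antipode.
         continuous_linear scaleH2 scaleH times_antipode_id \<and>
         (\<forall>x y. times_antipode_id (tens2 x y) = times (A x) y) \<and>
         continuous_linear scaleH2 scaleH times_id_antipode \<and>
         (\<forall>x y. times_id_antipode (tens2 x y) = times x (A y)) \<and>
         (\<forall>x. times_antipode_id (\<Delta> x) = scaleH (\<epsilon> x) (e []) \<and>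
              times_id_antipode (\<Delta> x) = scaleH (\<epsilon> x) (e []))"
      using A1 A2 antipode by (intro exI[of _ A1] exI[of _ A2]) simp
  qed (simp_all add: lc times_cont assoc unit \<Delta> \<epsilon> A \<Delta>_e \<epsilon>_times \<epsilon>_e)
qed

end

section \<open>Weighted seminorms\<close>

text \<open>Admits the scalar field as a target of \<open>linear_extension\<close>, as the counit
  requires.\<close>

instance real_normed_vector \<subseteq> uniform_topological_group_add ..

lemma tensor_component_tensor:
  "tensor_component M n (tensor M xs) = (if length xs = n then tensor M xs else (\<lambda>\<phi>. 0))"
  by (auto simp: tensor_component_def tensor_def multilinear_form_length fun_eq_iff)

lemma tensor_component_add:
  "tensor_component M n (\<lambda>\<phi>. s \<phi> + t \<phi>) = (\<lambda>\<phi>. tensor_component M n s \<phi> + tensor_component M n t \<phi>)"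
  by (auto simp: tensor_component_def fun_eq_iff)

lemma tensor_component_scale:
  "tensor_component M n (\<lambda>\<phi>. c * t \<phi>) = (\<lambda>\<phi>. c * tensor_component M n t \<phi>)"
  by (auto simp: tensor_component_def fun_eq_iff)

lemma tensor_component_zero: "tensor_component M n (\<lambda>\<phi>. 0) = (\<lambda>\<phi>. 0)"
  by (auto simp: tensor_component_def)

lemma tensor_component_closed:
  "t \<in> carrier (tensor_algebra M) \<Longrightarrow> tensor_component M n t \<in> carrier (tensor_power M n)"
  unfolding carrier_tensor_algebra
proof (induction rule: lspan_induct)
  case zero
  show ?case by (simp add: tensor_component_zero carrier_tensor_power)
next
  case (add c x t)
  have "tensor M x \<in> lspan (tensor M) {xs. length xs = length x \<and> set xs \<subseteq> carrier M}"
    using add by (intro lspan_base) auto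
  then show ?case
    using add.IH
    by (auto simp: tensor_component_add tensor_component_scale tensor_component_tensor carrier_tensor_power
        intro!: lspan_add lspan_scale)
qed

lemma tensor_component_finite:
  assumes "t \<in> carrier (tensor_algebra M)"
  shows "\<exists>N. (\<forall>n\<ge>N. tensor_component M n t = (\<lambda>\<phi>. 0)) \<and> (\<forall>m\<ge>N. t = (\<lambda>\<phi>. \<Sum>n<m. tensor_component M n t \<phi>))"
  using assms unfolding carrier_tensor_algebra
proof (induction rule: lspan_induct)
  case zero
  show ?case by (simp add: tensor_component_zero)
next
  case (add c x t)
  then obtain N where N: "\<forall>n\<ge>N. tensor_component M n t = (\<lambda>\<phi>. 0)"
    "\<forall>m\<ge>N. t = (\<lambda>\<phi>. \<Sum>n<m. tensor_component M n t \<phi>)" by blast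
  show ?case
  proof (intro exI[of _ "max N (Suc (length x))"] conjI allI impI)
    show "tensor_component M n (\<lambda>\<phi>. c * tensor M x \<phi> + t \<phi>) = (\<lambda>\<phi>. 0)" if "max N (Suc (length x)) \<le> n" for n
      using that N(1) by (auto simp: tensor_component_add tensor_component_scale tensor_component_tensor)
    fix m assume m: "max N (Suc (length x)) \<le> m"
    have t: "t \<phi> = (\<Sum>n<m. tensor_component M n t \<phi>)" for \<phi>
      using N(2) m by (metis max.boundedE)
    have "(\<Sum>n<m. tensor_component M n (tensor M x) \<phi>) = (\<Sum>n<m. if n = length x then tensor M x \<phi> else 0)" for \<phi>
      by (intro sum.cong) (auto simp: tensor_component_tensor)
    also have "\<dots> \<phi> = tensor M x \<phi>" for \<phi>
      using m by (simp add: sum.delta)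
    finally have x: "(\<Sum>n<m. tensor_component M n (tensor M x) \<phi>) = tensor M x \<phi>" for \<phi> .
    show "(\<lambda>\<phi>. c * tensor M x \<phi> + t \<phi>) =
        (\<lambda>\<phi>. \<Sum>n<m. tensor_component M n (\<lambda>\<phi>. c * tensor M x \<phi> + t \<phi>) \<phi>)"
      by (rule ext) (simp add: tensor_component_add tensor_component_scale sum.distrib t[symmetric] x sum_distrib_left[symmetric])
  qed
qed

text \<open>The identities are stated for all large cut-offs, so that several tensors can be treated
  with a common one.\<close>

lemma weighted_seminorm_finite:
  assumes t: "t \<in> carrier (tensor_algebra M)" and p: "\<And>x. 0 \<le> p x"
  shows "\<exists>N. (\<forall>m\<ge>N. weighted_seminorm M w p t = (\<Sum>n<m. w n * projective_power M p n (tensor_component M n t))) \<and>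
    (\<forall>m\<ge>N. t = (\<lambda>\<phi>. \<Sum>n<m. tensor_component M n t \<phi>))"
proof -
  obtain N where N: "\<forall>n\<ge>N. tensor_component M n t = (\<lambda>\<phi>. 0)"
    "\<forall>m\<ge>N. t = (\<lambda>\<phi>. \<Sum>n<m. tensor_component M n t \<phi>)" using tensor_component_finite[OF t] by blast
  have "weighted_seminorm M w p t = (\<Sum>n<m. w n * projective_power M p n (tensor_component M n t))" if "m \<ge> N" for m
    unfolding weighted_seminorm_def
    by (rule suminf_finite) (use N(1) that in \<open>auto simp: projective_power_zero[of p, OF p]\<close>)
  then show ?thesis using N(2) by blast
qed

lemma seminorm_on_weighted:
  assumes p: "\<And>x. 0 \<le> p x" and w: "\<And>n. 0 \<le> w n"
  shows "seminorm_on (tensor_algebra M) (weighted_seminorm M w p)"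
  unfolding seminorm_on_def
proof (intro conjI ballI allI)
  fix s t assume s: "s \<in> carrier (tensor_algebra M)" and t: "t \<in> carrier (tensor_algebra M)"
  obtain N1 N2 N3 where N:
    "\<forall>m\<ge>N1. weighted_seminorm M w p s = (\<Sum>n<m. w n * projective_power M p n (tensor_component M n s))"
    "\<forall>m\<ge>N2. weighted_seminorm M w p t = (\<Sum>n<m. w n * projective_power M p n (tensor_component M n t))"
    "\<forall>m\<ge>N3. weighted_seminorm M w p (\<lambda>\<phi>. s \<phi> + t \<phi>) =
      (\<Sum>n<m. w n * projective_power M p n (tensor_component M n (\<lambda>\<phi>. s \<phi> + t \<phi>)))"
    using weighted_seminorm_finite[of s M p w, OF s p] weighted_seminorm_finite[of t M p w, OF t p]
      weighted_seminorm_finite[of _ M p w, OF tensor_algebra_closed(1)[OF s t] p] by blast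
  define m where "m = max N1 (max N2 N3)"
  have "weighted_seminorm M w p (\<lambda>\<phi>. s \<phi> + t \<phi>) =
      (\<Sum>n<m. w n * projective_power M p n (tensor_component M n (\<lambda>\<phi>. s \<phi> + t \<phi>)))"
    using N(3) by (simp add: m_def)
  also have "\<dots> \<le> (\<Sum>n<m. w n * (projective_power M p n (tensor_component M n s) + projective_power M p n (tensor_component M n t)))"
    unfolding tensor_component_add
    by (intro sum_mono mult_left_mono w projective_power_add p tensor_component_closed s t)
  also have "\<dots> = weighted_seminorm M w p s + weighted_seminorm M w p t"
    using N(1)[rule_format, of m] N(2)[rule_format, of m] by (simp add: m_def distrib_left sum.distrib)
  finally show "weighted_seminorm M w p (\<lambda>\<phi>. s \<phi> + t \<phi>) \<le> weighted_seminorm M w p s + weighted_seminorm M w p t" .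
next
  fix c t assume t: "t \<in> carrier (tensor_algebra M)"
  obtain N1 N2 where N:
    "\<forall>m\<ge>N1. weighted_seminorm M w p t = (\<Sum>n<m. w n * projective_power M p n (tensor_component M n t))"
    "\<forall>m\<ge>N2. weighted_seminorm M w p (\<lambda>\<phi>. c * t \<phi>) =
      (\<Sum>n<m. w n * projective_power M p n (tensor_component M n (\<lambda>\<phi>. c * t \<phi>)))"
    using weighted_seminorm_finite[of t M p w, OF t p]
      weighted_seminorm_finite[of _ M p w, OF tensor_algebra_closed(3)[OF t] p] by blast
  have "projective_power M p n (tensor_component M n (\<lambda>\<phi>. c * t \<phi>)) = norm c * projective_power M p n (tensor_component M n t)" for n
    unfolding tensor_component_scale by (rule projective_power_scale[OF p tensor_component_closed[OF t]])
  then show "weighted_seminorm M w p (\<lambda>\<phi>. c * t \<phi>) = norm c * weighted_seminorm M w p t"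
    using N(1)[rule_format, of "max N1 N2"] N(2)[rule_format, of "max N1 N2"]
    by (simp add: sum_distrib_left mult_ac)
qed

text \<open>These values on words control the weighted seminorms in both directions, by
  \<open>weighted_seminorm_tensor\<close> and \<open>seminorm_le_weighted\<close>.\<close>

definition word_weight :: "(nat \<Rightarrow> real) \<Rightarrow> ('a \<Rightarrow> real) \<Rightarrow> 'a list \<Rightarrow> real" where
  "word_weight w q xs = w (length xs) * prod_list (map q xs)"

lemma weighted_seminorm_tensor:
  assumes p: "\<And>x. 0 \<le> p x" and w: "\<And>n. 0 \<le> w n" and xs: "set xs \<subseteq> carrier M"
  shows "weighted_seminorm M w p (tensor M xs) \<le> word_weight w p xs"
proof -
  have "weighted_seminorm M w p (tensor M xs) = (\<Sum>n\<in>{length xs}. w n * projective_power M p n (tensor_component M n (tensor M xs)))"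
    unfolding weighted_seminorm_def
    by (rule suminf_finite) (auto simp: projective_power_zero[of p, OF p] tensor_component_tensor)
  also have "\<dots> \<le> word_weight w p xs"
    using projective_power_tensor[of p xs "length xs" M, OF p] xs w
    by (auto simp: word_weight_def tensor_component_tensor intro!: mult_left_mono)
  finally show ?thesis .
qed

text \<open>The tensor is the finite sum of its components, and
  \<open>seminorm_le_projective_power\<close> applies in each degree. Thus a continuity estimate on
  the whole tensor algebra only has to be checked on words.\<close>

lemma seminorm_le_weighted:
  assumes \<rho>: "seminorm_on (tensor_algebra M) \<rho>" and C: "C \<ge> 0"
    and p: "\<And>x. 0 \<le> p x" and w: "\<And>n. 0 \<le> w n"
    and words: "\<And>xs. set xs \<subseteq> carrier M \<Longrightarrow> \<rho> (tensor M xs) \<le> C * word_weight w p xs"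
    and t: "t \<in> carrier (tensor_algebra M)"
  shows "\<rho> t \<le> C * weighted_seminorm M w p t"
proof -
  obtain N where N: "weighted_seminorm M w p t = (\<Sum>n<N. w n * projective_power M p n (tensor_component M n t))"
    "t = (\<lambda>\<phi>. \<Sum>n<N. tensor_component M n t \<phi>)"
    using weighted_seminorm_finite[of t M p w, OF t p] by blast
  have comp: "tensor_component M n t \<in> carrier (tensor_algebra M)" for n
    using tensor_component_closed[OF t] tensor_power_subset by blast
  have "\<rho> (\<lambda>\<phi>. \<Sum>n<m. tensor_component M n t \<phi>) \<le> (\<Sum>n<m. \<rho> (tensor_component M n t))" for m
  proof (induction m)
    case 0
    show ?case using seminorm_onD(4)[OF function_module_tensor_algebra \<rho> t] by simp
  next
    case (Suc m)
    have "(\<lambda>\<phi>. \<Sum>n<m. tensor_component M n t \<phi>) \<in> carrier (tensor_algebra M)"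
      unfolding carrier_tensor_algebra by (rule lspan_sum) (use comp in \<open>simp add: carrier_tensor_algebra\<close>)
    from seminorm_onD(1)[OF function_module_tensor_algebra \<rho> this comp[of m]] Suc show ?case by simp
  qed
  from this[of N] have "\<rho> t \<le> (\<Sum>n<N. \<rho> (tensor_component M n t))" using N(2) by simp
  also have "\<dots> \<le> (\<Sum>n<N. (C * w n) * projective_power M p n (tensor_component M n t))"
  proof (intro sum_mono seminorm_le_projective_power p tensor_component_closed t)
    fix n
    show "seminorm_on (tensor_power M n) \<rho>"
      unfolding seminorm_on_def
    proof (intro conjI ballI allI)
      fix s t assume "s \<in> carrier (tensor_power M n)" "t \<in> carrier (tensor_power M n)"
      then have "s \<in> carrier (tensor_algebra M)" "t \<in> carrier (tensor_algebra M)"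
        using tensor_power_subset[of M n] by blast+
      then show "\<rho> (\<lambda>\<phi>. s \<phi> + t \<phi>) \<le> \<rho> s + \<rho> t"
        using \<rho> unfolding seminorm_on_def by blast
    next
      fix c t assume "t \<in> carrier (tensor_power M n)"
      then have "t \<in> carrier (tensor_algebra M)" using tensor_power_subset[of M n] by blast
      then show "\<rho> (\<lambda>\<phi>. c * t \<phi>) = norm c * \<rho> t"
        using \<rho> unfolding seminorm_on_def by blast
    qed
    show "0 \<le> C * w n" using C w by simp
    show "\<rho> (tensor M xs) \<le> C * w n * prod_list (map p xs)" if "length xs = n" "set xs \<subseteq> carrier M" for xs
      using words[OF that(2)] that by (simp add: word_weight_def mult.assoc)
  qed
  also have "\<dots> = C * weighted_seminorm M w p t" by (simp add: N(1) sum_distrib_left mult.assoc)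
  finally show ?thesis .
qed

lemma word_weight_nonneg: "(\<And>x. 0 \<le> p x) \<Longrightarrow> (\<And>n. 0 \<le> w n) \<Longrightarrow> 0 \<le> word_weight w p xs"
  by (auto simp: word_weight_def intro!: mult_nonneg_nonneg prod_list_map_nonneg)

text \<open>One variable at a time: first x is extended for y in D, then y for every x in the whole
  space.\<close>

lemma bilinear_extension:
  fixes s :: "'k::real_normed_field \<Rightarrow> 'a::{uniform_topological_group_add,ab_group_add,complete_uniform_space,t2_space} \<Rightarrow> 'a"
  assumes lc: "locally_convex_space s"
    and D: "\<And>x y. x \<in> D \<Longrightarrow> y \<in> D \<Longrightarrow> x + y \<in> D" "\<And>c x. x \<in> D \<Longrightarrow> s c x \<in> D"
    and dense: "closure D = UNIV"
    and add: "\<And>x y w. x \<in> D \<Longrightarrow> y \<in> D \<Longrightarrow> w \<in> D \<Longrightarrow> f (x + y) w = f x w + f y w"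
      "\<And>x y w. x \<in> D \<Longrightarrow> y \<in> D \<Longrightarrow> w \<in> D \<Longrightarrow> f w (x + y) = f w x + f w y"
    and scale: "\<And>c x w. x \<in> D \<Longrightarrow> w \<in> D \<Longrightarrow> f (s c x) w = s c (f x w)"
      "\<And>c x w. x \<in> D \<Longrightarrow> w \<in> D \<Longrightarrow> f w (s c x) = s c (f w x)"
    and bound: "\<And>r. continuous_seminorm s r \<Longrightarrow>
      \<exists>p. continuous_seminorm s p \<and> (\<forall>x\<in>D. \<forall>y\<in>D. r (f x y) \<le> p x * p y)"
  obtains g where "bounded_bilinear_map s s s g" "\<And>x y. x \<in> D \<Longrightarrow> y \<in> D \<Longrightarrow> g x y = f x y"
proof -
  interpret locally_convex_space s by fact
  have cadd: "continuous_linear s s (\<lambda>\<tau>. a \<tau> + b \<tau>)"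
    if f: "continuous_linear s s a" and g: "continuous_linear s s b" for a b
  proof (rule continuous_linearI[OF lc lc])
    fix r assume r: "continuous_seminorm s r"
    show "\<exists>p. continuous_seminorm s p \<and> (\<forall>x. r (a x + b x) \<le> p x)"
      by (intro exI[of _ "\<lambda>x. r (a x) + r (b x)"] conjI allI continuous_seminorm_add
          continuous_linear_seminorm[OF f r] continuous_linear_seminorm[OF g r] continuous_seminorm_triangle[OF r])
  qed (auto simp: continuous_linearD[OF f] continuous_linearD[OF g] scale_right_distrib)
  have cscale: "continuous_linear s s (\<lambda>\<tau>. s c (a \<tau>))"
    if f: "continuous_linear s s a" for a c
  proof (rule continuous_linearI[OF lc lc])
    fix r assume r: "continuous_seminorm s r"
    show "\<exists>p. continuous_seminorm s p \<and> (\<forall>x. r (s c (a x)) \<le> p x)"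
      by (intro exI[of _ "\<lambda>x. norm c * r (a x)"] conjI allI continuous_seminorm_mult
          continuous_linear_seminorm[OF f r]) (auto simp: continuous_seminorm_scale[OF r])
  qed (auto simp: continuous_linearD[OF f] scale_right_distrib mult.commute)
  have dense_eq: "a x = b x"
    if "continuous_linear s s a" "continuous_linear s s b" "\<And>x. x \<in> D \<Longrightarrow> a x = b x" for a b :: "'a \<Rightarrow> 'a" and x
    by (rule continuous_eq_on_dense[OF continuous_linearD(3)[OF that(1)] continuous_linearD(3)[OF that(2)] dense that(3)])
  have "\<exists>F. continuous_linear s s F \<and> (\<forall>x\<in>D. F x = f x y)" if y: "y \<in> D" for y
  proof -
    obtain F where "continuous_linear s s F" "\<And>x. x \<in> D \<Longrightarrow> F x = f x y"
    proof (rule linear_extension[OF lc lc D dense, of "\<lambda>x. f x y"])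
      fix r assume r: "continuous_seminorm s r"
      then obtain p where p: "continuous_seminorm s p" "\<forall>x\<in>D. \<forall>y\<in>D. r (f x y) \<le> p x * p y" using bound by blast
      show "\<exists>p. continuous_seminorm s p \<and> (\<forall>x\<in>D. r (f x y) \<le> p x)"
        using p(2) y continuous_seminorm_mult[OF p(1) continuous_seminorm_nonneg[OF p(1), of y]]
        by (intro exI[of _ "\<lambda>x. p y * p x"]) (auto simp: mult.commute)
    qed ((rule that; assumption) | (simp add: add scale y))+
    then show ?thesis by blast
  qed
  then obtain F where F: "\<And>y. y \<in> D \<Longrightarrow> continuous_linear s s (F y)" "\<And>x y. x \<in> D \<Longrightarrow> y \<in> D \<Longrightarrow> F y x = f x y"
    by metis
  have F_bound: "r (F y x) \<le> p x * p y"
    if r: "continuous_seminorm s r" and p: "continuous_seminorm s p" "\<forall>x\<in>D. \<forall>y\<in>D. r (f x y) \<le> p x * p y"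
      and y: "y \<in> D" for r p x y
  proof -
    have "r (F y x) \<le> p y * p x"
    proof (rule continuous_linear_bound_dense[OF F(1)[OF y] r continuous_seminorm_mult[OF p(1) continuous_seminorm_nonneg[OF p(1)]] dense])
      show "r (F y x) \<le> p y * p x" if "x \<in> D" for x
        using p(2)[rule_format, OF that y] F(2)[OF that y] by (simp add: mult.commute)
    qed
    then show ?thesis by (simp add: mult.commute)
  qed
  have F_add: "F (y + y') x = F y x + F y' x" if "y \<in> D" "y' \<in> D" for y y' x
    by (rule dense_eq[OF F(1) cadd[OF F(1) F(1)]]) (auto simp: that D F(2) add)
  have F_scale: "F (s c y) x = s c (F y x)" if "y \<in> D" for y c x
    by (rule dense_eq[OF F(1) cscale[OF F(1)]]) (auto simp: that D F(2) scale)
  have "\<exists>G. continuous_linear s s G \<and> (\<forall>y\<in>D. G y = F y x)" for x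
  proof -
    obtain G where "continuous_linear s s G" "\<And>y. y \<in> D \<Longrightarrow> G y = F y x"
    proof (rule linear_extension[OF lc lc D dense, of "\<lambda>y. F y x"])
      fix r assume r: "continuous_seminorm s r"
      then obtain p where p: "continuous_seminorm s p" "\<forall>x\<in>D. \<forall>y\<in>D. r (f x y) \<le> p x * p y" using bound by blast
      show "\<exists>p. continuous_seminorm s p \<and> (\<forall>y\<in>D. r (F y x) \<le> p y)"
        using F_bound[OF r p] continuous_seminorm_mult[OF p(1) continuous_seminorm_nonneg[OF p(1), of x]]
        by (intro exI[of _ "\<lambda>y. p x * p y"]) auto
    qed ((rule that; assumption) | (simp add: F_add F_scale))+
    then show ?thesis by blast
  qed
  then obtain g where g: "\<And>x. continuous_linear s s (g x)" "\<And>x y. y \<in> D \<Longrightarrow> g x y = F y x"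
    by metis
  show ?thesis
  proof (rule that)
    show "g x y = f x y" if "x \<in> D" "y \<in> D" for x y
      using that g(2) F(2) by simp
    show "bounded_bilinear_map s s s g"
      unfolding bounded_bilinear_map_def
    proof (intro conjI allI impI)
      show "g (x + y) w = g x w + g y w" for x y w
        by (rule dense_eq[OF g(1) cadd[OF g(1) g(1)]]) (simp add: g(2) continuous_linearD[OF F(1)])
      show "g (s c x) w = s c (g x w)" for c x w
        by (rule dense_eq[OF g(1) cscale[OF g(1)]]) (simp add: g(2) continuous_linearD[OF F(1)])
      fix r assume r: "continuous_seminorm s r"
      then obtain p where p: "continuous_seminorm s p" "\<forall>x\<in>D. \<forall>y\<in>D. r (f x y) \<le> p x * p y" using bound by blast
      have "r (g x y) \<le> p x * p y" for x y
        by (rule continuous_linear_bound_dense[OF g(1) r continuous_seminorm_mult[OF p(1) continuous_seminorm_nonneg[OF p(1)]] dense])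
          (use F_bound[OF r p] g(2) in simp)
      then show "\<exists>p q. continuous_seminorm s p \<and> continuous_seminorm s q \<and> (\<forall>x y. r (g x y) \<le> p x * q y)"
        using p(1) by blast
    qed (simp_all add: continuous_linearD[OF g(1)])
  qed
qed

section \<open>Extension of the Hopf algebra structure to the completion\<close>

text \<open>The analytic input common to the three topologies, with \<W> the family of pairs of
  weights and seminorms. \<open>rep_bound\<close> controls the symmetric representatives,
  \<open>append_bound\<close> the product and \<open>split_bound\<close> the coproduct, its factor
  2^n being the number of splittings of a word of length n. The weight 1 in degree 0 serves the
  counit.\<close>

locale weighted_completion =
  lie_algebra scaleV bracket z + H: tensor_cube scaleH scaleH2 j2 scaleH3 j3
  for scaleV :: "'k::{real_normed_field,banach} \<Rightarrow> 'g::ab_group_add \<Rightarrow> 'g"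
    and bracket :: "'g \<Rightarrow> 'g \<Rightarrow> 'g" and z :: 'k
    and scaleH :: "'k \<Rightarrow>
        'h::{uniform_topological_group_add,ab_group_add,complete_uniform_space,t2_space} \<Rightarrow> 'h"
    and scaleH2 :: "'k \<Rightarrow>
        'h2::{uniform_topological_group_add,ab_group_add,complete_uniform_space,t2_space} \<Rightarrow> 'h2"
    and j2 :: "('k, 'h) tensor \<Rightarrow> 'h2"
    and scaleH3 :: "'k \<Rightarrow>
        'h3::{uniform_topological_group_add,ab_group_add,complete_uniform_space,t2_space} \<Rightarrow> 'h3"
    and j3 :: "('k, 'h) tensor \<Rightarrow> 'h3" +
  fixes j :: "('k, 'g) tensor \<Rightarrow> 'h" and \<W> :: "((nat \<Rightarrow> real) \<times> ('g \<Rightarrow> real)) set"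
  assumes complete: "is_completion (symmetric_tensors (vec_mod scaleV))
      {weighted_seminorm (vec_mod scaleV) w q | w q. (w, q) \<in> \<W>} scaleH j"
    and weight_nonneg: "(w, q) \<in> \<W> \<Longrightarrow> 0 \<le> w n"
    and weight_0: "(w, q) \<in> \<W> \<Longrightarrow> w 0 = 1"
    and seminorm_nonneg: "(w, q) \<in> \<W> \<Longrightarrow> 0 \<le> q x"
    and directed_weights: "(w1, q1) \<in> \<W> \<Longrightarrow> (w2, q2) \<in> \<W> \<Longrightarrow>
      \<exists>w q. (w, q) \<in> \<W> \<and> (\<forall>n. w1 n \<le> w n \<and> w2 n \<le> w n) \<and> (\<forall>x. q1 x \<le> q x \<and> q2 x \<le> q x)"
    and rep_bound: "(w, q) \<in> \<W> \<Longrightarrow> \<exists>w' q' C. (w', q') \<in> \<W> \<and> C \<ge> 0 \<and>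
      (\<forall>xs. weighted_seminorm M w q (rep xs) \<le> C * word_weight w' q' xs)"
    and append_bound: "(w, q) \<in> \<W> \<Longrightarrow> \<exists>w' q' C. (w', q') \<in> \<W> \<and> C \<ge> 0 \<and>
      (\<forall>xs ys. word_weight w q (xs @ ys) \<le> C * (word_weight w' q' xs * word_weight w' q' ys))"
    and split_bound: "(w, q) \<in> \<W> \<Longrightarrow> \<exists>w' q' C. (w', q') \<in> \<W> \<and> C \<ge> 0 \<and>
      (\<forall>xs a b. mset a + mset b = mset xs \<longrightarrow>
        2 ^ length xs * (word_weight w q a * word_weight w q b) \<le> C * word_weight w' q' xs)"
begin

abbreviation "P \<equiv> {weighted_seminorm M w q | w q. (w, q) \<in> \<W>}"

text \<open>Exhibits a nonzero symmetric tensor, as demanded by the locale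
  \<open>completion\<close>.\<close>

lemma sym_rep_one: "sym_rep (tensor M []) counit_form = 1"
  using sym_rep_eval[OF tensor_in_carrier exchange_counit_form]
    exchange_multilinear[OF exchange_counit_form] by (simp add: counit_form_def)

sublocale C: completion S P scaleH j
proof
  show "is_completion S P scaleH j" by (rule complete)
  show "function_module S" by (rule function_module_symmetric)
  show "seminorm_on S p" if p: "p \<in> P" for p
  proof -
    obtain w q where wq: "(w, q) \<in> \<W>" "p = weighted_seminorm M w q" using p by blast
    then have "seminorm_on T p"
      using seminorm_on_weighted[of q w M] weight_nonneg seminorm_nonneg by blast
    then show ?thesis unfolding seminorm_on_def using S_subset by simp
  qed
  show "\<exists>r\<in>P. \<forall>x\<in>carrier S. p x \<le> r x \<and> q x \<le> r x" if pq: "p \<in> P" "q \<in> P" for p q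
  proof -
    obtain w1 q1 w2 q2 where 1: "(w1, q1) \<in> \<W>" "p = weighted_seminorm M w1 q1"
      and 2: "(w2, q2) \<in> \<W>" "q = weighted_seminorm M w2 q2" using pq by blast
    obtain w q' where w: "(w, q') \<in> \<W>" "\<And>n. w1 n \<le> w n" "\<And>n. w2 n \<le> w n"
        "\<And>x. q1 x \<le> q' x" "\<And>x. q2 x \<le> q' x"
      using directed_weights[OF 1(1) 2(1)] by blast
    have le: "weighted_seminorm M w0 q0 x \<le> weighted_seminorm M w q' x"
      if 0: "(w0, q0) \<in> \<W>" "\<And>n. w0 n \<le> w n" "\<And>x. q0 x \<le> q' x" and x: "x \<in> carrier S" for w0 q0 x
    proof -
      have "word_weight w0 q0 xs \<le> 1 * word_weight w q' xs" for xs
        unfolding word_weight_def using 0 w weight_nonneg[OF 0(1)] weight_nonneg[OF w(1)] seminorm_nonneg[OF 0(1)]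
        by (auto intro!: mult_mono prod_list_map_mono prod_list_map_nonneg)
      moreover have "weighted_seminorm M w0 q0 (tensor M xs) \<le> word_weight w0 q0 xs" for xs
        by (rule weighted_seminorm_tensor) (use weight_nonneg[OF 0(1)] seminorm_nonneg[OF 0(1)] in auto)
      ultimately have "weighted_seminorm M w0 q0 (tensor M xs) \<le> 1 * word_weight w q' xs" for xs
        using order_trans by blast
      then have "weighted_seminorm M w0 q0 x \<le> 1 * weighted_seminorm M w q' x"
        using weight_nonneg[OF 0(1)] seminorm_nonneg[OF 0(1)] weight_nonneg[OF w(1)] seminorm_nonneg[OF w(1)]
          S_subset[OF x]
        by (intro seminorm_le_weighted[of M "weighted_seminorm M w0 q0" 1 q' w x] seminorm_on_weighted) auto
      then show ?thesis by simp
    qed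
    show ?thesis using 1 2 w le by blast
  qed
  show "\<exists>x\<in>carrier S. x \<noteq> (\<lambda>\<phi>. 0)" if "P = {}"
  proof
    show "sym_rep (tensor M []) \<noteq> (\<lambda>\<phi>. 0)" using sym_rep_one by force
  qed simp
qed

definition emb :: "('k, 'g) tensor \<Rightarrow> 'h" where
  "emb t = j (sym_rep t)"

definition emb_word :: "'g list \<Rightarrow> 'h" where
  "emb_word xs = j (rep xs)"

lemma emb_add: "s \<in> carrier T \<Longrightarrow> t \<in> carrier T \<Longrightarrow> emb (\<lambda>\<phi>. s \<phi> + t \<phi>) = emb s + emb t"
  by (simp add: emb_def sym_rep_add C.j_add)

lemma emb_scale: "t \<in> carrier T \<Longrightarrow> emb (\<lambda>\<phi>. c * t \<phi>) = scaleH c (emb t)"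
  by (simp add: emb_def sym_rep_scale C.j_scale)

lemma emb_tensor: "emb (tensor M xs) = emb_word xs"
  by (simp add: emb_def emb_word_def rep_def)

lemma emb_S: "f \<in> carrier S \<Longrightarrow> emb f = j f"
  by (simp add: emb_def sym_rep_id)

lemma emb_cong: "s \<in> carrier T \<Longrightarrow> t \<in> carrier T \<Longrightarrow> (\<And>\<phi>. exchange \<phi> \<Longrightarrow> s \<phi> = t \<phi>) \<Longrightarrow> emb s = emb t"
  unfolding emb_def using sym_rep_cong[of s t] by presburger

lemma rep_S [simp]: "rep xs \<in> carrier S"
  by (simp add: rep_def)

lemma emb_word_slot:
  "emb_word (us @ (x + y) # vs) = emb_word (us @ x # vs) + emb_word (us @ y # vs)"
  "emb_word (us @ scaleV c x # vs) = scaleH c (emb_word (us @ x # vs))"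
  using emb_add emb_scale by (simp_all add: emb_tensor[symmetric] tensor_slot)

lemma multilinear_emb_word: "multilinear_map H.MH emb_word"
  unfolding multilinear_map_def by (simp add: emb_word_slot)

lemma emb_word_exchange: "emb_word (us @ x # y # vs) = emb_word (us @ y # x # vs) + scaleH z (emb_word (us @ bracket x y # vs))"
proof -
  have "emb (tensor M (us @ x # y # vs)) =
      emb (\<lambda>\<phi>. tensor M (us @ y # x # vs) \<phi> + z * tensor M (us @ bracket x y # vs) \<phi>)"
    by (rule emb_cong)
      (auto intro!: tensor_algebra_closed simp: exchange_multilinear exchangeD[symmetric])
  then show ?thesis
    by (simp add: emb_add emb_scale tensor_algebra_closed emb_tensor)
qed

lemma dense_emb_word: "closure (H.span (range emb_word)) = UNIV"
proof -
  have "emb t \<in> H.span (range emb_word)" if "t \<in> carrier T" for t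
    using that unfolding carrier_tensor_algebra
  proof (induction rule: lspan_induct)
    case zero
    have "emb (\<lambda>\<phi>. 0) = 0" using emb_scale[OF tensor_algebra_zero_closed, of 0] by simp
    then show ?case by (simp add: H.span_zero)
  next
    case (add c xs t)
    then have t: "t \<in> carrier T" by (simp add: carrier_tensor_algebra)
    have "emb (\<lambda>\<phi>. c * tensor M xs \<phi> + t \<phi>) = scaleH c (emb_word xs) + emb t"
      by (simp add: emb_add emb_scale emb_tensor tensor_algebra_closed t)
    then show ?case using add.IH by (simp add: H.span_add H.span_scale H.span_base)
  qed
  then have "j ` carrier S \<subseteq> H.span (range emb_word)" using S_subset emb_S by force
  then show ?thesis using C.dense closure_mono by blast
qed

lemma emb_word_bound:
  assumes r: "continuous_seminorm scaleH r"
  obtains w q C where "(w, q) \<in> \<W>" "C \<ge> 0" "\<And>xs. r (emb_word xs) \<le> C * word_weight w q xs"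
proof -
  obtain p C where p: "p \<in> P" "C \<ge> 0" "\<And>x. x \<in> carrier S \<Longrightarrow> r (j x) \<le> C * p x"
    using C.continuous_seminorm_le[OF r] by blast
  then obtain w q where wq: "(w, q) \<in> \<W>" "p = weighted_seminorm M w q" by blast
  obtain w' q' C' where *: "(w', q') \<in> \<W>" "C' \<ge> 0" "\<And>xs. p (rep xs) \<le> C' * word_weight w' q' xs"
    using rep_bound[OF wq(1)] wq(2) by blast
  have "r (emb_word xs) \<le> (C * C') * word_weight w' q' xs" for xs
    unfolding emb_word_def using p(3)[OF rep_S, of xs] mult_left_mono[OF *(3)[of xs] p(2)] by (simp add: mult.assoc)
  then show ?thesis using that[of w' q' "C * C'"] * p(2) by simp
qed

lemma word_bound:
  assumes wq: "(w, q) \<in> \<W>" and C: "C \<ge> 0" and \<rho>: "seminorm_on T \<rho>"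
    and words: "\<And>xs. \<rho> (tensor M xs) \<le> C * word_weight w q xs" and t: "t \<in> carrier T"
  shows "\<rho> t \<le> C * weighted_seminorm M w q t"
  using seminorm_le_weighted[of M \<rho> C q w t, OF \<rho> C seminorm_nonneg[OF wq] weight_nonneg[OF wq] words t] .

definition j_inv :: "'h \<Rightarrow> ('k, 'g) tensor" where
  "j_inv = the_inv_into (carrier S) j"

lemma j_inv_j [simp]: "f \<in> carrier S \<Longrightarrow> j_inv (j f) = f"
  unfolding j_inv_def by (rule the_inv_into_f_f[OF C.inj])

lemma j_inv_closed [simp]: "x \<in> j ` carrier S \<Longrightarrow> j_inv x \<in> carrier T"
  using S_subset by auto

lemma j_image:
  assumes x: "x \<in> j ` carrier S"
  shows "y \<in> j ` carrier S \<Longrightarrow> x + y \<in> j ` carrier S" "scaleH c x \<in> j ` carrier S"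
    "y \<in> j ` carrier S \<Longrightarrow> j_inv (x + y) = (\<lambda>\<phi>. j_inv x \<phi> + j_inv y \<phi>)"
    "j_inv (scaleH c x) = (\<lambda>\<phi>. c * j_inv x \<phi>)"
proof -
  obtain f where f: "f \<in> carrier S" "x = j f" using x by blast
  have *: "scaleH c x = j (\<lambda>\<phi>. c * f \<phi>)"
    using f by (simp add: C.j_scale)
  show "scaleH c x \<in> j ` carrier S" "j_inv (scaleH c x) = (\<lambda>\<phi>. c * j_inv x \<phi>)"
    unfolding * using f S_closed[OF f(1)] by auto
  assume "y \<in> j ` carrier S"
  then obtain g where g: "g \<in> carrier S" "y = j g" by blast
  have *: "x + y = j (\<lambda>\<phi>. f \<phi> + g \<phi>)"
    using f g by (simp add: C.j_add)
  show "x + y \<in> j ` carrier S" "j_inv (x + y) = (\<lambda>\<phi>. j_inv x \<phi> + j_inv y \<phi>)"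
    unfolding * using f g S_closed[OF f(1)] by auto
qed

text \<open>The map is given on all tensors, where bounds can be checked on words, and is then
  restricted to the symmetric tensors, which are dense in the completion. There \<open>L\<close> is
  bounded by a seminorm of the defining family.\<close>

lemma extension:
  fixes sX :: "'k \<Rightarrow> 'x::{uniform_topological_group_add,ab_group_add,complete_uniform_space,t2_space} \<Rightarrow> 'x"
  assumes lc: "locally_convex_space sX"
    and add: "\<And>s t. s \<in> carrier T \<Longrightarrow> t \<in> carrier T \<Longrightarrow> L (\<lambda>\<phi>. s \<phi> + t \<phi>) = L s + L t"
    and scale: "\<And>c t. t \<in> carrier T \<Longrightarrow> L (\<lambda>\<phi>. c * t \<phi>) = sX c (L t)"
    and bound: "\<And>r. continuous_seminorm sX r \<Longrightarrow>
      \<exists>w q C. (w, q) \<in> \<W> \<and> C \<ge> 0 \<and> (\<forall>xs. r (L (tensor M xs)) \<le> C * word_weight w q xs)"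
  obtains g where "continuous_linear scaleH sX g" "\<And>f. f \<in> carrier S \<Longrightarrow> g (j f) = L f"
proof -
  interpret X: locally_convex_space sX by fact
  show ?thesis
  proof (rule linear_extension[of scaleH sX "j ` carrier S" "\<lambda>x. L (j_inv x)"])
    fix r assume r: "continuous_seminorm sX r"
    obtain w q C where wq: "(w, q) \<in> \<W>" "C \<ge> 0" "\<And>xs. r (L (tensor M xs)) \<le> C * word_weight w q xs"
      using bound[OF r] by blast
    have "seminorm_on T (\<lambda>t. r (L t))"
      unfolding seminorm_on_def
      using X.continuous_seminorm_triangle[OF r] X.continuous_seminorm_scale[OF r] by (simp add: add scale)
    from word_bound[OF wq(1,2) this wq(3)]
    have le: "r (L t) \<le> C * weighted_seminorm M w q t" if "t \<in> carrier T" for t using that by blast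
    obtain r' where r': "continuous_seminorm scaleH r'"
        "\<And>x. x \<in> carrier S \<Longrightarrow> weighted_seminorm M w q x \<le> r' (j x)"
      using C.seminorm_le[of "weighted_seminorm M w q"] wq(1) by blast
    show "\<exists>p. continuous_seminorm scaleH p \<and> (\<forall>x\<in>j ` carrier S. r (L (j_inv x)) \<le> p x)"
    proof (intro exI[of _ "\<lambda>x. C * r' x"] conjI ballI)
      show "continuous_seminorm scaleH (\<lambda>x. C * r' x)" by (rule H.continuous_seminorm_mult[OF r'(1) wq(2)])
      fix x assume "x \<in> j ` carrier S"
      then obtain f where f: "f \<in> carrier S" "x = j f" by blast
      have "r (L f) \<le> C * r' (j f)"
        using le[OF S_subset[OF f(1)]] mult_left_mono[OF r'(2)[OF f(1)] wq(2)] by simp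
      then show "r (L (j_inv x)) \<le> C * r' x" using f by simp
    qed
  next
    fix g assume g: "continuous_linear scaleH sX g" "\<And>x. x \<in> j ` carrier S \<Longrightarrow> g x = L (j_inv x)"
    have "g (j f) = L f" if "f \<in> carrier S" for f using g(2)[OF imageI[OF that]] j_inv_j[OF that] by simp
    with g(1) show thesis by (rule that)
  qed (simp_all add: lc C.dense j_image add scale H.locally_convex_space_axioms)
qed

lemma j2_split_sum:
  "j2 (\<lambda>\<psi>. split_sum xs (\<lambda>a b. tensor H.MH [f a, f b] \<psi>)) = split_sum xs (\<lambda>a b. H.tens2 (f a) (f b))"
proof -
  have "(\<lambda>\<psi>. split_sum xs (\<lambda>a b. tensor H.MH [F a b, G a b] \<psi>)) \<in> carrier (tensor_power H.MH 2) \<and>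
    j2 (\<lambda>\<psi>. split_sum xs (\<lambda>a b. tensor H.MH [F a b, G a b] \<psi>)) = split_sum xs (\<lambda>a b. H.tens2 (F a b) (G a b))" for F G
  proof (induction xs arbitrary: F G)
    case Nil
    show ?case using H.pair_closed by (simp add: H.tens2_def)
  next
    case (Cons x xs)
    show ?case
      using Cons.IH[of "\<lambda>a. F (x # a)" "\<lambda>a. G (x # a)"] Cons.IH[of "\<lambda>a b. F a (x # b)" "\<lambda>a b. G a (x # b)"]
      by (simp add: H.C2.j_add H.C2.closed)
  qed
  from this[of "\<lambda>a b. f a" "\<lambda>a b. f b"] show ?thesis by simp
qed

lemma exchange_emb_word:
  assumes "multilinear_form H.MH \<psi>"
  shows "exchange (\<lambda>a. \<psi> [emb_word a, v])" "exchange (\<lambda>b. \<psi> [v, emb_word b])"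
proof -
  have v: "v \<in> carrier H.MH" by simp
  show "exchange (\<lambda>a. \<psi> [emb_word a, v])"
    unfolding exchange_def
  proof (intro conjI allI)
    fix us x y vs
    have "\<psi> [emb_word (us @ x # y # vs), v] = \<psi> [emb_word (us @ y # x # vs), v] + z * \<psi> [emb_word (us @ bracket x y # vs), v]"
      unfolding emb_word_exchange[of us x y vs]
      using multilinear_formD[OF assms, of "[]" "[v]"] by simp
    then show "\<psi> [emb_word (us @ x # y # vs), v] - \<psi> [emb_word (us @ y # x # vs), v] = z * \<psi> [emb_word (us @ bracket x y # vs), v]" by simp
  qed (rule multilinear_map_form(1)[OF multilinear_emb_word assms v])
  show "exchange (\<lambda>b. \<psi> [v, emb_word b])"
    unfolding exchange_def
  proof (intro conjI allI)
    fix us x y vs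
    have "\<psi> [v, emb_word (us @ x # y # vs)] = \<psi> [v, emb_word (us @ y # x # vs)] + z * \<psi> [v, emb_word (us @ bracket x y # vs)]"
      unfolding emb_word_exchange[of us x y vs]
      using multilinear_formD[OF assms, of "[v]" "[]"] by simp
    then show "\<psi> [v, emb_word (us @ x # y # vs)] - \<psi> [v, emb_word (us @ y # x # vs)] = z * \<psi> [v, emb_word (us @ bracket x y # vs)]" by simp
  qed (rule multilinear_map_form(2)[OF multilinear_emb_word assms v])
qed

text \<open>The form at which \<open>cop\<close> evaluates is an exchange form, so it does not
  distinguish a word from its symmetric representative.\<close>

lemma cop_rep: "cop H.MH emb_word (rep xs) = cop H.MH emb_word (tensor M xs)"
proof
  fix \<psi>
  show "cop H.MH emb_word (rep xs) \<psi> = cop H.MH emb_word (tensor M xs) \<psi>"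
  proof (cases "multilinear_form H.MH \<psi>")
    case True
    have "exchange (\<lambda>xs. split_sum xs (\<lambda>a b. \<psi> [emb_word a, emb_word b]))"
      by (rule exchange_split_sum) (rule exchange_emb_word[OF True])+
    then show ?thesis using True sym_rep_eval[OF tensor_in_carrier] by (simp add: cop_def rep_def)
  qed (simp add: cop_def)
qed

lemma coproduct_extension:
  obtains \<Delta> where "continuous_linear scaleH scaleH2 \<Delta>"
    "\<And>f. f \<in> carrier S \<Longrightarrow> \<Delta> (j f) = j2 (cop H.MH emb_word f)"
    "\<And>xs. \<Delta> (emb_word xs) = split_sum xs (\<lambda>a b. H.tens2 (emb_word a) (emb_word b))"
proof -
  have word: "j2 (cop H.MH emb_word (tensor M xs)) = split_sum xs (\<lambda>a b. H.tens2 (emb_word a) (emb_word b))" for xs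
    unfolding cop_tensor[OF multilinear_emb_word] by (rule j2_split_sum)
  obtain \<Delta> where \<Delta>: "continuous_linear scaleH scaleH2 \<Delta>" "\<And>f. f \<in> carrier S \<Longrightarrow> \<Delta> (j f) = j2 (cop H.MH emb_word f)"
  proof (rule extension[of scaleH2 "\<lambda>t. j2 (cop H.MH emb_word t)"])
    show "locally_convex_space scaleH2" by (rule H.C2.locally_convex_space_axioms)
    fix s t assume st: "s \<in> carrier T" "t \<in> carrier T"
    have "cop H.MH emb_word (\<lambda>\<phi>. s \<phi> + t \<phi>) = (\<lambda>\<psi>. cop H.MH emb_word s \<psi> + cop H.MH emb_word t \<psi>)"
      by (auto simp: cop_def)
    then show "j2 (cop H.MH emb_word (\<lambda>\<phi>. s \<phi> + t \<phi>)) = j2 (cop H.MH emb_word s) + j2 (cop H.MH emb_word t)"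
      using cop_closed[OF multilinear_emb_word] st by (simp add: H.C2.j_add)
  next
    fix c t assume t: "t \<in> carrier T"
    have "cop H.MH emb_word (\<lambda>\<phi>. c * t \<phi>) = (\<lambda>\<psi>. c * cop H.MH emb_word t \<psi>)" by (auto simp: cop_def)
    then show "j2 (cop H.MH emb_word (\<lambda>\<phi>. c * t \<phi>)) = scaleH2 c (j2 (cop H.MH emb_word t))"
      using cop_closed[OF multilinear_emb_word t] by (simp add: H.C2.j_scale)
  next
    fix r assume r: "continuous_seminorm scaleH2 r"
    have "\<exists>p. continuous_seminorm scaleH p \<and> (\<forall>x y. r (H.tens2 x y) \<le> p x * p y)"
      by (rule H.tens2_bound[OF r]) (rule exI, rule conjI, assumption, simp)
    then obtain p where p: "continuous_seminorm scaleH p" "\<And>x y. r (H.tens2 x y) \<le> p x * p y"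
      by (elim exE conjE) simp
    obtain w q C where wq: "(w, q) \<in> \<W>" "C \<ge> 0" "\<And>xs. p (emb_word xs) \<le> C * word_weight w q xs"
      using emb_word_bound[OF p(1)] by blast
    obtain w' q' C' where wq': "(w', q') \<in> \<W>" "C' \<ge> 0"
      "\<And>xs a b. mset a + mset b = mset xs \<Longrightarrow> 2 ^ length xs * (word_weight w q a * word_weight w q b) \<le> C' * word_weight w' q' xs"
      using split_bound[OF wq(1)] by (elim exE conjE) simp
    have p0: "0 \<le> p x" for x by (rule H.continuous_seminorm_nonneg[OF p(1)])
    have "r (split_sum xs (\<lambda>a b. H.tens2 (F a b) (G a b))) \<le> split_sum xs (\<lambda>a b. p (F a b) * p (G a b))" for xs F G
    proof (induction xs arbitrary: F G)
      case Nil
      show ?case using p(2) by simp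
    next
      case (Cons x xs)
      show ?case
        using H.C2.continuous_seminorm_triangle[OF r,
            of "split_sum xs (\<lambda>a b. H.tens2 (F (x # a) b) (G (x # a) b))" "split_sum xs (\<lambda>a b. H.tens2 (F a (x # b)) (G a (x # b)))"]
          Cons.IH[of "\<lambda>a. F (x # a)" "\<lambda>a. G (x # a)"] Cons.IH[of "\<lambda>a b. F a (x # b)" "\<lambda>a b. G a (x # b)"]
        by simp
    qed
    then have "r (split_sum xs (\<lambda>a b. H.tens2 (emb_word a) (emb_word b))) \<le> split_sum xs (\<lambda>a b. p (emb_word a) * p (emb_word b))" for xs .
    \<comment> \<open>The bound of each summand is divided by 2^n in advance, so that the constant
      summands of \<open>split_sum_const\<close> add up to a multiple of the weight of
      \<open>xs\<close>.\<close>
    also have "split_sum xs (\<lambda>a b. p (emb_word a) * p (emb_word b)) \<le> split_sum xs (\<lambda>a b. C\<^sup>2 * C' * word_weight w' q' xs / 2 ^ length xs)" for xs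
    proof (rule split_sum_mono)
      fix a b assume ab: "mset a + mset b = mset xs"
      have "p (emb_word a) * p (emb_word b) \<le> (C * word_weight w q a) * (C * word_weight w q b)"
        by (rule mult_mono[OF wq(3) wq(3)])
          (use p0 wq(2) word_weight_nonneg[of q w a, OF seminorm_nonneg[OF wq(1)] weight_nonneg[OF wq(1)]] in auto)
      also have "\<dots> = C\<^sup>2 * (2 ^ length xs * (word_weight w q a * word_weight w q b)) / 2 ^ length xs"
        by (simp add: power2_eq_square)
      also have "\<dots> \<le> C\<^sup>2 * (C' * word_weight w' q' xs) / 2 ^ length xs"
        by (intro divide_right_mono mult_left_mono wq'(3) ab) auto
      finally show "p (emb_word a) * p (emb_word b) \<le> C\<^sup>2 * C' * word_weight w' q' xs / 2 ^ length xs" by (simp add: mult.assoc)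
    qed
    finally have "r (split_sum xs (\<lambda>a b. H.tens2 (emb_word a) (emb_word b))) \<le> (C\<^sup>2 * C') * word_weight w' q' xs" for xs
      by (simp add: split_sum_const)
    then show "\<exists>w q C. (w, q) \<in> \<W> \<and> C \<ge> 0 \<and> (\<forall>xs. r (j2 (cop H.MH emb_word (tensor M xs))) \<le> C * word_weight w q xs)"
      using wq' by (intro exI[of _ w'] exI[of _ q'] exI[of _ "C\<^sup>2 * C'"]) (simp add: word)
  qed (rule that)
  have "\<Delta> (emb_word xs) = split_sum xs (\<lambda>a b. H.tens2 (emb_word a) (emb_word b))" for xs
    using \<Delta>(2)[OF rep_S, of xs] by (simp add: emb_word_def[symmetric, of xs] cop_rep word)
  with \<Delta> show ?thesis by (rule that)
qed

text \<open>Among the words only the empty one has nonzero counit, and its weight is 1 by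
  \<open>weight_0\<close>.\<close>

lemma counit_extension:
  obtains \<epsilon> where "continuous_linear scaleH (*) \<epsilon>" "\<And>f. f \<in> carrier S \<Longrightarrow> \<epsilon> (j f) = f counit_form"
    "\<And>xs. \<epsilon> (emb_word xs) = (if xs = [] then 1 else 0)"
proof -
  have m: "multilinear_form M counit_form" by (rule exchange_multilinear[OF exchange_counit_form])
  obtain \<epsilon> where \<epsilon>: "continuous_linear scaleH (*) \<epsilon>" "\<And>f. f \<in> carrier S \<Longrightarrow> \<epsilon> (j f) = f counit_form"
  proof (rule extension[of "(*)" "\<lambda>t. t counit_form"])
    show "locally_convex_space ((*) :: 'k \<Rightarrow> 'k \<Rightarrow> 'k)" by (rule locally_convex_space_field)
    fix r :: "'k \<Rightarrow> real" assume r: "continuous_seminorm (*) r"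
    obtain w q where wq: "(w, q) \<in> \<W>" using C.P_nonempty by blast
    interpret K: locally_convex_space "(*) :: 'k \<Rightarrow> 'k \<Rightarrow> 'k" by (rule locally_convex_space_field)
    have "r (tensor M xs counit_form) \<le> r 1 * word_weight w q xs" for xs
      using K.continuous_seminorm_nonneg[OF r] K.continuous_seminorm_zero[OF r] weight_0[OF wq]
        word_weight_nonneg[of q w xs, OF seminorm_nonneg[OF wq] weight_nonneg[OF wq]]
      by (simp add: m counit_form_def word_weight_def)
    then show "\<exists>w q C. (w, q) \<in> \<W> \<and> C \<ge> 0 \<and> (\<forall>xs. r (tensor M xs counit_form) \<le> C * word_weight w q xs)"
      using wq K.continuous_seminorm_nonneg[OF r] by blast
  qed (rule refl | (rule that; assumption))+
  have "\<epsilon> (emb_word xs) = (if xs = [] then 1 else 0)" for xs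
    using \<epsilon>(2)[OF rep_S, of xs] sym_rep_eval[OF tensor_in_carrier exchange_counit_form, of xs] m
    by (simp add: emb_word_def rep_def counit_form_def)
  with \<epsilon> show ?thesis by (rule that)
qed

lemma antipode_extension:
  obtains A where "continuous_linear scaleH scaleH A" "\<And>f. f \<in> carrier S \<Longrightarrow> A (j f) = emb (antipode f)"
    "\<And>xs. A (emb_word xs) = scaleH ((- 1) ^ length xs) (emb_word (rev xs))"
proof -
  have word: "emb (antipode (tensor M xs)) = scaleH ((- 1) ^ length xs) (emb_word (rev xs))" for xs
    by (simp add: antipode_tensor emb_scale emb_tensor)
  obtain A where A: "continuous_linear scaleH scaleH A" "\<And>f. f \<in> carrier S \<Longrightarrow> A (j f) = emb (antipode f)"
  proof (rule extension[of scaleH "\<lambda>t. emb (antipode t)"])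
    show "locally_convex_space scaleH" by (rule H.locally_convex_space_axioms)
    fix s t assume st: "s \<in> carrier T" "t \<in> carrier T"
    have "antipode (\<lambda>\<phi>. s \<phi> + t \<phi>) = (\<lambda>\<phi>. antipode s \<phi> + antipode t \<phi>)" by (auto simp: antipode_def)
    then show "emb (antipode (\<lambda>\<phi>. s \<phi> + t \<phi>)) = emb (antipode s) + emb (antipode t)"
      using st by (simp add: emb_add antipode_closed)
  next
    fix c t assume t: "t \<in> carrier T"
    have "antipode (\<lambda>\<phi>. c * t \<phi>) = (\<lambda>\<phi>. c * antipode t \<phi>)" by (auto simp: antipode_def)
    then show "emb (antipode (\<lambda>\<phi>. c * t \<phi>)) = scaleH c (emb (antipode t))"
      using t by (simp add: emb_scale antipode_closed)
  next
    fix r assume r: "continuous_seminorm scaleH r"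
    obtain w q C where wq: "(w, q) \<in> \<W>" "C \<ge> 0" "\<And>xs. r (emb_word xs) \<le> C * word_weight w q xs"
      using emb_word_bound[OF r] by blast
    \<comment> \<open>Reversal preserves the weight and the sign has norm 1, so the bound for
      \<open>emb_word\<close> carries over with the same weight and seminorm.\<close>
    have "word_weight w q (rev xs) = word_weight w q xs" for xs
      by (simp add: word_weight_def rev_map[symmetric] prod_list.rev)
    then have "r (emb (antipode (tensor M xs))) \<le> C * word_weight w q xs" for xs
      using wq(3)[of "rev xs"] by (simp add: word H.continuous_seminorm_scale[OF r] norm_power)
    then show "\<exists>w q C. (w, q) \<in> \<W> \<and> C \<ge> 0 \<and> (\<forall>xs. r (emb (antipode (tensor M xs))) \<le> C * word_weight w q xs)"
      using wq by blast
  qed (rule that)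
  have "emb (antipode (rep xs)) = emb (antipode (tensor M xs))" for xs
  proof (rule emb_cong)
    fix \<phi> assume \<phi>: "exchange \<phi>"
    show "antipode (rep xs) \<phi> = antipode (tensor M xs) \<phi>"
      using sym_rep_eval[OF tensor_in_carrier exchange_antipode[OF \<phi>], of xs]
      by (simp add: antipode_def rep_def)
  qed (simp_all add: antipode_closed S_subset)
  then have "A (emb_word xs) = scaleH ((- 1) ^ length xs) (emb_word (rev xs))" for xs
    using A(2)[OF rep_S, of xs] by (simp add: word emb_word_def[symmetric, of xs])
  with A show ?thesis by (rule that)
qed

lemma mult_closed: "s \<in> carrier T \<Longrightarrow> t \<in> carrier T \<Longrightarrow> s \<otimes>\<^bsub>T\<^esub> t \<in> carrier T"
  by (rule tensor_algebra_mult_closed)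

lemma emb_mult_add:
  assumes "s \<in> carrier T" "t \<in> carrier T" "u \<in> carrier T"
  shows "emb ((\<lambda>\<phi>. s \<phi> + t \<phi>) \<otimes>\<^bsub>T\<^esub> u) = emb (s \<otimes>\<^bsub>T\<^esub> u) + emb (t \<otimes>\<^bsub>T\<^esub> u)"
    "emb (u \<otimes>\<^bsub>T\<^esub> (\<lambda>\<phi>. s \<phi> + t \<phi>)) = emb (u \<otimes>\<^bsub>T\<^esub> s) + emb (u \<otimes>\<^bsub>T\<^esub> t)"
  using ring.ring_simprules(13,23)[OF ring_T, of s t u] assms
  by (simp_all add: emb_add mult_closed)

lemma emb_mult_scale:
  assumes "s \<in> carrier T" "u \<in> carrier T"
  shows "emb ((\<lambda>\<phi>. c * s \<phi>) \<otimes>\<^bsub>T\<^esub> u) = scaleH c (emb (s \<otimes>\<^bsub>T\<^esub> u))"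
    "emb (u \<otimes>\<^bsub>T\<^esub> (\<lambda>\<phi>. c * s \<phi>)) = scaleH c (emb (u \<otimes>\<^bsub>T\<^esub> s))"
proof -
  have 1: "(\<lambda>\<phi>. c * s \<phi>) \<otimes>\<^bsub>T\<^esub> u = (\<lambda>\<phi>. c * (s \<otimes>\<^bsub>T\<^esub> u) \<phi>)"
    by (auto simp: tensor_algebra_mult)
  have "u \<otimes>\<^bsub>T\<^esub> (\<lambda>\<phi>. c * s \<phi>) = (\<lambda>\<phi>. c * (u \<otimes>\<^bsub>T\<^esub> s) \<phi>)"
    by (auto simp: tensor_algebra_mult tensor_algebra_eval_scale[OF assms(2) multilinear_form_inner[OF assms(1)]])
  with 1 show "emb ((\<lambda>\<phi>. c * s \<phi>) \<otimes>\<^bsub>T\<^esub> u) = scaleH c (emb (s \<otimes>\<^bsub>T\<^esub> u))"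
    "emb (u \<otimes>\<^bsub>T\<^esub> (\<lambda>\<phi>. c * s \<phi>)) = scaleH c (emb (u \<otimes>\<^bsub>T\<^esub> s))"
    using assms by (simp_all add: emb_scale mult_closed)
qed

text \<open>\<open>word_bound\<close> is applied twice: in the first factor while the second is a
  fixed word, then in the second factor for an arbitrary first one.\<close>

lemma star_bound:
  assumes r: "continuous_seminorm scaleH r"
  obtains p where "continuous_seminorm scaleH p"
    "\<And>f g. f \<in> carrier S \<Longrightarrow> g \<in> carrier S \<Longrightarrow> r (emb (f \<otimes>\<^bsub>T\<^esub> g)) \<le> p (j f) * p (j g)"
proof -
  obtain w q C where wq: "(w, q) \<in> \<W>" "C \<ge> 0" "\<And>xs. r (emb_word xs) \<le> C * word_weight w q xs"
    using emb_word_bound[OF r] by blast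
  obtain w' q' C' where wq': "(w', q') \<in> \<W>" "C' \<ge> 0"
    "\<And>xs ys. word_weight w q (xs @ ys) \<le> C' * (word_weight w' q' xs * word_weight w' q' ys)"
    using append_bound[OF wq(1)] by (elim exE conjE) simp
  define K where "K = C * C'"
  have K: "K \<ge> 0" using wq wq' by (simp add: K_def)
  have g0: "0 \<le> word_weight w' q' xs" for xs
    by (rule word_weight_nonneg) (use seminorm_nonneg[OF wq'(1)] weight_nonneg[OF wq'(1)] in auto)
  have words: "r (emb (tensor M xs \<otimes>\<^bsub>T\<^esub> tensor M ys)) \<le> (K * word_weight w' q' ys) * word_weight w' q' xs" for xs ys
  proof -
    have "r (emb (tensor M xs \<otimes>\<^bsub>T\<^esub> tensor M ys)) \<le> C * word_weight w q (xs @ ys)"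
      using wq(3)[of "xs @ ys"] by (simp only: tensor_append[symmetric] emb_tensor)
    also have "\<dots> \<le> C * (C' * (word_weight w' q' xs * word_weight w' q' ys))"
      by (rule mult_left_mono[OF wq'(3) wq(2)])
    finally show ?thesis by (simp add: K_def mult_ac)
  qed
  have sem: "seminorm_on T (\<lambda>s. r (emb (s \<otimes>\<^bsub>T\<^esub> u)))" "seminorm_on T (\<lambda>s. r (emb (u \<otimes>\<^bsub>T\<^esub> s)))"
    if u: "u \<in> carrier T" for u
    unfolding seminorm_on_def using u H.continuous_seminorm_triangle[OF r] H.continuous_seminorm_scale[OF r]
    by (simp_all add: emb_mult_add emb_mult_scale)
  have 1: "r (emb (s \<otimes>\<^bsub>T\<^esub> tensor M ys)) \<le> (K * word_weight w' q' ys) * weighted_seminorm M w' q' s"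
    if "s \<in> carrier T" for s ys
    by (rule word_bound[OF wq'(1) _ sem(1)[OF tensor_in_carrier] words that]) (use K g0 in simp)
  define N where "N = weighted_seminorm M w' q'"
  have N: "0 \<le> N s" if "s \<in> carrier T" for s
    unfolding N_def
    by (rule seminorm_onD(3)[OF function_module_tensor_algebra seminorm_on_weighted that])
      (use seminorm_nonneg[OF wq'(1)] weight_nonneg[OF wq'(1)] in auto)
  have 2: "r (emb (s \<otimes>\<^bsub>T\<^esub> t)) \<le> K * (N s * N t)" if s: "s \<in> carrier T" and t: "t \<in> carrier T" for s t
  proof -
    have "r (emb (s \<otimes>\<^bsub>T\<^esub> t)) \<le> (K * N s) * weighted_seminorm M w' q' t"
      by (rule word_bound[OF wq'(1) _ sem(2)[OF s] _ t]) (use 1[OF s] K N[OF s] in \<open>auto simp: N_def mult_ac\<close>)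
    then show ?thesis by (simp add: N_def mult_ac)
  qed
  obtain r' where r': "continuous_seminorm scaleH r'" "\<And>x. x \<in> carrier S \<Longrightarrow> N x \<le> r' (j x)"
    using C.seminorm_le[of N] wq'(1) unfolding N_def by blast
  define p where "p x = (K + 1) * r' x" for x
  have p: "continuous_seminorm scaleH p"
    unfolding p_def by (rule H.continuous_seminorm_mult[OF r'(1)]) (use K in simp)
  have "r (emb (f \<otimes>\<^bsub>T\<^esub> g)) \<le> p (j f) * p (j g)" if f: "f \<in> carrier S" and g: "g \<in> carrier S" for f g
  proof -
    have "r (emb (f \<otimes>\<^bsub>T\<^esub> g)) \<le> K * (N f * N g)" using 2 S_subset f g by blast
    also have "\<dots> \<le> ((K + 1) * (K + 1)) * (r' (j f) * r' (j g))"
    proof (intro mult_mono)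
      show "K \<le> (K + 1) * (K + 1)" using K by (simp add: algebra_simps)
    qed (use r'(2)[OF f] r'(2)[OF g] N[OF S_subset[OF f]] N[OF S_subset[OF g]] K in auto)
    finally show ?thesis by (simp add: p_def mult_ac)
  qed
  with p show ?thesis by (rule that)
qed

lemma times_extension:
  obtains times where "bounded_bilinear_map scaleH scaleH scaleH times"
    "\<And>f g. f \<in> carrier S \<Longrightarrow> g \<in> carrier S \<Longrightarrow> times (j f) (j g) = emb (f \<otimes>\<^bsub>T\<^esub> g)"
    "\<And>xs ys. times (emb_word xs) (emb_word ys) = emb_word (xs @ ys)"
proof -
  obtain times where t: "bounded_bilinear_map scaleH scaleH scaleH times"
    "\<And>x y. x \<in> j ` carrier S \<Longrightarrow> y \<in> j ` carrier S \<Longrightarrow> times x y = emb (j_inv x \<otimes>\<^bsub>T\<^esub> j_inv y)"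
  proof (rule bilinear_extension[of scaleH "j ` carrier S" "\<lambda>x y. emb (j_inv x \<otimes>\<^bsub>T\<^esub> j_inv y)"])
    fix r assume "continuous_seminorm scaleH r"
    then obtain p where p: "continuous_seminorm scaleH p"
      "\<And>f g. f \<in> carrier S \<Longrightarrow> g \<in> carrier S \<Longrightarrow> r (emb (f \<otimes>\<^bsub>T\<^esub> g)) \<le> p (j f) * p (j g)"
      using star_bound by blast
    show "\<exists>p. continuous_seminorm scaleH p \<and> (\<forall>x\<in>j ` carrier S. \<forall>y\<in>j ` carrier S. r (emb (j_inv x \<otimes>\<^bsub>T\<^esub> j_inv y)) \<le> p x * p y)"
      by (intro exI[of _ p] conjI p(1) ballI) (auto simp: p(2))
  next
    fix times assume "bounded_bilinear_map scaleH scaleH scaleH times"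
      "\<And>x y. x \<in> j ` carrier S \<Longrightarrow> y \<in> j ` carrier S \<Longrightarrow> times x y = emb (j_inv x \<otimes>\<^bsub>T\<^esub> j_inv y)"
    then show thesis by (rule that)
  qed (simp_all add: C.dense j_image emb_mult_add emb_mult_scale H.locally_convex_space_axioms)
  have star: "times (j f) (j g) = emb (f \<otimes>\<^bsub>T\<^esub> g)" if "f \<in> carrier S" "g \<in> carrier S" for f g
    using t(2)[of "j f" "j g"] that by simp
  have "times (emb_word xs) (emb_word ys) = emb_word (xs @ ys)" for xs ys
  proof -
    have "cl (rep xs \<otimes>\<^bsub>T\<^esub> rep ys) = cl (tensor M (xs @ ys))"
      by (simp add: cl_mult[symmetric] S_subset rep_def cl_sym_rep tensor_append)
    then have "emb (rep xs \<otimes>\<^bsub>T\<^esub> rep ys) = emb_word (xs @ ys)"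
      by (simp add: emb_def emb_word_def rep_def sym_rep_def)
    then show ?thesis using star[OF rep_S rep_S, of xs ys] by (simp add: emb_word_def)
  qed
  with t(1) star show ?thesis by (rule that)
qed

theorem gutt_hopf: "gutt_hopf_extends scaleV bracket z scaleH j scaleH2 j2 scaleH3 j3"
proof -
  obtain times where times: "bounded_bilinear_map scaleH scaleH scaleH times"
    "\<And>f g. f \<in> carrier S \<Longrightarrow> g \<in> carrier S \<Longrightarrow> times (j f) (j g) = emb (f \<otimes>\<^bsub>T\<^esub> g)"
    "\<And>xs ys. times (emb_word xs) (emb_word ys) = emb_word (xs @ ys)" using times_extension by blast
  obtain \<Delta> where \<Delta>: "continuous_linear scaleH scaleH2 \<Delta>"
    "\<And>f. f \<in> carrier S \<Longrightarrow> \<Delta> (j f) = j2 (cop H.MH emb_word f)"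
    "\<And>xs. \<Delta> (emb_word xs) = split_sum xs (\<lambda>a b. H.tens2 (emb_word a) (emb_word b))" using coproduct_extension by blast
  obtain \<epsilon> where \<epsilon>: "continuous_linear scaleH (*) \<epsilon>" "\<And>f. f \<in> carrier S \<Longrightarrow> \<epsilon> (j f) = f counit_form"
    "\<And>xs. \<epsilon> (emb_word xs) = (if xs = [] then 1 else 0)" using counit_extension by blast
  obtain A where A: "continuous_linear scaleH scaleH A" "\<And>f. f \<in> carrier S \<Longrightarrow> A (j f) = emb (antipode f)"
    "\<And>xs. A (emb_word xs) = scaleH ((- 1) ^ length xs) (emb_word (rev xs))" using antipode_extension by blast
  have "locally_convex_hopf_algebra scaleH scaleH2 j2 scaleH3 j3 times (emb_word []) \<Delta> \<epsilon> A"
    by (rule H.hopf_algebra_from_words[OF dense_emb_word times(1,3) \<Delta>(1,3) \<epsilon>(1,3) A(1,3)])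
  moreover have "times (j f) (j g) = j (gutt_star M bracket z f g)" if "f \<in> carrier S" "g \<in> carrier S" for f g
    using that by (simp add: times(2) gutt_star_eq emb_def)
  moreover have "emb_word [] = j (gutt_unit M bracket z)" by (simp add: emb_word_def rep_def gutt_unit_eq)
  moreover have "\<Delta> (j f) = j2 (tensor_map H.MH j (gutt_coproduct M bracket z f))" if f: "f \<in> carrier S" for f
  proof -
    have "tensor_map H.MH j (cop S rep f) = cop H.MH (\<lambda>xs. j (rep xs)) f"
      by (rule tensor_map_cop[OF multilinear_rep S_subset[OF f]]) (simp_all add: C.j_add C.j_scale)
    then show ?thesis using f by (simp add: gutt_coproduct_eq \<Delta>(2) emb_word_def[abs_def])
  qed
  moreover have "\<epsilon> (j f) = gutt_counit M bracket z f" if "f \<in> carrier S" for f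
    using that by (simp add: \<epsilon>(2) gutt_counit_eq)
  moreover have "A (j f) = j (gutt_antipode M bracket z f)" if "f \<in> carrier S" for f
    using that by (simp add: A(2) gutt_antipode_eq emb_def)
  ultimately show ?thesis unfolding gutt_hopf_extends_def Let_def by blast
qed

end

section \<open>Bounds on Lie words\<close>

context lie_algebra
begin

text \<open>A symmetric product is an average of rearrangements of one word, all of the same
  weight.\<close>

lemma weighted_seminorm_sym_prod:
  assumes p: "\<And>x. 0 \<le> p x" and w: "\<And>n. 0 \<le> w n"
  shows "weighted_seminorm M w p (sym_prod M ws) \<le> word_weight w p ws"
proof -
  note sem = seminorm_on_weighted[of p w M, OF p w]
  note D = seminorm_onD[OF function_module_tensor_algebra sem]
  define \<P> where "\<P> = {\<sigma>. \<sigma> permutes {..<length ws}}"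
  have fin: "finite \<P>" unfolding \<P>_def by (rule finite_permutations) simp
  have step: "(\<lambda>\<phi>. \<Sum>\<sigma>\<in>A. tensor M (permute_list \<sigma> ws) \<phi>) \<in> carrier T \<and>
      weighted_seminorm M w p (\<lambda>\<phi>. \<Sum>\<sigma>\<in>A. tensor M (permute_list \<sigma> ws) \<phi>) \<le> card A * word_weight w p ws"
    if "finite A" "A \<subseteq> \<P>" for A
    using that
  proof (induction A rule: finite_induct)
    case empty
    show ?case using D(4)[of "tensor M []"] by simp
  next
    case (insert \<sigma> A)
    then have \<sigma>: "\<sigma> permutes {..<length ws}" by (simp add: \<P>_def)
    have "mset (map p (permute_list \<sigma> ws)) = mset (map p ws)"
      using mset_permute_list[OF \<sigma>] by simp
    then have "prod_list (map p (permute_list \<sigma> ws)) = prod_list (map p ws)"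
      by (metis prod_mset_prod_list)
    then have "weighted_seminorm M w p (tensor M (permute_list \<sigma> ws)) \<le> word_weight w p ws"
      using weighted_seminorm_tensor[of p w "permute_list \<sigma> ws" M, OF p w] by (simp add: word_weight_def)
    moreover have "weighted_seminorm M w p (\<lambda>\<phi>. tensor M (permute_list \<sigma> ws) \<phi> + (\<Sum>\<sigma>\<in>A. tensor M (permute_list \<sigma> ws) \<phi>))
      \<le> weighted_seminorm M w p (tensor M (permute_list \<sigma> ws)) + weighted_seminorm M w p (\<lambda>\<phi>. \<Sum>\<sigma>\<in>A. tensor M (permute_list \<sigma> ws) \<phi>)"
      by (rule D(1)) (use insert in auto)
    ultimately show ?case
      using insert by (auto simp: algebra_simps intro!: tensor_algebra_closed)
  qed
  define u where "u = (\<lambda>\<phi>. \<Sum>\<sigma>\<in>\<P>. tensor M (permute_list \<sigma> ws) \<phi>)"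
  have u: "u \<in> carrier T" "weighted_seminorm M w p u \<le> fact (length ws) * word_weight w p ws"
    using step[OF fin subset_refl] card_permutations[of "{..<length ws}" "length ws"] by (simp_all add: u_def \<P>_def)
  have "sym_prod M ws = (\<lambda>\<phi>. (1 / fact (length ws)) * u \<phi>)"
    by (simp add: sym_prod_def u_def \<P>_def)
  then have "weighted_seminorm M w p (sym_prod M ws) = (1 / fact (length ws)) * weighted_seminorm M w p u"
    using D(2)[OF u(1), of "1 / fact (length ws)"] by (simp add: norm_divide)
  also have "\<dots> \<le> word_weight w p ws" using u(2) by (simp add: field_simps)
  finally show ?thesis .
qed

lemma rep_Nil: "rep [] = tensor M []"
proof -
  have "sym_prod M [] = tensor M []" by (simp add: sym_prod_def)
  then show ?thesis using sym_rep_id[OF sym_prod_S, of "[]"] by (simp add: rep_def)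
qed

lemma lie_word_length: "lie_word bracket a u \<Longrightarrow> 0 < length a"
  by (induction rule: lie_word.induct) auto

text \<open>The symmetric products arising in \<open>tensor_bound_induct\<close> consist of Lie
  words that together use every letter of \<open>xs\<close> exactly once, and K is the multiset of
  their lengths. While \<open>v m\<close> bounds Lie words of length m, \<open>parts\<close>
  compares the weight in degree \<open>size K\<close> with the size k! that the rewriting assigns to
  a product of k factors.\<close>

lemma weighted_seminorm_rep:
  fixes w v :: "nat \<Rightarrow> real"
  assumes w: "\<And>n. 0 \<le> w n" and p: "\<And>x. 0 \<le> p x" and q: "\<And>x. 0 \<le> q x" and v: "\<And>n. 0 \<le> v n" and h: "0 \<le> h"
    and words: "\<And>a u. lie_word bracket a u \<Longrightarrow> p u \<le> v (length a) * prod_list (map q a)"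
    and parts: "\<And>K. 0 \<notin># K \<Longrightarrow> \<Sum>\<^sub># K = length xs \<Longrightarrow> w (size K) * (\<Prod>m\<in>#K. v m) \<le> h * fact (size K)"
    and ne: "xs \<noteq> []"
  shows "weighted_seminorm M w p (rep xs) \<le>
    h * (4 * max 1 (norm z)) ^ length xs * fact (length xs) * prod_list (map q xs)"
proof -
  note sem = seminorm_on_weighted[of p w M, OF p w]
  note D = seminorm_onD[OF function_module_tensor_algebra sem]
  \<comment> \<open>N records for each factor the list of its letters along with the Lie word formed
    from them; taking the bracket of two factors concatenates their lists.\<close>
  define W where "W m \<longleftrightarrow> (\<exists>N. image_mset snd N = m \<and> (\<forall>x\<in>#N. lie_word bracket (fst x) (snd x)) \<and>
      (\<Sum>x\<in>#N. mset (fst x)) = mset xs)" for m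
  have qs: "0 \<le> prod_list (map q xs)" by (rule prod_list_map_nonneg) (rule q)
  have "weighted_seminorm M w p (sym_rep (tensor M xs)) \<le>
      (h * prod_list (map q xs)) * (4 * max 1 (norm z)) ^ length xs * fact (length xs)"
  proof (rule tensor_bound_induct[of "\<lambda>t b. weighted_seminorm M w p (sym_rep t) \<le> b" W])
    fix s t b assume "s \<in> carrier T" "t \<in> carrier T" "\<And>\<phi>. exchange \<phi> \<Longrightarrow> s \<phi> = t \<phi>"
      and b: "weighted_seminorm M w p (sym_rep s) \<le> b"
    then have "sym_rep s = sym_rep t" by (intro sym_rep_cong)
    with b show "weighted_seminorm M w p (sym_rep t) \<le> b" by simp
  next
    fix s t b c assume "s \<in> carrier T" "t \<in> carrier T"
      "weighted_seminorm M w p (sym_rep s) \<le> b" "weighted_seminorm M w p (sym_rep t) \<le> c"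
    then show "weighted_seminorm M w p (sym_rep (\<lambda>\<phi>. s \<phi> + t \<phi>)) \<le> b + c"
      using D(1)[of "sym_rep s" "sym_rep t"] by (simp add: sym_rep_add S_subset)
  next
    fix s b c assume "s \<in> carrier T" "weighted_seminorm M w p (sym_rep s) \<le> b"
    then show "weighted_seminorm M w p (sym_rep (\<lambda>\<phi>. c * s \<phi>)) \<le> norm c * b"
      using D(2)[of "sym_rep s" c] by (simp add: sym_rep_scale S_subset mult_left_mono)
  next
    have "sym_rep (\<lambda>\<phi>. 0) = (\<lambda>\<phi>. 0)" using sym_rep_scale[OF tensor_algebra_zero_closed, of 0] by simp
    then show "weighted_seminorm M w p (sym_rep (\<lambda>\<phi>. 0)) \<le> 0"
      using D(4)[OF tensor_algebra_zero_closed] by simp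
  next
    fix ws assume "W (mset ws)"
    then obtain N where N: "image_mset snd N = mset ws" "\<And>x. x \<in># N \<Longrightarrow> lie_word bracket (fst x) (snd x)"
      "(\<Sum>x\<in>#N. mset (fst x)) = mset xs" unfolding W_def by blast
    define K where "K = image_mset (\<lambda>x. length (fst x)) N"
    have "length ws = size (image_mset snd N)" by (simp only: N(1) size_mset)
    then have len: "length ws = size N" by simp
    have K: "0 \<notin># K" "size K = length ws" using N(2)[THEN lie_word_length] len by (force simp: K_def)+
    have "\<Sum>\<^sub># K = size (\<Sum>x\<in>#N. mset (fst x))"
      unfolding K_def by (induction N) auto
    then have sumK: "\<Sum>\<^sub># K = length xs" by (simp only: N(3) size_mset)
    have "prod_list (map p ws) = prod_mset (image_mset p (image_mset snd N))"
      unfolding N(1) by (simp add: prod_mset_prod_list[symmetric])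
    also have "\<dots> = (\<Prod>x\<in>#N. p (snd x))" by (simp add: multiset.map_comp comp_def)
    also have "\<dots> \<le> (\<Prod>x\<in>#N. v (length (fst x)) * prod_list (map q (fst x)))"
      using N(2)
    proof (induction N)
      case (add x N)
      have "0 \<le> (\<Prod>x\<in>#N. p (snd x))" for N by (induction N) (auto intro!: mult_nonneg_nonneg p)
      then show ?case
        using add.IH add.prems words[of "fst x" "snd x"]
        by (auto intro!: mult_mono mult_nonneg_nonneg v prod_list_map_nonneg q)
    qed simp
    also have "\<dots> = (\<Prod>m\<in>#K. v m) * (\<Prod>x\<in>#N. prod_mset (image_mset q (mset (fst x))))"
      unfolding K_def by (induction N) (auto simp: mult_ac prod_mset_prod_list[symmetric])
    also have "(\<Prod>x\<in>#N. prod_mset (image_mset q (mset (fst x)))) = prod_mset (image_mset q (\<Sum>x\<in>#N. mset (fst x)))"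
      by (induction N) auto
    also have "\<dots> = prod_list (map q xs)"
      unfolding N(3) by (simp add: prod_mset_prod_list[symmetric])
    finally have "prod_list (map p ws) \<le> (\<Prod>m\<in>#K. v m) * prod_list (map q xs)" .
    then have "word_weight w p ws \<le> w (size K) * (\<Prod>m\<in>#K. v m) * prod_list (map q xs)"
      unfolding word_weight_def K(2) using mult_left_mono[OF _ w[of "length ws"]] by (simp add: mult.assoc)
    also have "\<dots> \<le> h * fact (size K) * prod_list (map q xs)"
      by (rule mult_right_mono[OF parts[OF K(1) sumK] qs])
    finally show "weighted_seminorm M w p (sym_rep (sym_prod M ws)) \<le> h * prod_list (map q xs) * fact (length ws)"
      using weighted_seminorm_sym_prod[of p w ws, OF p w] K(2) by (simp add: sym_rep_id mult_ac)
  next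
    fix u v m assume "W (add_mset u (add_mset v m))"
    then obtain N where N: "image_mset snd N = add_mset u (add_mset v m)"
      "\<forall>x\<in>#N. lie_word bracket (fst x) (snd x)" "(\<Sum>x\<in>#N. mset (fst x)) = mset xs" unfolding W_def by blast
    from msed_map_invR[OF N(1)] obtain N1 x where x: "N = add_mset x N1" "snd x = u"
      "image_mset snd N1 = add_mset v m" by blast
    from msed_map_invR[OF x(3)] obtain N2 y where y: "N1 = add_mset y N2" "snd y = v"
      "image_mset snd N2 = m" by blast
    have "lie_word bracket (fst x @ fst y) (bracket u v)"
      using N(2) x y by (auto intro!: lie_word.bracket)
    then show "W (add_mset (bracket u v) m)"
      unfolding W_def using N x y by (intro exI[of _ "add_mset (fst x @ fst y, bracket u v) N2"]) (simp add: add.assoc)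
  next
    show "W (mset xs)"
      unfolding W_def
    proof (intro exI[of _ "image_mset (\<lambda>x. ([x], x)) (mset xs)"] conjI ballI)
      show "(\<Sum>x\<in>#image_mset (\<lambda>x. ([x], x)) (mset xs). mset (fst x)) = mset xs"
        by (induction xs) auto
    qed (auto simp: multiset.map_comp comp_def intro: lie_word.letter)
  qed (use h qs ne in auto)
  then show ?thesis by (simp add: rep_def mult_ac)
qed

lemma foldr_bracket_diff: "foldr bracket xs (x - y) = foldr bracket xs x - foldr bracket xs y"
proof (induction xs)
  case (Cons a xs)
  interpret L: Vector_Spaces.linear scaleV scaleV "bracket a" by (rule bracket_right)
  show ?case by (simp add: Cons L.diff)
qed simp

text \<open>By \<open>ad [u, v] = ad u \<circ> ad v - ad v \<circ> ad u\<close>, words expand into right-nested words.\<close>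

lemma foldr_word_le:
  assumes \<rho>: "\<And>x y. \<rho> (x - y) \<le> \<rho> x + (\<rho> y :: real)" and "lie_word bracket a u"
    and "\<And>xs. mset xs = mset a \<Longrightarrow> \<rho> (foldr bracket (us @ xs) t) \<le> B"
  shows "\<rho> (foldr bracket us (bracket u t)) \<le> 2 ^ length a / 2 * B"
  using assms(2,3)
proof (induction arbitrary: us t B rule: lie_word.induct)
  case (letter x)
  from letter[of "[x]"] show ?case by simp
next
  case (bracket a u b v)
  have "bracket (bracket u v) t = bracket u (bracket v t) - bracket v (bracket u t)"
    using jacobi_identity[of u v t] unfolding bracket_swap[of t "bracket u v"] bracket_swap[of t u] bracket_minus
    by (simp add: algebra_simps add_eq_0_iff)
  then have "\<rho> (foldr bracket us (bracket (bracket u v) t)) \<le>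
      \<rho> (foldr bracket us (bracket u (bracket v t))) + \<rho> (foldr bracket us (bracket v (bracket u t)))"
    using \<rho> by (simp add: foldr_bracket_diff)
  also have "\<rho> (foldr bracket us (bracket u (bracket v t))) \<le> 2 ^ length a / 2 * (2 ^ length b / 2 * B)"
  proof (rule bracket.IH(1))
    fix xs assume xs: "mset xs = mset a"
    show "\<rho> (foldr bracket (us @ xs) (bracket v t)) \<le> 2 ^ length b / 2 * B"
    proof (rule bracket.IH(2))
      fix ys assume "mset ys = mset b"
      then show "\<rho> (foldr bracket ((us @ xs) @ ys) t) \<le> B" using bracket.prems[of "xs @ ys"] xs by simp
    qed
  qed
  also have "\<rho> (foldr bracket us (bracket v (bracket u t))) \<le> 2 ^ length b / 2 * (2 ^ length a / 2 * B)"
  proof (rule bracket.IH(2))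
    fix xs assume xs: "mset xs = mset b"
    show "\<rho> (foldr bracket (us @ xs) (bracket u t)) \<le> 2 ^ length a / 2 * B"
    proof (rule bracket.IH(1))
      fix ys assume "mset ys = mset a"
      then show "\<rho> (foldr bracket ((us @ xs) @ ys) t) \<le> B" using bracket.prems[of "xs @ ys"] xs by simp
    qed
  qed
  finally show ?case by (simp add: power_add mult_ac)
qed

text \<open>Unfolding the left argument of every bracket by \<open>foldr_word_le\<close> turns a Lie
  word of length n into a signed sum of at most 2^(n - 1) right-nested words in the same letters.
  The prefix \<open>us\<close> holds the adjoint maps already unfolded.\<close>

lemma word_le:
  assumes \<rho>: "\<And>x y. \<rho> (x - y) \<le> \<rho> x + (\<rho> y :: real)" and "lie_word bracket a u"
    and "\<And>xs y. mset (y # xs) = mset a \<Longrightarrow> \<rho> (foldr bracket (us @ xs) y) \<le> B"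
  shows "\<rho> (foldr bracket us u) \<le> 2 ^ length a / 2 * B"
  using assms(2,3)
proof (induction arbitrary: us B rule: lie_word.induct)
  case (letter x)
  from letter[of x "[]"] show ?case by simp
next
  case (bracket a u b v)
  have "\<rho> (foldr bracket us (bracket u v)) \<le> 2 ^ length a / 2 * (2 ^ length b / 2 * B)"
  proof (rule foldr_word_le[OF \<rho> bracket.hyps(1)])
    fix xs assume xs: "mset xs = mset a"
    show "\<rho> (foldr bracket (us @ xs) v) \<le> 2 ^ length b / 2 * B"
    proof (rule bracket.IH(2))
      fix ys y assume "mset (y # ys) = mset b"
      then show "\<rho> (foldr bracket ((us @ xs) @ ys) y) \<le> B"
        using bracket.prems[of y "xs @ ys"] xs by simp
    qed
  qed
  \<comment> \<open>Subadditivity under differences forces \<rho> \<ge> 0. The sign of B is needed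
    to pass from the factor 1 / 4 obtained here to 1 / 2.\<close>
  moreover have "0 \<le> B"
  proof -
    obtain y xs where "a @ b = y # xs" using lie_word_length[OF bracket.hyps(1)] by (cases "a @ b") auto
    then have "\<rho> (foldr bracket (us @ xs) y) \<le> B" using bracket.prems[of y xs] by (metis mset.simps(2))
    moreover have "0 \<le> \<rho> x" for x using \<rho>[of x 0] \<rho>[of 0 0] \<rho>[of "x" x] by simp
    ultimately show ?thesis by (meson order_trans)
  qed
  moreover define X where "X = 2 ^ length (a @ b) * B"
  ultimately have "\<rho> (foldr bracket us (bracket u v)) \<le> X / 4" "0 \<le> X" by (simp_all add: power_add mult_ac)
  then have "\<rho> (foldr bracket us (bracket u v)) \<le> X / 2" by simp
  then show ?case by (simp add: X_def)
qed

text \<open>Apply \<open>word_le\<close> to the indicator of the nonzero vectors, which is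
  subadditive under differences. One letter serves as the argument of the adjoint maps; therefore
  the length has to exceed \<open>Suc N\<close>.\<close>

lemma nilpotent_words:
  assumes "\<And>xs y. length xs > N \<Longrightarrow> foldr bracket xs y = 0" "lie_word bracket a u" "length a > Suc N"
  shows "u = 0"
proof -
  have "(\<lambda>x. if x = 0 then 0 else 1 :: real) (foldr bracket [] u) \<le> 2 ^ length a / 2 * 0"
  proof (rule word_le[OF _ assms(2)])
    fix xs y assume "mset (y # xs) = mset a"
    then have "Suc (length xs) = length a" by (metis length_Cons size_mset)
    then show "(if foldr bracket ([] @ xs) y = 0 then 0 else 1) \<le> (0::real)" using assms(1)[of xs y] assms(3) by simp
  qed auto
  then show ?thesis by (simp split: if_splits)
qed

end

section \<open>Factorial weights\<close>

lemma prod_list_map_scale: "prod_list (map (\<lambda>x. c * q x) xs) = (c::real) ^ length xs * prod_list (map q xs)"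
  by (induction xs) auto

lemma word_weight_scale: "word_weight w (\<lambda>x. c * q x) xs = c ^ length xs * word_weight w q xs"
  by (simp add: word_weight_def prod_list_map_scale)

lemma size_le_sum_mset: "0 \<notin># K \<Longrightarrow> size K \<le> \<Sum>\<^sub># (K :: nat multiset)"
proof (induction K)
  case (add x K)
  then show ?case by (cases x) auto
qed simp

lemma sum_mset_le_size: "(\<And>m. m \<in># K \<Longrightarrow> m \<le> L) \<Longrightarrow> \<Sum>\<^sub># (K :: nat multiset) \<le> L * size K"
proof (induction K)
  case (add x K)
  then have "\<Sum>\<^sub># K \<le> L * size K" "x \<le> L" by auto
  then show ?case by simp
qed simp

text \<open>The left side divided by k! is a single term of the exponential series of k.\<close>

lemma power_self_le_exp_fact: "real k ^ k \<le> exp 1 ^ k * fact k"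
proof -
  have "(\<Sum>n\<in>{k}. real k ^ n /\<^sub>R fact n) \<le> exp (real k)"
    unfolding exp_def by (rule sum_le_suminf) (use summable_exp_generic[of "real k"] in auto)
  then have "real k ^ k / fact k \<le> exp 1 ^ k" by (simp add: exp_of_nat_mult[symmetric] field_simps)
  then show ?thesis by (simp add: field_simps)
qed

text \<open>Combines s! \<le> s^s \<le> (L k)^(L k) with k^k \<le> e^k k!.\<close>

lemma fact_le_power_fact:
  assumes "s \<le> L * k" "k \<le> s" "1 \<le> L"
  shows "fact s \<le> ((L * exp 1) ^ L) ^ s * (fact k :: real) ^ L"
proof -
  have "fact s \<le> real (s ^ s)" using fact_le_power[of s, where 'a = real] by simp
  also have "s ^ s \<le> (L * k) ^ (L * k)"
  proof (cases "L * k = 0")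
    case False
    have "s ^ s \<le> (L * k) ^ s" using assms by (intro power_mono) auto
    also have "\<dots> \<le> (L * k) ^ (L * k)" using assms False by (intro power_increasing) auto
    finally show ?thesis .
  qed (use assms in auto)
  also have "real ((L * k) ^ (L * k)) = real L ^ (L * k) * (real k ^ k) ^ L"
    by (simp add: power_mult_distrib power_mult[symmetric] mult.commute)
  also have "\<dots> \<le> real L ^ (L * k) * (exp 1 ^ k * fact k) ^ L"
    by (intro mult_left_mono power_mono power_self_le_exp_fact) auto
  also have "\<dots> = ((L * exp 1) ^ L) ^ k * fact k ^ L"
    by (simp add: power_mult_distrib power_mult[symmetric] mult_ac)
  also have "\<dots> \<le> ((L * exp 1) ^ L) ^ s * fact k ^ L"
  proof (intro mult_right_mono power_increasing one_le_power assms(2))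
    have "1 * 1 \<le> real L * exp 1" using assms(3) by (intro mult_mono) auto
    then show "1 \<le> real L * exp 1" by simp
  qed auto
  finally show ?thesis by simp
qed

text \<open>The topology defined by all R < 1 involves negative exponents as well; product and
  coproduct estimates are made after replacing these by 0.\<close>

lemma fact_powr_le_max: "(fact n :: real) powr R \<le> fact n powr max R 0"
  by (intro powr_mono) auto

text \<open>The quotient of the factorials is a binomial coefficient, which is at most 2^(m +
  n).\<close>

lemma fact_add_powr_le: "(fact (m + n) :: real) powr R \<le> (2 powr max R 0) ^ (m + n) * (fact m powr max R 0 * fact n powr max R 0)"
proof -
  have "fact m * fact n * real ((m + n) choose m) = fact (m + n)"
    using binomial_fact_lemma[of m "m + n"] by (metis add_diff_cancel_left' le_add1 of_nat_fact of_nat_mult)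
  moreover have "real ((m + n) choose m) \<le> 2 ^ (m + n)"
    using binomial_le_pow2[of "m + n" m] by (metis of_nat_le_iff of_nat_numeral of_nat_power)
  ultimately have "(fact (m + n) :: real) \<le> fact m * fact n * 2 ^ (m + n)"
    by (metis mult_left_mono fact_ge_zero mult_nonneg_nonneg)
  then have "(fact (m + n) :: real) powr max R 0 \<le> (fact m * fact n * 2 ^ (m + n)) powr max R 0"
    by (intro powr_mono2) auto
  also have "\<dots> = (2 powr max R 0) ^ (m + n) * (fact m powr max R 0 * fact n powr max R 0)"
    by (simp add: powr_mult powr_power mult_ac powr_realpow[symmetric] powr_powr)
  finally show ?thesis using fact_powr_le_max[of "m + n" R] by (rule order_trans[rotated])
qed

lemma fact_mult_powr_le: "(fact m :: real) powr R * fact n powr R \<le> fact (m + n) powr max R 0"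
proof -
  have "(fact m :: real) powr R * fact n powr R \<le> fact m powr max R 0 * fact n powr max R 0"
    by (intro mult_mono fact_powr_le_max) auto
  also have "\<dots> = (fact m * fact n) powr max R 0" by (simp add: powr_mult)
  also have "\<dots> \<le> fact (m + n) powr max R 0"
  proof (intro powr_mono2)
    have "(fact m * fact n :: nat) \<le> fact (m + n)"
      by (intro dvd_imp_le fact_fact_dvd_fact) simp
    then show "(fact m * fact n :: real) \<le> fact (m + n)" by (metis of_nat_fact of_nat_le_iff of_nat_mult)
  qed auto
  finally show ?thesis .
qed

text \<open>Permits normalization by r x + \<delta> when the seminorm r x may vanish.\<close>

lemma le_mult_by_epsilon:
  assumes "\<And>\<delta>. \<delta> > 0 \<Longrightarrow> a \<le> (b + \<delta>) * (c + \<delta> :: real)"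
  shows "a \<le> b * c"
proof (rule tendsto_lowerbound)
  show "((\<lambda>\<delta>. (b + \<delta>) * (c + \<delta>)) \<longlongrightarrow> b * c) (at_right 0)"
    by (rule tendsto_eq_intros refl | simp)+
  show "\<forall>\<^sub>F \<delta> in at_right 0. a \<le> (b + \<delta>) * (c + \<delta>)"
    using assms by (auto simp: eventually_at_right_field intro!: exI[of _ 1])
qed simp

section \<open>Seminorm bounds from continuity of the bracket and the factorial topologies\<close>

context locally_convex_lie_algebra
begin

lemma lie_algebra: "lie_algebra scaleV bracket"
  by (intro lie_algebra.intro lie_algebra_axioms.intro vector_space_axioms bracket_linear_left bracket_linear_right
      bracket_alternating jacobi)

text \<open>Continuity at (0, 0) bounds the bracket on a ball in each argument, and rescaling both
  arguments makes this bound homogeneous.\<close>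

lemma bracket_seminorm:
  assumes p: "continuous_seminorm scaleV p"
  obtains q where "continuous_seminorm scaleV q" "\<And>x y. p (bracket x y) \<le> q x * q y"
proof -
  have z: "bracket 0 0 = 0" by (rule bracket_alternating)
  have lin: "bracket (scaleV c x) (scaleV d y) = scaleV c (scaleV d (bracket x y))" for c d x y
    using bracket_linear_left[of "scaleV d y"] bracket_linear_right[of x] by (simp add: Vector_Spaces.linear_iff)
  have c: "continuous_on UNIV (\<lambda>(x, y). p (bracket x y))"
  proof -
    have "continuous_on UNIV p" using p by (simp add: continuous_seminorm_def)
    then have "continuous_on UNIV (\<lambda>v. p ((\<lambda>(x, y). bracket x y) v))"
      using continuous_on_compose2[OF _ continuous_bracket] by blast
    then show ?thesis by (simp add: case_prod_unfold)
  qed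
  have "open {v. (\<lambda>(x, y). p (bracket x y)) v < 1}" "(0, 0) \<in> {v. (\<lambda>(x, y). p (bracket x y)) v < 1}"
    using open_Collect_less[OF c continuous_on_const] z p by simp_all
  from open_prod_elim[OF this] obtain A B
    where AB: "open A" "open B" "0 \<in> A" "0 \<in> B" "A \<times> B \<subseteq> {v. (\<lambda>(x, y). p (bracket x y)) v < 1}"
    by (metis mem_Sigma_iff)
  obtain q1 q2 where q: "continuous_seminorm scaleV q1" "{x. q1 x < 1} \<subseteq> A" "continuous_seminorm scaleV q2" "{x. q2 x < 1} \<subseteq> B"
    using seminorm_neighbourhood AB by meson
  define r where "r x = q1 x + q2 x" for x
  have r: "continuous_seminorm scaleV r" unfolding r_def by (rule continuous_seminorm_add[OF q(1,3)])
  have small: "p (bracket x y) < 1" if "r x < 1" "r y < 1" for x y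
  proof -
    have "q1 x < 1" "q2 y < 1"
      using that continuous_seminorm_nonneg[OF q(1), of y] continuous_seminorm_nonneg[OF q(3), of x] by (auto simp: r_def)
    then have "(x, y) \<in> A \<times> B" using q by blast
    then show ?thesis using AB(5) by auto
  qed
  have "p (bracket x y) \<le> r x * r y" for x y
  proof (rule le_mult_by_epsilon)
    fix \<delta> :: real assume \<delta>: "\<delta> > 0"
    have pos: "r x + \<delta> > 0" "r y + \<delta> > 0"
      using \<delta> continuous_seminorm_nonneg[OF r, of x] continuous_seminorm_nonneg[OF r, of y] by auto
    have "r (scaleV (of_real (1 / (r x + \<delta>))) x) < 1" "r (scaleV (of_real (1 / (r y + \<delta>))) y) < 1"
      using pos \<delta> by (simp_all add: continuous_seminorm_scale[OF r] del: of_real_add of_real_divide)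
    from small[OF this] have "p (bracket x y) < (r x + \<delta>) * (r y + \<delta>)"
      using pos by (simp add: lin continuous_seminorm_scale[OF p] norm_mult del: of_real_add of_real_divide)
    then show "p (bracket x y) \<le> (r x + \<delta>) * (r y + \<delta>)" by simp
  qed
  with r show ?thesis by (rule that)
qed

text \<open>Iterating \<open>bracket_seminorm\<close> reaches words of any bounded length. In the
  nilpotent case this takes the place of an asymptotic estimate, as longer words vanish. The summand
  p covers single letters.\<close>

lemma short_words_seminorm:
  assumes "continuous_seminorm scaleV p"
  shows "\<exists>q. continuous_seminorm scaleV q \<and>
    (\<forall>a u. lie_word bracket a u \<longrightarrow> length a \<le> n \<longrightarrow> p u \<le> prod_list (map q a))"
  using assms
proof (induction n arbitrary: p)
  case 0
  then show ?case using lie_algebra.lie_word_length[OF lie_algebra] by (metis le_zero_eq less_nat_zero_code)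
next
  case (Suc n)
  obtain r where r: "continuous_seminorm scaleV r" "\<And>x y. p (bracket x y) \<le> r x * r y"
    using bracket_seminorm[OF Suc.prems] by blast
  obtain q where q: "continuous_seminorm scaleV q"
    "\<And>a u. lie_word bracket a u \<Longrightarrow> length a \<le> n \<Longrightarrow> r u \<le> prod_list (map q a)"
    using Suc.IH[OF r(1)] by blast
  note nn = continuous_seminorm_nonneg[OF Suc.prems] continuous_seminorm_nonneg[OF r(1)] continuous_seminorm_nonneg[OF q(1)]
  show ?case
  proof (intro exI[of _ "\<lambda>x. p x + q x"] conjI allI impI)
    show "continuous_seminorm scaleV (\<lambda>x. p x + q x)" by (rule continuous_seminorm_add[OF Suc.prems q(1)])
    fix c v assume "lie_word bracket c v" "length c \<le> Suc n"
    then show "p v \<le> prod_list (map (\<lambda>x. p x + q x) c)"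
    proof cases
      case letter
      then show ?thesis using nn by simp
    next
      case (bracket a u b w)
      have len: "0 < length a" "0 < length b" using bracket lie_algebra.lie_word_length[OF lie_algebra] by auto
      moreover have "length a + length b \<le> Suc n" using bracket(1) \<open>length c \<le> Suc n\<close> by simp
      ultimately have "length a \<le> n" "length b \<le> n" by linarith+
      then have "r u \<le> prod_list (map q a)" "r w \<le> prod_list (map q b)" using q(2) bracket by auto
      then have "p v \<le> prod_list (map q a) * prod_list (map q b)"
        using bracket r(2)[of u w] nn mult_mono[of "r u" "prod_list (map q a)" "r w" "prod_list (map q b)"]
        by (auto intro: order_trans prod_list_map_nonneg)
      also have "\<dots> = prod_list (map q c)" using bracket by simp
      also have "\<dots> \<le> prod_list (map (\<lambda>x. p x + q x) c)" using nn by (intro prod_list_map_mono) auto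
      finally show ?thesis .
    qed
  qed
qed

end

text \<open>The set I of exponents will be {R} or all numbers below 1. In \<open>words_bound\<close>
  the exponent is R' - 1 because \<open>weighted_seminorm_rep\<close> contributes one more factorial
  of the length; the factor \<open>fact (size K)\<close> is the size of a symmetric product
  there.\<close>

locale factorial_completion =
  G: locally_convex_lie_algebra scaleV bracket + H: tensor_cube scaleH scaleH2 j2 scaleH3 j3
  for scaleV :: "'k::{real_normed_field,banach} \<Rightarrow> 'g::{topological_group_add,ab_group_add,t2_space} \<Rightarrow> 'g"
    and bracket :: "'g \<Rightarrow> 'g \<Rightarrow> 'g"
    and scaleH :: "'k \<Rightarrow>
        'h::{uniform_topological_group_add,ab_group_add,complete_uniform_space,t2_space} \<Rightarrow> 'h"
    and scaleH2 :: "'k \<Rightarrow>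
        'h2::{uniform_topological_group_add,ab_group_add,complete_uniform_space,t2_space} \<Rightarrow> 'h2"
    and j2 :: "('k, 'h) tensor \<Rightarrow> 'h2"
    and scaleH3 :: "'k \<Rightarrow>
        'h3::{uniform_topological_group_add,ab_group_add,complete_uniform_space,t2_space} \<Rightarrow> 'h3"
    and j3 :: "('k, 'h) tensor \<Rightarrow> 'h3" +
  fixes z :: 'k and j :: "('k, 'g) tensor \<Rightarrow> 'h" and I :: "real set"
  assumes complete: "is_completion (symmetric_tensors (vec_mod scaleV)) (\<Union>R\<in>I. S_R_seminorms scaleV R) scaleH j"
    and exponent_max: "R \<in> I \<Longrightarrow> R' \<in> I \<Longrightarrow> max R R' \<in> I"
    and exponent_nonneg: "R \<in> I \<Longrightarrow> max R 0 \<in> I"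
    and words_bound: "R \<in> I \<Longrightarrow> continuous_seminorm scaleV p \<Longrightarrow>
      \<exists>R' q v D. R' \<in> I \<and> continuous_seminorm scaleV q \<and> (\<forall>m. 0 \<le> v m) \<and> 0 \<le> D \<and>
        (\<forall>a u. lie_word bracket a u \<longrightarrow> p u \<le> v (length a) * prod_list (map q a)) \<and>
        (\<forall>K. 0 \<notin># K \<longrightarrow> fact (size K) powr R * (\<Prod>m\<in>#K. v m) \<le>
           D ^ (\<Sum>\<^sub># K) * fact (\<Sum>\<^sub># K) powr (R' - 1) * fact (size K))"
begin

sublocale lie_algebra scaleV bracket z by (rule G.lie_algebra)

theorem hopf: "gutt_hopf_extends scaleV bracket z scaleH j scaleH2 j2 scaleH3 j3"
proof -
  define \<W> where "\<W> = {(\<lambda>n. fact n powr R :: real, p) | R p. R \<in> I \<and> continuous_seminorm scaleV p}"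
  have \<W>I: "(\<lambda>n. fact n powr R :: real, p) \<in> \<W>" if "R \<in> I" "continuous_seminorm scaleV p" for R p
    using that by (auto simp: \<W>_def)
  have \<W>E: "\<exists>R. w = (\<lambda>n. fact n powr R) \<and> R \<in> I \<and> continuous_seminorm scaleV p" if "(w, p) \<in> \<W>" for w p
    using that by (auto simp: \<W>_def)
  have "weighted_completion scaleV bracket z scaleH scaleH2 j2 scaleH3 j3 j \<W>"
  proof
    have "(\<Union>R\<in>I. S_R_seminorms scaleV R) = {weighted_seminorm M w q | w q. (w, q) \<in> \<W>}"
      by (auto simp: \<W>_def S_R_seminorms_def)
    then show "is_completion S {weighted_seminorm M w q | w q. (w, q) \<in> \<W>} scaleH j"
      using complete by simp
  next
    fix w p n assume "(w, p) \<in> \<W>"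
    then obtain R where R: "w = (\<lambda>n. fact n powr R)" "continuous_seminorm scaleV p" using \<W>E by blast
    show "0 \<le> w n" "w 0 = 1" by (simp_all add: R)
    show "0 \<le> p x" for x by (rule G.continuous_seminorm_nonneg[OF R(2)])
  next
    fix w1 q1 w2 q2 assume "(w1, q1) \<in> \<W>" "(w2, q2) \<in> \<W>"
    then obtain R1 R2 where R: "w1 = (\<lambda>n. fact n powr R1)" "R1 \<in> I" "continuous_seminorm scaleV q1"
      "w2 = (\<lambda>n. fact n powr R2)" "R2 \<in> I" "continuous_seminorm scaleV q2" using \<W>E by metis
    show "\<exists>w q. (w, q) \<in> \<W> \<and> (\<forall>n. w1 n \<le> w n \<and> w2 n \<le> w n) \<and> (\<forall>x. q1 x \<le> q x \<and> q2 x \<le> q x)"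
    proof (intro exI conjI allI)
      show "(\<lambda>n. fact n powr max R1 R2, \<lambda>x. q1 x + q2 x) \<in> \<W>"
        by (intro \<W>I exponent_max G.continuous_seminorm_add R)
      show "w1 n \<le> fact n powr max R1 R2" "w2 n \<le> fact n powr max R1 R2" for n
        unfolding R(1,4) by (intro powr_mono; simp)+
      show "q1 x \<le> q1 x + q2 x" "q2 x \<le> q1 x + q2 x" for x
        using G.continuous_seminorm_nonneg[OF R(3)] G.continuous_seminorm_nonneg[OF R(6)] by auto
    qed
  next
    fix w p assume "(w, p) \<in> \<W>"
    then obtain R where R: "w = (\<lambda>n. fact n powr R)" "R \<in> I" "continuous_seminorm scaleV p" using \<W>E by blast
    have p: "0 \<le> p x" for x by (rule G.continuous_seminorm_nonneg[OF R(3)])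
    obtain R' q v D where "R' \<in> I" "continuous_seminorm scaleV q" "\<forall>m. 0 \<le> v m" "0 \<le> D"
      "\<forall>a u. lie_word bracket a u \<longrightarrow> p u \<le> v (length a) * prod_list (map q a)"
      "\<forall>K. 0 \<notin># K \<longrightarrow> fact (size K) powr R * (\<Prod>m\<in>#K. v m) \<le>
           D ^ (\<Sum>\<^sub># K) * fact (\<Sum>\<^sub># K) powr (R' - 1) * fact (size K)"
      using words_bound[OF R(2,3)] by (elim exE conjE)
    note R' = this[rule_format]
    have q: "0 \<le> q x" for x by (rule G.continuous_seminorm_nonneg[OF R'(2)])
    \<comment> \<open>Exponential factors in the length are turned into a multiple of the seminorm
      by \<open>word_weight_scale\<close>.\<close>
    define Z where "Z = D * (4 * max 1 (norm z))"
    have Z: "0 \<le> Z" using R'(4) by (simp add: Z_def)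
    have le: "weighted_seminorm M w p (rep xs) \<le> word_weight (\<lambda>n. fact n powr R') (\<lambda>x. Z * q x) xs" for xs
    proof (cases "xs = []")
      case True
      then show ?thesis
        using weighted_seminorm_tensor[of p w "[]" M, OF p] by (simp add: R(1) rep_Nil word_weight_def)
    next
      case False
      have "weighted_seminorm M w p (rep xs) \<le>
          (D ^ length xs * fact (length xs) powr (R' - 1)) * (4 * max 1 (norm z)) ^ length xs * fact (length xs) * prod_list (map q xs)"
      proof (rule weighted_seminorm_rep[where v = v and q = q])
        fix K :: "nat multiset" assume "0 \<notin># K" "\<Sum>\<^sub># K = length xs"
        then show "w (size K) * (\<Prod>m\<in>#K. v m) \<le> D ^ length xs * fact (length xs) powr (R' - 1) * fact (size K)"
          using R'(6)[of K] by (simp add: R(1))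
      qed (use p q R' False R(1) in auto)
      also have "\<dots> = word_weight (\<lambda>n. fact n powr R') (\<lambda>x. Z * q x) xs"
        by (simp add: word_weight_scale) (simp add: word_weight_def Z_def power_mult_distrib powr_diff)
      finally show ?thesis .
    qed
    show "\<exists>w' q' C. (w', q') \<in> \<W> \<and> C \<ge> 0 \<and> (\<forall>xs. weighted_seminorm M w p (rep xs) \<le> C * word_weight w' q' xs)"
      by (intro exI[of _ "\<lambda>n. fact n powr R'"] exI[of _ "\<lambda>x. Z * q x"] exI[of _ 1] conjI
          \<W>I[OF R'(1)] G.continuous_seminorm_mult[OF R'(2) Z]) (simp_all add: le)
    define R0 where "R0 = max R 0"
    have R0: "R0 \<in> I" using exponent_nonneg[OF R(2)] by (simp add: R0_def)
    define c where "c = 2 powr R0"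
    have pp: "0 \<le> prod_list (map p xs)" for xs by (rule prod_list_map_nonneg) (rule p)
    have "word_weight w p (xs @ ys) \<le> word_weight (\<lambda>n. fact n powr R0) (\<lambda>x. c * p x) xs * word_weight (\<lambda>n. fact n powr R0) (\<lambda>x. c * p x) ys"
      for xs ys
    proof -
      have "word_weight w p (xs @ ys) \<le> (c ^ (length xs + length ys) * (fact (length xs) powr R0 * fact (length ys) powr R0)) *
          (prod_list (map p xs) * prod_list (map p ys))"
        unfolding word_weight_def R(1) c_def R0_def map_append prod_list.append length_append
        by (intro mult_right_mono fact_add_powr_le mult_nonneg_nonneg pp)
      then show ?thesis by (simp add: word_weight_scale) (simp add: word_weight_def power_add mult_ac)
    qed
    then show "\<exists>w' q' C. (w', q') \<in> \<W> \<and> C \<ge> 0 \<and> (\<forall>xs ys. word_weight w p (xs @ ys) \<le> C * (word_weight w' q' xs * word_weight w' q' ys))"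
      by (intro exI[of _ "\<lambda>n. fact n powr R0"] exI[of _ "\<lambda>x. c * p x"] exI[of _ 1] conjI
          \<W>I[OF R0] G.continuous_seminorm_mult[OF R(3)]) (simp_all add: c_def)
    have "2 ^ length xs * (word_weight w p a * word_weight w p b) \<le> word_weight (\<lambda>n. fact n powr R0) (\<lambda>x. 2 * p x) xs"
      if ab: "mset a + mset b = mset xs" for xs a b
    proof -
      have len: "length xs = length a + length b" using ab by (metis size_mset size_union)
      have "mset (map p a) + mset (map p b) = mset (map p xs)"
        using ab by (metis image_mset_union mset_map)
      then have prod: "prod_list (map p a) * prod_list (map p b) = prod_list (map p xs)"
        by (metis prod_mset_Un prod_mset_prod_list)
      have "word_weight w p a * word_weight w p b = (fact (length a) powr R * fact (length b) powr R) * prod_list (map p xs)"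
        by (simp add: word_weight_def R(1) prod[symmetric] mult_ac)
      also have "\<dots> \<le> fact (length a + length b) powr R0 * prod_list (map p xs)"
        unfolding R0_def by (intro mult_right_mono fact_mult_powr_le pp)
      also have "\<dots> = word_weight (\<lambda>n. fact n powr R0) p xs" by (simp add: word_weight_def len)
      finally show ?thesis by (simp add: word_weight_scale mult_left_mono)
    qed
    then show "\<exists>w' q' C. (w', q') \<in> \<W> \<and> C \<ge> 0 \<and> (\<forall>xs a b. mset a + mset b = mset xs \<longrightarrow>
        2 ^ length xs * (word_weight w p a * word_weight w p b) \<le> C * word_weight w' q' xs)"
      by (intro exI[of _ "\<lambda>n. fact n powr R0"] exI[of _ "\<lambda>x. 2 * p x"] exI[of _ 1] conjI
          \<W>I[OF R0] G.continuous_seminorm_mult[OF R(3)]) simp_all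
  qed
  then show ?thesis by (rule weighted_completion.gutt_hopf)
qed

end

text \<open>The asymptotic estimate treats Lie words of all lengths alike, so \<open>v\<close> can
  be constant.\<close>

lemma AE_words_bound:
  assumes "AE_lie_algebra scaleV bracket" and R: "1 \<le> R" and p: "continuous_seminorm scaleV p"
  shows "\<exists>q v D. continuous_seminorm scaleV q \<and> (\<forall>m. 0 \<le> v m) \<and> 0 \<le> D \<and>
        (\<forall>a u. lie_word bracket a u \<longrightarrow> p u \<le> v (length a) * prod_list (map q a)) \<and>
        (\<forall>K. 0 \<notin># K \<longrightarrow> fact (size K) powr R * (\<Prod>m\<in>#K. v m) \<le>
           D ^ (\<Sum>\<^sub># K) * fact (\<Sum>\<^sub># K) powr (R - 1) * (fact (size K) :: real))"
proof -
  interpret AE_lie_algebra scaleV bracket by fact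
  obtain q where q: "continuous_seminorm scaleV q" "\<And>a u. lie_word bracket a u \<Longrightarrow> p u \<le> prod_list (map q a)"
    using asymptotic_estimate[OF p] by blast
  have "(fact (size K) :: real) powr R \<le> fact (\<Sum>\<^sub># K) powr (R - 1) * fact (size K)" if K: "0 \<notin># K" for K
  proof -
    have "(fact (size K) :: real) powr (R - 1) \<le> fact (\<Sum>\<^sub># K) powr (R - 1)"
      using R size_le_sum_mset[OF K] by (intro powr_mono2) (auto intro: fact_mono)
    then show ?thesis by (simp add: powr_diff field_simps)
  qed
  then show ?thesis
    using q by (intro exI[of _ q] exI[of _ "\<lambda>_. 1"] exI[of _ 1]) simp
qed

text \<open>Words of length at most L are bounded by continuity alone and the others vanish, so
  \<open>v\<close> is a cut-off at L and kills every K with a part larger than L.\<close>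

lemma nilpotent_words_bound:
  assumes "locally_convex_lie_algebra scaleV bracket" and nil: "nilpotent_lie bracket"
    and R: "R < 1" and p: "continuous_seminorm scaleV p"
  shows "\<exists>R' q v D. R' < 1 \<and> continuous_seminorm scaleV q \<and> (\<forall>m. 0 \<le> v m) \<and> 0 \<le> D \<and>
        (\<forall>a u. lie_word bracket a u \<longrightarrow> p u \<le> v (length a) * prod_list (map q a)) \<and>
        (\<forall>K. 0 \<notin># K \<longrightarrow> fact (size K) powr R * (\<Prod>m\<in>#K. v m) \<le>
           D ^ (\<Sum>\<^sub># K) * fact (\<Sum>\<^sub># K) powr (R' - 1) * (fact (size K) :: real))"
proof -
  interpret locally_convex_lie_algebra scaleV bracket by fact
  interpret lie_algebra scaleV bracket 0 by (rule lie_algebra)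
  obtain N where N: "\<And>xs y. length xs > N \<Longrightarrow> foldr bracket xs y = 0"
    using nil unfolding nilpotent_lie_def by blast
  define L where "L = Suc N"
  define v where "v m = (if m \<le> L then 1 else 0 :: real)" for m
  obtain q where q: "continuous_seminorm scaleV q"
    "\<And>a u. lie_word bracket a u \<Longrightarrow> length a \<le> L \<Longrightarrow> p u \<le> prod_list (map q a)"
    using short_words_seminorm[OF p] by blast
  have words: "p u \<le> v (length a) * prod_list (map q a)" if "lie_word bracket a u" for a u
    using q(2)[OF that] nilpotent_words[OF N that] p by (auto simp: v_def L_def)
  \<comment> \<open>Chosen so that s! \<le> b^s k!^L, raised to the power d, has k! with exponent L
    d = 1 - max R 0; the new exponent is R' = 1 - d.\<close>
  define d where "d = (1 - max R 0) / L"
  have d: "d > 0" using R by (simp add: d_def L_def)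
  define b where "b = (real L * exp 1) ^ L"
  have b: "b > 0" by (simp add: b_def L_def)
  define D where "D = b powr d"
  have parts: "fact (size K) powr R * (\<Prod>m\<in>#K. v m) \<le> D ^ (\<Sum>\<^sub># K) * fact (\<Sum>\<^sub># K) powr (- d) * (fact (size K) :: real)"
    if K: "0 \<notin># K" for K
  proof (cases "\<exists>m\<in>#K. m > L")
    case True
    then have *: "(\<Prod>m\<in>#K. v m) = 0" by (auto simp: v_def)
    show ?thesis unfolding * by (simp add: D_def)
  next
    case False
    then have "(\<Prod>m\<in>#K. v m) = 1" by (induction K) (auto simp: v_def)
    define s k where "s = \<Sum>\<^sub># K" and "k = size K"
    have "s \<le> L * k" "k \<le> s"
      using False sum_mset_le_size[of K L] size_le_sum_mset[OF K] by (auto simp: s_def k_def not_less)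
    then have *: "fact s \<le> b ^ s * (fact k :: real) ^ L"
      unfolding b_def by (rule fact_le_power_fact) (simp add: L_def)
    have "fact s powr d \<le> (b ^ s * (fact k :: real) ^ L) powr d"
      using * d by (intro powr_mono2) auto
    also have "\<dots> = D ^ s * fact k powr (L * d)"
      unfolding D_def using b by (simp add: powr_mult powr_power powr_realpow[symmetric] powr_powr mult_ac)
    also have "L * d = 1 - max R 0" by (simp add: d_def L_def)
    finally have "fact k powr max R 0 * fact s powr d \<le> D ^ s * fact k"
      by (simp add: powr_diff field_simps)
    then have "fact k powr R * fact s powr d \<le> D ^ s * fact k"
      using mult_right_mono[OF fact_powr_le_max[of k R], of "fact s powr d"] by (meson order_trans powr_ge_zero)
    then have "fact k powr R \<le> D ^ s * fact s powr (- d) * fact k"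
      by (simp add: powr_minus field_simps)
    then show ?thesis using \<open>(\<Prod>m\<in>#K. v m) = 1\<close> by (simp add: s_def k_def)
  qed
  show ?thesis
  proof (intro exI conjI allI impI)
    show "1 - d < 1" using d by simp
    show "continuous_seminorm scaleV q" by (rule q)
    show "0 \<le> v m" for m by (simp add: v_def)
    show "0 \<le> D" by (simp add: D_def)
    show "p u \<le> v (length a) * prod_list (map q a)" if "lie_word bracket a u" for a u by (rule words[OF that])
    show "fact (size K) powr R * (\<Prod>m\<in>#K. v m) \<le>
        D ^ (\<Sum>\<^sub># K) * fact (\<Sum>\<^sub># K) powr (1 - d - 1) * (fact (size K) :: real)" if "0 \<notin># K" for K
      using parts[OF that] by simp
  qed
qed

section \<open>Uniformly topologically nilpotent Banach-Lie algebras\<close>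

text \<open>Diagonal choice: h s is the largest k whose condition holds at s, where k \<le> s is
  imposed to make the maximum exist.\<close>

lemma slow_growth:
  fixes Q :: "nat \<Rightarrow> nat \<Rightarrow> bool"
  assumes Q0: "\<And>s. Q 0 s" and Q: "\<And>k. eventually (Q k) sequentially"
  obtains h where "filterlim h at_top sequentially" "\<And>s. Q (h s) s"
proof -
  define h where "h s = Max {k. k \<le> s \<and> Q k s}" for s
  have fin: "finite {k. k \<le> s \<and> Q k s}" "{k. k \<le> s \<and> Q k s} \<noteq> {}" for s using Q0 by auto
  have "Q (h s) s" for s using Max_in[OF fin, of s] by (simp add: h_def)
  moreover have "filterlim h at_top sequentially"
    unfolding filterlim_at_top
  proof
    fix k show "eventually (\<lambda>s. k \<le> h s) sequentially"
      using Q[of k] eventually_ge_at_top[of k]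
      by eventually_elim (auto simp: h_def intro: Max_ge)
  qed
  ultimately show ?thesis using that by blast
qed

lemma prod_mset_le_one: "(\<And>m. m \<in># K \<Longrightarrow> 0 \<le> f m \<and> f m \<le> (1::real)) \<Longrightarrow> 0 \<le> (\<Prod>m\<in>#K. f m) \<and> (\<Prod>m\<in>#K. f m) \<le> 1"
  by (induction K) (auto intro: mult_le_one)

context banach_lie_algebra
begin

sublocale L: lie_algebra scaleV bracket 0 by (rule lie_algebra)

lemma nrm_add: "nrm (x + y) \<le> nrm x + nrm y" and nrm_scale: "nrm (scaleV c x) = norm c * nrm x"
  using seminorm_nrm by (simp_all add: seminorm_def)

lemma nrm_0 [simp]: "nrm 0 = 0"
  using nrm_scale[of 0 0] by simp

lemma nrm_uminus: "nrm (- x) = nrm x"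
  using nrm_scale[of "- 1" x] by simp

lemma nrm_nonneg [simp]: "0 \<le> nrm x"
  using nrm_add[of x "- x"] by (simp add: nrm_uminus)

lemma nrm_diff: "nrm (x - y) \<le> nrm x + nrm y"
  using nrm_add[of x "- y"] by (simp add: nrm_uminus)

lemma prod_nrm_nonneg [simp]: "0 \<le> prod_list (map nrm xs)"
  by (rule prod_list_map_nonneg) simp

lemma nrm_foldr: "nrm (foldr bracket xs y) \<le> prod_list (map nrm xs) * nrm y"
proof (induction xs)
  case (Cons x xs)
  have "nrm (foldr bracket (x # xs) y) \<le> nrm x * nrm (foldr bracket xs y)" by (simp add: nrm_bracket)
  also have "\<dots> \<le> nrm x * (prod_list (map nrm xs) * nrm y)" by (intro mult_left_mono Cons) simp
  finally show ?case by (simp add: mult.assoc)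
qed simp

lemma foldr_scale:
  "foldr bracket (map (\<lambda>x. scaleV (c x) x) xs) (scaleV d y) = scaleV (prod_list (map c xs) * d) (foldr bracket xs y)"
  by (induction xs) (simp_all add: mult_ac)

abbreviation "rate \<equiv> nilpotency_rate nrm bracket"

text \<open>Since \<open>nilpotency_rate\<close> refers to unit vectors, all letters are normalized;
  if one of the vectors has norm zero, both sides vanish. The modulus avoids a discussion of the
  sign of \<open>rate\<close>, a supremum over a set that may be empty.\<close>

lemma nrm_foldr_rate:
  assumes "xs \<noteq> []"
  shows "nrm (foldr bracket xs y) \<le> \<bar>rate (length xs)\<bar> ^ length xs * (prod_list (map nrm xs) * nrm y)"
proof (cases "prod_list (map nrm xs) * nrm y = 0")
  case True
  then show ?thesis using nrm_foldr[of xs y] by (simp only: mult_zero_right)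
next
  case False
  define n where "n = length xs"
  have n: "n > 0" using assms by (simp add: n_def)
  have nz: "nrm x \<noteq> 0" if "x \<in> set xs" for x using False that by (auto simp: prod_list_zero_iff)
  define c :: "'g \<Rightarrow> 'k" where "c x = of_real (1 / nrm x)" for x
  define us where "us = map (\<lambda>x. scaleV (c x) x) xs"
  define y' where "y' = scaleV (c y) y"
  have c: "norm (c x) = 1 / nrm x" for x by (simp add: c_def del: of_real_divide)
  have us: "length us = n" "\<forall>u\<in>set us. nrm u = 1"
    using nz by (auto simp: us_def n_def nrm_scale c)
  have prod_us: "prod_list (map nrm vs) = 1" if "\<forall>u\<in>set vs. nrm u = 1" for vs using that by (induction vs) auto
  have y': "nrm y' \<le> 1" using False by (auto simp: y'_def nrm_scale c)
  \<comment> \<open>The bracket is submultiplicative, so 1 bounds the sets in \<open>ad_norm\<close>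
    and \<open>nilpotency_rate\<close>; without an upper bound their suprema would be
    meaningless.\<close>
  have ad_le: "nrm (foldr bracket vs x) \<le> 1" if "\<forall>u\<in>set vs. nrm u = 1" "nrm x \<le> 1" for vs x
    using nrm_foldr[of vs x] that by (simp add: prod_us)
  have ad1: "ad_norm nrm bracket vs \<le> 1" if "\<forall>u\<in>set vs. nrm u = 1" for vs
    unfolding ad_norm_def by (rule cSup_least) (use ad_le[OF that] in \<open>auto intro: exI[of _ 0]\<close>)
  have "nrm (foldr bracket us y') \<le> ad_norm nrm bracket us"
    unfolding ad_norm_def
    by (rule cSup_upper) (use ad_le[OF us(2)] y' in \<open>auto intro!: bdd_aboveI[of _ 1]\<close>)
  moreover have ad0: "0 \<le> ad_norm nrm bracket us" using calculation nrm_nonneg order_trans by blast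
  have "root n (ad_norm nrm bracket us) \<le> rate n"
    unfolding nilpotency_rate_def
  proof (rule cSup_upper)
    show "bdd_above {root n (ad_norm nrm bracket xs) | xs. length xs = n \<and> (\<forall>x\<in>set xs. nrm x = 1)}"
      using ad1 n by (auto intro!: bdd_aboveI[of _ 1])
  qed (use us in blast)
  then have "root n (ad_norm nrm bracket us) ^ n \<le> \<bar>rate n\<bar> ^ n"
    using n ad0 by (intro power_mono) auto
  then have "ad_norm nrm bracket us \<le> \<bar>rate n\<bar> ^ n" using n ad0 by (simp add: real_root_pow_pos2)
  ultimately have "nrm (foldr bracket us y') \<le> \<bar>rate n\<bar> ^ n" by simp
  moreover have "nrm (foldr bracket us y') = nrm (foldr bracket xs y) / (prod_list (map nrm xs) * nrm y)"
  proof -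
    have "norm (prod_list (map c xs)) = 1 / prod_list (map nrm xs)"
      by (induction xs) (simp_all add: norm_mult c)
    then show ?thesis
      unfolding us_def y'_def foldr_scale nrm_scale by (simp add: norm_mult c)
  qed
  moreover have "0 < prod_list (map nrm xs) * nrm y"
    using False by (metis less_eq_real_def mult_nonneg_nonneg nrm_nonneg prod_nrm_nonneg)
  ultimately show ?thesis by (simp add: n_def[symmetric] field_simps)
qed

text \<open>A right-nested word of length m applies m - 1 adjoint maps to a letter, hence the shift.
  The minimum with 1 records that the bracket is submultiplicative.\<close>

definition decay :: "nat \<Rightarrow> real" where
  "decay m = (if m \<le> 1 then 1 else min 1 (\<bar>rate (m - 1)\<bar> ^ (m - 1)))"

lemma decay_bounds: "0 \<le> decay m" "decay m \<le> 1"
  by (auto simp: decay_def)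

lemma nrm_word:
  assumes "lie_word bracket a u"
  shows "nrm u \<le> 2 ^ length a * decay (length a) * prod_list (map nrm a)"
proof -
  have "nrm (foldr bracket [] u) \<le> 2 ^ length a / 2 * (decay (length a) * prod_list (map nrm a))"
  proof (rule L.word_le[OF nrm_diff assms])
    fix xs y assume *: "mset (y # xs) = mset a"
    then have len: "length a = Suc (length xs)" by (metis length_Cons size_mset)
    have "mset (map nrm (y # xs)) = mset (map nrm a)" using * by (metis mset_map)
    then have prod: "prod_list (map nrm a) = prod_list (map nrm xs) * nrm y"
      by (metis list.simps(9) mult.commute prod_list.Cons prod_mset_prod_list)
    show "nrm (foldr bracket ([] @ xs) y) \<le> decay (length a) * prod_list (map nrm a)"
      using nrm_foldr[of xs y] nrm_foldr_rate[of xs y] by (auto simp: decay_def prod len min_def)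
  qed
  moreover have "0 \<le> decay (length a) * prod_list (map nrm a)" by (simp add: decay_bounds)
  moreover define X where "X = 2 ^ length a * (decay (length a) * prod_list (map nrm a))"
  ultimately have "nrm u \<le> X / 2" "0 \<le> X" by simp_all
  then have "nrm u \<le> X" by linarith
  then show ?thesis by (simp add: X_def mult.assoc)
qed

lemma rapidly_increasing_ge:
  assumes "rapidly_increasing nrm bracket \<alpha>"
  shows "\<exists>n0. \<forall>n\<ge>n0. n \<ge> 1 \<longrightarrow> exp (r * real n) \<le> \<alpha> n"
proof -
  have "eventually (\<lambda>n. r \<le> ln (\<alpha> n) / real n) sequentially"
    using assms by (simp add: rapidly_increasing_def filterlim_at_top)
  then obtain n0 where n0: "\<And>n. n \<ge> n0 \<Longrightarrow> r \<le> ln (\<alpha> n) / real n" by (auto simp: eventually_sequentially)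
  have "exp (r * real n) \<le> \<alpha> n" if n: "n \<ge> n0" "n \<ge> 1" for n
  proof -
    have "\<alpha> n > 1" using assms n(2) by (simp add: rapidly_increasing_def)
    moreover have "r * real n \<le> ln (\<alpha> n)" using n0[OF n(1)] n(2) by (simp add: field_simps)
    ultimately show ?thesis by (metis exp_le_cancel_iff exp_ln less_trans zero_less_one)
  qed
  then show ?thesis by blast
qed

text \<open>Let s be the sum and n the number of the parts of K. If s \<ge> 2 L n, the decay alone
  compensates e^(k s). Otherwise n > s / (2 L) is large, and \<alpha> n is at least e^(2 L k n)
  \<ge> e^(k s).\<close>

lemma decay_product:
  assumes nil: "uniformly_topologically_nilpotent nrm bracket" and \<alpha>: "rapidly_increasing nrm bracket \<alpha>"
  shows "\<exists>s0. \<forall>K. 0 \<notin># K \<longrightarrow> K \<noteq> {#} \<longrightarrow> s0 \<le> \<Sum>\<^sub># K \<longrightarrow>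
    (\<Prod>m\<in>#K. decay m) * exp (real k * real (\<Sum>\<^sub># K)) \<le> \<alpha> (size K)"
proof -
  have "eventually (\<lambda>n. dist (rate n) 0 < exp (- 4 * real k)) sequentially"
    using nil unfolding uniformly_topologically_nilpotent_def by (rule tendstoD) simp
  then obtain n0 where "\<And>n. n \<ge> n0 \<Longrightarrow> \<bar>rate n\<bar> < exp (- 4 * real k)"
    by (auto simp: eventually_sequentially)
  then have n0: "\<bar>rate n\<bar> \<le> exp (- 4 * real k)" if "n \<ge> n0" for n using that less_imp_le by blast
  \<comment> \<open>For m \<ge> L the index m - 1 is at least n0 and m \<le> 2 (m - 1), so the rate
    e^(-4 k) per adjoint map leaves e^(-2 k) per letter.\<close>
  define L where "L = n0 + 2"
  \<comment> \<open>Short words need not decay; the factor e^(2 k L) per word makes the exponential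
    bound true for them too.\<close>
  have decay: "decay m \<le> exp (2 * real k * real L) * exp (- (2 * real k * real m))" for m
  proof (cases "m < L")
    case True
    then have "decay m \<le> exp (2 * real k * real L - 2 * real k * real m)"
      using decay_bounds(2)[of m] by (intro order_trans[OF decay_bounds(2)]) (auto simp: mult_left_mono)
    then show ?thesis by (simp add: exp_diff exp_minus field_simps)
  next
    case False
    then have m: "m - 1 \<ge> n0" "m \<ge> 2" by (auto simp: L_def)
    have "decay m \<le> \<bar>rate (m - 1)\<bar> ^ (m - 1)" using m by (simp add: decay_def)
    also have "\<dots> \<le> exp (- 4 * real k) ^ (m - 1)" by (intro power_mono n0 m) simp
    also have "\<dots> = exp (- (4 * real k * real (m - 1)))" by (simp add: exp_of_nat_mult[symmetric] mult_ac)
    also have "\<dots> \<le> exp (- (2 * real k * real m))"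
    proof -
      have "real m \<le> 2 * real (m - 1)" using m by (simp add: of_nat_diff)
      then have "2 * real k * real m \<le> 2 * real k * (2 * real (m - 1))" by (intro mult_left_mono) auto
      then show ?thesis by simp
    qed
    also have "\<dots> \<le> exp (2 * real k * real L) * exp (- (2 * real k * real m))" by simp
    finally show ?thesis .
  qed
  have prod: "(\<Prod>m\<in>#K. decay m) \<le> exp (2 * real k * real L * real (size K) - 2 * real k * real (\<Sum>\<^sub># K))" for K
  proof (induction K)
    case (add m K)
    have "(\<Prod>m\<in>#add_mset m K. decay m) \<le>
        (exp (2 * real k * real L) * exp (- (2 * real k * real m))) *
        exp (2 * real k * real L * real (size K) - 2 * real k * real (\<Sum>\<^sub># K))"
      unfolding image_mset_add_mset prod_mset.add_mset
      using prod_mset_le_one[of K decay] decay_bounds by (intro mult_mono[OF decay add]) auto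
    also have "\<dots> = exp (2 * real k * real L * real (size (add_mset m K)) - 2 * real k * real (\<Sum>\<^sub># (add_mset m K)))"
      by (simp add: exp_add[symmetric] algebra_simps)
    finally show ?case .
  qed simp
  obtain n1 where n1: "\<And>n. n \<ge> n1 \<Longrightarrow> n \<ge> 1 \<Longrightarrow> exp ((2 * real L * real k) * real n) \<le> \<alpha> n"
    using rapidly_increasing_ge[OF \<alpha>, of "2 * real L * real k"] by blast
  show ?thesis
  proof (intro exI[of _ "2 * L * n1"] allI impI)
    fix K :: "nat multiset" assume K: "0 \<notin># K" "K \<noteq> {#}" "2 * L * n1 \<le> \<Sum>\<^sub># K"
    define s n where "s = \<Sum>\<^sub># K" and "n = size K"
    have n: "n \<ge> 1" using K(2) by (cases K) (auto simp: n_def)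
    have \<alpha>1: "\<alpha> n > 1" using \<alpha> n by (simp add: rapidly_increasing_def)
    show "(\<Prod>m\<in>#K. decay m) * exp (real k * real (\<Sum>\<^sub># K)) \<le> \<alpha> (size K)"
    proof (cases "2 * L * n \<le> s")
      case True
      have "(\<Prod>m\<in>#K. decay m) * exp (real k * real s) \<le>
          exp (2 * real k * real L * real n - 2 * real k * real s) * exp (real k * real s)"
        using prod[of K] by (intro mult_right_mono) (auto simp: s_def n_def)
      also have "\<dots> = exp (real k * (real (2 * L * n) - real s))" by (simp add: exp_add[symmetric] algebra_simps)
      also have "\<dots> \<le> 1" using True by (simp add: mult_nonneg_nonpos del: of_nat_mult)
      finally show ?thesis using \<alpha>1 by (simp add: s_def n_def)
    next
      case False
      then have "n1 \<le> n" using K(3) by (simp add: s_def) (metis le_less_trans less_imp_le mult_less_cancel1 L_def zero_less_Suc add_2_eq_Suc' not_le)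
      have "(\<Prod>m\<in>#K. decay m) * exp (real k * real s) \<le> 1 * exp (real k * real s)"
        using prod_mset_le_one[of K decay] decay_bounds by (intro mult_right_mono) auto
      also have "\<dots> \<le> exp (real k * real (2 * L * n))"
        using False by (simp add: mult_left_mono del: of_nat_mult)
      also have "\<dots> \<le> \<alpha> n" using n1[OF \<open>n1 \<le> n\<close> n] by (simp add: mult_ac)
      finally show ?thesis by (simp add: s_def n_def)
    qed
  qed
qed

text \<open>
  The new sequence is \<open>\<beta>\<^sub>n = 2\<^sup>n exp (n h(n))\<close>, where \<open>h\<close> tends to infinity so slowly that the stated
  comparisons with \<open>\<alpha>\<close> hold.
\<close>

lemma slower_weight:
  assumes nil: "uniformly_topologically_nilpotent nrm bracket" and \<alpha>: "rapidly_increasing nrm bracket \<alpha>"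
  shows "\<exists>\<beta>. rapidly_increasing nrm bracket \<beta> \<and> \<beta> 0 = 1 \<and> (\<forall>n. 0 < \<beta> n) \<and>
    (\<forall>s t. 0 < s + t \<longrightarrow> \<beta> s * \<beta> t \<le> 2 ^ (s + t) * \<alpha> (s + t)) \<and>
    (\<forall>n m. n \<le> 2 * m \<longrightarrow> 0 < m \<longrightarrow> \<beta> n \<le> 2 ^ n * \<alpha> m) \<and>
    (\<forall>K. 0 \<notin># K \<longrightarrow> K \<noteq> {#} \<longrightarrow> (\<Prod>m\<in>#K. decay m) * \<beta> (\<Sum>\<^sub># K) \<le> 2 ^ (\<Sum>\<^sub># K) * \<alpha> (size K))"
proof -
  have \<alpha>1: "1 < \<alpha> n" if "0 < n" for n using \<alpha> that by (simp add: rapidly_increasing_def)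
  \<comment> \<open>Q k s lists what \<beta> has to satisfy at s with growth rate k. In the first
    condition the 2 in the exponent pays for two values of \<beta> in the product bound and for n
    \<le> 2 m in the coproduct bound; the second condition is the one for symmetric
    representatives.\<close>
  define Q where "Q k s \<longleftrightarrow> (\<forall>a. s \<le> 2 * a \<longrightarrow> 0 < a \<longrightarrow> exp (2 * real k * real a) \<le> \<alpha> a) \<and>
    (\<forall>K. 0 \<notin># K \<longrightarrow> K \<noteq> {#} \<longrightarrow> \<Sum>\<^sub># K = s \<longrightarrow> (\<Prod>m\<in>#K. decay m) * exp (real k * real s) \<le> \<alpha> (size K))" for k s
  obtain h where h: "filterlim h at_top sequentially" "\<And>s. Q (h s) s"
  proof (rule slow_growth[of Q])
    show "Q 0 s" for s
      unfolding Q_def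
    proof (intro conjI allI impI)
      fix K :: "nat multiset" assume "K \<noteq> {#}"
      then have "1 < \<alpha> (size K)" using \<alpha>1[of "size K"] by (simp add: nonempty_has_size)
      then show "(\<Prod>m\<in>#K. decay m) * exp (real 0 * real s) \<le> \<alpha> (size K)"
        using prod_mset_le_one[of K decay] decay_bounds by auto
    qed (use \<alpha>1 in \<open>auto intro: less_imp_le\<close>)
    show "eventually (Q k) sequentially" for k
    proof -
      obtain n0 where n0: "\<And>n. n \<ge> n0 \<Longrightarrow> n \<ge> 1 \<Longrightarrow> exp ((2 * real k) * real n) \<le> \<alpha> n"
        using rapidly_increasing_ge[OF \<alpha>, of "2 * real k"] by blast
      obtain s0 where s0: "\<And>K. 0 \<notin># K \<Longrightarrow> K \<noteq> {#} \<Longrightarrow> s0 \<le> \<Sum>\<^sub># K \<Longrightarrow>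
          (\<Prod>m\<in>#K. decay m) * exp (real k * real (\<Sum>\<^sub># K)) \<le> \<alpha> (size K)"
        using decay_product[OF nil \<alpha>, of k] by blast
      have "Q k s" if "s \<ge> max s0 (2 * n0)" for s
        unfolding Q_def using that n0 s0 by auto
      then show ?thesis unfolding eventually_sequentially by blast
    qed
  qed (rule that)
  \<comment> \<open>The factor 2^n ensures \<beta> n > 1 even where h n = 0.\<close>
  define \<beta> where "\<beta> n = 2 ^ n * exp (real (h n) * real n)" for n
  have Q1: "exp (2 * real (h s) * real a) \<le> \<alpha> a" if "s \<le> 2 * a" "0 < a" for s a
    using h(2)[of s] that unfolding Q_def by blast
  have Q2: "(\<Prod>m\<in>#K. decay m) * exp (real (h (\<Sum>\<^sub># K)) * real (\<Sum>\<^sub># K)) \<le> \<alpha> (size K)"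
    if "0 \<notin># K" "K \<noteq> {#}" for K
    using h(2)[of "\<Sum>\<^sub># K"] that unfolding Q_def by blast
  have le: "exp (real (h n) * real n) \<le> \<alpha> m" if "n \<le> 2 * m" "0 < m" for n m
  proof -
    have "real (h n) * real n \<le> real (h n) * (2 * real m)" using that by (intro mult_left_mono) auto
    then have "exp (real (h n) * real n) \<le> exp (2 * real (h n) * real m)" by (simp add: mult_ac)
    then show ?thesis using Q1[OF that] by (rule order_trans)
  qed
  show ?thesis
  proof (intro exI[of _ \<beta>] conjI allI impI)
    show "\<beta> 0 = 1" "0 < \<beta> n" for n by (simp_all add: \<beta>_def)
    show "\<beta> n \<le> 2 ^ n * \<alpha> m" if "n \<le> 2 * m" "0 < m" for n m
      using le[OF that] by (simp add: \<beta>_def)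
    show "(\<Prod>m\<in>#K. decay m) * \<beta> (\<Sum>\<^sub># K) \<le> 2 ^ (\<Sum>\<^sub># K) * \<alpha> (size K)" if "0 \<notin># K" "K \<noteq> {#}" for K
      using mult_left_mono[OF Q2[OF that], of "2 ^ (\<Sum>\<^sub># K)"] by (simp add: \<beta>_def mult_ac)
    show "\<beta> s * \<beta> t \<le> 2 ^ (s + t) * \<alpha> (s + t)" if st: "0 < s + t" for s t
    proof -
      have "exp (real (h s) * real s + real (h t) * real t) \<le> \<alpha> (s + t)"
      proof (cases "real (h s) * real s \<le> real (h t) * real t")
        case True
        have "real (h t) * real t \<le> real (h t) * real (s + t)" by (intro mult_left_mono) auto
        then have "exp (real (h s) * real s + real (h t) * real t) \<le> exp (2 * real (h t) * real (s + t))"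
          using True by simp
        also have "\<dots> \<le> \<alpha> (s + t)" by (rule Q1) (use st in auto)
        finally show ?thesis .
      next
        case False
        have "real (h s) * real s \<le> real (h s) * real (s + t)" by (intro mult_left_mono) auto
        then have "exp (real (h s) * real s + real (h t) * real t) \<le> exp (2 * real (h s) * real (s + t))"
          using False by simp
        also have "\<dots> \<le> \<alpha> (s + t)" by (rule Q1) (use st in auto)
        finally show ?thesis .
      qed
      then show ?thesis by (simp add: \<beta>_def power_add exp_add mult_ac)
    qed
    show "rapidly_increasing nrm bracket \<beta>"
      unfolding rapidly_increasing_def
    proof (intro conjI allI impI)
      show "1 < \<beta> n" if "1 \<le> n" for n
      proof -
        have "(1::real) < 2 ^ n" using that by simp
        moreover have "(1::real) \<le> exp (real (h n) * real n)" by simp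
        ultimately show ?thesis unfolding \<beta>_def by (metis mult.right_neutral less_le_trans mult_left_mono zero_le_numeral zero_le_power)
      qed
      have "filterlim (\<lambda>n. real (h n)) at_top sequentially"
        using filterlim_compose[OF filterlim_real_sequentially h(1)] .
      moreover have "eventually (\<lambda>n. real (h n) \<le> ln (\<beta> n) / real n) sequentially"
        using eventually_gt_at_top[of 0]
      proof eventually_elim
        case (elim n)
        have "ln (\<beta> n) = real n * ln 2 + real (h n) * real n" by (simp add: \<beta>_def ln_mult ln_realpow)
        then show ?case using elim by (simp add: field_simps)
      qed
      ultimately show "filterlim (\<lambda>n. ln (\<beta> n) / real n) at_top sequentially" by (rule filterlim_at_top_mono)
      obtain c where c: "c > 0" "\<And>n. n \<ge> 1 \<Longrightarrow> \<alpha> n \<le> c ^ n * nilpotency_chi nrm bracket n"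
        using \<alpha> unfolding rapidly_increasing_def by blast
      show "\<exists>c>0. \<forall>n\<ge>1. \<beta> n \<le> c ^ n * nilpotency_chi nrm bracket n"
      proof (intro exI[of _ "2 * c"] conjI allI impI)
        fix n :: nat assume n: "n \<ge> 1"
        have "\<beta> n \<le> 2 ^ n * \<alpha> n" using le[of n n] n by (simp add: \<beta>_def)
        also have "\<dots> \<le> 2 ^ n * (c ^ n * nilpotency_chi nrm bracket n)" by (intro mult_left_mono c n) simp
        finally show "\<beta> n \<le> (2 * c) ^ n * nilpotency_chi nrm bracket n" by (simp add: power_mult_distrib mult_ac)
      qed (use c in simp)
    qed
  qed
qed

text \<open>The smaller sequence has the larger weights n! / \<alpha> n, so the minimum provides the
  directedness of the seminorms.\<close>

lemma rapidly_increasing_min: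
  assumes "rapidly_increasing nrm bracket \<alpha>" "rapidly_increasing nrm bracket \<beta>"
  shows "rapidly_increasing nrm bracket (\<lambda>n. min (\<alpha> n) (\<beta> n))"
  unfolding rapidly_increasing_def
proof (intro conjI allI impI)
  show "1 < min (\<alpha> n) (\<beta> n)" if "1 \<le> n" for n using assms that by (auto simp: rapidly_increasing_def)
  show "filterlim (\<lambda>n. ln (min (\<alpha> n) (\<beta> n)) / real n) at_top sequentially"
    unfolding filterlim_at_top
  proof
    fix r
    have "eventually (\<lambda>n. r \<le> ln (\<alpha> n) / real n) sequentially" "eventually (\<lambda>n. r \<le> ln (\<beta> n) / real n) sequentially"
      using assms by (simp_all add: rapidly_increasing_def filterlim_at_top)
    then show "eventually (\<lambda>n. r \<le> ln (min (\<alpha> n) (\<beta> n)) / real n) sequentially"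
      by eventually_elim (auto simp: min_def)
  qed
  obtain c where "c > 0" "\<forall>n\<ge>1. \<alpha> n \<le> c ^ n * nilpotency_chi nrm bracket n"
    using assms(1) unfolding rapidly_increasing_def by blast
  then show "\<exists>c>0. \<forall>n\<ge>1. min (\<alpha> n) (\<beta> n) \<le> c ^ n * nilpotency_chi nrm bracket n"
    by (meson min.coboundedI1)
qed

end

text \<open>Replacing \<alpha> by the sequence \<beta> of \<open>slower_weight\<close> enlarges the
  seminorms up to exponential factors. The three families of inequalities for \<beta> answer to
  \<open>append_bound\<close>, \<open>split_bound\<close> and \<open>rep_bound\<close>.\<close>

lemma banach_hopf:
  fixes scaleV :: "'k::{real_normed_field,banach} \<Rightarrow> 'g::{topological_group_add,ab_group_add,t2_space} \<Rightarrow> 'g"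
  assumes "banach_lie_algebra scaleV bracket nrm" and nil: "uniformly_topologically_nilpotent nrm bracket"
    and cube: "tensor_cube scaleH scaleH2 j2 scaleH3 j3"
    and complete: "is_completion (symmetric_tensors (vec_mod scaleV)) (S_1minusminus_seminorms scaleV bracket nrm) scaleH j"
  shows "gutt_hopf_extends scaleV bracket z scaleH j scaleH2 j2 scaleH3 j3"
proof -
  interpret B: banach_lie_algebra scaleV bracket nrm by fact
  interpret lie_algebra scaleV bracket z by (rule B.lie_algebra)
  interpret H: tensor_cube scaleH scaleH2 j2 scaleH3 j3 by (rule cube)
  define wt :: "(nat \<Rightarrow> real) \<Rightarrow> nat \<Rightarrow> real" where "wt \<alpha> n = (if n = 0 then 1 else fact n / \<alpha> n)" for \<alpha> n
  define \<W> where "\<W> = {(wt \<alpha>, \<lambda>x. c * nrm x) | c \<alpha>. c > 0 \<and> rapidly_increasing nrm bracket \<alpha>}"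
  have \<W>I: "(wt \<alpha>, \<lambda>x. c * nrm x) \<in> \<W>" if "c > 0" "rapidly_increasing nrm bracket \<alpha>" for c \<alpha>
    using that by (auto simp: \<W>_def)
  have \<W>E: "\<exists>c \<alpha>. w = wt \<alpha> \<and> q = (\<lambda>x. c * nrm x) \<and> c > 0 \<and> rapidly_increasing nrm bracket \<alpha>" if "(w, q) \<in> \<W>" for w q
    using that by (auto simp: \<W>_def)
  have p4: "(4::real) ^ n = 2 ^ n * 2 ^ n" for n by (simp add: power_mult_distrib[symmetric])
  have wt_nonneg: "0 \<le> wt \<alpha> n" if "rapidly_increasing nrm bracket \<alpha>" for \<alpha> n
  proof (cases "n = 0")
    case False
    then have "1 < \<alpha> n" using that by (simp add: rapidly_increasing_def)
    then show ?thesis by (simp add: wt_def)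
  qed (simp add: wt_def)
  have "weighted_completion scaleV bracket z scaleH scaleH2 j2 scaleH3 j3 j \<W>"
  proof
    have "S_1minusminus_seminorms scaleV bracket nrm = {weighted_seminorm M w q | w q. (w, q) \<in> \<W>}"
      unfolding S_1minusminus_seminorms_def \<W>_def wt_def[abs_def] by blast
    then show "is_completion S {weighted_seminorm M w q | w q. (w, q) \<in> \<W>} scaleH j"
      using complete by simp
  next
    fix w p n assume "(w, p) \<in> \<W>"
    then obtain c \<alpha> where *: "w = wt \<alpha>" "p = (\<lambda>x. c * nrm x)" "c > 0" "rapidly_increasing nrm bracket \<alpha>" using \<W>E by blast
    show "0 \<le> w n" "w 0 = 1" using wt_nonneg[OF *(4)] by (simp_all add: *(1)) (simp add: wt_def)
    show "0 \<le> p x" for x using * by simp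
  next
    fix w1 q1 w2 q2 assume "(w1, q1) \<in> \<W>" "(w2, q2) \<in> \<W>"
    then obtain c1 \<alpha>1 c2 \<alpha>2 where 1: "w1 = wt \<alpha>1" "q1 = (\<lambda>x. c1 * nrm x)" "c1 > 0" "rapidly_increasing nrm bracket \<alpha>1"
      and 2: "w2 = wt \<alpha>2" "q2 = (\<lambda>x. c2 * nrm x)" "c2 > 0" "rapidly_increasing nrm bracket \<alpha>2" using \<W>E by metis
    have pos: "\<alpha>1 n > 1" "\<alpha>2 n > 1" if "n > 0" for n using 1(4) 2(4) that by (auto simp: rapidly_increasing_def)
    show "\<exists>w q. (w, q) \<in> \<W> \<and> (\<forall>n. w1 n \<le> w n \<and> w2 n \<le> w n) \<and> (\<forall>x. q1 x \<le> q x \<and> q2 x \<le> q x)"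
    proof (intro exI conjI allI)
      show "(wt (\<lambda>n. min (\<alpha>1 n) (\<alpha>2 n)), \<lambda>x. max c1 c2 * nrm x) \<in> \<W>"
        by (intro \<W>I B.rapidly_increasing_min 1 2) (use 1 in auto)
      show "w1 n \<le> wt (\<lambda>n. min (\<alpha>1 n) (\<alpha>2 n)) n" "w2 n \<le> wt (\<lambda>n. min (\<alpha>1 n) (\<alpha>2 n)) n" for n
        using pos[of n] by (auto simp: 1(1) 2(1) wt_def intro!: divide_left_mono mult_pos_pos)
      show "q1 x \<le> max c1 c2 * nrm x" "q2 x \<le> max c1 c2 * nrm x" for x
        unfolding 1(2) 2(2) by (auto intro!: mult_right_mono)
    qed
  next
    fix w p assume "(w, p) \<in> \<W>"
    then obtain c \<alpha> where wp: "w = wt \<alpha>" "p = (\<lambda>x. c * nrm x)" "c > 0" "rapidly_increasing nrm bracket \<alpha>" using \<W>E by blast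
    have w: "0 \<le> w n" for n using wt_nonneg[OF wp(4)] wp(1) by simp
    have p: "0 \<le> p x" for x using wp by simp
    have \<alpha>1: "1 < \<alpha> n" if "0 < n" for n using wp(4) that by (simp add: rapidly_increasing_def)
    obtain \<beta> where "rapidly_increasing nrm bracket \<beta>" "\<beta> 0 = 1" "\<forall>n. 0 < \<beta> n"
      "\<forall>s t. 0 < s + t \<longrightarrow> \<beta> s * \<beta> t \<le> 2 ^ (s + t) * \<alpha> (s + t)"
      "\<forall>n m. n \<le> 2 * m \<longrightarrow> 0 < m \<longrightarrow> \<beta> n \<le> 2 ^ n * \<alpha> m"
      "\<forall>K. 0 \<notin># K \<longrightarrow> K \<noteq> {#} \<longrightarrow> (\<Prod>m\<in>#K. B.decay m) * \<beta> (\<Sum>\<^sub># K) \<le> 2 ^ (\<Sum>\<^sub># K) * \<alpha> (size K)"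
      using B.slower_weight[OF nil wp(4)] by (elim exE conjE)
    note \<beta> = this[rule_format]
    \<comment> \<open>The value \<beta> 0 = 1 removes the exceptional case in degree 0.\<close>
    have wt_\<beta>: "wt \<beta> n = fact n / \<beta> n" for n using \<beta>(2) by (simp add: wt_def)
    \<comment> \<open>As d \<ge> 1, the constant c is at most d^m and can be distributed over the
      letters of a Lie word of any length m \<ge> 1.\<close>
    define d where "d = max 1 c"
    have d: "d \<ge> 1" "c \<le> d" by (auto simp: d_def)
    define q where "q x = d * nrm x" for x
    have q: "0 \<le> q x" for x using d by (simp add: q_def)
    define v where "v m = 2 ^ m * B.decay m" for m
    have v: "0 \<le> v m" for m by (simp add: v_def B.decay_bounds)
    have words: "p u \<le> v (length a) * prod_list (map q a)" if a: "lie_word bracket a u" for a u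
    proof -
      have "c \<le> d ^ length a" using d lie_word_length[OF a] self_le_power[of d "length a"] by simp
      then have "c * nrm u \<le> d ^ length a * (2 ^ length a * B.decay (length a) * prod_list (map nrm a))"
        using d by (intro mult_mono B.nrm_word[OF a]) auto
      then show ?thesis by (simp add: wp(2) v_def q_def[abs_def] prod_list_map_scale mult_ac)
    qed
    \<comment> \<open>The first 4 collects one 2 from the expansion of Lie words and one from
      \<open>slower_weight\<close>; the other factor comes from the rewriting.\<close>
    define Z where "Z = 4 * (4 * max 1 (norm z))"
    have Z: "0 < Z" by (simp add: Z_def)
    have Zpow: "Z ^ n = 4 ^ n * (4 * max 1 (norm z)) ^ n" for n by (simp only: Z_def power_mult_distrib)
    have le: "weighted_seminorm M w p (rep xs) \<le> word_weight (wt \<beta>) (\<lambda>x. (Z * d) * nrm x) xs" for xs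
    proof (cases "xs = []")
      case True
      then show ?thesis
        using weighted_seminorm_tensor[of p w "[]" M, OF p w] by (simp add: wp(1) rep_Nil word_weight_def wt_def)
    next
      case False
      have "weighted_seminorm M w p (rep xs) \<le>
          (4 ^ length xs / \<beta> (length xs)) * (4 * max 1 (norm z)) ^ length xs * fact (length xs) * prod_list (map q xs)"
      proof (rule weighted_seminorm_rep[where v = v and q = q])
        fix K :: "nat multiset" assume K: "0 \<notin># K" "\<Sum>\<^sub># K = length xs"
        then have ne: "K \<noteq> {#}" using False by auto
        have \<alpha>K: "1 < \<alpha> (size K)" using \<alpha>1[of "size K"] ne by (simp add: nonempty_has_size)
        have "(\<Prod>m\<in>#K. v m) = 2 ^ \<Sum>\<^sub># K * (\<Prod>m\<in>#K. B.decay m)"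
          by (induction K) (auto simp: v_def power_add mult_ac)
        also have "\<dots> \<le> 2 ^ \<Sum>\<^sub># K * (2 ^ \<Sum>\<^sub># K * \<alpha> (size K) / \<beta> (\<Sum>\<^sub># K))"
          using \<beta>(6)[OF K(1) ne] \<beta>(3)[of "\<Sum>\<^sub># K"] by (intro mult_left_mono) (simp_all add: field_simps)
        finally have "(\<Prod>m\<in>#K. v m) \<le> 4 ^ length xs / \<beta> (length xs) * \<alpha> (size K)"
          by (simp add: K(2) p4 mult_ac)
        then have "fact (size K) / \<alpha> (size K) * (\<Prod>m\<in>#K. v m) \<le>
            fact (size K) / \<alpha> (size K) * (4 ^ length xs / \<beta> (length xs) * \<alpha> (size K))"
          using \<alpha>K by (intro mult_left_mono) auto
        then show "w (size K) * (\<Prod>m\<in>#K. v m) \<le> 4 ^ length xs / \<beta> (length xs) * fact (size K)"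
          using \<alpha>K ne by (simp add: wp(1) wt_def mult_ac)
      qed (use p q v w words False \<beta>(3)[of "length xs"] in auto)
      also have "\<dots> = word_weight (wt \<beta>) (\<lambda>x. (Z * d) * nrm x) xs"
        by (simp add: word_weight_def q_def[abs_def] prod_list_map_scale wt_\<beta> Zpow power_mult_distrib mult_ac)
      finally show ?thesis .
    qed
    show "\<exists>w' q' C. (w', q') \<in> \<W> \<and> C \<ge> 0 \<and> (\<forall>xs. weighted_seminorm M w p (rep xs) \<le> C * word_weight w' q' xs)"
      by (intro exI[of _ "wt \<beta>"] exI[of _ "\<lambda>x. (Z * d) * nrm x"] exI[of _ 1] conjI \<W>I \<beta>(1)) (use Z d le in auto)
    have pp: "0 \<le> prod_list (map p xs)" for xs by (rule prod_list_map_nonneg) (rule p)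
    have \<W>4: "(wt \<beta>, \<lambda>x. 4 * p x) \<in> \<W>"
      using \<W>I[of "4 * c" \<beta>] wp(3) \<beta>(1) by (simp add: wp(2) mult.assoc)
    have word_weight4: "word_weight (wt \<beta>) (\<lambda>x. 4 * p x) xs = 4 ^ length xs * (wt \<beta> (length xs) * prod_list (map p xs))" for xs
      by (simp only: word_weight_scale) (simp only: word_weight_def)
    have add: "wt \<alpha> (s + t) \<le> 4 ^ (s + t) * (wt \<beta> s * wt \<beta> t)" for s t
    proof (cases "s + t = 0")
      case True
      then show ?thesis by (simp add: wt_def)
    next
      case False
      have "(fact (s + t) :: real) \<le> 2 ^ (s + t) * (fact s * fact t)"
        using fact_add_powr_le[of s t 1] by simp
      then have "fact (s + t) * (\<beta> s * \<beta> t) \<le> (2 ^ (s + t) * (fact s * fact t)) * (2 ^ (s + t) * \<alpha> (s + t))"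
        using \<beta>(3)[of s] \<beta>(3)[of t] False by (intro mult_mono \<beta>(4)) auto
      then have le4: "fact (s + t) * (\<beta> s * \<beta> t) \<le> 4 ^ (s + t) * (fact s * fact t) * \<alpha> (s + t)"
        by (simp add: p4 mult_ac)
      have weq: "wt \<alpha> (s + t) = fact (s + t) / \<alpha> (s + t)"
        unfolding wt_def by (rule if_not_P[OF False])
      have "0 < \<alpha> (s + t)" "0 < \<beta> s" "0 < \<beta> t" using False \<alpha>1[of "s + t"] \<beta>(3) by auto
      then show ?thesis unfolding wt_\<beta> weq using le4 by (simp add: field_simps)
    qed
    have "word_weight w p (xs @ ys) \<le> word_weight (wt \<beta>) (\<lambda>x. 4 * p x) xs * word_weight (wt \<beta>) (\<lambda>x. 4 * p x) ys" for xs ys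
    proof -
      have "word_weight w p (xs @ ys) \<le> (4 ^ (length xs + length ys) * (wt \<beta> (length xs) * wt \<beta> (length ys))) *
          (prod_list (map p xs) * prod_list (map p ys))"
        unfolding word_weight_def wp(1) map_append prod_list.append length_append
        by (intro mult_right_mono add mult_nonneg_nonneg pp)
      then show ?thesis unfolding word_weight4 by (simp add: power_add mult_ac)
    qed
    then show "\<exists>w' q' C. (w', q') \<in> \<W> \<and> C \<ge> 0 \<and> (\<forall>xs ys. word_weight w p (xs @ ys) \<le> C * (word_weight w' q' xs * word_weight w' q' ys))"
      by (intro exI[of _ "wt \<beta>"] exI[of _ "\<lambda>x. 4 * p x"] exI[of _ 1] conjI \<W>4) simp_all
    have split: "wt \<alpha> a * wt \<alpha> b \<le> 2 ^ (a + b) * wt \<beta> (a + b)" for a b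
    proof -
      \<comment> \<open>The sequence with value 1 in degree 0, so that one of the two parts may be
        empty.\<close>
      define \<alpha>' where "\<alpha>' n = (if n = 0 then 1 else \<alpha> n)" for n
      have \<alpha>': "1 \<le> \<alpha>' n" "wt \<alpha> n = fact n / \<alpha>' n" for n using \<alpha>1[of n] by (auto simp: \<alpha>'_def wt_def)
      have "\<beta> (a + b) \<le> 2 ^ (a + b) * (\<alpha>' a * \<alpha>' b)"
      proof (cases "a + b = 0")
        case True
        then show ?thesis using \<beta>(2) by (simp add: \<alpha>'_def)
      next
        case False
        define m where "m = max a b"
        have m: "a + b \<le> 2 * m" "0 < m" using False by (auto simp: m_def max_def)
        have "\<alpha> m \<le> \<alpha>' a * \<alpha>' b"
        proof (cases "a \<le> b")
          case True
          then have "\<alpha> m = \<alpha>' b" using m(2) by (simp add: m_def \<alpha>'_def)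
          then show ?thesis using mult_right_mono[OF \<alpha>'(1)[of a], of "\<alpha>' b"] \<alpha>'(1)[of b] by simp
        next
          case False
          then have "\<alpha> m = \<alpha>' a" using m(2) by (simp add: m_def \<alpha>'_def)
          then show ?thesis using mult_left_mono[OF \<alpha>'(1)[of b], of "\<alpha>' a"] \<alpha>'(1)[of a] by simp
        qed
        then show ?thesis using \<beta>(5)[OF m] by (meson mult_left_mono order_trans zero_le_numeral zero_le_power)
      qed
      moreover have "(fact a * fact b :: real) \<le> fact (a + b)" using fact_mult_powr_le[of a 1 b] by simp
      ultimately have "(fact a * fact b) * \<beta> (a + b) \<le> fact (a + b) * (2 ^ (a + b) * (\<alpha>' a * \<alpha>' b))"
        using \<beta>(3)[of "a + b"] by (intro mult_mono) auto
      then show ?thesis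
        unfolding wt_\<beta> \<alpha>'(2) using \<beta>(3)[of "a + b"] \<alpha>'(1)[of a] \<alpha>'(1)[of b] by (simp add: field_simps)
    qed
    have "2 ^ length xs * (word_weight w p a * word_weight w p b) \<le> word_weight (wt \<beta>) (\<lambda>x. 4 * p x) xs"
      if ab: "mset a + mset b = mset xs" for xs a b
    proof -
      have len: "length xs = length a + length b" using ab by (metis size_mset size_union)
      have "mset (map p a) + mset (map p b) = mset (map p xs)"
        using ab by (metis image_mset_union mset_map)
      then have prod: "prod_list (map p a) * prod_list (map p b) = prod_list (map p xs)"
        by (metis prod_mset_Un prod_mset_prod_list)
      have "word_weight w p a * word_weight w p b = (wt \<alpha> (length a) * wt \<alpha> (length b)) * prod_list (map p xs)"
        by (simp add: word_weight_def wp(1) prod[symmetric] mult_ac)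
      also have "\<dots> \<le> (2 ^ length xs * wt \<beta> (length xs)) * prod_list (map p xs)"
        unfolding len by (intro mult_right_mono split pp)
      finally have "2 ^ length xs * (word_weight w p a * word_weight w p b) \<le> 2 ^ length xs * (2 ^ length xs * wt \<beta> (length xs) * prod_list (map p xs))"
        by (intro mult_left_mono) auto
      then show ?thesis unfolding word_weight4 by (simp add: p4 mult_ac)
    qed
    then show "\<exists>w' q' C. (w', q') \<in> \<W> \<and> C \<ge> 0 \<and> (\<forall>xs a b. mset a + mset b = mset xs \<longrightarrow>
        2 ^ length xs * (word_weight w p a * word_weight w p b) \<le> C * word_weight w' q' xs)"
      by (intro exI[of _ "wt \<beta>"] exI[of _ "\<lambda>x. 4 * p x"] exI[of _ 1] conjI \<W>4) simp_all
  qed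
  then show ?thesis by (rule weighted_completion.gutt_hopf)
qed

section \<open>The three topologies as instances of the extension theorem\<close>

theorem theorem7p2p3:
  fixes scaleV :: "'k::{real_normed_field,banach} \<Rightarrow>
          'g::{topological_group_add,ab_group_add,t2_space} \<Rightarrow> 'g"
    and bracket :: "'g \<Rightarrow> 'g \<Rightarrow> 'g"
    and nrm :: "'g \<Rightarrow> real"
    and z :: 'k
    and R :: real
    and scaleH :: "'k \<Rightarrow>
          'h::{uniform_topological_group_add,ab_group_add,complete_uniform_space,t2_space} \<Rightarrow> 'h"
    and j :: "('k, 'g) tensor \<Rightarrow> 'h"
    and scaleH2 :: "'k \<Rightarrow>
          'h2::{uniform_topological_group_add,ab_group_add,complete_uniform_space,t2_space} \<Rightarrow> 'h2"
    and j2 :: "('k, 'h) tensor \<Rightarrow> 'h2"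
    and scaleH3 :: "'k \<Rightarrow>
          'h3::{uniform_topological_group_add,ab_group_add,complete_uniform_space,t2_space} \<Rightarrow> 'h3"
    and j3 :: "('k, 'h) tensor \<Rightarrow> 'h3"
  assumes "is_completed_tensor_power scaleH 2 scaleH2 j2"
    and "is_completed_tensor_power scaleH 3 scaleH3 j3"
  shows
    "(AE_lie_algebra scaleV bracket \<and> R \<ge> 1 \<and>
      is_completion (symmetric_tensors (vec_mod scaleV)) (S_R_seminorms scaleV R) scaleH j \<longrightarrow>
      gutt_hopf_extends scaleV bracket z scaleH j scaleH2 j2 scaleH3 j3) \<and>
     (locally_convex_lie_algebra scaleV bracket \<and> nilpotent_lie bracket \<and>
      is_completion (symmetric_tensors (vec_mod scaleV)) (S_1minus_seminorms scaleV) scaleH j \<longrightarrow>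
      gutt_hopf_extends scaleV bracket z scaleH j scaleH2 j2 scaleH3 j3) \<and>
     (banach_lie_algebra scaleV bracket nrm \<and> uniformly_topologically_nilpotent nrm bracket \<and>
      (\<forall>n\<ge>1. nilpotency_omega nrm bracket n > 0) \<and>
      is_completion (symmetric_tensors (vec_mod scaleV))
        (S_1minusminus_seminorms scaleV bracket nrm) scaleH j \<longrightarrow>
      gutt_hopf_extends scaleV bracket z scaleH j scaleH2 j2 scaleH3 j3)"
proof (intro conjI impI; elim conjE)
  let ?S = "symmetric_tensors (vec_mod scaleV)"
  \<comment> \<open>That \<open>scaleH\<close> is locally convex is part of being a completion of
    the symmetric tensors, and gives what the tensor locales ask for beyond the two tensor
    powers.\<close>
  have cube: "tensor_cube scaleH scaleH2 j2 scaleH3 j3" if "is_completion ?S P scaleH j" for P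
    using assms that
    by (simp add: tensor_cube_def tensor_cube_axioms_def tensor_square_def tensor_square_axioms_def is_completion_def)
  {
    assume AE: "AE_lie_algebra scaleV bracket" and R: "1 \<le> R"
      and c: "is_completion ?S (S_R_seminorms scaleV R) scaleH j"
    have "factorial_completion scaleV bracket scaleH scaleH2 j2 scaleH3 j3 j {R}"
    proof (rule factorial_completion.intro[OF AE_lie_algebra.axioms(1)[OF AE] cube[OF c]], unfold_locales)
      show "is_completion ?S (\<Union>R\<in>{R}. S_R_seminorms scaleV R) scaleH j" using c by simp
      show "\<exists>R'' q v D. R'' \<in> {R} \<and> continuous_seminorm scaleV q \<and> (\<forall>m. 0 \<le> v m) \<and> 0 \<le> D \<and>
          (\<forall>a u. lie_word bracket a u \<longrightarrow> p u \<le> v (length a) * prod_list (map q a)) \<and>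
          (\<forall>K. 0 \<notin># K \<longrightarrow> fact (size K) powr R' * (\<Prod>m\<in>#K. v m) \<le>
             D ^ (\<Sum>\<^sub># K) * fact (\<Sum>\<^sub># K) powr (R'' - 1) * fact (size K))"
        if "R' \<in> {R}" "continuous_seminorm scaleV p" for R' p
        using AE_words_bound[OF AE R that(2)] that(1) by simp
    qed (use R in auto)
    then show "gutt_hopf_extends scaleV bracket z scaleH j scaleH2 j2 scaleH3 j3"
      by (rule factorial_completion.hopf)
  next
    assume lc: "locally_convex_lie_algebra scaleV bracket" and nil: "nilpotent_lie bracket"
      and c: "is_completion ?S (S_1minus_seminorms scaleV) scaleH j"
    have "factorial_completion scaleV bracket scaleH scaleH2 j2 scaleH3 j3 j {..<1}"
    proof (rule factorial_completion.intro[OF lc cube[OF c]], unfold_locales)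
      show "is_completion ?S (\<Union>R\<in>{..<1}. S_R_seminorms scaleV R) scaleH j"
        using c by (simp add: S_1minus_seminorms_def)
      show "\<exists>R' q v D. R' \<in> {..<1} \<and> continuous_seminorm scaleV q \<and> (\<forall>m. 0 \<le> v m) \<and> 0 \<le> D \<and>
          (\<forall>a u. lie_word bracket a u \<longrightarrow> p u \<le> v (length a) * prod_list (map q a)) \<and>
          (\<forall>K. 0 \<notin># K \<longrightarrow> fact (size K) powr R * (\<Prod>m\<in>#K. v m) \<le>
             D ^ (\<Sum>\<^sub># K) * fact (\<Sum>\<^sub># K) powr (R' - 1) * fact (size K))"
        if "R \<in> {..<1}" "continuous_seminorm scaleV p" for R p
        unfolding lessThan_iff
        using nilpotent_words_bound[OF lc nil _ that(2), of R] that(1) by simp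
    qed auto
    then show "gutt_hopf_extends scaleV bracket z scaleH j scaleH2 j2 scaleH3 j3"
      by (rule factorial_completion.hopf)
  next
    assume "banach_lie_algebra scaleV bracket nrm" "uniformly_topologically_nilpotent nrm bracket"
      and c: "is_completion ?S (S_1minusminus_seminorms scaleV bracket nrm) scaleH j"
    then show "gutt_hopf_extends scaleV bracket z scaleH j scaleH2 j2 scaleH3 j3"
      using banach_hopf cube[OF c] by blast
  }
qed

end
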